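(* Let $N\ge1$, let $L_1\le L_2\le\dots\le L_N$ be the ordered eigenvalues of an $N$-GOE matrix and let $q_N^k$ denote the probability density of $L_k$. Then for $\ell\in\mathbb R$ and $k=1,\dots,N$, $$q_N^k(\ell)=k_N\,N!\,(-1)^{k-1}\exp\Big(-\frac{\ell^2}{2}\Big)\sum_{I\in\mathcal F_{k-1}(N-1)}\operatorname{Pf}\big(\mathcal A^1(I,\ell)\big),$$ where $\mathcal A^1(I,\ell)$ is the matrix $\mathcal A^\alpha(I,\ell)$ defined below with $n=N-1$ and $\alpha=1$.
   Context: An $n$-GOE matrix is symmetric with independent centred Gaussian entries on and above the diagonal, variance 1 on the diagonal and $1/2$ off it. $k_N:=(2\pi)^{-N/2}(\Gamma(3/2))^N\big(\prod_{i=1}^N\Gamma(1+i/2)\big)^{-1}$. $\mathcal F_p(n)$ is the set of subsets of $\{1,\dots,n\}$ of size $p$. For $I\in\mathcal F_p(n)$ and $\ell\in\mathbb R$, set $\mathcal D_i^I(\ell)=(-\infty,\ell)$ if $i\in I$ and $\mathcal D_i^I(\ell)=(\ell,+\infty)$ if $i\notin I$. Let $\mathbf s$ be the sign function. For $\alpha\in\{1,2\}$ define, for $i,j=1,\dots,n$, $$a^\alpha_{i,j}(I,\ell)=\int_{\mathcal D_i^I(\ell)}dx\int_{\mathcal D_j^I(\ell)}dy\ \mathbf s(y-x)\,x^{i-1}y^{j-1}(x-\ell)^\alpha(y-\ell)^\alpha\exp\Big(-\frac{x^2+y^2}{2}\Big).$$ If $n$ is even, $\mathcal A^\alpha(I,\ell)$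 is the $n\times n$ skew-symmetric matrix $(a^\alpha_{i,j}(I,\ell))$. If $n$ is odd, $\mathcal A^\alpha(I,\ell)$ is the $(n+1)\times(n+1)$ skew-symmetric matrix with these entries for $i,j\le n$ and in addition $a^\alpha_{i,n+1}(I,\ell)=-a^\alpha_{n+1,i}(I,\ell)=\int_{\mathcal D_i^I(\ell)}x^{i-1}(x-\ell)^\alpha e^{-x^2/2}dx$ for $i\le n$, $a^\alpha_{n+1,n+1}=0$. $\operatorname{Pf}$ denotes the Pfaffian. (For $n=0$ the Pfaffian of the empty matrix is $1$.) *)

theory Defs
  imports "HOL-Probability.Probability" "HOL-Combinatorics.Permutations" "Jordan_Normal_Form.Char_Poly"
begin

definition goe_index :: "nat \<Rightarrow> (nat \<times> nat) set" where
  "goe_index N = {(i, j). i \<le> j \<and> j < N}"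

text \<open>Law of the independent entries: centred Gaussians, variance 1 on the diagonal,
  variance 1/2 off the diagonal (normal_density takes the standard deviation).\<close>
definition GOE_entries :: "nat \<Rightarrow> ((nat \<times> nat) \<Rightarrow> real) measure" where
  "GOE_entries N = (\<Pi>\<^sub>M p\<in>goe_index N.
      density lborel (\<lambda>x. ennreal (normal_density 0
          (if fst p = snd p then 1 else sqrt (1/2)) x)))"

definition goe_matrix :: "nat \<Rightarrow> ((nat \<times> nat) \<Rightarrow> real) \<Rightarrow> real mat" where
  "goe_matrix N x = mat N N (\<lambda>(i, j). x (min i j, max i j))"

text \<open>Ordered eigenvalues (with multiplicity) of a real matrix whose characteristic
  polynomial splits over the reals: the unique sorted list of its roots.\<close>
definition ordered_eigenvalues :: "real mat \<Rightarrow> real list" where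
  "ordered_eigenvalues A = (THE xs. sorted xs \<and> length xs = dim_row A \<and>
      char_poly A = (\<Prod>x\<leftarrow>xs. [:- x, 1:]))"

definition goe_eig :: "nat \<Rightarrow> nat \<Rightarrow> ((nat \<times> nat) \<Rightarrow> real) \<Rightarrow> real" where
  "goe_eig N k x = ordered_eigenvalues (goe_matrix N x) ! (k - 1)"

definition k_const :: "nat \<Rightarrow> real" where
  "k_const N = (2 * pi) powr (- real N / 2) * (Gamma (3/2)) ^ N
      / (\<Prod>i=1..N. Gamma (1 + real i / 2))"

definition pfaffian :: "nat \<Rightarrow> (nat \<Rightarrow> nat \<Rightarrow> real) \<Rightarrow> real" where
  "pfaffian m A = (\<Sum>\<sigma> | \<sigma> permutes {0..<2*m}.
        of_int (sign \<sigma>) * (\<Prod>i<m. A (\<sigma> (2*i)) (\<sigma> (2*i+1))))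
      / (2 ^ m * fact m)"

definition subsets_F :: "nat \<Rightarrow> nat \<Rightarrow> nat set set" where
  "subsets_F p n = {I. I \<subseteq> {1..n} \<and> card I = p}"

definition D_set :: "nat set \<Rightarrow> real \<Rightarrow> nat \<Rightarrow> real set" where
  "D_set I l i = (if i \<in> I then {..<l} else {l<..})"

text \<open>a^alpha_{i,j}(I,l), with the paper's 1-based indices i, j.\<close>
definition a_entry :: "nat \<Rightarrow> nat set \<Rightarrow> real \<Rightarrow> nat \<Rightarrow> nat \<Rightarrow> real" where
  "a_entry \<alpha> I l i j = (LINT x|lborel. LINT y|lborel.
      indicator (D_set I l i) x * indicator (D_set I l j) y * sgn (y - x)
      * x ^ (i - 1) * y ^ (j - 1) * (x - l) ^ \<alpha> * (y - l) ^ \<alpha>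
      * exp (- (x\<^sup>2 + y\<^sup>2) / 2))"

text \<open>Extra column entry for odd n (paper's 1-based i).\<close>
definition b_entry :: "nat \<Rightarrow> nat set \<Rightarrow> real \<Rightarrow> nat \<Rightarrow> real" where
  "b_entry \<alpha> I l i = (LINT x|lborel.
      indicator (D_set I l i) x * x ^ (i - 1) * (x - l) ^ \<alpha> * exp (- x\<^sup>2 / 2))"

text \<open>The matrix A^alpha(I,l), 0-based: entry (i,j) is the paper's entry (i+1,j+1).
  Size n if n is even, n+1 if n is odd.\<close>
definition A_mat :: "nat \<Rightarrow> nat \<Rightarrow> nat set \<Rightarrow> real \<Rightarrow> nat \<Rightarrow> nat \<Rightarrow> real" where
  "A_mat \<alpha> n I l i j =
     (if i < n \<and> j < n then a_entry \<alpha> I l (i+1) (j+1)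
      else if i < n \<and> j = n then b_entry \<alpha> I l (i+1)
      else if i = n \<and> j < n then - b_entry \<alpha> I l (j+1)
      else 0)"

definition Pf_A :: "nat \<Rightarrow> nat \<Rightarrow> nat set \<Rightarrow> real \<Rightarrow> real" where
  "Pf_A \<alpha> n I l = pfaffian ((n + 1) div 2) (A_mat \<alpha> n I l)"

end

theory Submission
  imports Defs
begin

text \<open>
  The joint density of the ordered eigenvalues of an \<open>N\<close>-GOE matrix is found by induction on \<open>N\<close>,
  together with its normalising constant.  Border the matrix by a last row \<open>(v, a)\<close>.  Given the old
  eigenvalues \<open>\<mu>\<close>, rotating \<open>v\<close> into the eigenbasis does not change its law, and the new
  characteristic polynomial is \<open>(x - a) \<Prod>(x - \<mu>\<^sub>i) - \<Sum> v\<^sub>i\<^sup>2 \<Prod>\<^bsub>j\<noteq>i\<^esub> (x - \<mu>\<^sub>j)\<close>.  Its coefficients are affine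
  in \<open>a\<close> and \<open>v\<^sub>i\<^sup>2\<close> (an interpolation problem with nodes \<open>\<mu>\<close>), and the passage from coefficients to
  roots has the Vandermonde determinant as Jacobian.  This yields the joint density of the
  interlacing pair \<open>(\<mu>, \<lambda>)\<close>; the old eigenvalues are integrated out by the Dixon-Anderson integral
  with all exponents \<open>1/2\<close>, which is constant in \<open>\<lambda>\<close>.

  Integrating over all eigenvalues but the \<open>k\<close>-th leaves \<open>(-1)\<^bsup>k-1\<^esup> \<Prod>(\<mu>\<^sub>i - l)\<close> times a Vandermonde determinant on the
  region where exactly \<open>k - 1\<close> of the ordered variables are below \<open>l\<close>.  Multilinearity in the rows
  splits the indicator of that region into a sum over the subsets \<open>I\<close>, and de Bruijn's formula
  turns each term into a Pfaffian.
\<close>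

section \<open>Lebesgue measure on finite products\<close>

text \<open>Changes of variables in several dimensions are factored by Fubini into one-dimensional
  moves: translations, scalings, squaring, and one injective substitution for the largest root. The
  Vandermonde factors thus accumulate one root or node at a time, without any Jacobian determinant.
  Rotations are treated separately, by an invariance argument. The orthogonal matrix diagonalising
  the old block is chosen for one fixed block inside an inner integral, which avoids a measurable
  choice of eigenvectors. The exponent 1/2 in the Dixon-Anderson weight comes from the passage from
  \<open>v_i\<close> to \<open>v_i^2\<close>, whose density is \<open>w^(-1/2)\<close>. The Gaussian
  weight survives because the sum of the squares of all entries is the trace of the square: the
  squares of the new eigenvalues sum to \<open>a^2 + 2 * |v|^2\<close> plus the squares of the old
  ones, and the variances 1 and 1/2 match exactly these factors. Integrals on product spaces are
  nonnegative extended ones until the signed sums behind the Pfaffians require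
  integrability.\<close>

lemma emeasure_injective_image_real:
  fixes h h' :: "real \<Rightarrow> real"
  assumes S[measurable]: "S \<in> sets borel" and hS[measurable]: "h ` S \<in> sets borel"
    and der: "\<And>x. x \<in> S \<Longrightarrow> (h has_field_derivative h' x) (at x)"
    and inj: "inj_on h S" and h'[measurable]: "h' \<in> borel_measurable borel"
  shows "emeasure lborel (h ` S) = (\<integral>\<^sup>+x. ennreal \<bar>h' x\<bar> * indicator S x \<partial>lborel)"
proof -
  \<comment> \<open>Change of variables for the constant function 1. As an equivalence it moves
    finiteness in both directions, so an infinite measure of the image forces an infinite integral
    of \<open>\<bar>h' x\<bar>\<close>; the two cases below rest on this.\<close>
  have cv: "(\<lambda>x. \<bar>h' x\<bar>) absolutely_integrable_on S \<and> integral S (\<lambda>x. \<bar>h' x\<bar>) = b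
     \<longleftrightarrow> (\<lambda>_. 1::real) absolutely_integrable_on h ` S \<and> integral (h ` S) (\<lambda>_. 1::real) = b" for b
    using has_absolute_integral_change_of_variables_real[of S h h' "\<lambda>_. 1::real" b] der inj S
    by (simp add: has_field_derivative_at_within)
  show ?thesis
  proof (cases "emeasure lborel (h ` S) = \<infinity>")
    case False
    then obtain r where r: "emeasure lborel (h ` S) = ennreal r" "0 \<le> r"
      by (cases "emeasure lborel (h ` S)") auto
    then have hi: "((\<lambda>_. 1::real) has_integral r) (h ` S)"
      by (subst has_integral_iff_emeasure_lborel) auto
    then have "(\<lambda>_. 1::real) absolutely_integrable_on h ` S"
      by (intro nonnegative_absolutely_integrable_1) (auto simp: integrable_on_def)
    with cv[of r] hi have "(\<lambda>x. \<bar>h' x\<bar>) absolutely_integrable_on S" "integral S (\<lambda>x. \<bar>h' x\<bar>) = r"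
      by (auto simp: integral_unique)
    then have "((\<lambda>x. \<bar>h' x\<bar>) has_integral r) S"
      using set_lebesgue_integral_eq_integral(1) by (auto simp: has_integral_integral)
    from nn_integral_has_integral_lebesgue'[OF _ this] r show ?thesis by simp
  next
    case True
    have "(\<integral>\<^sup>+x. ennreal \<bar>h' x\<bar> * indicator S x \<partial>lborel) = \<infinity>"
    proof (rule ccontr)
      assume fin: "\<not> ?thesis"
      have "integrable lborel (\<lambda>x. indicator S x *\<^sub>R \<bar>h' x\<bar>)"
        using fin by (intro integrableI_bounded)
          (auto simp: less_top[symmetric] mult.commute ennreal_mult'' ennreal_indicator[symmetric] abs_mult)
      then have "(\<lambda>x. \<bar>h' x\<bar>) absolutely_integrable_on S"
        by (simp add: set_integrable_def integrable_completion)
      with cv[of "integral S (\<lambda>x. \<bar>h' x\<bar>)"] have "(\<lambda>_. 1::real) absolutely_integrable_on h ` S" by auto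
      then obtain r where r: "((\<lambda>_. 1::real) has_integral r) (h ` S)"
        using set_lebesgue_integral_eq_integral(1) by (auto simp: integrable_on_def)
      moreover have "0 \<le> r" using r by (rule has_integral_nonneg) simp
      ultimately show False using True
        by (subst (asm) has_integral_iff_emeasure_lborel) auto
    qed
    with True show ?thesis by simp
  qed
qed

text \<open>Two measures are compared: Lebesgue measure on the image of \<open>S\<close>, and the
  push-forward under \<open>h\<close> of the density \<open>\<bar>h' x\<bar>\<close> on
  \<open>S\<close>. They agree on each Borel set \<open>B\<close> by the preceding lemma for
  \<open>S\<close> intersected with the preimage of \<open>B\<close>, hence they integrate every
  nonnegative \<open>F\<close> alike.\<close>

lemma nn_integral_subst_injective_real:
  fixes h h' :: "real \<Rightarrow> real"
  assumes S[measurable]: "S \<in> sets borel" and hS[measurable]: "h ` S \<in> sets borel"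
    and der: "\<And>x. x \<in> S \<Longrightarrow> (h has_field_derivative h' x) (at x)"
    and inj: "inj_on h S" and h'[measurable]: "h' \<in> borel_measurable borel"
    and h[measurable]: "h \<in> borel_measurable borel" and F[measurable]: "F \<in> borel_measurable borel"
  shows "(\<integral>\<^sup>+y. indicator (h ` S) y * F y \<partial>lborel) = (\<integral>\<^sup>+x. indicator S x * (ennreal \<bar>h' x\<bar> * F (h x)) \<partial>lborel)"
proof -
  let ?M = "density lborel (indicator (h ` S))"
  let ?N = "distr (density lborel (\<lambda>x. ennreal \<bar>h' x\<bar> * indicator S x)) borel h"
  have "?M = ?N"
  proof (rule measure_eqI)
    show "sets ?M = sets ?N" by simp
    fix B assume "B \<in> sets ?M"
    then have B[measurable]: "B \<in> sets borel" by simp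
    let ?S = "S \<inter> h -` B"
    have Sm: "?S \<in> sets borel"
    proof -
      have "h -` B \<in> sets borel" using measurable_sets[OF h B] by simp
      then show ?thesis by simp
    qed
    have im: "h ` ?S = h ` S \<inter> B" by auto
    have "emeasure ?M B = emeasure lborel (h ` ?S)"
      by (simp add: emeasure_density im indicator_inter_arith[symmetric])
    also have "\<dots> = (\<integral>\<^sup>+x. ennreal \<bar>h' x\<bar> * indicator ?S x \<partial>lborel)"
      by (rule emeasure_injective_image_real)
         (use Sm der inj h' im in \<open>auto intro: inj_on_subset\<close>)
    also have "\<dots> = emeasure ?N B"
      using measurable_sets[OF h B]
      by (simp add: emeasure_distr emeasure_density) (auto intro!: nn_integral_cong split: split_indicator)
    finally show "emeasure ?M B = emeasure ?N B" .
  qed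
  then have "integral\<^sup>N ?M F = integral\<^sup>N ?N F" by simp
  then show ?thesis
    by (simp add: nn_integral_density nn_integral_distr mult_ac)
qed

text \<open>Points of this space are extensional: they are \<open>undefined\<close> from index
  \<open>n\<close> on. This is why coordinate maps are written with
  \<open>\<lambda>i\<in>{..<n}\<close> and why some identities are claimed only for
  \<open>x \<in> space (leb n)\<close>.\<close>

abbreviation leb :: "nat \<Rightarrow> (nat \<Rightarrow> real) measure" where
  "leb n \<equiv> (\<Pi>\<^sub>M i\<in>{..<n}. lborel)"

global_interpretation leb: product_sigma_finite "\<lambda>_::nat. lborel :: real measure"
  by standard

lemma sigma_finite_leb [intro, simp]: "sigma_finite_measure (leb n)"
  by (rule leb.sigma_finite) simp

lemma borel_measurable_nn_integral_leb [measurable (raw)]: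
  "case_prod f \<in> borel_measurable (N \<Otimes>\<^sub>M leb n) \<Longrightarrow> (\<lambda>x. \<integral>\<^sup>+y. f x y \<partial>leb n) \<in> borel_measurable N"
  by (rule sigma_finite_measure.borel_measurable_nn_integral[OF sigma_finite_leb])

lemma leb_Fubini:
  assumes [measurable]: "case_prod f \<in> borel_measurable (leb n \<Otimes>\<^sub>M lborel)"
  shows "(\<integral>\<^sup>+x. \<integral>\<^sup>+y. f x y \<partial>lborel \<partial>leb n) = (\<integral>\<^sup>+y. \<integral>\<^sup>+x. f x y \<partial>leb n \<partial>lborel)"
  by (rule pair_sigma_finite.Fubini'[symmetric])
     (auto intro!: pair_sigma_finite.intro sigma_finite_lborel)

lemma leb_leb_Fubini:
  assumes [measurable]: "case_prod f \<in> borel_measurable (leb n \<Otimes>\<^sub>M leb m)"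
  shows "(\<integral>\<^sup>+x. \<integral>\<^sup>+y. f x y \<partial>leb m \<partial>leb n) = (\<integral>\<^sup>+y. \<integral>\<^sup>+x. f x y \<partial>leb n \<partial>leb m)"
  by (rule pair_sigma_finite.Fubini'[symmetric])
     (auto intro!: pair_sigma_finite.intro)

lemma lborel_lborel_Fubini:
  fixes f :: "real \<Rightarrow> real \<Rightarrow> ennreal"
  assumes [measurable]: "case_prod f \<in> borel_measurable (lborel \<Otimes>\<^sub>M lborel)"
  shows "(\<integral>\<^sup>+x. \<integral>\<^sup>+y. f x y \<partial>lborel \<partial>lborel) = (\<integral>\<^sup>+y. \<integral>\<^sup>+x. f x y \<partial>lborel \<partial>lborel)"
  by (rule pair_sigma_finite.Fubini'[symmetric])
     (auto intro!: pair_sigma_finite.intro sigma_finite_lborel)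

lemma measurable_leb_update [measurable (raw)]:
  assumes f: "f \<in> M \<rightarrow>\<^sub>M leb n" and g: "g \<in> borel_measurable M"
  shows "(\<lambda>w. (f w)(n := g w)) \<in> M \<rightarrow>\<^sub>M leb (Suc n)"
  unfolding lessThan_Suc using f g by (auto intro!: measurable_fun_upd[where J="{..<n}"])

lemma measurable_leb_restrict [measurable (raw)]:
  assumes "\<And>i. i < n \<Longrightarrow> f i \<in> borel_measurable M"
  shows "(\<lambda>w. \<lambda>i\<in>{..<n}. f i w) \<in> M \<rightarrow>\<^sub>M leb n"
  using assms by (intro measurable_restrict) auto

lemma measurable_leb_component:
  assumes "f \<in> M \<rightarrow>\<^sub>M leb n" "i < n"
  shows "(\<lambda>w. f w i) \<in> borel_measurable M"
  using measurable_compose[OF assms(1) measurable_component_singleton[of i "{..<n}" "\<lambda>_. lborel"]] assms(2)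
  by simp

lemma leb_space_ext: "x \<in> space (leb n) \<longleftrightarrow> x \<in> extensional {..<n}"
  by (auto simp: space_PiM PiE_def)

lemma restrict_leb_space: "x \<in> space (leb n) \<Longrightarrow> (\<lambda>i\<in>{..<n}. x i) = x"
  by (auto simp: leb_space_ext extensional_def fun_eq_iff)

lemma nn_integral_leb_0: "(\<integral>\<^sup>+x. F x \<partial>(\<Pi>\<^sub>M i\<in>{}. lborel)) = F (\<lambda>_. undefined)"
  by (simp add: PiM_empty nn_integral_count_space_finite)

lemma nn_integral_leb_Suc:
  assumes "F \<in> borel_measurable (leb (Suc n))"
  shows "(\<integral>\<^sup>+x. F x \<partial>leb (Suc n)) = (\<integral>\<^sup>+x. \<integral>\<^sup>+y. F (x(n := y)) \<partial>lborel \<partial>leb n)"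
  using assms leb.product_nn_integral_insert[of "{..<n}" n F] by (simp add: lessThan_Suc)

lemma nn_integral_leb_Suc_rev:
  assumes "F \<in> borel_measurable (leb (Suc n))"
  shows "(\<integral>\<^sup>+x. F x \<partial>leb (Suc n)) = (\<integral>\<^sup>+y. \<integral>\<^sup>+x. F (x(n := y)) \<partial>leb n \<partial>lborel)"
  using assms leb.product_nn_integral_insert_rev[of "{..<n}" n F] by (simp add: lessThan_Suc)

lemma restrict_Suc_upd:
  fixes n :: nat shows "(\<lambda>i\<in>{..<Suc n}. f i) = (\<lambda>i\<in>{..<n}. f i)(n := f n)"
  by (auto simp: fun_eq_iff restrict_def)

lemma restrict_less_upd:
  fixes n :: nat shows "(\<lambda>i\<in>{..<n}. f i ((x(n := y)) i)) = (\<lambda>i\<in>{..<n}. f i (x i))"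
  by (auto simp: fun_eq_iff restrict_def)

text \<open>\<open>d i\<close> is the density of the push-forward of Lebesgue measure under
  \<open>g i\<close>, which may fail to be injective. Such densities multiply; the induction splits
  off the last coordinate, and Fubini exchanges the order of integration. The two uses are affine
  maps and squaring.\<close>

lemma nn_integral_leb_coordinatewise:
  fixes g :: "nat \<Rightarrow> real \<Rightarrow> real" and d :: "nat \<Rightarrow> real \<Rightarrow> ennreal"
  assumes subst: "\<And>i k. i < n \<Longrightarrow> k \<in> borel_measurable borel \<Longrightarrow>
      (\<integral>\<^sup>+v. k (g i v) \<partial>lborel) = (\<integral>\<^sup>+b. d i b * k b \<partial>lborel)"
    and g: "\<And>i. i < n \<Longrightarrow> g i \<in> borel_measurable borel"
    and d: "\<And>i. i < n \<Longrightarrow> d i \<in> borel_measurable borel"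
    and K: "K \<in> borel_measurable (leb n)"
  shows "(\<integral>\<^sup>+v. K (\<lambda>i\<in>{..<n}. g i (v i)) \<partial>leb n) = (\<integral>\<^sup>+b. (\<Prod>i<n. d i (b i)) * K b \<partial>leb n)"
  using assms
proof (induction n arbitrary: K)
  case 0
  then show ?case by (simp add: nn_integral_leb_0 restrict_def del: nn_integral_const)
next
  case (Suc n)
  note [measurable] = Suc.prems(4) Suc.prems(2,3)[OF less_SucI] Suc.prems(2,3)[OF lessI]
  have Km: "(\<lambda>z. K (z(n := y))) \<in> borel_measurable (leb n)" for y by measurable
  have "(\<integral>\<^sup>+v. K (\<lambda>i\<in>{..<Suc n}. g i (v i)) \<partial>leb (Suc n))
      = (\<integral>\<^sup>+y. \<integral>\<^sup>+x. K ((\<lambda>i\<in>{..<n}. g i (x i))(n := g n y)) \<partial>leb n \<partial>lborel)"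
  proof (subst nn_integral_leb_Suc_rev)
    show "(\<lambda>v. K (\<lambda>i\<in>{..<Suc n}. g i (v i))) \<in> borel_measurable (leb (Suc n))"
      using Suc.prems(2) by (intro measurable_compose[OF _ Suc.prems(4)] measurable_leb_restrict) auto
  qed (simp only: restrict_Suc_upd restrict_less_upd fun_upd_same)
  also have "\<dots> = (\<integral>\<^sup>+y. \<integral>\<^sup>+b. (\<Prod>i<n. d i (b i)) * K (b(n := g n y)) \<partial>leb n \<partial>lborel)"
    by (rule nn_integral_cong, rule Suc.IH[OF _ _ _ Km]) (use Suc.prems(1-3) in \<open>auto simp: less_Suc_eq\<close>)
  also have "\<dots> = (\<integral>\<^sup>+b. \<integral>\<^sup>+y. (\<Prod>i<n. d i (b i)) * K (b(n := g n y)) \<partial>lborel \<partial>leb n)"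
    by (rule leb_Fubini[symmetric]) measurable
  also have "\<dots> = (\<integral>\<^sup>+b. \<integral>\<^sup>+y. d n y * ((\<Prod>i<n. d i (b i)) * K (b(n := y))) \<partial>lborel \<partial>leb n)"
    by (intro nn_integral_cong Suc.prems(1)) measurable
  also have "\<dots> = (\<integral>\<^sup>+b. (\<Prod>i<Suc n. d i (b i)) * K b \<partial>leb (Suc n))"
    by (subst nn_integral_leb_Suc) (auto intro!: nn_integral_cong simp: mult_ac)
  finally show ?case .
qed

lemma nn_integral_leb_affine:
  fixes s t :: "nat \<Rightarrow> real"
  assumes s: "\<And>i. i < n \<Longrightarrow> s i \<noteq> 0" and K[measurable]: "K \<in> borel_measurable (leb n)"
  shows "(\<integral>\<^sup>+v. K (\<lambda>i\<in>{..<n}. s i * v i + t i) \<partial>leb n) = ennreal (\<Prod>i<n. 1 / \<bar>s i\<bar>) * (\<integral>\<^sup>+b. K b \<partial>leb n)"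
proof -
  have "(\<integral>\<^sup>+v. K (\<lambda>i\<in>{..<n}. s i * v i + t i) \<partial>leb n)
     = (\<integral>\<^sup>+b. (\<Prod>i<n. ennreal (1 / \<bar>s i\<bar>)) * K b \<partial>leb n)"
  proof (rule nn_integral_leb_coordinatewise)
    fix i and k :: "real \<Rightarrow> ennreal" assume i: "i < n" and [measurable]: "k \<in> borel_measurable borel"
    have "(\<integral>\<^sup>+b. k b \<partial>lborel) = ennreal \<bar>s i\<bar> * (\<integral>\<^sup>+v. k (t i + s i * v) \<partial>lborel)"
      using s[OF i] by (subst nn_integral_real_affine[of k "s i" "t i"]) auto
    then have "ennreal (1 / \<bar>s i\<bar>) * (\<integral>\<^sup>+b. k b \<partial>lborel) = (\<integral>\<^sup>+v. k (t i + s i * v) \<partial>lborel)"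
      using s[OF i] by (simp add: mult.assoc[symmetric] ennreal_mult[symmetric])
    then show "(\<integral>\<^sup>+v. k (s i * v + t i) \<partial>lborel) = (\<integral>\<^sup>+b. ennreal (1 / \<bar>s i\<bar>) * k b \<partial>lborel)"
      by (simp add: nn_integral_cmult add.commute)
  qed auto
  also have "(\<Prod>i<n. ennreal (1 / \<bar>s i\<bar>)) = ennreal (\<Prod>i<n. 1 / \<bar>s i\<bar>)"
    by (rule prod_ennreal) auto
  also have "(\<integral>\<^sup>+b. ennreal (\<Prod>i<n. 1 / \<bar>s i\<bar>) * K b \<partial>leb n) = ennreal (\<Prod>i<n. 1 / \<bar>s i\<bar>) * (\<integral>\<^sup>+b. K b \<partial>leb n)"
    by (rule nn_integral_cmult) measurable
  finally show ?thesis .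
qed

lemma nn_integral_leb_translate:
  assumes K[measurable]: "K \<in> borel_measurable (leb n)"
  shows "(\<integral>\<^sup>+v. K (\<lambda>i\<in>{..<n}. v i + t i) \<partial>leb n) = (\<integral>\<^sup>+b. K b \<partial>leb n)"
  using nn_integral_leb_affine[of n "\<lambda>_. 1" K t, OF _ K] by (simp only: mult_1) simp

lemma measurable_leb_case_nat [measurable (raw)]:
  assumes f: "f \<in> M \<rightarrow>\<^sub>M leb n" and g: "g \<in> borel_measurable M"
  shows "(\<lambda>w. case_nat (g w) (f w)) \<in> M \<rightarrow>\<^sub>M leb (Suc n)"
proof (rule measurable_PiM_single')
  fix i assume i: "i \<in> {..<Suc n}"
  have "i - 1 < n" if "i \<noteq> 0" using that i by auto
  then show "(\<lambda>w. case_nat (g w) (f w) i) \<in> M \<rightarrow>\<^sub>M lborel"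
    using measurable_leb_component[OF f, of "i-1"] g by (cases i) auto
next
  show "(\<lambda>w. case_nat (g w) (f w)) \<in> space M \<rightarrow> (\<Pi>\<^sub>E i\<in>{..<Suc n}. space lborel)"
    using measurable_space[OF f] by (auto simp: PiE_def extensional_def leb_space_ext split: nat.splits)
qed

text \<open>The first coordinate is split off instead of the last one. In the Horner numbering,
  index 0 holds the highest coefficient, which later plays the part of the trace or of a free
  leading coefficient.\<close>

lemma nn_integral_leb_case_nat:
  assumes "F \<in> borel_measurable (leb (Suc n))"
  shows "(\<integral>\<^sup>+x. F x \<partial>leb (Suc n)) = (\<integral>\<^sup>+y. \<integral>\<^sup>+x. F (case_nat y x) \<partial>leb n \<partial>lborel)"
  using assms
proof (induction n arbitrary: F)
  case 0
  have "(\<lambda>_. undefined)(0 := y) = case_nat y (\<lambda>_. undefined)" for y :: real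
    by (auto simp: fun_eq_iff split: nat.splits)
  then show ?case
    by (subst nn_integral_leb_Suc_rev[OF 0]) (simp add: nn_integral_leb_0)
next
  case (Suc n)
  note [measurable] = Suc.prems
  have upd: "(case_nat y x)(Suc n := z) = case_nat y (x(n := z))" for y z :: real and x
    by (auto simp: fun_eq_iff split: nat.splits)
  have "(\<integral>\<^sup>+x. F x \<partial>leb (Suc (Suc n))) = (\<integral>\<^sup>+z. \<integral>\<^sup>+x. F (x(Suc n := z)) \<partial>leb (Suc n) \<partial>lborel)"
    by (rule nn_integral_leb_Suc_rev) measurable
  also have "\<dots> = (\<integral>\<^sup>+z. \<integral>\<^sup>+y. \<integral>\<^sup>+x. F (case_nat y (x(n := z))) \<partial>leb n \<partial>lborel \<partial>lborel)"
    by (intro nn_integral_cong) (subst Suc.IH, simp_all add: upd)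
  also have "\<dots> = (\<integral>\<^sup>+y. \<integral>\<^sup>+z. \<integral>\<^sup>+x. F (case_nat y (x(n := z))) \<partial>leb n \<partial>lborel \<partial>lborel)"
  proof (rule lborel_lborel_Fubini)
    have "(\<lambda>(w, x). F (case_nat (snd w) (x(n := fst w)))) \<in> borel_measurable ((lborel \<Otimes>\<^sub>M lborel) \<Otimes>\<^sub>M leb n)"
      unfolding case_prod_beta by (rule measurable_compose[OF _ Suc.prems], rule measurable_leb_case_nat) measurable
    from sigma_finite_measure.borel_measurable_nn_integral[OF sigma_finite_leb this]
    show "(\<lambda>(z, y). \<integral>\<^sup>+x. F (case_nat y (x(n := z))) \<partial>leb n) \<in> borel_measurable (lborel \<Otimes>\<^sub>M lborel)"
      by (simp add: case_prod_beta)
  qed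
  also have "\<dots> = (\<integral>\<^sup>+y. \<integral>\<^sup>+x. F (case_nat y x) \<partial>leb (Suc n) \<partial>lborel)"
    by (intro nn_integral_cong nn_integral_leb_Suc_rev[symmetric]) measurable
  finally show ?case .
qed

lemma measurable_leb_permute:
  assumes "p permutes {..<n}" shows "(\<lambda>x. x \<circ> p) \<in> leb n \<rightarrow>\<^sub>M leb n"
proof (rule measurable_PiM_single')
  have pin: "p i < n \<longleftrightarrow> i < n" for i
    using permutes_in_image[OF assms, of i] by simp
  show "(\<lambda>x. (x \<circ> p) i) \<in> leb n \<rightarrow>\<^sub>M lborel" if "i \<in> {..<n}" for i
    using that pin by (auto simp: o_def)
  show "(\<lambda>x. x \<circ> p) \<in> space (leb n) \<rightarrow> (\<Pi>\<^sub>E i\<in>{..<n}. space lborel)"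
    by (auto simp: leb_space_ext extensional_def PiE_def pin)
qed

lemma distr_leb_permute:
  assumes p: "p permutes {..<n}"
  shows "distr (leb n) (leb n) (\<lambda>x. x \<circ> p) = leb n"
proof (rule leb.PiM_eqI)
  have pin: "p i < n \<longleftrightarrow> i < n" for i
    using permutes_in_image[OF p, of i] by simp
  note m = measurable_leb_permute[OF p]
  fix A :: "nat \<Rightarrow> real set" assume A: "\<And>i. i \<in> {..<n} \<Longrightarrow> A i \<in> sets lborel"
  have pi: "inv_into UNIV p permutes {..<n}" using p by (rule permutes_inv)
  have "(\<lambda>x. x \<circ> p) -` (Pi\<^sub>E {..<n} A) \<inter> space (leb n) = Pi\<^sub>E {..<n} (A \<circ> inv_into UNIV p)"
  proof (intro equalityI subsetI)
    fix x assume "x \<in> (\<lambda>x. x \<circ> p) -` (Pi\<^sub>E {..<n} A) \<inter> space (leb n)"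
    then have x: "\<And>i. i < n \<Longrightarrow> x (p i) \<in> A i" "x \<in> extensional {..<n}"
      by (auto simp: PiE_def leb_space_ext)
    have "x i \<in> A (inv_into UNIV p i)" if "i < n" for i
      using x(1)[of "inv_into UNIV p i"] that permutes_in_image[OF pi, of i] permutes_inverses[OF p] by simp
    then show "x \<in> Pi\<^sub>E {..<n} (A \<circ> inv_into UNIV p)" using x(2) by (auto simp: PiE_def)
  next
    fix x assume "x \<in> Pi\<^sub>E {..<n} (A \<circ> inv_into UNIV p)"
    then have x: "\<And>i. i < n \<Longrightarrow> x i \<in> A (inv_into UNIV p i)" "x \<in> extensional {..<n}"
      by (auto simp: PiE_def)
    have "x (p i) \<in> A i" if "i < n" for i
      using x(1)[of "p i"] that pin permutes_inverses[OF p] by simp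
    then show "x \<in> (\<lambda>x. x \<circ> p) -` (Pi\<^sub>E {..<n} A) \<inter> space (leb n)"
      using x(2) by (auto simp: PiE_def leb_space_ext extensional_def pin)
  qed
  then have "emeasure (distr (leb n) (leb n) (\<lambda>x. x \<circ> p)) (Pi\<^sub>E {..<n} A)
     = emeasure (leb n) (Pi\<^sub>E {..<n} (A \<circ> inv_into UNIV p))"
    using A m by (subst emeasure_distr) (auto intro!: sets_PiM_I_finite)
  also have "\<dots> = (\<Prod>i<n. emeasure lborel ((A \<circ> inv_into UNIV p) i))"
    using A permutes_in_image[OF pi] by (intro leb.emeasure_PiM) auto
  also have "\<dots> = (\<Prod>i<n. emeasure lborel (A i))"
    using prod.permute[OF pi, of "\<lambda>i. emeasure lborel (A i)"] by (simp add: o_def)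
  finally show "emeasure (distr (leb n) (leb n) (\<lambda>x. x \<circ> p)) (Pi\<^sub>E {..<n} A) = (\<Prod>i<n. emeasure lborel (A i))" .
qed auto

section \<open>Horner coordinates and interpolation\<close>

text \<open>Strictness makes the coordinates distinct, so a polynomial determines its ordered roots,
  \<open>vand\<close> is positive, and each tuple with distinct entries has exactly one
  rearrangement in the chamber.\<close>

definition chamber :: "nat \<Rightarrow> (nat \<Rightarrow> real) \<Rightarrow> bool" where
  "chamber n x \<longleftrightarrow> (\<forall>j<n. \<forall>i<j. x i < x j)"

definition vand :: "nat \<Rightarrow> (nat \<Rightarrow> real) \<Rightarrow> real" where
  "vand n x = (\<Prod>j<n. \<Prod>i<j. (x j - x i))"

lemma chamber_Suc_upd: "chamber (Suc n) (x(n := t)) \<longleftrightarrow> chamber n x \<and> (\<forall>i<n. x i < t)"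
  by (auto simp: chamber_def less_Suc_eq)

lemma chamber_less: "chamber n x \<Longrightarrow> i < j \<Longrightarrow> j < n \<Longrightarrow> x i < x j"
  by (auto simp: chamber_def)

lemma chamber_neq: "chamber n x \<Longrightarrow> i < n \<Longrightarrow> j < n \<Longrightarrow> i \<noteq> j \<Longrightarrow> x i \<noteq> x j"
  by (metis chamber_less less_irrefl nat_neq_iff)

lemma chamber_inj_on: "chamber n x \<Longrightarrow> inj_on x {..<n}"
  by (auto simp: inj_on_def dest: chamber_neq)

lemma vand_cong: "(\<And>i. i < n \<Longrightarrow> x i = y i) \<Longrightarrow> vand n x = vand n y"
  by (auto simp: vand_def intro!: prod.cong)

lemma vand_Suc: "vand (Suc n) x = vand n x * (\<Prod>i<n. x n - x i)"
  by (simp add: vand_def)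

lemma vand_Suc_upd: "vand (Suc n) (x(n := t)) = vand n x * (\<Prod>i<n. t - x i)"
  by (simp add: vand_Suc vand_cong[of n "x(n := t)" x])

lemma vand_pos: "chamber n x \<Longrightarrow> vand n x > 0"
  unfolding vand_def chamber_def by (intro prod_pos ballI) auto

lemma measurable_chamber [measurable (raw)]:
  assumes "f \<in> M \<rightarrow>\<^sub>M leb n"
  shows "Measurable.pred M (\<lambda>w. chamber n (f w))"
proof -
  have [measurable]: "(\<lambda>w. f w i) \<in> borel_measurable M" if "i < n" for i
    using measurable_leb_component[OF assms that] .
  have "Measurable.pred M (\<lambda>w. \<forall>p\<in>{(i, j). i < j \<and> j < n}. f w (fst p) < f w (snd p))"
    by (intro pred_intros_finite(3)) (auto intro: finite_subset[of _ "{..<n} \<times> {..<n}"])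
  moreover have "(\<lambda>w. \<forall>p\<in>{(i, j). i < j \<and> j < n}. f w (fst p) < f w (snd p)) = (\<lambda>w. chamber n (f w))"
    by (auto simp: chamber_def fun_eq_iff)
  ultimately show ?thesis by (simp only:)
qed

lemma measurable_vand [measurable (raw)]:
  assumes "f \<in> M \<rightarrow>\<^sub>M leb n"
  shows "(\<lambda>w. vand n (f w)) \<in> borel_measurable M"
  unfolding vand_def
proof (intro borel_measurable_prod borel_measurable_diff)
  fix i j assume "i \<in> {..<n}" "j \<in> {..<i}"
  then show "(\<lambda>w. f w i) \<in> borel_measurable M" "(\<lambda>w. f w j) \<in> borel_measurable M"
    using measurable_leb_component[OF assms] by auto
qed

text \<open>Horner scheme: \<open>hor s n c x = s x\<^sup>n + c\<^sub>0 x\<^bsup>n-1\<^esup> + \<dots> + c\<^bsub>n-1\<^esub>\<close>.  With this numbering, synthetic division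
  by \<open>x - t\<close> replaces \<open>c\<^sub>j\<close> by the partial Horner value \<open>hor s (j + 1) c t\<close>, so it is unitriangular
  and preserves Lebesgue measure.\<close>

primrec hor :: "real \<Rightarrow> nat \<Rightarrow> (nat \<Rightarrow> real) \<Rightarrow> real \<Rightarrow> real" where
  "hor s 0 c x = s"
| "hor s (Suc n) c x = x * hor s n c x + c n"

lemma hor_cong: "(\<And>i. i < n \<Longrightarrow> c i = c' i) \<Longrightarrow> hor s n c x = hor s n c' x"
  by (induction n) auto

lemma hor_restrict [simp]: "hor s n (restrict c {..<n}) x = hor s n c x"
  by (rule hor_cong) auto

lemma hor_upd [simp]: "hor s n (c(n := y)) x = hor s n c x"
  by (rule hor_cong) auto

lemma hor_synthetic_division:
  "hor s (Suc n) c x = (x - t) * hor s n (\<lambda>j. hor s (Suc j) c t) x + hor s (Suc n) c t"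
proof (induction n)
  case (Suc n)
  have "hor s (Suc (Suc n)) c x = x * hor s (Suc n) c x + c (Suc n)" by simp
  also have "\<dots> = x * ((x - t) * hor s n (\<lambda>j. hor s (Suc j) c t) x + hor s (Suc n) c t) + c (Suc n)"
    by (subst Suc.IH) simp
  finally show ?case by (simp add: algebra_simps)
qed (simp add: algebra_simps)

lemma hor_zeros:
  assumes "inj_on l {..<n}" "\<And>i. i < n \<Longrightarrow> hor s n c (l i) = 0"
  shows "hor s n c x = s * (\<Prod>i<n. x - l i)"
  using assms
proof (induction n arbitrary: c x)
  case (Suc n)
  let ?d = "\<lambda>j. hor s (Suc j) c (l n)"
  have div: "hor s (Suc n) c y = (y - l n) * hor s n ?d y" for y
    using hor_synthetic_division[of s n c y "l n"] Suc.prems(2)[of n] by simp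
  have "hor s n ?d (l i) = 0" if "i < n" for i
  proof -
    have "l i \<noteq> l n" using Suc.prems(1) that by (auto simp: inj_on_def)
    then show ?thesis using div[of "l i"] Suc.prems(2)[of i] that by simp
  qed
  moreover have "inj_on l {..<n}" using Suc.prems(1) by (rule inj_on_subset) auto
  ultimately have "hor s n ?d x = s * (\<Prod>i<n. x - l i)" using Suc.IH by blast
  then show ?case using div[of x] by (simp add: mult_ac)
qed simp

lemma measurable_hor [measurable (raw)]:
  assumes f: "f \<in> M \<rightarrow>\<^sub>M leb n" and g[measurable]: "g \<in> borel_measurable M"
  shows "(\<lambda>w. hor s n (f w) (g w)) \<in> borel_measurable M"
proof -
  have "(\<lambda>w. hor s k (f w) (g w)) \<in> borel_measurable M" if "k \<le> n" for k
    using that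
  proof (induction k)
    case (Suc k)
    then have [measurable]: "(\<lambda>w. hor s k (f w) (g w)) \<in> borel_measurable M" by simp
    have [measurable]: "(\<lambda>w. f w k) \<in> borel_measurable M"
      using Suc.prems by (intro measurable_leb_component[OF f]) auto
    show ?case by simp
  qed simp
  then show ?thesis by simp
qed

lemma measurable_hor_le:
  assumes f: "f \<in> M \<rightarrow>\<^sub>M leb n" and g: "g \<in> borel_measurable M" and k: "k \<le> n"
  shows "(\<lambda>w. hor s k (f w) (g w)) \<in> borel_measurable M"
proof -
  have "(\<lambda>w. \<lambda>i\<in>{..<k}. f w i) \<in> M \<rightarrow>\<^sub>M leb k"
    using k by (intro measurable_leb_restrict measurable_leb_component[OF f]) auto
  from measurable_hor[OF this g, of s] show ?thesis by simp
qed

definition synth :: "real \<Rightarrow> nat \<Rightarrow> (nat \<Rightarrow> real) \<Rightarrow> real \<Rightarrow> nat \<Rightarrow> real" where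
  "synth s n c t = (\<lambda>j\<in>{..<n}. hor s (Suc j) c t)"

lemma measurable_synth [measurable (raw)]:
  assumes f: "f \<in> M \<rightarrow>\<^sub>M leb n" and g: "g \<in> borel_measurable M"
  shows "(\<lambda>w. synth s n (f w) (g w)) \<in> M \<rightarrow>\<^sub>M leb n"
  unfolding synth_def by (intro measurable_leb_restrict measurable_hor_le[OF f g]) auto

lemma hor_synth: "hor s n (synth s n c t) x = hor s n (\<lambda>j. hor s (Suc j) c t) x"
  by (simp add: synth_def)

lemma nn_integral_translate:
  fixes k :: "real \<Rightarrow> ennreal"
  assumes "k \<in> borel_measurable borel"
  shows "(\<integral>\<^sup>+y. k (t + y) \<partial>lborel) = (\<integral>\<^sup>+y. k y \<partial>lborel)"
  using nn_integral_real_affine[OF assms, of 1 t] by simp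

lemma nn_integral_leb_synth:
  assumes "G \<in> borel_measurable (leb n)"
  shows "(\<integral>\<^sup>+c. G (synth s n c t) \<partial>leb n) = (\<integral>\<^sup>+d. G d \<partial>leb n)"
  using assms
proof (induction n arbitrary: G)
  case 0
  then show ?case by (simp add: nn_integral_leb_0 synth_def restrict_def del: nn_integral_const)
next
  case (Suc n)
  note [measurable] = Suc.prems
  \<comment> \<open>Only the last coordinate involves \<open>y\<close>, and only through a
    translation by a function of the earlier ones. Integrating it first removes the shift; the
    induction hypothesis then treats the earlier coordinates for fixed \<open>y\<close>.\<close>
  have eq: "synth s (Suc n) (c(n := y)) t = (synth s n c t)(n := t * hor s n c t + y)" for c y
  proof
    fix j show "synth s (Suc n) (c(n := y)) t j = ((synth s n c t)(n := t * hor s n c t + y)) j"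
      using hor_cong[of j "c(n := y)" c s t] by (auto simp: synth_def restrict_def)
  qed
  have "(\<integral>\<^sup>+c. G (synth s (Suc n) c t) \<partial>leb (Suc n))
      = (\<integral>\<^sup>+c. \<integral>\<^sup>+y. G ((synth s n c t)(n := t * hor s n c t + y)) \<partial>lborel \<partial>leb n)"
    by (subst nn_integral_leb_Suc) (simp_all add: eq)
  also have "\<dots> = (\<integral>\<^sup>+c. \<integral>\<^sup>+y. G ((synth s n c t)(n := y)) \<partial>lborel \<partial>leb n)"
  proof (rule nn_integral_cong)
    fix c assume [measurable]: "c \<in> space (leb n)"
    show "(\<integral>\<^sup>+y. G ((synth s n c t)(n := t * hor s n c t + y)) \<partial>lborel) = (\<integral>\<^sup>+y. G ((synth s n c t)(n := y)) \<partial>lborel)"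
      by (rule nn_integral_translate) measurable
  qed
  also have "\<dots> = (\<integral>\<^sup>+y. \<integral>\<^sup>+c. G ((synth s n c t)(n := y)) \<partial>leb n \<partial>lborel)"
    by (rule leb_Fubini) measurable
  also have "\<dots> = (\<integral>\<^sup>+y. \<integral>\<^sup>+c. G (c(n := y)) \<partial>leb n \<partial>lborel)"
    by (rule nn_integral_cong, rule Suc.IH) measurable
  also have "\<dots> = (\<integral>\<^sup>+d. G d \<partial>leb (Suc n))"
    by (rule nn_integral_leb_Suc_rev[symmetric]) measurable
  finally show ?case .
qed

lemma measurable_hor_const [measurable]: "hor s n c \<in> borel_measurable borel"
  by (induction n) (auto intro!: borel_measurable_add borel_measurable_times)

text \<open>Evaluation at the nodes is the Vandermonde map, taken apart by division by
  \<open>x - \<mu> n\<close>. The remainder is the value at the last node, which is a translate of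
  the last coefficient; the other values are \<open>\<mu> i - \<mu> n\<close> times those of the
  quotient, plus the remainder. The scalings supply the new factors of \<open>vand\<close>.\<close>

lemma nn_integral_leb_interpolation:
  assumes "inj_on \<mu> {..<n}" "G \<in> borel_measurable (leb n)"
  shows "(\<integral>\<^sup>+c. G (\<lambda>i\<in>{..<n}. hor s n c (\<mu> i)) \<partial>leb n) = ennreal (1 / \<bar>vand n \<mu>\<bar>) * (\<integral>\<^sup>+b. G b \<partial>leb n)"
  using assms
proof (induction n arbitrary: G)
  case 0
  then show ?case by (simp add: nn_integral_leb_0 restrict_def vand_def del: nn_integral_const)
next
  case (Suc n)
  note [measurable] = Suc.prems(2)
  let ?t = "\<mu> n"
  let ?V = "\<lambda>d y. (\<lambda>i\<in>{..<n}. (\<mu> i - ?t) * hor s n d (\<mu> i) + y)(n := y)"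
  let ?W = "\<lambda>b y. (\<lambda>i\<in>{..<n}. (\<mu> i - ?t) * b i + y)(n := y)"
  have eq: "(\<lambda>i\<in>{..<Suc n}. hor s (Suc n) (c(n := y)) (\<mu> i)) = ?V (synth s n c ?t) (?t * hor s n c ?t + y)" for c y
  proof
    fix i
    have "hor s (Suc n) (c(n := y)) (\<mu> i) = (\<mu> i - ?t) * hor s n (\<lambda>j. hor s (Suc j) (c(n := y)) ?t) (\<mu> i)
        + hor s (Suc n) (c(n := y)) ?t"
      by (rule hor_synthetic_division)
    also have "hor s n (\<lambda>j. hor s (Suc j) (c(n := y)) ?t) (\<mu> i) = hor s n (synth s n c ?t) (\<mu> i)"
      unfolding hor_synth by (rule hor_cong, rule hor_cong) auto
    finally have "hor s (Suc n) (c(n := y)) (\<mu> i) = (\<mu> i - ?t) * hor s n (synth s n c ?t) (\<mu> i) + (?t * hor s n c ?t + y)"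
      by (simp only: hor.simps hor_upd fun_upd_same)
    then show "(\<lambda>i\<in>{..<Suc n}. hor s (Suc n) (c(n := y)) (\<mu> i)) i
      = ?V (synth s n c ?t) (?t * hor s n c ?t + y) i"
      by (cases "i = n") (simp_all del: hor.simps)
  qed
  have inj: "inj_on \<mu> {..<n}" using Suc.prems(1) by (rule inj_on_subset) auto
  have ne: "\<mu> i - ?t \<noteq> 0" if "i < n" for i using Suc.prems(1) that by (auto simp: inj_on_def)
  have "(\<integral>\<^sup>+c. G (\<lambda>i\<in>{..<Suc n}. hor s (Suc n) c (\<mu> i)) \<partial>leb (Suc n))
     = (\<integral>\<^sup>+c. \<integral>\<^sup>+y. G (\<lambda>i\<in>{..<Suc n}. hor s (Suc n) (c(n := y)) (\<mu> i)) \<partial>lborel \<partial>leb n)"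
    by (rule nn_integral_leb_Suc) measurable
  also have "\<dots> = (\<integral>\<^sup>+c. \<integral>\<^sup>+y. G (?V (synth s n c ?t) (?t * hor s n c ?t + y)) \<partial>lborel \<partial>leb n)"
    by (simp only: eq)
  also have "\<dots> = (\<integral>\<^sup>+c. \<integral>\<^sup>+y. G (?V (synth s n c ?t) y) \<partial>lborel \<partial>leb n)"
  proof (rule nn_integral_cong)
    fix c assume [measurable]: "c \<in> space (leb n)"
    show "(\<integral>\<^sup>+y. G (?V (synth s n c ?t) (?t * hor s n c ?t + y)) \<partial>lborel) = (\<integral>\<^sup>+y. G (?V (synth s n c ?t) y) \<partial>lborel)"
      by (rule nn_integral_translate) measurable
  qed
  also have "\<dots> = (\<integral>\<^sup>+y. \<integral>\<^sup>+c. G (?V (synth s n c ?t) y) \<partial>leb n \<partial>lborel)"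
    by (rule leb_Fubini) measurable
  also have "\<dots> = (\<integral>\<^sup>+y. \<integral>\<^sup>+d. G (?V d y) \<partial>leb n \<partial>lborel)"
    by (rule nn_integral_cong, rule nn_integral_leb_synth) measurable
  also have "\<dots> = (\<integral>\<^sup>+y. \<integral>\<^sup>+d. G (?W (\<lambda>i\<in>{..<n}. hor s n d (\<mu> i)) y) \<partial>leb n \<partial>lborel)"
    by (simp cong: restrict_cong)
  also have "\<dots> = (\<integral>\<^sup>+y. ennreal (1 / \<bar>vand n \<mu>\<bar>) * (\<integral>\<^sup>+b. G (?W b y) \<partial>leb n) \<partial>lborel)"
    by (rule nn_integral_cong, rule Suc.IH[OF inj]) measurable
  also have "\<dots> = (\<integral>\<^sup>+y. ennreal (1 / \<bar>vand n \<mu>\<bar>) * (ennreal (\<Prod>i<n. 1 / \<bar>\<mu> i - ?t\<bar>) * (\<integral>\<^sup>+b. G (b(n := y)) \<partial>leb n)) \<partial>lborel)"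
  proof (intro nn_integral_cong arg_cong2[where f="(*)"] refl)
    fix y
    show "(\<integral>\<^sup>+b. G (?W b y) \<partial>leb n) = ennreal (\<Prod>i<n. 1 / \<bar>\<mu> i - ?t\<bar>) * (\<integral>\<^sup>+b. G (b(n := y)) \<partial>leb n)"
      by (rule nn_integral_leb_affine[OF ne]) (auto intro!: measurable_compose[OF _ Suc.prems(2)])
  qed
  also have "\<dots> = (\<integral>\<^sup>+y. ennreal (1 / \<bar>vand n \<mu>\<bar> * (\<Prod>i<n. 1 / \<bar>\<mu> i - ?t\<bar>)) * (\<integral>\<^sup>+b. G (b(n := y)) \<partial>leb n) \<partial>lborel)"
    by (subst ennreal_mult) (simp_all add: prod_nonneg mult.assoc)
  also have "\<dots> = ennreal (1 / \<bar>vand n \<mu>\<bar> * (\<Prod>i<n. 1 / \<bar>\<mu> i - ?t\<bar>)) * (\<integral>\<^sup>+y. \<integral>\<^sup>+b. G (b(n := y)) \<partial>leb n \<partial>lborel)"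
    by (rule nn_integral_cmult) measurable
  also have "1 / \<bar>vand n \<mu>\<bar> * (\<Prod>i<n. 1 / \<bar>\<mu> i - ?t\<bar>) = 1 / \<bar>vand (Suc n) \<mu>\<bar>"
    by (simp add: vand_Suc abs_mult abs_prod prod_dividef abs_minus_commute)
  also have "(\<integral>\<^sup>+y. \<integral>\<^sup>+b. G (b(n := y)) \<partial>leb n \<partial>lborel) = (\<integral>\<^sup>+b. G b \<partial>leb (Suc n))"
    by (rule nn_integral_leb_Suc_rev[symmetric]) measurable
  finally show ?case .
qed

section \<open>From coefficients to roots\<close>

text \<open>\<open>lift_root n d t\<close> are the coefficients of \<open>(x - t) (x\<^sup>n + d\<^sub>0 x\<^bsup>n-1\<^esup> + \<dots>)\<close>, and \<open>co n l\<close> those of the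
  monic polynomial with roots \<open>l\<^sub>0, \<dots>, l\<^bsub>n-1\<^esub>\<close>.\<close>

definition lift_root :: "nat \<Rightarrow> (nat \<Rightarrow> real) \<Rightarrow> real \<Rightarrow> nat \<Rightarrow> real" where
  "lift_root n d t j = (if j < n then d j else 0) - t * (if j = 0 then 1 else d (j - 1))"

primrec co :: "nat \<Rightarrow> (nat \<Rightarrow> real) \<Rightarrow> nat \<Rightarrow> real" where
  "co 0 l = (\<lambda>_. 0)"
| "co (Suc n) l = lift_root n (co n l) (l n)"

lemma co_cong: "(\<And>i. i < n \<Longrightarrow> l i = l' i) \<Longrightarrow> co n l = co n l'"
  by (induction n) auto

lemma lift_root_cong: "(\<And>i. i < n \<Longrightarrow> d i = d' i) \<Longrightarrow> j \<le> n \<Longrightarrow> lift_root n d t j = lift_root n d' t j"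
  by (cases j) (auto simp: lift_root_def)

lemma hor_lift_root_less:
  "k < n \<Longrightarrow> hor 1 (Suc k) (lift_root n d t) x = hor 1 (Suc k) d x - t * hor 1 k d x"
proof (induction k)
  case 0 then show ?case by (simp add: lift_root_def)
next
  case (Suc k)
  have "hor 1 (Suc (Suc k)) (lift_root n d t) x = x * hor 1 (Suc k) (lift_root n d t) x + (d (Suc k) - t * d k)"
    using Suc.prems by (simp add: lift_root_def)
  also have "\<dots> = x * (hor 1 (Suc k) d x - t * hor 1 k d x) + (d (Suc k) - t * d k)"
    using Suc by (simp del: hor.simps)
  finally show ?case by (simp add: algebra_simps)
qed

lemma hor_lift_root: "hor 1 (Suc n) (lift_root n d t) x = (x - t) * hor 1 n d x"
proof (cases n)
  case 0 then show ?thesis by (simp add: lift_root_def)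
next
  case (Suc m)
  have "hor 1 (Suc n) (lift_root n d t) x = x * hor 1 (Suc m) (lift_root n d t) x - t * d m"
    by (simp add: Suc lift_root_def)
  also have "\<dots> = x * (hor 1 (Suc m) d x - t * hor 1 m d x) - t * d m"
    using Suc by (subst hor_lift_root_less) auto
  finally show ?thesis by (simp add: Suc algebra_simps)
qed

lemma hor_co: "hor 1 n (co n l) x = (\<Prod>i<n. x - l i)"
  by (induction n) (simp_all add: hor_lift_root mult_ac del: hor.simps(2))

text \<open>Multiplying the quotient by \<open>x - t\<close> again restores the coefficients, except
  that the constant term becomes the one for which \<open>t\<close> is a root.\<close>

lemma lift_root_synth:
  assumes "j \<le> n"
  shows "lift_root n (synth 1 n c t) t j = (c(n := - t * hor 1 n c t)) j"
  using assms by (cases j) (auto simp: lift_root_def synth_def restrict_def)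

definition has_roots :: "nat \<Rightarrow> (nat \<Rightarrow> real) \<Rightarrow> (nat \<Rightarrow> real) \<Rightarrow> bool" where
  "has_roots n c l \<longleftrightarrow> chamber n l \<and> (\<forall>x. hor 1 n c x = (\<Prod>i<n. x - l i))"

lemma has_roots_restrict [simp]: "has_roots n (restrict c {..<n}) l = has_roots n c l"
  by (simp add: has_roots_def)

lemma has_roots_co: "chamber n l \<Longrightarrow> has_roots n (co n l) l"
  by (simp add: has_roots_def hor_co)

lemma has_roots_zeros: "has_roots n c l \<Longrightarrow> hor 1 n c x = 0 \<longleftrightarrow> (\<exists>i<n. x = l i)"
  by (auto simp: has_roots_def)

lemma chamber_unique:
  assumes "chamber n l" "chamber n l'" "l ` {..<n} = l' ` {..<n}" "i < n"
  shows "l i = l' i"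
proof -
  have "sorted_wrt (<) (map l [0..<n])" if "chamber n l" for l
    using that by (auto simp: sorted_wrt_iff_nth_less chamber_def)
  then have "map l [0..<n] = map l' [0..<n]"
    using assms by (intro sorted_distinct_set_unique) (auto simp: strict_sorted_iff atLeast0LessThan)
  then have "map l [0..<n] ! i = map l' [0..<n] ! i" by (rule arg_cong)
  then show ?thesis using assms(4) by simp
qed

lemma has_roots_unique:
  assumes "has_roots n c l" "has_roots n c l'" "i < n"
  shows "l i = l' i"
proof (rule chamber_unique[OF _ _ _ assms(3)])
  show "l ` {..<n} = l' ` {..<n}"
    using has_roots_zeros[OF assms(1)] has_roots_zeros[OF assms(2)] by (fastforce simp: image_iff)
qed (use assms in \<open>auto simp: has_roots_def\<close>)

text \<open>Exactly the \<open>n - i\<close> factors with \<open>j \<ge> i\<close> are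
  negative.\<close>

lemma sign_prod_chamber:
  assumes "\<And>j. j < i \<Longrightarrow> l j < x" "\<And>j. i \<le> j \<Longrightarrow> j < n \<Longrightarrow> x < l j" "i \<le> n"
  shows "(-1) ^ (n - i) * (\<Prod>j<n. x - l j) > (0::real)"
proof -
  have "{..<n} = {..<i} \<union> {i..<n}" using assms(3) by auto
  then have "(\<Prod>j<n. x - l j) = (\<Prod>j<i. x - l j) * (\<Prod>j=i..<n. x - l j)"
    by (simp add: prod.union_disjoint ivl_disj_int)
  also have "(\<Prod>j=i..<n. x - l j) = (-1) ^ (n - i) * (\<Prod>j=i..<n. l j - x)"
  proof -
    have "(\<Prod>j=i..<n. x - l j) = (\<Prod>j=i..<n. (-1) * (l j - x))" by (rule prod.cong) auto
    also have "\<dots> = (-1) ^ (n - i) * (\<Prod>j=i..<n. l j - x)" by (subst prod.distrib) simp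
    finally show ?thesis .
  qed
  finally have "(-1) ^ (n - i) * (\<Prod>j<n. x - l j) = (\<Prod>j<i. x - l j) * (\<Prod>j=i..<n. l j - x)"
    by (simp add: power_add[symmetric] mult.left_commute)
  also have "\<dots> > 0" using assms by (intro mult_pos_pos prod_pos) auto
  finally show ?thesis .
qed

lemma isCont_hor [continuous_intros]: "isCont (hor s n c) x"
  by (induction n) (auto intro!: continuous_intros)

text \<open>The intermediate value theorem gives a root in each of the \<open>n\<close> gaps. These
  roots are distinct and exhaust the degree, so the monic polynomial is the product of their linear
  factors.\<close>

lemma hor_alternating_roots:
  assumes r: "\<And>i. i < n \<Longrightarrow> r i < r (Suc i)"
    and alt: "\<And>i. i \<le> n \<Longrightarrow> (-1) ^ (n - i) * hor 1 n c (r i) > 0"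
  obtains l where "has_roots n c l" "\<And>i. i < n \<Longrightarrow> r i < l i \<and> l i < r (Suc i)"
proof -
  have "\<exists>x. r i < x \<and> x < r (Suc i) \<and> hor 1 n c x = 0" if i: "i < n" for i
  proof -
    let ?e = "(-1) ^ (n - Suc i) :: real"
    let ?f = "\<lambda>x. ?e * hor 1 n c x"
    have ni: "n - i = Suc (n - Suc i)" using i by simp
    have "?f (r (Suc i)) > 0" using alt[of "Suc i"] i by simp
    moreover have "?f (r i) < 0" using alt[of i] i unfolding ni by simp
    moreover have "\<forall>x. r i \<le> x \<and> x \<le> r (Suc i) \<longrightarrow> isCont ?f x"
      by (auto intro!: continuous_intros)
    ultimately obtain x where x: "r i \<le> x" "x \<le> r (Suc i)" "?f x = 0"
      using IVT[of ?f "r i" 0 "r (Suc i)"] r[OF i] by (auto simp: less_imp_le)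
    then have "hor 1 n c x = 0" by simp
    moreover have "x \<noteq> r i" "x \<noteq> r (Suc i)"
      using x(3) \<open>?f (r i) < 0\<close> \<open>?f (r (Suc i)) > 0\<close> by auto
    ultimately show ?thesis using x by (intro exI[of _ x]) auto
  qed
  then obtain l where l: "\<And>i. i < n \<Longrightarrow> r i < l i \<and> l i < r (Suc i) \<and> hor 1 n c (l i) = 0"
    by metis
  have mono: "r i \<le> r j" if "i \<le> j" "j \<le> n" for i j
    using that
  proof (induction rule: dec_induct)
    case (step k) then show ?case using r[of k] by simp
  qed simp
  have ch: "chamber n l"
    unfolding chamber_def
  proof (intro allI impI)
    fix i j assume "j < n" "i < j"
    then have "l i < r (Suc i)" "r (Suc i) \<le> r j" "r j < l j" using l mono by auto
    then show "l i < l j" by simp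
  qed
  show ?thesis
    by (rule that[of l]) (use l ch hor_zeros[of l n 1 c] chamber_inj_on in \<open>auto simp: has_roots_def\<close>)
qed

section \<open>Measurability of real-rootedness\<close>

definition roots_below :: "nat \<Rightarrow> (nat \<Rightarrow> real) \<Rightarrow> real \<Rightarrow> bool" where
  "roots_below n c t \<longleftrightarrow> (\<exists>l. has_roots n c l \<and> (\<forall>i<n. l i < t))"

text \<open>A vector of real roots is replaced by a list of rationals that separate them and at
  which the signs alternate. The existential quantifier then ranges over a countable set, as
  measurability in the coefficients and in \<open>t\<close> requires.\<close>

lemma roots_below_iff_rat:
  "roots_below n c t \<longleftrightarrow> (\<exists>rs :: rat list. (\<forall>i<n. rs ! i < rs ! Suc i) \<and>
     (\<forall>i\<le>n. (-1) ^ (n - i) * hor 1 n c (of_rat (rs ! i)) > 0) \<and> of_rat (rs ! n) < t)"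
proof
  assume "roots_below n c t"
  then obtain l where l: "has_roots n c l" "\<And>i. i < n \<Longrightarrow> l i < t"
    by (auto simp: roots_below_def)
  have ch: "chamber n l" using l by (simp add: has_roots_def)
  \<comment> \<open>The \<open>i\<close>-th rational is taken between \<open>lo i\<close> and
    \<open>hi i\<close>: before the first root, between neighbouring roots, and finally between the
    last root and \<open>t\<close>. For \<open>n = 0\<close> there is a single rational, placed
    between \<open>t - 1\<close> and \<open>t\<close>.\<close>
  define lo where "lo i = (if i = 0 then (if n = 0 then t - 1 else l 0 - 1) else l (i - 1))" for i
  define hi where "hi i = (if i = n then t else l i)" for i
  have "lo i < hi i" if "i \<le> n" for i
  proof (cases "i = 0")
    case True then show ?thesis using that by (auto simp: lo_def hi_def)
  next
    case False
    then have "l (i - 1) < l i" if "i < n" using that ch by (intro chamber_less[of n]) auto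
    then show ?thesis using False that l(2)[of "i - 1"] by (auto simp: lo_def hi_def)
  qed
  then have "\<exists>q. lo i < of_rat q \<and> of_rat q < hi i" if "i \<le> n" for i
    using of_rat_dense that by blast
  then obtain q where q: "\<And>i. i \<le> n \<Longrightarrow> lo i < of_rat (q i) \<and> of_rat (q i) < hi i"
    by metis
  define rs where "rs = map q [0..<Suc n]"
  have rs: "rs ! i = q i" if "i \<le> n" for i
    using that unfolding rs_def by (subst nth_map) (auto simp del: upt_Suc)
  show "\<exists>rs :: rat list. (\<forall>i<n. rs ! i < rs ! Suc i) \<and>
     (\<forall>i\<le>n. (-1) ^ (n - i) * hor 1 n c (of_rat (rs ! i)) > 0) \<and> of_rat (rs ! n) < t"
  proof (intro exI[of _ rs] conjI allI impI)
    fix i assume i: "i < n"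
    have "real_of_rat (q i) < l i" "l i < real_of_rat (q (Suc i))"
      using q[of i] q[of "Suc i"] i by (auto simp: lo_def hi_def)
    then have "real_of_rat (q i) < real_of_rat (q (Suc i))" by linarith
    then show "rs ! i < rs ! Suc i" using i by (simp add: rs of_rat_less)
  next
    fix i assume i: "i \<le> n"
    have "l j < of_rat (q i)" if "j < i" for j
    proof -
      have "l j \<le> l (i - 1)"
        using chamber_less[OF ch, of j "i - 1"] that i by (cases "j = i - 1") (auto simp: less_imp_le)
      also have "\<dots> < of_rat (q i)" using q[of i] i that by (auto simp: lo_def)
      finally show ?thesis .
    qed
    moreover have "of_rat (q i) < l j" if "i \<le> j" "j < n" for j
    proof -
      have "of_rat (q i) < l i" using q[of i] i that by (auto simp: hi_def)
      also have "l i \<le> l j" using chamber_less[OF ch, of i j] that by (cases "i = j") (auto simp: less_imp_le)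
      finally show ?thesis .
    qed
    ultimately show "(-1) ^ (n - i) * hor 1 n c (of_rat (rs ! i)) > 0"
      using sign_prod_chamber[of i l "of_rat (q i)" n] i l(1) by (simp add: rs has_roots_def)
  next
    show "of_rat (rs ! n) < t" using q[of n] by (simp add: rs hi_def)
  qed
next
  assume "\<exists>rs :: rat list. (\<forall>i<n. rs ! i < rs ! Suc i) \<and>
     (\<forall>i\<le>n. (-1) ^ (n - i) * hor 1 n c (of_rat (rs ! i)) > 0) \<and> of_rat (rs ! n) < t"
  then obtain rs :: "rat list" where rs: "\<forall>i<n. rs ! i < rs ! Suc i"
     "\<forall>i\<le>n. (-1) ^ (n - i) * hor 1 n c (of_rat (rs ! i)) > 0" "of_rat (rs ! n) < t" by blast
  obtain l where l: "has_roots n c l" "\<And>i. i < n \<Longrightarrow> of_rat (rs ! i) < l i \<and> l i < of_rat (rs ! Suc i)"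
    using hor_alternating_roots[of n "\<lambda>i. of_rat (rs ! i)" c] rs by (auto simp: of_rat_less)
  have "l i < t" if "i < n" for i
  proof -
    have "rs ! Suc i \<le> rs ! n"
      using that by (intro dec_induct[of "Suc i" n "\<lambda>k. rs ! Suc i \<le> rs ! k"])
        (use rs(1) in \<open>auto intro: order_trans less_imp_le\<close>)
    then have "real_of_rat (rs ! Suc i) \<le> of_rat (rs ! n)" by (simp add: of_rat_less_eq)
    then show ?thesis using l(2)[OF that] rs(3) by linarith
  qed
  then show "roots_below n c t" using l(1) by (auto simp: roots_below_def)
qed

lemma measurable_roots_below [measurable (raw)]:
  assumes [measurable]: "f \<in> M \<rightarrow>\<^sub>M leb n" "g \<in> borel_measurable M"
  shows "Measurable.pred M (\<lambda>w. roots_below n (f w) (g w))"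
  unfolding roots_below_iff_rat by measurable

definition real_rooted :: "nat \<Rightarrow> (nat \<Rightarrow> real) \<Rightarrow> bool" where
  "real_rooted n c \<longleftrightarrow> (\<exists>l. has_roots n c l)"

lemma real_rooted_iff_below: "real_rooted n c \<longleftrightarrow> (\<exists>k::nat. roots_below n c (real k))"
proof
  assume "real_rooted n c"
  then obtain l where l: "has_roots n c l" by (auto simp: real_rooted_def)
  obtain k :: nat where "(\<Sum>i<n. \<bar>l i\<bar>) < real k" using reals_Archimedean2 by blast
  moreover have "l i \<le> (\<Sum>i<n. \<bar>l i\<bar>)" if "i < n" for i
    using member_le_sum[of i "{..<n}" "\<lambda>i. \<bar>l i\<bar>"] that by auto
  ultimately show "\<exists>k::nat. roots_below n c (real k)"
    using l unfolding roots_below_def by (meson le_less_trans)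
qed (auto simp: real_rooted_def roots_below_def)

lemma measurable_real_rooted [measurable (raw)]:
  assumes [measurable]: "f \<in> M \<rightarrow>\<^sub>M leb n"
  shows "Measurable.pred M (\<lambda>w. real_rooted n (f w))"
  unfolding real_rooted_iff_below by measurable

lemma measurable_lift_root [measurable (raw)]:
  assumes f: "f \<in> M \<rightarrow>\<^sub>M leb n" and [measurable]: "g \<in> borel_measurable M"
  shows "(\<lambda>w. \<lambda>j\<in>{..<Suc n}. lift_root n (f w) (g w) j) \<in> M \<rightarrow>\<^sub>M leb (Suc n)"
proof (rule measurable_leb_restrict)
  fix j assume j: "j < Suc n"
  have [measurable]: "(\<lambda>w. f w i) \<in> borel_measurable M" if "i < n" for i
    by (rule measurable_leb_component[OF f that])
  show "(\<lambda>w. lift_root n (f w) (g w) j) \<in> borel_measurable M"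
    using j by (cases j) (auto simp: lift_root_def less_Suc_eq)
qed

lemma measurable_co [measurable (raw)]:
  assumes f: "f \<in> M \<rightarrow>\<^sub>M leb n"
  shows "(\<lambda>w. \<lambda>j\<in>{..<n}. co n (f w) j) \<in> M \<rightarrow>\<^sub>M leb n"
  using f
proof (induction n arbitrary: f)
  case (Suc n)
  have fi: "(\<lambda>w. f w i) \<in> borel_measurable M" if "i < Suc n" for i
    by (rule measurable_leb_component[OF Suc.prems that])
  have "(\<lambda>w. \<lambda>i\<in>{..<n}. f w i) \<in> M \<rightarrow>\<^sub>M leb n"
    by (intro measurable_leb_restrict fi) auto
  from Suc.IH[OF this] have "(\<lambda>w. \<lambda>j\<in>{..<n}. co n (f w) j) \<in> M \<rightarrow>\<^sub>M leb n"
    by (subst (asm) co_cong[of n "\<lambda>i\<in>{..<n}. f w i" "f w" for w]) simp_all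
  from measurable_lift_root[OF this fi[of n]]
  have "(\<lambda>w. \<lambda>j\<in>{..<Suc n}. lift_root n (\<lambda>j\<in>{..<n}. co n (f w) j) (f w n) j) \<in> M \<rightarrow>\<^sub>M leb (Suc n)"
    by simp
  moreover have "(\<lambda>j\<in>{..<Suc n}. lift_root n (\<lambda>j\<in>{..<n}. co n (f w) j) (f w n) j) = (\<lambda>j\<in>{..<Suc n}. co (Suc n) (f w) j)" for w
    by (rule restrict_ext) (auto intro!: lift_root_cong)
  ultimately show ?case by (simp only:)
qed (auto intro!: measurable_leb_restrict)

text \<open>Synthetic division is exactly the difference quotient:
  \<open>y * hor 1 n c y - t * hor 1 n c t\<close> equals \<open>y - t\<close> times the value at
  \<open>y\<close> of the quotient polynomial, whose continuity gives the limit.\<close>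

lemma hor_lift_derivative:
  "((\<lambda>t. - t * hor 1 n c t) has_field_derivative - hor 1 n (synth 1 n c t) t) (at t)"
proof -
  have eq: "- y * hor 1 n c y - (- t * hor 1 n c t) = (y - t) * - hor 1 n (synth 1 n c t) y" for y
    using hor_synthetic_division[of 1 n c y t] by (simp add: hor_synth algebra_simps)
  have "((\<lambda>y. (- y * hor 1 n c y - (- t * hor 1 n c t)) / (y - t)) \<longlongrightarrow> - hor 1 n (synth 1 n c t) t) (at t)"
  proof (rule Lim_transform_eventually)
    show "((\<lambda>y. - hor 1 n (synth 1 n c t) y) \<longlongrightarrow> - hor 1 n (synth 1 n c t) t) (at t)"
      using isCont_hor[of t 1 n "synth 1 n c t"] by (intro tendsto_minus) (simp add: isCont_def)
    show "\<forall>\<^sub>F y in at t. - hor 1 n (synth 1 n c t) y = (- y * hor 1 n c y - (- t * hor 1 n c t)) / (y - t)"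
      unfolding eq by (auto simp: eventually_at_filter)
  qed
  then show ?thesis by (simp add: has_field_derivative_iff)
qed

lemma hor_root_split:
  assumes "y = - t * hor 1 n c t"
  shows "hor 1 (Suc n) (c(n := y)) x = (x - t) * hor 1 n (synth 1 n c t) x"
proof -
  have "hor 1 (Suc n) (c(n := y)) x = (x - t) * hor 1 n (\<lambda>j. hor 1 (Suc j) (c(n := y)) t) x + hor 1 (Suc n) (c(n := y)) t"
    by (rule hor_synthetic_division)
  also have "hor 1 n (\<lambda>j. hor 1 (Suc j) (c(n := y)) t) x = hor 1 n (synth 1 n c t) x"
    unfolding hor_synth by (rule hor_cong, rule hor_cong) auto
  also have "hor 1 (Suc n) (c(n := y)) t = 0" using assms by simp
  finally have "hor 1 (Suc n) (c(n := y)) x = (x - t) * hor 1 n (synth 1 n c t) x + 0" .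
  then show ?thesis by (simp only: add_0_right)
qed

lemma has_roots_Suc_upd:
  assumes "has_roots n (synth 1 n c t) l" "\<And>i. i < n \<Longrightarrow> l i < t"
  shows "has_roots (Suc n) (c(n := - t * hor 1 n c t)) (l(n := t))"
  unfolding has_roots_def
proof (intro conjI allI)
  show "chamber (Suc n) (l(n := t))" using assms by (simp add: chamber_Suc_upd has_roots_def)
  fix x
  have "hor 1 (Suc n) (c(n := - t * hor 1 n c t)) x = (x - t) * hor 1 n (synth 1 n c t) x"
    by (rule hor_root_split) simp
  also have "\<dots> = (\<Prod>i<n. x - l i) * (x - t)" using assms(1) by (simp add: has_roots_def)
  also have "(\<Prod>i<n. x - l i) = (\<Prod>i<n. x - (l(n := t)) i)" by (rule prod.cong) auto
  finally have "hor 1 (Suc n) (c(n := - t * hor 1 n c t)) x = (\<Prod>i<n. x - (l(n := t)) i) * (x - t)" .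
  then show "hor 1 (Suc n) (c(n := - t * hor 1 n c t)) x = (\<Prod>i<Suc n. x - (l(n := t)) i)"
    by (simp only: prod.lessThan_Suc fun_upd_same)
qed

text \<open>With the first \<open>n\<close> coefficients fixed, a completion by a constant term
  \<open>y\<close> to a polynomial with distinct real roots amounts to a choice of its largest root
  \<open>t\<close> such that the quotient by \<open>x - t\<close> has all its roots below
  \<open>t\<close>. This gives domain and range of the substitution for the last
  coefficient.\<close>

lemma roots_below_synth_image:
  "(\<lambda>t. - t * hor 1 n c t) ` {t. roots_below n (synth 1 n c t) t} = {y. real_rooted (Suc n) (c(n := y))}"
proof (intro equalityI subsetI)
  fix y assume "y \<in> (\<lambda>t. - t * hor 1 n c t) ` {t. roots_below n (synth 1 n c t) t}"
  then show "y \<in> {y. real_rooted (Suc n) (c(n := y))}"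
    by (auto simp: roots_below_def real_rooted_def dest!: has_roots_Suc_upd)
next
  fix y assume "y \<in> {y. real_rooted (Suc n) (c(n := y))}"
  then obtain l where l: "has_roots (Suc n) (c(n := y)) l" by (auto simp: real_rooted_def)
  have ch: "chamber (Suc n) l" using l by (simp add: has_roots_def)
  have "hor 1 (Suc n) (c(n := y)) (l n) = 0"
    unfolding has_roots_zeros[OF l] by auto
  then have y: "y = - l n * hor 1 n c (l n)" by simp
  have lt: "l i < l n" if "i < n" for i using chamber_less[OF ch, of i n] that by simp
  have chn: "chamber n l" using ch by (auto simp: chamber_def)
  have "hor 1 n (synth 1 n c (l n)) (l i) = 0" if "i < n" for i
  proof -
    have "hor 1 (Suc n) (c(n := y)) (l i) = 0"
      unfolding has_roots_zeros[OF l] using that less_SucI by blast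
    then show ?thesis using lt[OF that] hor_root_split[OF y, of "l i"] by simp
  qed
  then have "has_roots n (synth 1 n c (l n)) l"
    using chn hor_zeros[OF chamber_inj_on[OF chn], of 1] by (auto simp: has_roots_def)
  then have "roots_below n (synth 1 n c (l n)) (l n)" using lt by (auto simp: roots_below_def)
  with y show "y \<in> (\<lambda>t. - t * hor 1 n c t) ` {t. roots_below n (synth 1 n c t) t}" by blast
qed

text \<open>The constant term determines the whole polynomial and hence its ordered roots, the last
  of which is \<open>t\<close>.\<close>

lemma inj_on_roots_below_synth:
  "inj_on (\<lambda>t. - t * hor 1 n c t) {t. roots_below n (synth 1 n c t) t}"
proof (rule inj_onI)
  fix t t' assume *: "t \<in> {t. roots_below n (synth 1 n c t) t}" "t' \<in> {t. roots_below n (synth 1 n c t) t}"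
    "- t * hor 1 n c t = - t' * hor 1 n c t'"
  obtain l where l: "has_roots n (synth 1 n c t) l" "\<And>i. i < n \<Longrightarrow> l i < t"
    using * by (auto simp: roots_below_def)
  obtain l' where l': "has_roots n (synth 1 n c t') l'" "\<And>i. i < n \<Longrightarrow> l' i < t'"
    using * by (auto simp: roots_below_def)
  have "(l(n := t)) n = (l'(n := t')) n"
    by (rule has_roots_unique[OF has_roots_Suc_upd[OF l]])
       (use has_roots_Suc_upd[OF l'] * in \<open>auto simp del: fun_upd_apply\<close>)
  then show "t = t'" by simp
qed

text \<open>Splitting off the largest root \<open>t\<close>: for fixed leading coefficients the constant term
  \<open>- t hor 1 n c t\<close> is an injective function of \<open>t\<close> whose derivative is the value at \<open>t\<close> of the
  remaining factor, that is, the new factors of the Vandermonde product.\<close>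

lemma nn_integral_Viete:
  assumes "F \<in> borel_measurable (leb n)"
  shows "(\<integral>\<^sup>+l. (if chamber n l then ennreal (vand n l) * F (\<lambda>j\<in>{..<n}. co n l j) else 0) \<partial>leb n)
       = (\<integral>\<^sup>+c. (if real_rooted n c then F c else 0) \<partial>leb n)"
  using assms
proof (induction n arbitrary: F)
  case 0
  have "real_rooted 0 c" "chamber 0 c" for c by (auto simp: real_rooted_def has_roots_def chamber_def)
  then show ?case by (simp add: nn_integral_leb_0 restrict_def vand_def del: nn_integral_const)
next
  case (Suc n)
  note [measurable] = Suc.prems
  \<comment> \<open>The integrand in terms of the largest root \<open>t\<close> and the coefficients
    \<open>d\<close> of the quotient. The factor \<open>hor 1 n d t\<close> is the product of the
    \<open>t - l i\<close>, by which \<open>vand\<close> grows when \<open>t\<close> is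
    appended.\<close>
  define G where "G t d = (if roots_below n d t then ennreal (hor 1 n d t) * F (\<lambda>j\<in>{..<Suc n}. lift_root n d t j) else 0)" for t d
  have [measurable]: "(\<lambda>(d, t). G t d) \<in> borel_measurable (leb n \<Otimes>\<^sub>M lborel)"
    unfolding G_def by measurable
  have Gt[measurable]: "G t \<in> borel_measurable (leb n)" for t
    unfolding G_def by measurable
  have integrand: "(if chamber (Suc n) (l(n := t)) then ennreal (vand (Suc n) (l(n := t))) * F (\<lambda>j\<in>{..<Suc n}. co (Suc n) (l(n := t)) j) else 0)
     = (if chamber n l then ennreal (vand n l) * G t (\<lambda>j\<in>{..<n}. co n l j) else 0)" for l t
  proof (cases "chamber n l")
    case ch: True
    have below: "roots_below n (\<lambda>j\<in>{..<n}. co n l j) t \<longleftrightarrow> (\<forall>i<n. l i < t)"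
    proof
      assume "roots_below n (\<lambda>j\<in>{..<n}. co n l j) t"
      then obtain l' where l': "has_roots n (co n l) l'" "\<forall>i<n. l' i < t" by (auto simp: roots_below_def)
      then show "\<forall>i<n. l i < t" using has_roots_unique[OF has_roots_co[OF ch] l'(1)] by simp
    qed (use has_roots_co[OF ch] in \<open>auto simp: roots_below_def\<close>)
    have co: "(\<lambda>j\<in>{..<Suc n}. co (Suc n) (l(n := t)) j) = (\<lambda>j\<in>{..<Suc n}. lift_root n (\<lambda>j\<in>{..<n}. co n l j) t j)"
    proof (rule restrict_ext)
      fix j assume "j \<in> {..<Suc n}"
      have "co n (l(n := t)) = co n l" by (rule co_cong) auto
      then have "co (Suc n) (l(n := t)) j = lift_root n (co n l) t j" by (simp only: co.simps fun_upd_same)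
      also have "\<dots> = lift_root n (\<lambda>j\<in>{..<n}. co n l j) t j"
        using \<open>j \<in> {..<Suc n}\<close> by (intro lift_root_cong) auto
      finally show "co (Suc n) (l(n := t)) j = lift_root n (\<lambda>j\<in>{..<n}. co n l j) t j" .
    qed
    show ?thesis
    proof (cases "\<forall>i<n. l i < t")
      case True
      then have "(\<Prod>i<n. t - l i) \<ge> 0" by (intro prod_nonneg) (auto simp: less_imp_le)
      then have "ennreal (vand (Suc n) (l(n := t))) = ennreal (vand n l) * ennreal (hor 1 n (\<lambda>j\<in>{..<n}. co n l j) t)"
        using vand_pos[OF ch] by (simp add: vand_Suc_upd hor_co ennreal_mult)
      then show ?thesis using True ch by (simp add: chamber_Suc_upd G_def below co mult.assoc del: co.simps)
    next
      case False
      then have "\<not> chamber (Suc n) (l(n := t))" by (simp add: chamber_Suc_upd)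
      moreover have "G t (\<lambda>j\<in>{..<n}. co n l j) = 0" using False below unfolding G_def by (simp only: if_False)
      ultimately show ?thesis by (simp only: if_False mult_zero_right if_cancel)
    qed
  qed (simp add: chamber_Suc_upd)
  have "(\<integral>\<^sup>+l. (if chamber (Suc n) l then ennreal (vand (Suc n) l) * F (\<lambda>j\<in>{..<Suc n}. co (Suc n) l j) else 0) \<partial>leb (Suc n))
     = (\<integral>\<^sup>+t. \<integral>\<^sup>+l. (if chamber n l then ennreal (vand n l) * G t (\<lambda>j\<in>{..<n}. co n l j) else 0) \<partial>leb n \<partial>lborel)"
    by (subst nn_integral_leb_Suc_rev) (measurable, simp only: integrand)
  also have "\<dots> = (\<integral>\<^sup>+t. \<integral>\<^sup>+d. (if real_rooted n d then G t d else 0) \<partial>leb n \<partial>lborel)"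
    by (intro nn_integral_cong Suc.IH Gt)
  also have "\<dots> = (\<integral>\<^sup>+t. \<integral>\<^sup>+d. G t d \<partial>leb n \<partial>lborel)"
    by (intro nn_integral_cong) (auto simp: G_def roots_below_def real_rooted_def)
  \<comment> \<open>For each fixed \<open>t\<close> synthetic division preserves Lebesgue measure,
    so \<open>d\<close> may be replaced by the quotient of a polynomial with coefficients
    \<open>c\<close>. The range of \<open>c\<close> does not depend on \<open>t\<close>, and
    \<open>t\<close> can be integrated first.\<close>
  also have "\<dots> = (\<integral>\<^sup>+t. \<integral>\<^sup>+c. G t (synth 1 n c t) \<partial>leb n \<partial>lborel)"
    by (rule nn_integral_cong, rule nn_integral_leb_synth[symmetric]) measurable
  also have "\<dots> = (\<integral>\<^sup>+c. \<integral>\<^sup>+t. G t (synth 1 n c t) \<partial>lborel \<partial>leb n)"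
    unfolding G_def by (rule leb_Fubini[symmetric]) measurable
  also have "\<dots> = (\<integral>\<^sup>+c. \<integral>\<^sup>+y. (if real_rooted (Suc n) (c(n := y)) then F (c(n := y)) else 0) \<partial>lborel \<partial>leb n)"
  proof (rule nn_integral_cong)
    fix c assume c[measurable]: "c \<in> space (leb n)"
    let ?h = "\<lambda>t. - t * hor 1 n c t"
    let ?S = "{t. roots_below n (synth 1 n c t) t}"
    have lift: "(\<lambda>j\<in>{..<Suc n}. lift_root n (synth 1 n c t) t j) = c(n := ?h t)" for t
    proof
      fix j show "(\<lambda>j\<in>{..<Suc n}. lift_root n (synth 1 n c t) t j) j = (c(n := ?h t)) j"
        using lift_root_synth[of j n c t] c
        by (auto simp: restrict_def leb_space_ext extensional_def)
    qed
    have S: "?S \<in> sets borel" 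
    proof -
      have "Measurable.pred borel (\<lambda>t. roots_below n (synth 1 n c t) t)" by measurable
      then show ?thesis by (simp add: pred_def)
    qed
    have I: "?h ` ?S \<in> sets borel"
    proof -
      have "Measurable.pred borel (\<lambda>y. real_rooted (Suc n) (c(n := y)))" by measurable
      then show ?thesis unfolding roots_below_synth_image by (simp add: pred_def)
    qed
    have hn: "\<bar>- hor 1 n (synth 1 n c t) t\<bar> = hor 1 n (synth 1 n c t) t" if tS: "t \<in> ?S" for t
    proof -
      obtain l where l: "has_roots n (synth 1 n c t) l" "\<And>i. i < n \<Longrightarrow> l i < t"
        using tS by (auto simp: roots_below_def)
      then have "hor 1 n (synth 1 n c t) t \<ge> 0"
        by (auto simp: has_roots_def less_imp_le intro!: prod_nonneg)
      then show ?thesis by simp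
    qed
    have "(\<integral>\<^sup>+t. G t (synth 1 n c t) \<partial>lborel)
        = (\<integral>\<^sup>+t. indicator ?S t * (ennreal \<bar>- hor 1 n (synth 1 n c t) t\<bar> * F (c(n := ?h t))) \<partial>lborel)"
      unfolding G_def lift using hn by (intro nn_integral_cong) (auto split: split_indicator)
    also have "\<dots> = (\<integral>\<^sup>+y. indicator (?h ` ?S) y * F (c(n := y)) \<partial>lborel)"
      by (rule nn_integral_subst_injective_real[symmetric, OF S I hor_lift_derivative inj_on_roots_below_synth]) measurable
    also have "\<dots> = (\<integral>\<^sup>+y. (if real_rooted (Suc n) (c(n := y)) then F (c(n := y)) else 0) \<partial>lborel)"
      unfolding roots_below_synth_image by (intro nn_integral_cong) (auto split: split_indicator)
    finally show "(\<integral>\<^sup>+t. G t (synth 1 n c t) \<partial>lborel)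
      = (\<integral>\<^sup>+y. (if real_rooted (Suc n) (c(n := y)) then F (c(n := y)) else 0) \<partial>lborel)" .
  qed
  also have "\<dots> = (\<integral>\<^sup>+c. (if real_rooted (Suc n) c then F c else 0) \<partial>leb (Suc n))"
    by (rule nn_integral_leb_Suc[symmetric]) measurable
  finally show ?case .
qed

section \<open>Interlacing polynomials\<close>

definition interlace :: "nat \<Rightarrow> (nat \<Rightarrow> real) \<Rightarrow> (nat \<Rightarrow> real) \<Rightarrow> bool" where
  "interlace n \<mu> l \<longleftrightarrow> (\<forall>i<n. l i < \<mu> i \<and> \<mu> i < l (Suc i))"

lemma measurable_interlace [measurable (raw)]:
  assumes f: "f \<in> M \<rightarrow>\<^sub>M leb n" and g: "g \<in> M \<rightarrow>\<^sub>M leb (Suc n)"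
  shows "Measurable.pred M (\<lambda>w. interlace n (f w) (g w))"
proof -
  have [measurable]: "(\<lambda>w. f w i) \<in> borel_measurable M" if "i < n" for i
    by (rule measurable_leb_component[OF f that])
  have [measurable]: "(\<lambda>w. g w i) \<in> borel_measurable M" if "i < Suc n" for i
    by (rule measurable_leb_component[OF g that])
  have "Measurable.pred M (\<lambda>w. \<forall>i\<in>{..<n}. g w i < f w i \<and> f w i < g w (Suc i))"
    by (intro pred_intros_finite(3)) auto
  moreover have "(\<lambda>w. \<forall>i\<in>{..<n}. g w i < f w i \<and> f w i < g w (Suc i)) = (\<lambda>w. interlace n (f w) (g w))"
    by (auto simp: interlace_def fun_eq_iff)
  ultimately show ?thesis by (simp only:)
qed

lemma hor_at_top: "eventually (\<lambda>x. hor 1 n c x \<ge> 1/2) at_top"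
proof (induction n)
  case (Suc n)
  \<comment> \<open>The threshold makes the induction close: a Horner value of at least 1/2 is
    followed by one of at least \<open>x / 2 - \<bar>c n\<bar> \<ge> 1/2\<close>.\<close>
  have "eventually (\<lambda>x::real. x \<ge> 1 + 2 * \<bar>c n\<bar>) at_top" by (rule eventually_ge_at_top)
  with Suc.IH show ?case
  proof eventually_elim
    case (elim x)
    have "x * hor 1 n c x \<ge> x * (1/2)" using elim by (intro mult_left_mono) auto
    moreover have "- \<bar>c n\<bar> \<le> c n" by simp
    ultimately show ?case using elim(2) unfolding hor.simps by linarith
  qed
qed simp

lemma hor_at_bot: "eventually (\<lambda>x. (-1) ^ n * hor 1 n c x \<ge> 1/2) at_bot"
proof (induction n)
  case (Suc n)
  have "eventually (\<lambda>x::real. x \<le> - 1 - 2 * \<bar>c n\<bar>) at_bot" by (rule eventually_le_at_bot)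
  with Suc.IH show ?case
  proof eventually_elim
    case (elim x)
    have "(-x) * ((-1) ^ n * hor 1 n c x) \<ge> (-x) * (1/2)" using elim by (intro mult_left_mono) auto
    moreover have "(-1) ^ n * c n \<le> \<bar>c n\<bar>" by (cases "even n") auto
    ultimately have "(-x) * ((-1) ^ n * hor 1 n c x) - (-1) ^ n * c n \<ge> 1/2" using elim(2) by linarith
    then show ?case by (simp add: algebra_simps)
  qed
qed simp

lemma sign_prod_interlace:
  assumes "chamber (Suc n) l" "interlace n \<mu> l" "i < n"
  shows "(-1) ^ (n - i) * (\<Prod>j<Suc n. \<mu> i - l j) > 0"
proof -
  have "(-1) ^ (Suc n - Suc i) * (\<Prod>j<Suc n. \<mu> i - l j) > 0"
  proof (rule sign_prod_chamber)
    fix j assume "j < Suc i"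
    then have "l j \<le> l i" using chamber_less[OF assms(1), of j i] assms(3)
      by (cases "j = i") (auto simp: less_imp_le)
    also have "l i < \<mu> i" using assms by (auto simp: interlace_def)
    finally show "l j < \<mu> i" .
  next
    fix j assume j: "Suc i \<le> j" "j < Suc n"
    have "\<mu> i < l (Suc i)" using assms by (auto simp: interlace_def)
    also have "\<dots> \<le> l j" using chamber_less[OF assms(1), of "Suc i" j] j
      by (cases "j = Suc i") (auto simp: less_imp_le)
    finally show "\<mu> i < l j" .
  qed (use assms in auto)
  then show ?thesis by (simp only: diff_Suc_Suc)
qed

lemma sign_prod_interlace_below:
  assumes "chamber n \<mu>" "interlace n \<mu> l" "i \<le> n"
  shows "(-1) ^ (n - i) * (\<Prod>j<n. l i - \<mu> j) > 0"
proof (rule sign_prod_chamber)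
  fix j assume j: "j < i"
  have "\<mu> j \<le> \<mu> (i - 1)" using chamber_less[OF assms(1), of j "i - 1"] j assms(3)
    by (cases "j = i - 1") (auto simp: less_imp_le)
  also have "\<dots> < l i" using assms(2)[unfolded interlace_def, rule_format, of "i - 1"] j assms(3) by simp
  finally show "\<mu> j < l i" .
next
  fix j assume j: "i \<le> j" "j < n"
  have "l i < \<mu> i" using assms j by (auto simp: interlace_def)
  also have "\<dots> \<le> \<mu> j" using chamber_less[OF assms(1), of i j] j
    by (cases "j = i") (auto simp: less_imp_le)
  finally show "l i < \<mu> j" .
qed (use assms in auto)

text \<open>Interlacing, a condition on roots, becomes a sign condition on the values at
  \<open>\<mu>\<close>, the coordinates in which the integral factorises. Signs produce roots by the
  intermediate value theorem; conversely the sign at \<open>\<mu> i\<close> counts the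
  \<open>n - i\<close> roots above it.\<close>

lemma interlace_above_iff:
  assumes \<mu>: "chamber n \<mu>"
  shows "(\<forall>i<n. (-1) ^ (n - i) * hor 1 (Suc n) c (\<mu> i) > 0) \<longleftrightarrow> (\<exists>l. has_roots (Suc n) c l \<and> interlace n \<mu> l)"
proof
  assume sg: "\<forall>i<n. (-1) ^ (n - i) * hor 1 (Suc n) c (\<mu> i) > 0"
  define b where "b = (\<Sum>i<n. \<bar>\<mu> i\<bar>)"
  have b: "\<bar>\<mu> i\<bar> \<le> b" if "i < n" for i
    unfolding b_def using that by (intro member_le_sum) auto
  have b0: "b \<ge> 0" unfolding b_def by (rule sum_nonneg) simp
  obtain R where R: "R > b" "hor 1 (Suc n) c R \<ge> 1/2"
    using eventually_conj[OF eventually_gt_at_top[of b] hor_at_top[of "Suc n" c]]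
    by (metis (mono_tags, lifting) eventually_happens trivial_limit_at_top_linorder)
  obtain L where L: "L < - b" "(-1) ^ Suc n * hor 1 (Suc n) c L \<ge> 1/2"
    using eventually_conj[OF eventually_gt_at_bot[of "-b"] hor_at_bot[of "Suc n" c]]
    by (metis (mono_tags, lifting) eventually_happens trivial_limit_at_bot_linorder)
  \<comment> \<open>The nodes \<open>\<mu>\<close> are flanked by points \<open>L\<close> and
    \<open>R\<close> beyond all of them, where the polynomial has the sign of its leading term. This
    yields the \<open>n + 2\<close> alternation points needed for degree
    \<open>n + 1\<close>.\<close>
  define r where "r i = (if i = 0 then L else if i = Suc n then R else \<mu> (i - 1))" for i
  have "r i < r (Suc i)" if "i < Suc n" for i
  proof -
    have "\<mu> (i - 1) < \<mu> i" if "i \<noteq> 0" "i < n" using that \<mu> by (intro chamber_less) auto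
    then show ?thesis using that b[of i] b[of "i - 1"] R(1) L(1) b0
      by (auto simp: r_def abs_le_iff)
  qed
  moreover have "(-1) ^ (Suc n - i) * hor 1 (Suc n) c (r i) > 0" if i: "i \<le> Suc n" for i
  proof -
    consider "i = 0" | "i = Suc n" | k where "i = Suc k" "k < n" using i by (cases i) force+
    then show ?thesis
    proof cases
      case 1 then show ?thesis using L(2) by (simp add: r_def del: hor.simps)
    next
      case 2 then show ?thesis using R(2) by (simp add: r_def del: hor.simps)
    next
      case 3 then show ?thesis using sg by (simp add: r_def del: hor.simps)
    qed
  qed
  ultimately obtain l where l: "has_roots (Suc n) c l" "\<And>i. i < Suc n \<Longrightarrow> r i < l i \<and> l i < r (Suc i)"
    using hor_alternating_roots[of "Suc n" r c] by blast
  have "interlace n \<mu> l"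
    unfolding interlace_def
  proof (intro allI impI)
    fix i assume "i < n"
    then show "l i < \<mu> i \<and> \<mu> i < l (Suc i)" using l(2)[of i] l(2)[of "Suc i"] by (auto simp: r_def)
  qed
  with l show "\<exists>l. has_roots (Suc n) c l \<and> interlace n \<mu> l" by blast
next
  assume "\<exists>l. has_roots (Suc n) c l \<and> interlace n \<mu> l"
  then obtain l where l: "has_roots (Suc n) c l" "interlace n \<mu> l" by blast
  then have "chamber (Suc n) l" "\<And>x. hor 1 (Suc n) c x = (\<Prod>i<Suc n. x - l i)"
    unfolding has_roots_def by blast+
  then show "\<forall>i<n. (-1) ^ (n - i) * hor 1 (Suc n) c (\<mu> i) > 0"
    using sign_prod_interlace[OF _ l(2)] by presburger
qed

text \<open>The roles are reversed: the nodes \<open>l\<close> now enclose the roots, and their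
  number \<open>n + 1\<close> is exactly what \<open>n\<close> sign changes require.\<close>

lemma interlace_below_iff:
  assumes l: "chamber (Suc n) l"
  shows "(\<forall>i\<le>n. (-1) ^ (n - i) * hor 1 n d (l i) > 0) \<longleftrightarrow> (\<exists>\<mu>. has_roots n d \<mu> \<and> interlace n \<mu> l)"
proof
  assume sg: "\<forall>i\<le>n. (-1) ^ (n - i) * hor 1 n d (l i) > 0"
  obtain \<mu> where "has_roots n d \<mu>" "\<And>i. i < n \<Longrightarrow> l i < \<mu> i \<and> \<mu> i < l (Suc i)"
    using hor_alternating_roots[of n l d] sg chamber_less[OF l, of i "Suc i" for i]
    by (metis Suc_mono lessI)
  then show "\<exists>\<mu>. has_roots n d \<mu> \<and> interlace n \<mu> l" by (auto simp: interlace_def)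
next
  assume "\<exists>\<mu>. has_roots n d \<mu> \<and> interlace n \<mu> l"
  then obtain \<mu> where "has_roots n d \<mu>" "interlace n \<mu> l" by blast
  then show "\<forall>i\<le>n. (-1) ^ (n - i) * hor 1 n d (l i) > 0"
    using sign_prod_interlace_below[of n \<mu> l] by (auto simp: has_roots_def)
qed

text \<open>The Lagrange interpolation polynomial through the \<open>n + 1\<close> nodes is
  \<open>p\<close> itself; comparing coefficients of \<open>x^n\<close> gives the claim. The
  summands are the residues of \<open>p\<close> divided by the product of the
  \<open>x - l j\<close>.\<close>

lemma lagrange_lead_coeff:
  fixes l :: "nat \<Rightarrow> real"
  assumes inj: "inj_on l {..<Suc n}" and deg: "degree p \<le> n"
  shows "(\<Sum>j<Suc n. poly p (l j) / (\<Prod>i\<in>{..<Suc n} - {j}. l j - l i)) = coeff p n"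
proof -
  define w where "w j = (\<Prod>i\<in>{..<Suc n} - {j}. l j - l i)" for j
  define L where "L j = (\<Prod>i\<in>{..<Suc n} - {j}. [:- l i, 1:])" for j
  define q where "q = (\<Sum>j<Suc n. Polynomial.smult (poly p (l j) / w j) (L j))"
  have degL: "degree (L j) = n" if "j < Suc n" for j
    unfolding L_def using that by (subst degree_prod_eq_sum_degree) auto
  have monL: "lead_coeff (L j) = 1" for j
    unfolding L_def by (subst lead_coeff_prod) auto
  have w0: "w j \<noteq> 0" if "j < Suc n" for j
    using inj that unfolding w_def by (auto simp: inj_on_def)
  have Lj: "poly (L j) (l k) = (if k = j then w j else 0)" if "j < Suc n" "k < Suc n" for j k
    unfolding L_def w_def poly_prod using that by (auto intro!: prod_zero)
  have "p = q"
  proof (rule poly_eqI_degree[where A="l ` {..<Suc n}"])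
    have card: "card (l ` {..<Suc n}) = Suc n" using card_image[OF inj] by simp
    show "card (l ` {..<Suc n}) > degree p" using deg card by simp
    have "degree q \<le> n" unfolding q_def
      by (intro degree_sum_le) (use degL in \<open>auto intro!: order_trans[OF degree_smult_le]\<close>)
    then show "card (l ` {..<Suc n}) > degree q" using card by simp
    fix x assume "x \<in> l ` {..<Suc n}"
    then obtain k where k: "k < Suc n" "x = l k" by auto
    have "poly q x = (\<Sum>j<Suc n. if j = k then poly p (l k) else 0)"
      unfolding q_def poly_sum using k w0 Lj by (intro sum.cong) auto
    also have "\<dots> = poly p x" using k by (simp add: sum.delta del: sum.lessThan_Suc)
    finally show "poly p x = poly q x" by simp
  qed
  then have "coeff p n = coeff q n" by simp
  also have "\<dots> = (\<Sum>j<Suc n. poly p (l j) / w j * coeff (L j) n)"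
    by (simp add: q_def coeff_sum del: sum.lessThan_Suc)
  also have "\<dots> = (\<Sum>j<Suc n. poly p (l j) / w j)"
    using monL degL by (intro sum.cong) auto
  finally show ?thesis by (simp add: w_def)
qed

section \<open>Horner sums as polynomials, and coefficients in terms of roots\<close>

primrec horp :: "real \<Rightarrow> nat \<Rightarrow> (nat \<Rightarrow> real) \<Rightarrow> real poly" where
  "horp s 0 c = [:s:]"
| "horp s (Suc n) c = pCons (c n) (horp s n c)"

lemma poly_horp: "poly (horp s n c) x = hor s n c x"
  by (induction n) auto

lemma degree_horp: "degree (horp s n c) \<le> n"
  by (induction n) (auto intro: order_trans[OF degree_pCons_le])

lemma coeff_horp: "coeff (horp s n c) n = s"
  by (induction n) auto

lemma hor_lagrange_lead:
  assumes "inj_on l {..<Suc n}"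
  shows "(\<Sum>j<Suc n. hor s n c (l j) / (\<Prod>i\<in>{..<Suc n} - {j}. l j - l i)) = s"
  using lagrange_lead_coeff[OF assms degree_horp[of s n c]] by (simp only: poly_horp coeff_horp)

definition rootp :: "nat \<Rightarrow> (nat \<Rightarrow> real) \<Rightarrow> real poly" where
  "rootp n l = (\<Prod>i<n. [:- l i, 1:])"

lemma poly_rootp: "poly (rootp n l) x = (\<Prod>i<n. x - l i)"
  by (simp add: rootp_def poly_prod)

lemma coeff_linear_mult: "coeff ([:- a, 1:] * p) k = (if k = 0 then 0 else coeff p (k - 1)) - a * coeff p (k::nat)" for a :: real
  by (cases k) (auto simp: coeff_pCons algebra_simps split: nat.splits)

lemma rootp_Suc: "rootp (Suc n) l = [:- l n, 1:] * rootp n l"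
  by (simp add: rootp_def mult.commute del: mult_pCons_left)

lemma degree_rootp: "degree (rootp n l) = n"
  unfolding rootp_def by (subst degree_prod_eq_sum_degree) auto

lemma coeff_rootp_top: "coeff (rootp n l) n = 1"
proof -
  have "lead_coeff (rootp n l) = 1" unfolding rootp_def by (subst lead_coeff_prod) auto
  then show ?thesis by (simp add: degree_rootp)
qed

lemma coeff_rootp_1: "coeff (rootp (Suc n) l) n = - (\<Sum>i<Suc n. l i)"
proof (induction n)
  case 0 then show ?case by (simp add: rootp_Suc coeff_linear_mult rootp_def del: mult_pCons_left)
next
  case (Suc n)
  then show ?case
    by (subst rootp_Suc) (simp add: coeff_linear_mult coeff_rootp_top del: mult_pCons_left)
qed

text \<open>Newton's identity: the coefficient is the second elementary symmetric function of the
  roots.\<close>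

lemma coeff_rootp_2: "2 * coeff (rootp (Suc (Suc n)) l) n = (\<Sum>i<Suc (Suc n). l i)\<^sup>2 - (\<Sum>i<Suc (Suc n). (l i)\<^sup>2)"
proof (induction n)
  case 0
  have "coeff (rootp (Suc (Suc 0)) l) 0 = - l 1 * coeff (rootp (Suc 0) l) 0"
    by (subst rootp_Suc) (simp add: coeff_linear_mult del: mult_pCons_left)
  then show ?case by (simp add: coeff_rootp_1 power2_eq_square algebra_simps numeral_2_eq_2)
next
  case (Suc n)
  have "coeff (rootp (Suc (Suc (Suc n))) l) (Suc n) = coeff (rootp (Suc (Suc n)) l) n - l (Suc (Suc n)) * coeff (rootp (Suc (Suc n)) l) (Suc n)"
    by (subst rootp_Suc) (simp add: coeff_linear_mult del: mult_pCons_left)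
  also have "coeff (rootp (Suc (Suc n)) l) (Suc n) = - (\<Sum>i<Suc (Suc n). l i)" by (rule coeff_rootp_1)
  finally have "2 * coeff (rootp (Suc (Suc (Suc n))) l) (Suc n)
      = (\<Sum>i<Suc (Suc n). l i)\<^sup>2 - (\<Sum>i<Suc (Suc n). (l i)\<^sup>2) + 2 * l (Suc (Suc n)) * (\<Sum>i<Suc (Suc n). l i)"
    using Suc.IH by (simp add: algebra_simps)
  then show ?case by (subst (1 2) sum.lessThan_Suc) (simp add: power2_eq_square algebra_simps del: sum.lessThan_Suc)
qed

text \<open>Taking the corner to be the difference of the two traces cancels the coefficient of
  \<open>x^n\<close> as well as the leading one. The remaining polynomial has degree below
  \<open>n\<close> and is therefore determined by its values at \<open>n\<close> nodes.\<close>

lemma coeff_rootp_bordered: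
  assumes "n \<le> k"
  shows "coeff (rootp (Suc n) l - [:- ((\<Sum>i<Suc n. l i) - (\<Sum>i<n. \<mu> i)), 1:] * rootp n \<mu>) k = 0"
proof -
  let ?a = "(\<Sum>i<Suc n. l i) - (\<Sum>i<n. \<mu> i)"
  have rk: "coeff (rootp (Suc n) l - [:- ?a, 1:] * rootp n \<mu>) k
      = coeff (rootp (Suc n) l) k - ((if k = 0 then 0 else coeff (rootp n \<mu>) (k - 1)) - ?a * coeff (rootp n \<mu>) k)"
    by (simp only: coeff_diff coeff_linear_mult)
  consider "k = n" | "k = Suc n" | "k > Suc n" using assms by linarith
  then show ?thesis
  proof cases
    case 1
    have "(if k = 0 then 0 else coeff (rootp n \<mu>) (k - 1)) = - (\<Sum>i<n. \<mu> i)"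
      using 1 coeff_rootp_1[of "n - 1" \<mu>] by (cases n) auto
    then show ?thesis unfolding rk using 1 coeff_rootp_1[of n l] coeff_rootp_top[of n \<mu>] by simp
  next
    case 2
    then show ?thesis unfolding rk
      using coeff_rootp_top[of "Suc n" l] coeff_rootp_top[of n \<mu>] coeff_eq_0[of "rootp n \<mu>" "Suc n"]
      by (simp add: degree_rootp)
  next
    case 3
    then show ?thesis unfolding rk by (simp add: coeff_eq_0 degree_rootp)
  qed
qed

text \<open>With \<open>\<mu>\<close> and \<open>l\<close> the eigenvalues before and after
  bordering, the quotients are minus the squares of the rotated border entries, so this is the trace
  of the squared matrix. The proof stays with polynomials: the Lagrange sum is the coefficient of
  \<open>x^(n-1)\<close> in the remainder \<open>r\<close>, which is computed from Newton's
  identity.\<close>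

lemma bordered_trace_identity:
  fixes l \<mu> :: "nat \<Rightarrow> real"
  assumes \<mu>: "inj_on \<mu> {..<n}"
  defines "a \<equiv> (\<Sum>i<Suc n. l i) - (\<Sum>i<n. \<mu> i)"
  shows "(\<Sum>i<Suc n. (l i)\<^sup>2) = a\<^sup>2 - 2 * (\<Sum>i<n. (\<Prod>j<Suc n. \<mu> i - l j) / (\<Prod>k\<in>{..<n} - {i}. \<mu> i - \<mu> k)) + (\<Sum>i<n. (\<mu> i)\<^sup>2)"
proof (cases n)
  case 0 then show ?thesis by (simp add: a_def)
next
  case (Suc m)
  define r where "r = rootp (Suc n) l - [:- a, 1:] * rootp n \<mu>"
  have rk: "coeff r k = coeff (rootp (Suc n) l) k - ((if k = 0 then 0 else coeff (rootp n \<mu>) (k - 1)) - a * coeff (rootp n \<mu>) k)" for k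
    by (simp add: r_def coeff_linear_mult del: mult_pCons_left)
  have "degree r \<le> m"
    unfolding r_def a_def using Suc by (intro degree_le allI impI coeff_rootp_bordered) simp
  from lagrange_lead_coeff[of \<mu> m r, OF _ this] \<mu> Suc
  have "(\<Sum>i<n. poly r (\<mu> i) / (\<Prod>k\<in>{..<n} - {i}. \<mu> i - \<mu> k)) = coeff r m" by simp
  moreover have "poly r (\<mu> i) = (\<Prod>j<Suc n. \<mu> i - l j)" if "i < n" for i
  proof -
    have "(\<Prod>j<n. \<mu> i - \<mu> j) = 0" using that by (intro prod_zero) auto
    then show ?thesis unfolding r_def poly_diff poly_mult poly_rootp by (simp del: prod.lessThan_Suc)
  qed
  ultimately have S: "(\<Sum>i<n. (\<Prod>j<Suc n. \<mu> i - l j) / (\<Prod>k\<in>{..<n} - {i}. \<mu> i - \<mu> k)) = coeff r m"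
    by (simp del: prod.lessThan_Suc)
  have cl: "2 * coeff (rootp (Suc n) l) m = (\<Sum>i<Suc n. l i)\<^sup>2 - (\<Sum>i<Suc n. (l i)\<^sup>2)"
    using coeff_rootp_2[of m l] Suc by simp
  have c\<mu>: "2 * (if m = 0 then 0 else coeff (rootp n \<mu>) (m - 1)) = (\<Sum>i<n. \<mu> i)\<^sup>2 - (\<Sum>i<n. (\<mu> i)\<^sup>2)"
    using coeff_rootp_2[of "m - 1" \<mu>] Suc by (cases m) auto
  have c1: "coeff (rootp n \<mu>) m = - (\<Sum>i<n. \<mu> i)" using coeff_rootp_1[of m \<mu>] Suc by simp
  have "2 * coeff r m = 2 * coeff (rootp (Suc n) l) m - 2 * (if m = 0 then 0 else coeff (rootp n \<mu>) (m - 1)) + 2 * a * coeff (rootp n \<mu>) m"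
    unfolding rk by simp
  also have "\<dots> = a\<^sup>2 - (\<Sum>i<Suc n. (l i)\<^sup>2) + (\<Sum>i<n. (\<mu> i)\<^sup>2)"
    unfolding cl c\<mu> c1 a_def by (simp add: power2_eq_square algebra_simps del: sum.lessThan_Suc)
  finally show ?thesis unfolding S by simp
qed

section \<open>Real symmetric matrices\<close>

abbreviation fm :: "nat \<Rightarrow> (nat \<Rightarrow> nat \<Rightarrow> 'a) \<Rightarrow> 'a mat" where
  "fm n f \<equiv> mat n n (\<lambda>(i, j). f i j)"

lemma fm_mult: "fm n f * fm n g = fm n (\<lambda>i j. \<Sum>k<n. f i k * g k j)"
  by (rule eq_matI) (auto simp: scalar_prod_def atLeast0LessThan)

lemma fm_one: "1\<^sub>m n = fm n (\<lambda>i j. if i = j then 1 else 0)"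
  by (rule eq_matI) auto

lemma fm_transpose: "transpose_mat (fm n f) = fm n (\<lambda>i j. f j i)"
  by (rule eq_matI) auto

lemma fm_eqI: "(\<And>i j. i < n \<Longrightarrow> j < n \<Longrightarrow> f i j = g i j) \<Longrightarrow> fm n f = fm n g"
  by (rule eq_matI) auto

lemma fm_eqD: "fm n f = fm n g \<Longrightarrow> i < n \<Longrightarrow> j < n \<Longrightarrow> f i j = g i j"
  by (metis (no_types, lifting) case_prod_conv index_mat(1))

lemma carrier_fm: "A \<in> carrier_mat n n \<Longrightarrow> A = fm n (\<lambda>i j. A $$ (i, j))"
  by (rule eq_matI) auto

text \<open>Over the complex numbers the characteristic polynomial has a root. The Hermitian form at
  its eigenvector is real by symmetry and equals the root times a positive number, so the root is
  real, and the real and imaginary parts of the eigenvector satisfy the same equation. One that does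
  not vanish is normalised.\<close>

lemma real_symmetric_eigenvector:
  fixes f :: "nat \<Rightarrow> nat \<Rightarrow> real"
  assumes n: "n > 0" and sym: "\<And>i j. i < n \<Longrightarrow> j < n \<Longrightarrow> f i j = f j i"
  obtains r v where "(\<Sum>i<n. (v i)\<^sup>2) = 1" "\<And>i. i < n \<Longrightarrow> (\<Sum>j<n. f i j * v j) = r * v i"
proof -
  let ?A = "fm n (\<lambda>i j. complex_of_real (f i j))"
  have A: "?A \<in> carrier_mat n n" by simp
  have "degree (char_poly ?A) = n" using degree_monic_char_poly[OF A] by simp
  then have "\<not> constant (poly (char_poly ?A))" using n by (simp add: constant_degree)
  then obtain k where "poly (char_poly ?A) k = 0" using fundamental_theorem_of_algebra by blast
  then obtain z where z: "eigenvector ?A z k"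
    using eigenvalue_root_char_poly[OF A] by (auto simp: eigenvalue_def)
  then have zc: "z \<in> carrier_vec n" "z \<noteq> 0\<^sub>v n" and Az: "?A *\<^sub>v z = k \<cdot>\<^sub>v z"
    by (auto simp: eigenvector_def)
  have eq: "(\<Sum>j<n. of_real (f i j) * z $ j) = k * z $ i" if "i < n" for i
  proof -
    have "(?A *\<^sub>v z) $ i = (k \<cdot>\<^sub>v z) $ i" using Az by simp
    then show ?thesis using that zc(1) by (simp add: scalar_prod_def atLeast0LessThan)
  qed
  obtain i0 where i0: "i0 < n" "z $ i0 \<noteq> 0"
    using zc by (metis carrier_vecD eq_vecI index_zero_vec(1) index_zero_vec(2))
  define S where "S = (\<Sum>i<n. cnj (z $ i) * (\<Sum>j<n. of_real (f i j) * z $ j))"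
  define M where "M = (\<Sum>i<n. (cmod (z $ i))\<^sup>2)"
  have M0: "M > 0" unfolding M_def using i0 by (intro sum_pos2[of _ i0]) auto
  have "S = k * of_real M"
    unfolding S_def M_def using eq
    by (simp add: sum_distrib_left complex_norm_square[symmetric] mult_ac of_real_sum)
  moreover have "cnj S = S"
  proof -
    have "cnj S = (\<Sum>i<n. \<Sum>j<n. of_real (f i j) * (z $ i * cnj (z $ j)))"
      unfolding S_def by (simp add: sum_distrib_left mult_ac)
    also have "\<dots> = (\<Sum>j<n. \<Sum>i<n. of_real (f i j) * (z $ i * cnj (z $ j)))"
      by (rule sum.swap)
    also have "\<dots> = (\<Sum>j<n. \<Sum>i<n. of_real (f j i) * (z $ i * cnj (z $ j)))"
      using sym by (intro sum.cong refl) auto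
    also have "\<dots> = S" unfolding S_def by (simp add: sum_distrib_left mult_ac)
    finally show ?thesis .
  qed
  ultimately have "cnj k = k" using M0 by simp
  then obtain r where k: "k = of_real r" by (metis Reals_cnj_iff Reals_cases)
  define x where "x = (if Re (z $ i0) \<noteq> 0 then (\<lambda>i. Re (z $ i)) else (\<lambda>i. Im (z $ i)))"
  have xi0: "x i0 \<noteq> 0" using i0 by (auto simp: x_def complex_eq_iff)
  have ex: "(\<Sum>j<n. f i j * x j) = r * x i" if "i < n" for i
    using arg_cong[OF eq[OF that], of Re] arg_cong[OF eq[OF that], of Im] k by (auto simp: x_def)
  define c where "c = sqrt (\<Sum>i<n. (x i)\<^sup>2)"
  have pos: "(\<Sum>i<n. (x i)\<^sup>2) > 0" using i0 xi0 by (intro sum_pos2[of _ i0]) auto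
  then have c: "c > 0" "c\<^sup>2 = (\<Sum>i<n. (x i)\<^sup>2)" by (auto simp: c_def)
  show ?thesis
  proof (rule that[of "\<lambda>i. x i / c" r])
    show "(\<Sum>i<n. (x i / c)\<^sup>2) = 1"
      using c pos by (simp add: power_divide sum_divide_distrib[symmetric])
    show "(\<Sum>j<n. f i j * (x j / c)) = r * (x i / c)" if "i < n" for i
      using ex[OF that] c by (simp add: sum_divide_distrib[symmetric])
  qed
qed

text \<open>The reflection along \<open>w = v - e_m\<close> exchanges the unit vectors
  \<open>e_m\<close> and \<open>v\<close>. If they coincide, \<open>S = 0\<close>, and division by
  zero turns \<open>2 / S\<close> into 0, so that \<open>h\<close> becomes the identity, as it
  should.\<close>

lemma householder:
  fixes v :: "nat \<Rightarrow> real"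
  assumes m: "m < n" and v: "(\<Sum>i<n. (v i)\<^sup>2) = 1"
  obtains h where "\<And>i j. h i j = h j i" "fm n h * fm n h = 1\<^sub>m n" "\<And>i. i < n \<Longrightarrow> h i m = v i"
proof -
  define w where "w i = v i - (if i = m then 1 else 0)" for i
  define S where "S = (\<Sum>i<n. (w i)\<^sup>2)"
  define h where "h i j = (if i = j then 1 else 0) - 2 / S * w i * w j" for i j :: nat
  have "(w i)\<^sup>2 = (v i)\<^sup>2 + (if i = m then 1 - 2 * v i else 0)" for i
    by (auto simp: w_def power2_eq_square algebra_simps)
  then have S: "S = 2 - 2 * v m"
    unfolding S_def using m by (simp add: sum.distrib v sum.delta)
  have "fm n h * fm n h = 1\<^sub>m n"
    unfolding fm_mult fm_one
  proof (rule fm_eqI)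
    fix i j assume ij: "i < n" "j < n"
    have "(\<Sum>k<n. h i k * h k j) = (\<Sum>k<n. (if k = i then (if k = j then 1 else 0) - 2 / S * w k * w j else 0)
       - (if k = j then 2 / S * w i * w k else 0) + (2 / S)\<^sup>2 * w i * w j * (w k)\<^sup>2)"
      by (rule sum.cong) (auto simp: h_def power2_eq_square algebra_simps)
    also have "\<dots> = (if i = j then 1 else 0) - 2 / S * w i * w j - 2 / S * w i * w j + (2 / S)\<^sup>2 * w i * w j * S"
      using ij by (simp add: sum.distrib sum_subtractf sum.delta sum_distrib_left[symmetric] S_def[symmetric])
    also have "\<dots> = (if i = j then 1 else 0)" by (cases "S = 0") (auto simp: power2_eq_square)
    finally show "(\<Sum>k<n. h i k * h k j) = (if i = j then 1 else 0)" .
  qed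
  moreover have "h i m = v i" if "i < n" for i
  proof (cases "S = 0")
    case True
    then have "(w i)\<^sup>2 = 0" using that unfolding S_def by (subst (asm) sum_nonneg_eq_0_iff) auto
    then show ?thesis using True by (auto simp: h_def w_def)
  next
    case False
    then have "2 / S * w m = -1" using S by (simp add: w_def field_simps)
    moreover have "h i m = (if i = m then 1 else 0) - w i * (2 / S * w m)" by (simp add: h_def)
    ultimately have "h i m = (if i = m then 1 else 0) + w i" by simp
    then show ?thesis by (simp add: w_def)
  qed
  ultimately show ?thesis by (intro that[of h]) (auto simp: h_def mult_ac)
qed

abbreviation dmat :: "nat \<Rightarrow> (nat \<Rightarrow> real) \<Rightarrow> real mat" where
  "dmat n d \<equiv> fm n (\<lambda>i j. if i = j then d i else 0)"

lemma mat_conj_assoc: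
  fixes H V D W :: "real mat"
  assumes "H \<in> carrier_mat n n" "V \<in> carrier_mat n n" "D \<in> carrier_mat n n" "W \<in> carrier_mat n n"
  shows "(H * V) * (W * H) = H * (V * W) * H" "H * (V * D * W) * H = (H * V) * D * (W * H)"
    "(H * H) * D * (H * H) = H * (H * (D * H)) * H"
  using assms by (simp_all add: assoc_mult_mat[of _ n n _ n _ n] mult_carrier_mat[of _ n n _ n])

lemma sum_mult_diag:
  fixes a d :: "nat \<Rightarrow> real"
  assumes "k < n" shows "(\<Sum>l<n. a l * (if l = k then d l else 0)) = a k * d k"
proof -
  have "(\<Sum>l<n. a l * (if l = k then d l else 0)) = (\<Sum>l<n. if l = k then a k * d k else 0)"
    by (rule sum.cong) auto
  then show ?thesis using assms by (simp add: sum.delta)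
qed

text \<open>A Householder reflection moves an eigenvector to the last basis vector. By symmetry the
  conjugated matrix \<open>G\<close> then splits into a block of size \<open>m\<close> and the
  eigenvalue \<open>r\<close>; the induction hypothesis diagonalises the block.\<close>

lemma real_spectral_theorem:
  fixes A :: "real mat"
  assumes "A \<in> carrier_mat n n" "transpose_mat A = A"
  shows "\<exists>U d. U \<in> carrier_mat n n \<and> U * transpose_mat U = 1\<^sub>m n \<and> A = U * dmat n d * transpose_mat U"
  using assms
proof (induction n arbitrary: A)
  case 0
  then show ?case by (intro exI[of _ "1\<^sub>m 0"] exI[of _ "\<lambda>_. 0"]) (auto intro!: eq_matI)
next
  case (Suc m)
  define f where "f i j = A $$ (i, j)" for i j
  have A: "A = fm (Suc m) f" using carrier_fm[OF Suc.prems(1)] by (simp add: f_def)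
  have sym: "f i j = f j i" if "i < Suc m" "j < Suc m" for i j
    using Suc.prems that unfolding f_def by (metis carrier_matD index_transpose_mat(1))
  obtain r v where v: "(\<Sum>i<Suc m. (v i)\<^sup>2) = 1" "\<And>i. i < Suc m \<Longrightarrow> (\<Sum>j<Suc m. f i j * v j) = r * v i"
    by (rule real_symmetric_eigenvector[of "Suc m" f]) (use sym in auto)
  obtain h where h: "\<And>i j. h i j = h j i" "fm (Suc m) h * fm (Suc m) h = 1\<^sub>m (Suc m)" "\<And>i. i < Suc m \<Longrightarrow> h i m = v i"
    using householder[of m "Suc m" v] v(1) by auto
  let ?n = "Suc m"
  let ?H = "fm ?n h"
  have Hc: "?H \<in> carrier_mat ?n ?n" by simp
  have Ht: "transpose_mat ?H = ?H" unfolding fm_transpose using h(1) by (intro fm_eqI) auto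
  define G where "G = ?H * (A * ?H)"
  have Gc: "G \<in> carrier_mat ?n ?n" using Suc.prems unfolding G_def by auto
  have Gt: "transpose_mat G = G"
  proof -
    have "transpose_mat G = transpose_mat (A * ?H) * transpose_mat ?H"
      unfolding G_def using Suc.prems by (intro transpose_mult[of _ ?n ?n _ ?n]) auto
    also have "transpose_mat (A * ?H) = transpose_mat ?H * transpose_mat A"
      using Suc.prems by (intro transpose_mult[of _ ?n ?n _ ?n]) auto
    finally show ?thesis unfolding G_def Ht Suc.prems(2)
      using Suc.prems by (simp add: assoc_mult_mat[of _ ?n ?n _ ?n _ ?n])
  qed
  define g where "g i j = G $$ (i, j)" for i j
  have G: "G = fm ?n g" using carrier_fm[OF Gc] by (simp add: g_def)
  have gsym: "g i j = g j i" if "i < ?n" "j < ?n" for i j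
    using Gt Gc that unfolding g_def by (metis carrier_matD index_transpose_mat(1))
  have gm: "g i m = (if i = m then r else 0)" if i: "i < ?n" for i
  proof -
    have "A * ?H = fm ?n (\<lambda>i j. \<Sum>k<?n. f i k * h k j)" unfolding A fm_mult ..
    then have "G = fm ?n (\<lambda>i j. \<Sum>l<?n. h i l * (\<Sum>k<?n. f l k * h k j))" unfolding G_def by (simp only: fm_mult)
    then have "fm ?n g = fm ?n (\<lambda>i j. \<Sum>l<?n. h i l * (\<Sum>k<?n. f l k * h k j))" unfolding G .
    then have "g i m = (\<Sum>l<?n. h i l * (\<Sum>k<?n. f l k * h k m))"
      by (rule fm_eqD[OF _ i lessI])
    also have "\<dots> = (\<Sum>l<?n. h i l * (r * h l m))"
    proof (rule sum.cong[OF refl])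
      fix l assume "l \<in> {..<?n}"
      moreover have "(\<Sum>k<?n. f l k * h k m) = (\<Sum>k<?n. f l k * v k)" using h(3) by (intro sum.cong) auto
      ultimately show "h i l * (\<Sum>k<?n. f l k * h k m) = h i l * (r * h l m)"
        using v(2)[of l] h(3)[of l] by (simp del: sum.lessThan_Suc)
    qed
    also have "\<dots> = r * (\<Sum>l<?n. h i l * h l m)" by (simp add: sum_distrib_left mult_ac del: sum.lessThan_Suc)
    also have "(\<Sum>l<?n. h i l * h l m) = (if i = m then 1 else 0)"
      by (rule fm_eqD[OF h(2)[unfolded fm_mult fm_one] i lessI])
    finally show ?thesis by simp
  qed
  have "\<exists>U d. U \<in> carrier_mat m m \<and> U * transpose_mat U = 1\<^sub>m m \<and> fm m g = U * dmat m d * transpose_mat U"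
    by (rule Suc.IH) (auto simp: fm_transpose gsym intro!: fm_eqI)
  then obtain U' d' where U': "U' \<in> carrier_mat m m" "U' * transpose_mat U' = 1\<^sub>m m"
     "fm m g = U' * dmat m d' * transpose_mat U'" by blast
  define u where "u i j = U' $$ (i, j)" for i j
  have U'u: "U' = fm m u" using carrier_fm[OF U'(1)] by (simp add: u_def)
  define V where "V i j = (if i < m \<and> j < m then u i j else if i = j then 1 else 0)" for i j
  define d where "d = d'(m := r)"
  have uu: "(\<Sum>k<m. u i k * u j k) = (if i = j then 1 else 0)" if "i < m" "j < m" for i j
    by (rule fm_eqD[OF U'(2)[unfolded U'u fm_transpose fm_mult fm_one] that])
  have gu: "g i j = (\<Sum>k<m. u i k * d' k * u j k)" if "i < m" "j < m" for i j
  proof -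
    have "fm m g = fm m (\<lambda>i j. \<Sum>k<m. (\<Sum>l<m. u i l * (if l = k then d' l else 0)) * u j k)"
      using U'(3) unfolding U'u fm_transpose fm_mult .
    then have "g i j = (\<Sum>k<m. (\<Sum>l<m. u i l * (if l = k then d' l else 0)) * u j k)"
      using that by (rule fm_eqD)
    then show ?thesis by (simp add: sum_mult_diag)
  qed
  have VV: "fm ?n V * transpose_mat (fm ?n V) = 1\<^sub>m ?n"
    unfolding fm_transpose fm_mult fm_one
  proof (rule fm_eqI)
    fix i j assume ij: "i < ?n" "j < ?n"
    show "(\<Sum>k<?n. V i k * V j k) = (if i = j then 1 else 0)"
      using ij uu[of i j] by (cases "i < m"; cases "j < m") (auto simp: V_def less_Suc_eq)
  qed
  have GV: "G = fm ?n V * dmat ?n d * transpose_mat (fm ?n V)"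
    unfolding G fm_transpose fm_mult
  proof (rule fm_eqI)
    fix i j assume ij: "i < ?n" "j < ?n"
    have "(\<Sum>k<?n. (\<Sum>l<?n. V i l * (if l = k then d l else 0)) * V j k) = (\<Sum>k<?n. V i k * d k * V j k)"
      by (simp add: sum_mult_diag del: sum.lessThan_Suc)
    also have "\<dots> = g i j"
      using ij gu[of i j] gm[of i] gm[of j] gsym[of m j]
      by (cases "i < m"; cases "j < m") (auto simp: V_def d_def less_Suc_eq)
    finally show "g i j = (\<Sum>k<?n. (\<Sum>l<?n. V i l * (if l = k then d l else 0)) * V j k)" by simp
  qed
  let ?V = "fm ?n V"
  let ?U = "?H * ?V"
  have Vc: "?V \<in> carrier_mat ?n ?n" "transpose_mat ?V \<in> carrier_mat ?n ?n" by auto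
  have Ut: "transpose_mat ?U = transpose_mat ?V * ?H"
    using transpose_mult[of ?H ?n ?n ?V ?n] Ht by simp
  have Uc: "?U \<in> carrier_mat ?n ?n" using Hc Vc(1) by (rule mult_carrier_mat)
  have "?U * transpose_mat ?U = ?H * (?V * transpose_mat ?V) * ?H"
    unfolding Ut by (rule mat_conj_assoc(1)[OF Hc Vc(1) Vc(1) Vc(2)])
  also have "\<dots> = ?H * 1\<^sub>m ?n * ?H" unfolding VV ..
  also have "\<dots> = 1\<^sub>m ?n" unfolding right_mult_one_mat[OF Hc] by (rule h(2))
  finally have UU: "?U * transpose_mat ?U = 1\<^sub>m ?n" .
  have "A = (?H * ?H) * A * (?H * ?H)" unfolding h(2) using Suc.prems(1) by simp
  also have "\<dots> = ?H * G * ?H" unfolding G_def by (rule mat_conj_assoc(3)[OF Hc Hc Suc.prems(1) Hc])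
  also have "\<dots> = ?U * dmat ?n d * transpose_mat ?U"
    unfolding GV Ut by (rule mat_conj_assoc(2)[OF Hc Vc(1) _ Vc(2)]) simp
  finally show ?case using UU Uc by blast
qed

lemma sorting_permutation:
  fixes d :: "nat \<Rightarrow> real"
  obtains p where "p permutes {..<n}" "\<And>i j. i \<le> j \<Longrightarrow> j < n \<Longrightarrow> d (p i) \<le> d (p j)"
proof -
  have "mset (sort (map d [0..<n])) = mset (map d [0..<n])" by simp
  then obtain p where p: "p permutes {..<length (map d [0..<n])}" "permute_list p (map d [0..<n]) = sort (map d [0..<n])"
    by (rule mset_eq_permutation)
  have pn: "p permutes {..<n}" using p(1) by simp
  have nth: "sort (map d [0..<n]) ! i = d (p i)" if "i < n" for i
  proof -
    have "sort (map d [0..<n]) ! i = permute_list p (map d [0..<n]) ! i" using p(2) by simp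
    also have "\<dots> = map d [0..<n] ! p i" using p(1) that by (intro permute_list_nth) auto
    also have "\<dots> = d (p i)" using that permutes_in_image[OF pn, of i] by simp
    finally show ?thesis .
  qed
  show ?thesis
  proof (rule that[OF pn])
    fix i j :: nat assume ij: "i \<le> j" "j < n"
    then have "sort (map d [0..<n]) ! i \<le> sort (map d [0..<n]) ! j" by (intro sorted_nth_mono) auto
    then show "d (p i) \<le> d (p j)" using ij nth by simp
  qed
qed

lemma sorted_spectral_theorem:
  fixes f :: "nat \<Rightarrow> nat \<Rightarrow> real"
  assumes "\<And>i j. i < n \<Longrightarrow> j < n \<Longrightarrow> f i j = f j i"
  obtains u d where "\<And>i j. i \<le> j \<Longrightarrow> j < n \<Longrightarrow> d i \<le> d j"
    "\<And>i j. i < n \<Longrightarrow> j < n \<Longrightarrow> (\<Sum>k<n. u i k * u j k) = (if i = j then 1 else 0)"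
    "\<And>i j. i < n \<Longrightarrow> j < n \<Longrightarrow> (\<Sum>k<n. u k i * u k j) = (if i = j then 1 else 0)"
    "\<And>i j. i < n \<Longrightarrow> j < n \<Longrightarrow> f i j = (\<Sum>k<n. u i k * d k * u j k)"
proof -
  have "\<exists>U d. U \<in> carrier_mat n n \<and> U * transpose_mat U = 1\<^sub>m n \<and> fm n f = U * dmat n d * transpose_mat U"
    by (rule real_spectral_theorem) (auto simp: fm_transpose assms intro!: fm_eqI)
  then obtain U d where U: "U \<in> carrier_mat n n" "U * transpose_mat U = 1\<^sub>m n" "fm n f = U * dmat n d * transpose_mat U"
    by blast
  obtain p where p: "p permutes {..<n}" "\<And>i j. i \<le> j \<Longrightarrow> j < n \<Longrightarrow> d (p i) \<le> d (p j)"
    using sorting_permutation by blast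
  define u where "u i j = U $$ (i, j)" for i j
  have Uu: "U = fm n u" using carrier_fm[OF U(1)] by (simp add: u_def)
  have UU': "transpose_mat U * U = 1\<^sub>m n"
    using mat_mult_left_right_inverse[OF U(1) _ U(2)] U(1) by simp
  have perm: "(\<Sum>k<n. g (p k)) = (\<Sum>k<n. g k)" for g :: "nat \<Rightarrow> real"
    using sum.permute[OF p(1), of g] by (simp add: o_def)
  have pin: "p i < n \<longleftrightarrow> i < n" for i using permutes_in_image[OF p(1), of i] by simp
  have pinj: "p i = p j \<longleftrightarrow> i = j" for i j using permutes_inj[OF p(1)] by (auto dest: injD)
  show ?thesis
  proof (rule that[of "d \<circ> p" "\<lambda>i k. u i (p k)"])
    show "(d \<circ> p) i \<le> (d \<circ> p) j" if "i \<le> j" "j < n" for i j using p(2)[OF that] by simp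
    fix i j assume ij: "i < n" "j < n"
    show "(\<Sum>k<n. u i (p k) * u j (p k)) = (if i = j then 1 else 0)"
      unfolding perm[of "\<lambda>k. u i k * u j k"]
      by (rule fm_eqD[OF U(2)[unfolded Uu fm_transpose fm_mult fm_one] ij])
    show "(\<Sum>k<n. u k (p i) * u k (p j)) = (if i = j then 1 else 0)"
      using fm_eqD[OF UU'[unfolded Uu fm_transpose fm_mult fm_one], of "p i" "p j"] ij pin[of i] pin[of j] pinj[of i j]
      by simp
    have "fm n f = fm n (\<lambda>i j. \<Sum>k<n. (\<Sum>l<n. u i l * (if l = k then d l else 0)) * u j k)"
      using U(3) unfolding Uu fm_transpose fm_mult .
    then have "f i j = (\<Sum>k<n. (\<Sum>l<n. u i l * (if l = k then d l else 0)) * u j k)"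
      using ij by (rule fm_eqD)
    also have "\<dots> = (\<Sum>k<n. u i k * d k * u j k)"
      by (simp add: sum_mult_diag)
    also have "\<dots> = (\<Sum>k<n. u i (p k) * (d \<circ> p) k * u j (p k))"
      using perm[of "\<lambda>k. u i k * d k * u j k"] by simp
    finally show "f i j = (\<Sum>k<n. u i (p k) * (d \<circ> p) k * u j (p k))" .
  qed
qed

section \<open>Characteristic polynomials of conjugate and bordered matrices\<close>

lemma poly_char_poly_fm:
  fixes f :: "nat \<Rightarrow> nat \<Rightarrow> real"
  shows "poly (char_poly (fm n f)) x = det (fm n (\<lambda>i j. (if i = j then x else 0) - f i j))"
proof -
  have "- char_matrix (fm n f) x = fm n (\<lambda>i j. (if i = j then x else 0) - f i j)"
    by (rule eq_matI) (auto simp: char_matrix_def)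
  then show ?thesis using char_poly_matrix[of "fm n f" n x] by simp
qed

lemma char_poly_conj:
  fixes u f g :: "nat \<Rightarrow> nat \<Rightarrow> real"
  assumes u: "\<And>i j. i < n \<Longrightarrow> j < n \<Longrightarrow> (\<Sum>k<n. u i k * u j k) = (if i = j then 1 else 0)"
    and f: "\<And>i j. i < n \<Longrightarrow> j < n \<Longrightarrow> f i j = (\<Sum>l<n. (\<Sum>k<n. u i k * g k l) * u j l)"
  shows "char_poly (fm n f) = char_poly (fm n g)"
proof (rule char_poly_similar)
  let ?U = "fm n u"
  have UU: "?U * transpose_mat ?U = 1\<^sub>m n"
    unfolding fm_transpose fm_mult fm_one using u by (intro fm_eqI)
  have "transpose_mat ?U * ?U = 1\<^sub>m n" using mat_mult_left_right_inverse[OF _ _ UU] by simp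
  moreover have "fm n f = ?U * fm n g * transpose_mat ?U"
    unfolding fm_transpose fm_mult using f by (intro fm_eqI)
  ultimately show "similar_mat (fm n f) (fm n g)"
    using UU unfolding similar_mat_def similar_mat_wit_def Let_def
    by (intro exI[of _ ?U] exI[of _ "transpose_mat ?U"]) auto
qed

lemma char_poly_dmat: "char_poly (dmat n d) = rootp n d"
proof (rule poly_eqI_degree[where A="real ` {..n}"])
  have card: "card (real ` {..n}) = Suc n" by (subst card_image) (auto simp: inj_on_def)
  show "card (real ` {..n}) > degree (char_poly (dmat n d))"
    using card degree_monic_char_poly[of "dmat n d" n] by simp
  show "card (real ` {..n}) > degree (rootp n d)" using card by (simp add: degree_rootp)
  fix x
  have "poly (char_poly (dmat n d)) x = det (fm n (\<lambda>i j. if i = j then x - d i else 0))"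
    unfolding poly_char_poly_fm by (intro arg_cong[of _ _ det] fm_eqI) auto
  also have "\<dots> = (\<Prod>i<n. x - d i)"
    by (subst det_lower_triangular[of n]) (auto simp: prod_list_diag_prod atLeast0LessThan)
  finally show "poly (char_poly (dmat n d)) x = poly (rootp n d) x" by (simp add: poly_rootp)
qed

text \<open>The arrowhead matrix, which a bordered symmetric matrix becomes in the eigenbasis of its
  old block: \<open>d\<close> holds the old eigenvalues, \<open>u\<close> the rotated border and
  \<open>a\<close> the corner.\<close>

definition arrow :: "nat \<Rightarrow> (nat \<Rightarrow> real) \<Rightarrow> (nat \<Rightarrow> real) \<Rightarrow> real \<Rightarrow> nat \<Rightarrow> nat \<Rightarrow> real" where
  "arrow n d u a i j = (if i = n \<and> j = n then a else if i = n then u j else if j = n then u i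
      else if i = j then d i else 0)"

lemma det_arrow:
  assumes e: "\<And>i. i < n \<Longrightarrow> e i \<noteq> 0"
  shows "det (fm (Suc n) (arrow n e u a)) = (\<Prod>i<n. e i) * (a - (\<Sum>i<n. (u i)\<^sup>2 / e i))"
proof -
  \<comment> \<open>Unit upper triangular, so of determinant 1. Multiplication by it from the right
    subtracts multiples of the first \<open>n\<close> columns from the last one, clears it above the
    corner and leaves the Schur complement there; the product is lower triangular.\<close>
  define t where "t i j = (if i = j then 1 else if j = n then - u i / e i else 0)" for i j
  let ?n = "Suc n"
  have "det (fm ?n t) = (\<Prod>i = 0..<?n. t i i)"
    by (subst det_upper_triangular[of _ ?n]) (auto simp: prod_list_diag_prod upper_triangular_def t_def)
  then have dt: "det (fm ?n t) = 1" by (simp add: t_def)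
  define p where "p i j = (\<Sum>k<?n. arrow n e u a i k * t k j)" for i j
  have p: "p i j = (if i < n then (if i = j then e i else 0) else if j < n then u j else a - (\<Sum>k<n. (u k)\<^sup>2 / e k))"
    if "i < ?n" "j < ?n" for i j
  proof (cases "j < n")
    case True
    then have "p i j = arrow n e u a i j"
      unfolding p_def using that by (subst sum.remove[of _ j]) (auto simp: t_def intro!: sum.neutral)
    then show ?thesis using True that by (auto simp: arrow_def)
  next
    case False
    then have j: "j = n" using that by simp
    have "p i j = (\<Sum>k<n. arrow n e u a i k * t k n) + arrow n e u a i n"
      unfolding p_def j by (simp add: t_def)
    also have "(\<Sum>k<n. arrow n e u a i k * t k n) = (if i < n then - u i else - (\<Sum>k<n. (u k)\<^sup>2 / e k))"
    proof (cases "i < n")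
      case True
      have "(\<Sum>k<n. arrow n e u a i k * t k n) = (\<Sum>k<n. if k = i then - u i else 0)"
        using e True by (intro sum.cong) (auto simp: arrow_def t_def)
      then show ?thesis using True by (simp add: sum.delta)
    next
      case False
      then have "i = n" using that by simp
      then show ?thesis
        by (auto simp: arrow_def t_def power2_eq_square sum_negf[symmetric] intro!: sum.cong)
    qed
    finally show ?thesis using j that by (auto simp: arrow_def)
  qed
  have "det (fm ?n (arrow n e u a)) * det (fm ?n t) = det (fm ?n p)"
    by (subst det_mult[symmetric, of _ ?n]) (auto simp: fm_mult p_def[abs_def] simp del: sum.lessThan_Suc)
  also have "\<dots> = (\<Prod>i = 0..<?n. p i i)"
    by (subst det_lower_triangular[of ?n]) (auto simp: prod_list_diag_prod p)
  also have "\<dots> = (\<Prod>i<n. e i) * (a - (\<Sum>i<n. (u i)\<^sup>2 / e i))"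
  proof -
    have "(\<Prod>i<n. p i i) = (\<Prod>i<n. e i)" using p by (intro prod.cong) auto
    then show ?thesis by (simp add: p atLeast0LessThan)
  qed
  finally show ?thesis by (simp add: dt)
qed

lemma char_poly_arrow:
  assumes "\<And>i. i < n \<Longrightarrow> x \<noteq> d i"
  shows "poly (char_poly (fm (Suc n) (arrow n d u a))) x = (\<Prod>i<n. x - d i) * (x - a - (\<Sum>i<n. (u i)\<^sup>2 / (x - d i)))"
proof -
  have "poly (char_poly (fm (Suc n) (arrow n d u a))) x = det (fm (Suc n) (arrow n (\<lambda>i. x - d i) (\<lambda>i. - u i) (x - a)))"
    unfolding poly_char_poly_fm by (intro arg_cong[of _ _ det] fm_eqI) (auto simp: arrow_def)
  also have "\<dots> = (\<Prod>i<n. x - d i) * (x - a - (\<Sum>i<n. (- u i)\<^sup>2 / (x - d i)))"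
    using assms by (intro det_arrow) auto
  finally show ?thesis by simp
qed

text \<open>The determinant is first known away from the \<open>d i\<close>, where one may divide;
  polynomials that agree at all but finitely many points are equal. In this form \<open>u\<close>
  enters through its squares only, and affinely.\<close>

lemma char_poly_arrow_eq:
  "char_poly (fm (Suc n) (arrow n d u a)) = [:- a, 1:] * rootp n d
     - (\<Sum>i<n. Polynomial.smult ((u i)\<^sup>2) (\<Prod>j\<in>{..<n} - {i}. [:- d j, 1:]))" (is "?P = ?Q")
proof (rule ccontr)
  assume "?P \<noteq> ?Q"
  then have "finite {x. poly (?P - ?Q) x = 0}" by (intro poly_roots_finite) simp
  \<comment> \<open>The minus sign is the complement of a set: all points except the
    \<open>d i\<close>.\<close>
  moreover have "- d ` {..<n} \<subseteq> {x. poly (?P - ?Q) x = 0}"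
  proof
    fix x assume "x \<in> - d ` {..<n}"
    then have x: "\<And>i. i < n \<Longrightarrow> x \<noteq> d i" by auto
    have "poly ?Q x = (x - a) * (\<Prod>i<n. x - d i) - (\<Sum>i<n. (u i)\<^sup>2 * (\<Prod>j\<in>{..<n} - {i}. x - d j))"
      unfolding poly_diff poly_mult poly_rootp poly_sum poly_smult poly_prod by simp
    also have "(\<Sum>i<n. (u i)\<^sup>2 * (\<Prod>j\<in>{..<n} - {i}. x - d j)) = (\<Sum>i<n. (\<Prod>j<n. x - d j) * ((u i)\<^sup>2 / (x - d i)))"
    proof (rule sum.cong[OF refl])
      fix i assume i: "i \<in> {..<n}"
      then have "(\<Prod>j<n. x - d j) = (x - d i) * (\<Prod>j\<in>{..<n} - {i}. x - d j)" by (intro prod.remove) auto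
      then show "(u i)\<^sup>2 * (\<Prod>j\<in>{..<n} - {i}. x - d j) = (\<Prod>j<n. x - d j) * ((u i)\<^sup>2 / (x - d i))"
        using x[of i] i by simp
    qed
    finally have Q: "poly ?Q x = (x - a) * (\<Prod>i<n. x - d i) - (\<Sum>i<n. (\<Prod>j<n. x - d j) * ((u i)\<^sup>2 / (x - d i)))" .
    have "poly ?P x = poly ?Q x"
      unfolding Q char_poly_arrow[OF x, of n "\<lambda>i. i" u a, simplified] by (simp add: sum_distrib_left right_diff_distrib left_diff_distrib mult.commute)
    then show "x \<in> {x. poly (?P - ?Q) x = 0}" by simp
  qed
  ultimately have "finite (- d ` {..<n})" using finite_subset by blast
  then have "finite (UNIV :: real set)" using finite_compl[of "d ` {..<n}"] by simp
  then show False using infinite_UNIV_char_0 by blast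
qed

section \<open>Ordered eigenvalues of the GOE matrix\<close>

lemma rootp_list: "(\<Prod>x\<leftarrow>map d [0..<n]. [:- x, 1:]) = rootp n d"
  by (induction n) (simp_all add: rootp_def mult.commute del: mult_pCons_left)

lemma proots_linear_factors: "proots (\<Prod>x\<leftarrow>xs. [:- x, 1:]) = mset (xs :: real list)"
proof (induction xs)
  case (Cons x xs)
  have "(\<Prod>x\<leftarrow>xs. [:- x, 1:]) \<noteq> 0" by (subst prod_list_zero_iff) auto
  then have "proots ([:- x, 1:] * (\<Prod>x\<leftarrow>xs. [:- x, 1:])) = proots [:- x, 1:] + proots (\<Prod>x\<leftarrow>xs. [:- x, 1:])"
    by (intro proots_mult) auto
  then show ?case using Cons by (simp del: mult_pCons_left)
qed simp

text \<open>The description by \<open>THE\<close> asks for uniqueness: a product of monic linear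
  factors determines the multiset of its roots, and sorting turns this into a single list.\<close>

lemma ordered_eigenvalues_eqI:
  assumes A: "A \<in> carrier_mat n n" and cp: "char_poly A = rootp n d"
    and mono: "\<And>i j. i \<le> j \<Longrightarrow> j < n \<Longrightarrow> d i \<le> d j"
  shows "ordered_eigenvalues A = map d [0..<n]"
  unfolding ordered_eigenvalues_def
proof (rule the_equality)
  have "sorted (map d [0..<n])" using mono by (auto simp: sorted_iff_nth_mono)
  then show "sorted (map d [0..<n]) \<and> length (map d [0..<n]) = dim_row A \<and> char_poly A = (\<Prod>x\<leftarrow>map d [0..<n]. [:- x, 1:])"
    using A cp unfolding rootp_list by simp
  fix xs assume xs: "sorted xs \<and> length xs = dim_row A \<and> char_poly A = (\<Prod>x\<leftarrow>xs. [:- x, 1:])"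
  then have "(\<Prod>x\<leftarrow>xs. [:- x, 1:]) = (\<Prod>x\<leftarrow>map d [0..<n]. [:- x, 1:])" using cp by (simp only: rootp_list)
  then have "proots (\<Prod>x\<leftarrow>xs. [:- x, 1:]) = proots (\<Prod>x\<leftarrow>map d [0..<n]. [:- x, 1:])" by (rule arg_cong)
  then have "mset xs = mset (map d [0..<n])" unfolding proots_linear_factors .
  then have "sort xs = sort (map d [0..<n])" by (metis sorted_list_of_multiset_mset)
  then show "xs = map d [0..<n]" using xs \<open>sorted (map d [0..<n])\<close> by (simp add: sorted_sort_id)
qed

text \<open>Indices start at 0 here and at 1 in \<open>goe_eig\<close>; the restriction makes the
  result a point of \<open>leb N\<close>.\<close>

definition eigs :: "nat \<Rightarrow> (nat \<times> nat \<Rightarrow> real) \<Rightarrow> nat \<Rightarrow> real" where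
  "eigs N x = (\<lambda>i\<in>{..<N}. goe_eig N (Suc i) x)"

lemma goe_matrix_fm: "goe_matrix N x = fm N (\<lambda>i j. x (min i j, max i j))"
  by (simp add: goe_matrix_def)

lemma eigs_eqI:
  assumes "char_poly (goe_matrix N x) = rootp N d" "\<And>i j. i \<le> j \<Longrightarrow> j < N \<Longrightarrow> d i \<le> d j"
  shows "eigs N x = (\<lambda>i\<in>{..<N}. d i)"
proof -
  have "ordered_eigenvalues (goe_matrix N x) = map d [0..<N]"
    by (rule ordered_eigenvalues_eqI[OF _ assms]) (simp add: goe_matrix_fm)
  then show ?thesis by (auto simp: eigs_def goe_eig_def fun_eq_iff restrict_def)
qed

text \<open>The matrix \<open>u\<close> is obtained separately for each \<open>x\<close>, with no
  regularity in \<open>x\<close>; it serves only inside integrals taken for fixed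
  \<open>x\<close>.\<close>

lemma goe_spectral:
  obtains u where
    "\<And>i j. i < N \<Longrightarrow> j < N \<Longrightarrow> (\<Sum>k<N. u i k * u j k) = (if i = j then 1 else 0)"
    "\<And>i j. i < N \<Longrightarrow> j < N \<Longrightarrow> (\<Sum>k<N. u k i * u k j) = (if i = j then 1 else 0)"
    "\<And>i j. i < N \<Longrightarrow> j < N \<Longrightarrow> x (min i j, max i j) = (\<Sum>k<N. u i k * eigs N x k * u j k)"
    "char_poly (goe_matrix N x) = rootp N (eigs N x)"
    "\<And>i j. i \<le> j \<Longrightarrow> j < N \<Longrightarrow> eigs N x i \<le> eigs N x j"
proof -
  let ?f = "\<lambda>i j. x (min i j, max i j)"
  obtain u d where d: "\<And>i j. i \<le> j \<Longrightarrow> j < N \<Longrightarrow> d i \<le> d j"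
    and u: "\<And>i j. i < N \<Longrightarrow> j < N \<Longrightarrow> (\<Sum>k<N. u i k * u j k) = (if i = j then 1 else 0)"
    "\<And>i j. i < N \<Longrightarrow> j < N \<Longrightarrow> (\<Sum>k<N. u k i * u k j) = (if i = j then 1 else 0)"
    and f: "\<And>i j. i < N \<Longrightarrow> j < N \<Longrightarrow> ?f i j = (\<Sum>k<N. u i k * d k * u j k)"
    by (rule sorted_spectral_theorem[of N ?f]) (auto simp: min.commute max.commute)
  have cp: "char_poly (goe_matrix N x) = rootp N d"
    unfolding goe_matrix_fm char_poly_dmat[symmetric]
    by (rule char_poly_conj[OF u(1)]) (simp_all add: f sum_mult_diag)
  have e: "eigs N x = (\<lambda>i\<in>{..<N}. d i)" by (rule eigs_eqI[OF cp d])
  have "rootp N (eigs N x) = rootp N d" unfolding e rootp_def by (rule prod.cong) auto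
  then show ?thesis using d f cp
    by (intro that[OF u]) (auto simp: e)
qed

text \<open>Conjugation by \<open>u\<close>, extended by a 1 in the corner, diagonalises the old
  block and replaces the border by its coordinates with respect to the columns of
  \<open>u\<close>.\<close>

lemma bordered_char_poly:
  fixes u f :: "nat \<Rightarrow> nat \<Rightarrow> real"
  assumes u: "\<And>i j. i < n \<Longrightarrow> j < n \<Longrightarrow> (\<Sum>k<n. u i k * u j k) = (if i = j then 1 else 0)"
    and f: "\<And>i j. i < n \<Longrightarrow> j < n \<Longrightarrow> f i j = (\<Sum>k<n. u i k * d k * u j k)"
    and sym: "\<And>i. i < n \<Longrightarrow> f n i = f i n"
  shows "char_poly (fm (Suc n) f) = char_poly (fm (Suc n) (arrow n d (\<lambda>k. \<Sum>i<n. u i k * f i n) (f n n)))"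
proof -
  define w where "w i j = (if i < n \<and> j < n then u i j else if i = j then 1 else 0)" for i j
  define v where "v k = (\<Sum>i<n. u i k * f i n)" for k
  have wu: "(\<Sum>k<n. w i k * g k) = (if i < n then \<Sum>k<n. u i k * g k else 0)" if "i < Suc n" for i g
    using that by (auto simp: w_def intro!: sum.cong sum.neutral)
  have uv: "(\<Sum>k<n. u i k * v k) = f i n" if i: "i < n" for i
  proof -
    have "(\<Sum>k<n. u i k * v k) = (\<Sum>k<n. \<Sum>l<n. f l n * (u i k * u l k))"
      unfolding v_def by (simp add: sum_distrib_left mult_ac)
    also have "\<dots> = (\<Sum>l<n. f l n * (\<Sum>k<n. u i k * u l k))"
      by (subst sum.swap) (simp add: sum_distrib_left)
    also have "\<dots> = (\<Sum>l<n. if l = i then f i n else 0)" using u[OF i] by (intro sum.cong) auto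
    finally show ?thesis using i by (simp add: sum.delta)
  qed
  show ?thesis unfolding v_def[symmetric]
  proof (rule char_poly_conj[where u=w])
    fix i j assume ij: "i < Suc n" "j < Suc n"
    show "(\<Sum>k<Suc n. w i k * w j k) = (if i = j then 1 else 0)"
      using ij u[of i j] by (cases "i < n"; cases "j < n") (auto simp: w_def less_Suc_eq)
    have inner: "(\<Sum>k<Suc n. w i k * arrow n d v (f n n) k l) = (if i < n then (if l < n then u i l * d l else f i n) else (if l < n then v l else f n n))"
      if l: "l < Suc n" for l
    proof -
      have "(\<Sum>k<n. u i k * arrow n d v (f n n) k l) = (if l < n then u i l * d l else (\<Sum>k<n. u i k * v k))"
      proof (cases "l < n")
        case True
        have "(\<Sum>k<n. u i k * arrow n d v (f n n) k l) = (\<Sum>k<n. u i k * (if k = l then d k else 0))"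
          using True by (intro sum.cong) (auto simp: arrow_def)
        then show ?thesis using True by (simp add: sum_mult_diag)
      next
        case False
        then have "l = n" using l by simp
        then show ?thesis by (auto simp: arrow_def intro!: sum.cong)
      qed
      then show ?thesis using ij l uv[of i] by (auto simp: wu w_def arrow_def)
    qed
    have "(\<Sum>l<Suc n. (\<Sum>k<Suc n. w i k * arrow n d v (f n n) k l) * w j l)
      = (\<Sum>l<Suc n. (if i < n then (if l < n then u i l * d l else f i n) else (if l < n then v l else f n n)) * w j l)"
      by (intro sum.cong refl) (simp only: inner lessThan_iff)
    also have "\<dots> = f i j"
      using ij f[of i j] uv[of j] sym[of j]
      by (cases "i < n"; cases "j < n") (auto simp: w_def less_Suc_eq mult.commute)
    finally show "f i j = (\<Sum>l<Suc n. (\<Sum>k<Suc n. w i k * arrow n d v (f n n) k l) * w j l)" by simp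
  qed
qed

section \<open>Measurability of the eigenvalues\<close>

abbreviation entries :: "nat \<Rightarrow> (nat \<times> nat \<Rightarrow> real) measure" where
  "entries N \<equiv> (\<Pi>\<^sub>M p\<in>goe_index N. borel)"

lemma measurable_goe_char_poly:
  "(\<lambda>x. poly (char_poly (goe_matrix N x)) t) \<in> borel_measurable (entries N)"
proof -
  have comp: "(\<lambda>x. x (min i j, max i j)) \<in> borel_measurable (entries N)" if "i < N" "j < N" for i j
    using that by (intro measurable_component_singleton) (auto simp: goe_index_def)
  have "poly (char_poly (goe_matrix N x)) t = (\<Sum>p | p permutes {0..<N}. signof p *
     (\<Prod>i = 0..<N. (if i = p i then t else 0) - x (min i (p i), max i (p i))))" for x
    unfolding goe_matrix_fm poly_char_poly_fm
  proof (subst det_def'[OF mat_carrier], intro sum.cong refl arg_cong2[where f="(*)"] prod.cong)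
    fix p i assume "p \<in> {p. p permutes {0..<N}}" "i \<in> {0..<N}"
    then have "i < N" "p i < N" using permutes_in_image[of p "{0..<N}" i] by auto
    then show "fm N (\<lambda>i j. (if i = j then t else 0) - x (min i j, max i j)) $$ (i, p i)
      = (if i = p i then t else 0) - x (min i (p i), max i (p i))" by simp
  qed
  moreover have "(\<lambda>x. \<Sum>p | p permutes {0..<N}. signof p *
     (\<Prod>i = 0..<N. (if i = p i then t else 0) - x (min i (p i), max i (p i)))) \<in> borel_measurable (entries N)"
  proof (intro borel_measurable_sum borel_measurable_times borel_measurable_prod borel_measurable_diff borel_measurable_const comp)
    fix p i assume "p \<in> {p. p permutes {0..<N}}" "i \<in> {0..<N}"
    then show "i < N" "p i < N" using permutes_in_image[of p "{0..<N}" i] by auto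
  qed
  ultimately show ?thesis by (simp only:)
qed

text \<open>Measurability of the eigenvalues: the monic polynomials with ordered real roots in a box
  whose \<open>k\<close>-th root is at most \<open>t\<close> form a compact set, here encoded by values at the naturals.\<close>

lemma compact_sorted_box:
  "compact {l :: nat \<Rightarrow> real. (\<forall>i. \<bar>l i\<bar> \<le> m) \<and> (\<forall>i. Suc i < N \<longrightarrow> l i \<le> l (Suc i)) \<and> l k \<le> t}"
proof -
  have box: "compact {l :: nat \<Rightarrow> real. \<forall>i. \<bar>l i\<bar> \<le> m}"
  proof -
    have "compactin (product_topology (\<lambda>_. euclidean) UNIV) (PiE UNIV (\<lambda>_::nat. {-m..m}))"
      by (subst compactin_PiE) auto
    then have "compact (PiE UNIV (\<lambda>_::nat. {-m..m}))"
      by (simp add: euclidean_product_topology)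
    moreover have "PiE UNIV (\<lambda>_::nat. {-m..m}) = {l. \<forall>i. \<bar>l i\<bar> \<le> m}"
      by (simp add: PiE_def Pi_def abs_le_iff minus_le_iff conj_commute)
    ultimately show ?thesis by simp
  qed
  have "closed {l :: nat \<Rightarrow> real. (\<forall>i. Suc i < N \<longrightarrow> l i \<le> l (Suc i)) \<and> l k \<le> t}"
    by (intro closed_Collect_conj closed_Collect_all closed_Collect_imp closed_Collect_le open_Collect_const)
       (auto intro: continuous_on_product_coordinates)
  with box have "compact ({l. \<forall>i. \<bar>l i\<bar> \<le> m} \<inter> {l :: nat \<Rightarrow> real. (\<forall>i. Suc i < N \<longrightarrow> l i \<le> l (Suc i)) \<and> l k \<le> t})"
    by (rule compact_Int_closed)
  then show ?thesis by (simp add: Collect_conj_eq[symmetric] conj_ac)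
qed

lemma measurable_goe_eig:
  assumes k: "k < N"
  shows "goe_eig N (Suc k) \<in> borel_measurable (entries N)"
proof (rule borel_measurableI_le)
  fix t :: real
  \<comment> \<open>The bound is imposed at all indices, also beyond \<open>N\<close>, so that
    \<open>K m\<close> is compact in the product topology. Its image under \<open>e\<close> is then
    compact, hence closed, and the countable union over \<open>m\<close> is Borel.\<close>
  define K where "K m = {l :: nat \<Rightarrow> real. (\<forall>i. \<bar>l i\<bar> \<le> m) \<and> (\<forall>i. Suc i < N \<longrightarrow> l i \<le> l (Suc i)) \<and> l k \<le> t}" for m
  define e where "e l = (\<lambda>j::nat. \<Prod>i<N. real j - l i)" for l :: "nat \<Rightarrow> real"
  define \<Phi> where "\<Phi> x = (\<lambda>j::nat. poly (char_poly (goe_matrix N x)) (real j))" for x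
  have cont: "continuous_on UNIV e"
    unfolding e_def by (intro continuous_on_coordinatewise_then_product continuous_intros) auto
  have "closed (e ` K (real m))" for m :: nat
    using compact_sorted_box[of "real m" N k t] cont unfolding K_def
    by (intro compact_imp_closed compact_continuous_image) (auto intro: continuous_on_subset)
  then have B: "(\<Union>m::nat. e ` K (real m)) \<in> sets borel" by auto
  have \<Phi>m: "\<Phi> \<in> entries N \<rightarrow>\<^sub>M borel"
    unfolding \<Phi>_def by (intro measurable_coordinatewise_then_product measurable_goe_char_poly)
  have "goe_eig N (Suc k) x \<le> t \<longleftrightarrow> \<Phi> x \<in> (\<Union>m::nat. e ` K (real m))" for x
  proof
    obtain u where cp: "char_poly (goe_matrix N x) = rootp N (eigs N x)"
      and mono: "\<And>i j. i \<le> j \<Longrightarrow> j < N \<Longrightarrow> eigs N x i \<le> eigs N x j"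
      by (rule goe_spectral[of N x]) auto
    {
      assume le: "goe_eig N (Suc k) x \<le> t"
      define l where "l i = (if i < N then eigs N x i else 0)" for i
      obtain m :: nat where m: "(\<Sum>i<N. \<bar>l i\<bar>) \<le> real m" using real_arch_simple by blast
      have "\<bar>l i\<bar> \<le> real m" for i
      proof (cases "i < N")
        case True
        then have "\<bar>l i\<bar> \<le> (\<Sum>i<N. \<bar>l i\<bar>)" by (intro member_le_sum) auto
        with m show ?thesis by simp
      qed (simp add: l_def)
      then have "l \<in> K (real m)"
        using mono le k by (auto simp: K_def l_def eigs_def)
      moreover have "\<Phi> x = e l"
        unfolding \<Phi>_def e_def cp poly_rootp by (auto simp: l_def fun_eq_iff intro!: prod.cong)
      ultimately show "\<Phi> x \<in> (\<Union>m::nat. e ` K (real m))" by blast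
    next
      assume "\<Phi> x \<in> (\<Union>m::nat. e ` K (real m))"
      then obtain l m where l: "l \<in> K (real m)" "\<Phi> x = e l" by blast
      have lmono: "l i \<le> l j" if "i \<le> j" "j < N" for i j
        using that(1,2)
      proof (induction j rule: dec_induct)
        case (step j) then show ?case using l(1) by (force simp: K_def)
      qed simp
      \<comment> \<open>Both polynomials have degree \<open>N\<close>, so agreement at
        \<open>0, ..., N\<close> suffices; this is why values at the naturals can stand for the
        polynomial.\<close>
      have "char_poly (goe_matrix N x) = rootp N l"
      proof (rule poly_eqI_degree[where A="real ` {..N}"])
        have card: "card (real ` {..N}) = Suc N" by (subst card_image) (auto simp: inj_on_def)
        show "card (real ` {..N}) > degree (char_poly (goe_matrix N x))"
          unfolding cp degree_rootp card by simp
        show "card (real ` {..N}) > degree (rootp N l)" unfolding degree_rootp card by simp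
        fix y assume "y \<in> real ` {..N}"
        then obtain j where "y = real j" by blast
        then show "poly (char_poly (goe_matrix N x)) y = poly (rootp N l) y"
          using fun_cong[OF l(2), of j] by (simp add: \<Phi>_def e_def poly_rootp)
      qed
      from eigs_eqI[OF this lmono] have "eigs N x k = l k" using k by simp
      then show "goe_eig N (Suc k) x \<le> t" using l(1) k by (simp add: eigs_def K_def)
    }
  qed
  then have "{x \<in> space (entries N). goe_eig N (Suc k) x \<le> t} = \<Phi> -` (\<Union>m::nat. e ` K (real m)) \<inter> space (entries N)"
    by blast
  then show "{x \<in> space (entries N). goe_eig N (Suc k) x \<le> t} \<in> sets (entries N)"
    using measurable_sets[OF \<Phi>m B] by simp
qed

lemma measurable_eigs [measurable]: "eigs N \<in> entries N \<rightarrow>\<^sub>M leb N"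
  unfolding eigs_def[abs_def] by (intro measurable_leb_restrict measurable_goe_eig)

section \<open>Orthogonal invariance of Lebesgue measure\<close>

definition rot :: "nat \<Rightarrow> (nat \<Rightarrow> nat \<Rightarrow> real) \<Rightarrow> (nat \<Rightarrow> real) \<Rightarrow> nat \<Rightarrow> real" where
  "rot n u v = (\<lambda>i\<in>{..<n}. \<Sum>k<n. u k i * v k)"

text \<open>An auxiliary rotation invariant probability density, distinct from the law of the matrix
  entries: every coordinate has variance 1.\<close>

definition std_gauss :: "nat \<Rightarrow> (nat \<Rightarrow> real) \<Rightarrow> ennreal" where
  "std_gauss n v = (\<Prod>i<n. ennreal (normal_density 0 1 (v i)))"

lemma measurable_rot [measurable (raw)]:
  assumes h: "h \<in> M \<rightarrow>\<^sub>M leb n"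
  shows "(\<lambda>w. rot n u (h w)) \<in> M \<rightarrow>\<^sub>M leb n"
proof -
  have [measurable]: "(\<lambda>w. h w k) \<in> borel_measurable M" if "k < n" for k
    by (rule measurable_leb_component[OF h that])
  show ?thesis unfolding rot_def by (intro measurable_leb_restrict borel_measurable_sum borel_measurable_times) auto
qed

lemma measurable_rot_component [measurable (raw)]:
  assumes "h \<in> M \<rightarrow>\<^sub>M leb n" "i < n"
  shows "(\<lambda>w. rot n u (h w) i) \<in> borel_measurable M"
  by (rule measurable_leb_component[OF measurable_rot[OF assms(1)] assms(2)])

lemma measurable_std_gauss [measurable (raw)]:
  assumes h: "h \<in> M \<rightarrow>\<^sub>M leb n"
  shows "(\<lambda>w. std_gauss n (h w)) \<in> borel_measurable M"
proof -
  have [measurable]: "(\<lambda>w. h w k) \<in> borel_measurable M" if "k < n" for k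
    by (rule measurable_leb_component[OF h that])
  show ?thesis unfolding std_gauss_def by measurable
qed

lemma rot_norm:
  assumes u: "\<And>i j. i < n \<Longrightarrow> j < n \<Longrightarrow> (\<Sum>k<n. u i k * u j k) = (if i = j then 1 else 0)"
  shows "(\<Sum>i<n. (rot n u v i)\<^sup>2) = (\<Sum>i<n. (v i)\<^sup>2)"
proof -
    have "(\<Sum>i<n. (rot n u v i)\<^sup>2) = (\<Sum>i<n. \<Sum>k<n. \<Sum>l<n. v k * v l * (u k i * u l i))"
      unfolding rot_def by (simp add: power2_eq_square sum_product mult_ac)
    also have "\<dots> = (\<Sum>k<n. \<Sum>l<n. v k * v l * (\<Sum>i<n. u k i * u l i))"
      by (subst sum.swap, rule sum.cong[OF refl], subst sum.swap) (simp add: sum_distrib_left)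
    also have "\<dots> = (\<Sum>k<n. \<Sum>l<n. if l = k then (v k)\<^sup>2 else 0)"
      using u by (intro sum.cong) (auto simp: power2_eq_square)
    finally show ?thesis by (simp add: sum.delta)
qed

text \<open>Uniqueness of Haar measure in miniature: insert a rotation invariant probability density
  and use Fubini together with translation invariance.\<close>

lemma nn_integral_leb_rotate:
  fixes u :: "nat \<Rightarrow> nat \<Rightarrow> real"
  assumes u: "\<And>i j. i < n \<Longrightarrow> j < n \<Longrightarrow> (\<Sum>k<n. u i k * u j k) = (if i = j then 1 else 0)"
    and u': "\<And>i j. i < n \<Longrightarrow> j < n \<Longrightarrow> (\<Sum>k<n. u k i * u k j) = (if i = j then 1 else 0)"
    and f[measurable]: "f \<in> borel_measurable (leb n)"
  shows "(\<integral>\<^sup>+v. f (rot n u v) \<partial>leb n) = (\<integral>\<^sup>+v. f v \<partial>leb n)"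
proof -
  let ?T = "rot n u"
  let ?g = "std_gauss n"
  \<comment> \<open>The inverse rotation: \<open>rot\<close> applies the transpose of
    \<open>u\<close>, and \<open>T'\<close> applies \<open>u\<close> itself.\<close>
  define T' where "T' v = (\<lambda>i\<in>{..<n}. \<Sum>k<n. u i k * v k)" for v
  have g: "?g v = ennreal ((1 / sqrt (2 * pi)) ^ n * exp (- (\<Sum>i<n. (v i)\<^sup>2) / 2))" for v
  proof -
    have "?g v = ennreal (\<Prod>i<n. 1 / sqrt (2 * pi) * exp (- (v i)\<^sup>2 / 2))"
      unfolding std_gauss_def by (subst prod_ennreal) (auto simp: normal_density_def)
    also have "(\<Prod>i<n. 1 / sqrt (2 * pi) * exp (- (v i)\<^sup>2 / 2)) = (1 / sqrt (2 * pi)) ^ n * exp (\<Sum>i<n. - (v i)\<^sup>2 / 2)"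
      by (subst prod.distrib) (simp add: exp_sum)
    also have "(\<Sum>i<n. - (v i)\<^sup>2 / 2) = - (\<Sum>i<n. (v i)\<^sup>2) / 2"
      by (simp add: sum_negf sum_divide_distrib)
    finally show ?thesis .
  qed
  have g1: "(\<integral>\<^sup>+v. ?g v \<partial>leb n) = 1"
  proof -
    have "(\<integral>\<^sup>+x. ennreal (normal_density 0 1 x) \<partial>lborel) = 1"
      using prob_space.emeasure_space_1[OF prob_space_normal_density[of 1 0]] by (simp add: emeasure_density)
    then show ?thesis unfolding std_gauss_def by (subst leb.product_nn_integral_prod) auto
  qed
  have norm: "(\<Sum>i<n. (?T v i)\<^sup>2) = (\<Sum>i<n. (v i)\<^sup>2)" for v
    by (rule rot_norm[OF u])
  have TT': "?T (T' v) i = v i" if i: "i < n" for v i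
  proof -
    have "?T (T' v) i = (\<Sum>k<n. \<Sum>l<n. v l * (u k i * u k l))"
      using i by (simp add: rot_def T'_def sum_distrib_left mult_ac)
    also have "\<dots> = (\<Sum>l<n. v l * (\<Sum>k<n. u k i * u k l))"
      by (subst sum.swap) (simp add: sum_distrib_left)
    also have "\<dots> = (\<Sum>l<n. if l = i then v i else 0)" using u'[OF i] by (intro sum.cong) auto
    finally show ?thesis using i by (simp add: sum.delta)
  qed
  have Tadd: "?T (\<lambda>i\<in>{..<n}. c * v i + w i) i = c * ?T v i + ?T w i" if "i < n" for v w i c
    using that by (simp add: rot_def sum.distrib[symmetric] sum_distrib_left algebra_simps)
  have "(\<integral>\<^sup>+x. f (?T x) \<partial>leb n) = (\<integral>\<^sup>+x. f (?T x) \<partial>leb n) * (\<integral>\<^sup>+y. ?g y \<partial>leb n)" by (simp add: g1)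
  also have "\<dots> = (\<integral>\<^sup>+y. \<integral>\<^sup>+x. ?g y * f (?T x) \<partial>leb n \<partial>leb n)"
    by (simp add: nn_integral_cmult nn_integral_multc mult.commute)
  \<comment> \<open>Substituting \<open>x + T' y\<close> for \<open>x\<close> turns
    \<open>?T x\<close> into \<open>y + ?T x\<close>. A translation of \<open>y\<close>, after
    Fubini, then moves the rotation from \<open>f\<close> to the Gaussian.\<close>
  also have "\<dots> = (\<integral>\<^sup>+y. \<integral>\<^sup>+x. ?g y * f (\<lambda>i\<in>{..<n}. y i + ?T x i) \<partial>leb n \<partial>leb n)"
  proof (rule nn_integral_cong)
    fix y assume y: "y \<in> space (leb n)"
    have "?T (\<lambda>i\<in>{..<n}. x i + T' y i) = (\<lambda>i\<in>{..<n}. y i + ?T x i)" for x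
    proof
      fix i show "?T (\<lambda>i\<in>{..<n}. x i + T' y i) i = (\<lambda>i\<in>{..<n}. y i + ?T x i) i"
        using Tadd[of i 1 x "T' y"] TT'[of i y] by (cases "i < n") (auto simp: rot_def)
    qed
    then show "(\<integral>\<^sup>+x. ?g y * f (?T x) \<partial>leb n) = (\<integral>\<^sup>+x. ?g y * f (\<lambda>i\<in>{..<n}. y i + ?T x i) \<partial>leb n)"
      using nn_integral_leb_translate[of "\<lambda>x. ?g y * f (?T x)" n "T' y"] by simp
  qed
  also have "\<dots> = (\<integral>\<^sup>+x. \<integral>\<^sup>+y. ?g y * f (\<lambda>i\<in>{..<n}. y i + ?T x i) \<partial>leb n \<partial>leb n)"
    by (rule leb_leb_Fubini) measurable
  also have "\<dots> = (\<integral>\<^sup>+x. \<integral>\<^sup>+y. ?g (\<lambda>i\<in>{..<n}. y i - ?T x i) * f y \<partial>leb n \<partial>leb n)"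
  proof (rule nn_integral_cong)
    fix x assume [measurable]: "x \<in> space (leb n)"
    have "?g (\<lambda>i\<in>{..<n}. (\<lambda>i\<in>{..<n}. y i + ?T x i) i - ?T x i) = ?g y" for y
      unfolding std_gauss_def by (intro prod.cong) auto
    then show "(\<integral>\<^sup>+y. ?g y * f (\<lambda>i\<in>{..<n}. y i + ?T x i) \<partial>leb n) = (\<integral>\<^sup>+y. ?g (\<lambda>i\<in>{..<n}. y i - ?T x i) * f y \<partial>leb n)"
      using nn_integral_leb_translate[of "\<lambda>y. ?g (\<lambda>i\<in>{..<n}. y i - ?T x i) * f y" n "?T x"] by simp
  qed
  also have "\<dots> = (\<integral>\<^sup>+y. \<integral>\<^sup>+x. ?g (\<lambda>i\<in>{..<n}. y i - ?T x i) * f y \<partial>leb n \<partial>leb n)"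
    by (rule leb_leb_Fubini) measurable
  \<comment> \<open>Only the Gaussian depends on \<open>x\<close> now. Since \<open>y - ?T x\<close>
    is the rotation of \<open>T' y - x\<close>, both have the same norm, and the Gaussian integrates
    to 1 after a reflection and a translation.\<close>
  also have "\<dots> = (\<integral>\<^sup>+y. f y \<partial>leb n)"
  proof (rule nn_integral_cong)
    fix y assume [measurable]: "y \<in> space (leb n)"
    have "?g (\<lambda>i\<in>{..<n}. y i - ?T x i) = ?g (\<lambda>i\<in>{..<n}. -1 * x i + T' y i)" for x
    proof -
      have "(\<Sum>i<n. ((\<lambda>i\<in>{..<n}. y i - ?T x i) i)\<^sup>2) = (\<Sum>i<n. (?T (\<lambda>i\<in>{..<n}. -1 * x i + T' y i) i)\<^sup>2)"
      proof (rule sum.cong[OF refl])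
        fix i assume "i \<in> {..<n}"
        then show "((\<lambda>i\<in>{..<n}. y i - ?T x i) i)\<^sup>2 = (?T (\<lambda>i\<in>{..<n}. -1 * x i + T' y i) i)\<^sup>2"
          using Tadd[of i "-1" x "T' y"] TT'[of i y] by simp
      qed
      then show ?thesis unfolding g norm by simp
    qed
    then have "(\<integral>\<^sup>+x. ?g (\<lambda>i\<in>{..<n}. y i - ?T x i) * f y \<partial>leb n) = (\<integral>\<^sup>+x. ?g (\<lambda>i\<in>{..<n}. -1 * x i + T' y i) \<partial>leb n) * f y"
      by (simp only:) (rule nn_integral_multc, measurable)
    also have "(\<integral>\<^sup>+x. ?g (\<lambda>i\<in>{..<n}. -1 * x i + T' y i) \<partial>leb n) = 1"
      using nn_integral_leb_affine[of n "\<lambda>_. -1" "?g" "T' y"] by (simp add: g1)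
    finally have "(\<integral>\<^sup>+x. ?g (\<lambda>i\<in>{..<n}. y i - ?T x i) * f y \<partial>leb n) = 1 * f y" .
    then show "(\<integral>\<^sup>+x. ?g (\<lambda>i\<in>{..<n}. y i - ?T x i) * f y \<partial>leb n) = f y" by (simp only: mult_1_left)
  qed
  finally show ?thesis .
qed

lemma nn_integral_PiM_density:
  fixes f :: "nat \<Rightarrow> real \<Rightarrow> ennreal"
  assumes P: "\<And>i. prob_space (density lborel (f i))" and f[measurable]: "\<And>i. f i \<in> borel_measurable borel"
    and F: "F \<in> borel_measurable (leb n)"
  shows "(\<integral>\<^sup>+x. F x \<partial>(\<Pi>\<^sub>M i\<in>{..<n}. density lborel (f i))) = (\<integral>\<^sup>+x. (\<Prod>i<n. f i (x i)) * F x \<partial>leb n)"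
  using F
proof (induction n arbitrary: F)
  case 0
  then show ?case by (simp add: nn_integral_leb_0 PiM_empty nn_integral_count_space_finite del: nn_integral_const)
next
  case (Suc n)
  interpret D: product_sigma_finite "\<lambda>i. density lborel (f i)"
    by standard (meson P prob_space_imp_sigma_finite sigma_finite_measure.sigma_finite_countable)
  note [measurable] = Suc.prems
  have sets_eq: "sets (\<Pi>\<^sub>M i\<in>J. density lborel (f i)) = sets (\<Pi>\<^sub>M i\<in>J. lborel)" for J :: "nat set"
    by (rule sets_PiM_cong) auto
  have "(\<integral>\<^sup>+x. F x \<partial>(\<Pi>\<^sub>M i\<in>{..<Suc n}. density lborel (f i)))
     = (\<integral>\<^sup>+y. \<integral>\<^sup>+x. F (x(n := y)) \<partial>(\<Pi>\<^sub>M i\<in>{..<n}. density lborel (f i)) \<partial>density lborel (f n))"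
    using D.product_nn_integral_insert_rev[of "{..<n}" n F] Suc.prems
    by (simp add: lessThan_Suc measurable_cong_sets[OF sets_eq refl])
  also have "\<dots> = (\<integral>\<^sup>+y. \<integral>\<^sup>+x. (\<Prod>i<n. f i (x i)) * F (x(n := y)) \<partial>leb n \<partial>density lborel (f n))"
    by (rule nn_integral_cong, rule Suc.IH) measurable
  also have "\<dots> = (\<integral>\<^sup>+y. f n y * (\<integral>\<^sup>+x. (\<Prod>i<n. f i (x i)) * F (x(n := y)) \<partial>leb n) \<partial>lborel)"
    by (rule nn_integral_density) measurable
  also have "\<dots> = (\<integral>\<^sup>+y. \<integral>\<^sup>+x. f n y * ((\<Prod>i<n. f i (x i)) * F (x(n := y))) \<partial>leb n \<partial>lborel)"
    by (intro nn_integral_cong nn_integral_cmult[symmetric]) measurable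
  also have "\<dots> = (\<integral>\<^sup>+x. (\<Prod>i<Suc n. f i (x i)) * F x \<partial>leb (Suc n))"
    by (subst nn_integral_leb_Suc_rev) (auto intro!: nn_integral_cong simp: mult_ac)
  finally show ?case .
qed

section \<open>The Dixon-Anderson integral\<close>

text \<open>\<open>node_deriv n \<mu> i\<close> is the derivative of \<open>\<Prod>(x - \<mu>\<^sub>j)\<close> at \<open>\<mu>\<^sub>i\<close>.\<close>

definition node_deriv :: "nat \<Rightarrow> (nat \<Rightarrow> real) \<Rightarrow> nat \<Rightarrow> real" where
  "node_deriv n \<mu> i = (\<Prod>k\<in>{..<n} - {i}. \<mu> i - \<mu> k)"

lemma node_deriv_Suc: "i < n \<Longrightarrow> node_deriv (Suc n) \<mu> i = node_deriv n \<mu> i * (\<mu> i - \<mu> n)"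
proof -
  assume "i < n"
  then have "{..<Suc n} - {i} = insert n ({..<n} - {i})" by auto
  then show ?thesis by (simp add: node_deriv_def mult.commute)
qed

lemma node_deriv_last: "node_deriv (Suc n) \<mu> n = (\<Prod>k<n. \<mu> n - \<mu> k)"
proof -
  have "{..<Suc n} - {n} = {..<n}" by auto
  then show ?thesis by (simp add: node_deriv_def)
qed

text \<open>Each pair of nodes contributes its distance to exactly two of the factors: this is the
  discriminant.\<close>

lemma prod_node_deriv: "(\<Prod>i<n. \<bar>node_deriv n \<mu> i\<bar>) = (vand n \<mu>)\<^sup>2"
proof (induction n)
  case 0 then show ?case by (simp add: vand_def)
next
  case (Suc n)
  have "(\<Prod>i<Suc n. \<bar>node_deriv (Suc n) \<mu> i\<bar>) = (\<Prod>i<n. \<bar>node_deriv n \<mu> i\<bar> * \<bar>\<mu> n - \<mu> i\<bar>) * (\<Prod>k<n. \<bar>\<mu> n - \<mu> k\<bar>)"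
    by (simp add: node_deriv_Suc node_deriv_last abs_mult abs_prod abs_minus_commute)
  also have "\<dots> = (vand n \<mu>)\<^sup>2 * (\<Prod>k<n. \<bar>\<mu> n - \<mu> k\<bar>)\<^sup>2"
    by (subst prod.distrib) (simp add: Suc.IH power2_eq_square)
  also have "\<dots> = (vand (Suc n) \<mu>)\<^sup>2"
    by (simp add: vand_Suc power_mult_distrib abs_prod[symmetric])
  finally show ?case .
qed

text \<open>Exactly the \<open>n - Suc i\<close> nodes above \<open>\<mu> i\<close> give negative
  factors.\<close>

lemma sign_node_deriv:
  assumes "chamber n \<mu>" "i < n"
  shows "(-1) ^ (n - Suc i) * node_deriv n \<mu> i > 0"
proof -
  have "{..<n} - {i} = {..<i} \<union> {Suc i..<n}" using assms(2) by auto
  then have "node_deriv n \<mu> i = (\<Prod>k\<in>{..<i} \<union> {Suc i..<n}. \<mu> i - \<mu> k)" by (simp add: node_deriv_def)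
  also have "\<dots> = (\<Prod>k<i. \<mu> i - \<mu> k) * (\<Prod>k=Suc i..<n. \<mu> i - \<mu> k)"
    by (rule prod.union_disjoint) auto
  also have "(\<Prod>k=Suc i..<n. \<mu> i - \<mu> k) = (-1) ^ (n - Suc i) * (\<Prod>k=Suc i..<n. \<mu> k - \<mu> i)"
  proof -
    have "(\<Prod>k=Suc i..<n. \<mu> i - \<mu> k) = (\<Prod>k=Suc i..<n. (-1) * (\<mu> k - \<mu> i))" by (rule prod.cong) auto
    also have "\<dots> = (-1) ^ (n - Suc i) * (\<Prod>k=Suc i..<n. \<mu> k - \<mu> i)" by (subst prod.distrib) simp
    finally show ?thesis .
  qed
  finally have "(-1) ^ (n - Suc i) * node_deriv n \<mu> i = (\<Prod>k<i. \<mu> i - \<mu> k) * (\<Prod>k=Suc i..<n. \<mu> k - \<mu> i)"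
    by (simp add: power_add[symmetric] mult.left_commute)
  also have "\<dots> > 0"
    using assms by (intro mult_pos_pos prod_pos) (auto intro!: chamber_less[OF assms(1)])
  finally show ?thesis .
qed

text \<open>The weights \<open>e\<close> will be the alternating signs
  \<open>(-1) ^ (n - i)\<close>. By the sign criteria above, the condition then says that the roots
  of the polynomial with values \<open>b\<close> at the nodes interlace the nodes.\<close>

definition altpos :: "nat \<Rightarrow> (nat \<Rightarrow> real) \<Rightarrow> (nat \<Rightarrow> real) \<Rightarrow> bool" where
  "altpos n e b \<longleftrightarrow> (\<forall>i<n. e i * b i > 0)"

definition invsq :: "nat \<Rightarrow> (nat \<Rightarrow> real) \<Rightarrow> real" where
  "invsq n b = (\<Prod>i<n. 1 / sqrt \<bar>b i\<bar>)"

lemma invsq_cong: "(\<And>i. i < n \<Longrightarrow> b i = b' i) \<Longrightarrow> invsq n b = invsq n b'"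
  by (auto simp: invsq_def intro!: prod.cong)

lemma measurable_altpos [measurable (raw)]:
  assumes f: "f \<in> M \<rightarrow>\<^sub>M leb n"
  shows "Measurable.pred M (\<lambda>w. altpos n e (f w))"
proof -
  have [measurable]: "(\<lambda>w. f w i) \<in> borel_measurable M" if "i < n" for i
    by (rule measurable_leb_component[OF f that])
  have "Measurable.pred M (\<lambda>w. \<forall>i\<in>{..<n}. e i * f w i > 0)"
    by (intro pred_intros_finite(3)) auto
  moreover have "(\<lambda>w. \<forall>i\<in>{..<n}. e i * f w i > 0) = (\<lambda>w. altpos n e (f w))"
    by (auto simp: altpos_def fun_eq_iff)
  ultimately show ?thesis by (simp only:)
qed

lemma measurable_invsq [measurable (raw)]:
  assumes f: "f \<in> M \<rightarrow>\<^sub>M leb n"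
  shows "(\<lambda>w. invsq n (f w)) \<in> borel_measurable M"
proof -
  have [measurable]: "(\<lambda>w. f w i) \<in> borel_measurable M" if "i < n" for i
    by (rule measurable_leb_component[OF f that])
  show ?thesis unfolding invsq_def by (intro borel_measurable_prod) auto
qed

lemma sqrt_prod: "sqrt (\<Prod>i\<in>A. f i) = (\<Prod>i\<in>A. sqrt (f i))"
  by (induction A rule: infinite_finite_induct) (auto simp: real_sqrt_mult)

text \<open>Squaring is two-to-one. Each half-line contributes the density
  \<open>1 / (2 * sqrt w)\<close>, and the point 0 is null.\<close>

lemma nn_integral_square:
  fixes k :: "real \<Rightarrow> ennreal"
  assumes [measurable]: "k \<in> borel_measurable borel"
  shows "(\<integral>\<^sup>+v. k (v\<^sup>2) \<partial>lborel) = (\<integral>\<^sup>+w. (if w > 0 then ennreal (1 / sqrt w) else 0) * k w \<partial>lborel)"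
proof -
  let ?h = "\<lambda>v::real. v\<^sup>2"
  have im: "?h ` {0<..} = {0<..}"
  proof (intro equalityI subsetI)
    fix y :: real assume "y \<in> {0<..}"
    then have "y = (sqrt y)\<^sup>2" "sqrt y \<in> {0<..}" by auto
    then show "y \<in> ?h ` {0<..}" by blast
  qed auto
  have "(\<integral>\<^sup>+y. indicator (?h ` {0<..}) y * (ennreal (1 / sqrt y) * k y) \<partial>lborel)
     = (\<integral>\<^sup>+x. indicator {0<..} x * (ennreal \<bar>2 * x\<bar> * (ennreal (1 / sqrt (?h x)) * k (?h x))) \<partial>lborel)"
  proof (rule nn_integral_subst_injective_real)
    show "inj_on ?h {0<..}" by (auto simp: inj_on_def power2_eq_iff)
    show "(?h has_field_derivative 2 * x) (at x)" for x by (auto intro!: derivative_eq_intros)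
  qed (auto simp: im)
  also have "\<dots> = (\<integral>\<^sup>+x. indicator {0<..} x * (2 * k (x\<^sup>2)) \<partial>lborel)"
  proof (intro nn_integral_cong)
    fix x :: real
    show "indicator {0<..} x * (ennreal \<bar>2 * x\<bar> * (ennreal (1 / sqrt (x\<^sup>2)) * k (x\<^sup>2))) = indicator {0<..} x * (2 * k (x\<^sup>2))"
    proof (cases "x > 0")
      case True
      then have "ennreal \<bar>2 * x\<bar> * ennreal (1 / sqrt (x\<^sup>2)) = 2"
        by (subst ennreal_mult[symmetric]) (auto simp: ennreal_numeral)
      then show ?thesis by (simp add: mult.assoc[symmetric])
    qed simp
  qed
  also have "\<dots> = (\<integral>\<^sup>+x. indicator {0<..} x * k (x\<^sup>2) \<partial>lborel) + (\<integral>\<^sup>+x. indicator {0<..} x * k (x\<^sup>2) \<partial>lborel)"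
    by (subst nn_integral_add[symmetric]) (auto intro!: nn_integral_cong simp: mult_2 split: split_indicator)
  also have "(\<integral>\<^sup>+x. indicator {0<..} x * k (x\<^sup>2) \<partial>lborel) = (\<integral>\<^sup>+x. indicator {..<0} x * k (x\<^sup>2) \<partial>lborel)"
    by (subst nn_integral_real_affine[of _ "-1" 0]) (auto intro!: nn_integral_cong split: split_indicator)
  \<comment> \<open>The preceding rewriting reflects both copies of the integral; the second one is
    reflected back here.\<close>
  also have "(\<integral>\<^sup>+x. indicator {..<0} x * k (x\<^sup>2) \<partial>lborel) + (\<integral>\<^sup>+x. indicator {..<0} x * k (x\<^sup>2) \<partial>lborel)
     = (\<integral>\<^sup>+x. indicator {..<0} x * k (x\<^sup>2) \<partial>lborel) + (\<integral>\<^sup>+x. indicator {0<..} x * k (x\<^sup>2) \<partial>lborel)"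
    by (subst (2) nn_integral_real_affine[of _ "-1" 0]) (auto intro!: nn_integral_cong split: split_indicator)
  also have "\<dots> = (\<integral>\<^sup>+x. indicator {..<0} x * k (x\<^sup>2) + indicator {0<..} x * k (x\<^sup>2) \<partial>lborel)"
    by (rule nn_integral_add[symmetric]) auto
  also have "\<dots> = (\<integral>\<^sup>+x. k (x\<^sup>2) \<partial>lborel)"
  proof (rule nn_integral_cong_AE)
    have "AE x in lborel. x \<noteq> (0::real)" by (rule AE_lborel_singleton)
    then show "AE x in lborel. indicator {..<0} x * k (x\<^sup>2) + indicator {0<..} x * k (x\<^sup>2) = k (x\<^sup>2)"
      by eventually_elim (auto split: split_indicator)
  qed
  finally have "(\<integral>\<^sup>+x. k (x\<^sup>2) \<partial>lborel) = (\<integral>\<^sup>+y. indicator (?h ` {0<..}) y * (ennreal (1 / sqrt y) * k y) \<partial>lborel)" by (rule sym)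
  also have "\<dots> = (\<integral>\<^sup>+w. (if w > 0 then ennreal (1 / sqrt w) else 0) * k w \<partial>lborel)"
    unfolding im by (intro nn_integral_cong) (auto split: split_indicator)
  finally show ?thesis .
qed

definition dsq :: "real \<Rightarrow> ennreal" where
  "dsq w = (if w > 0 then ennreal (1 / sqrt w) else 0)"

lemma measurable_dsq [measurable]: "dsq \<in> borel_measurable borel"
  unfolding dsq_def by measurable

lemma nn_integral_leb_scale:
  fixes s :: "nat \<Rightarrow> real"
  assumes s: "\<And>i. i < n \<Longrightarrow> s i \<noteq> 0" and K[measurable]: "K \<in> borel_measurable (leb n)"
  shows "(\<integral>\<^sup>+b. K b \<partial>leb n) = ennreal (\<Prod>i<n. \<bar>s i\<bar>) * (\<integral>\<^sup>+v. K (\<lambda>i\<in>{..<n}. s i * v i) \<partial>leb n)"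
proof -
  have p: "(\<Prod>i<n. \<bar>s i\<bar>) * (\<Prod>i<n. 1 / \<bar>s i\<bar>) = 1"
    unfolding prod.distrib[symmetric] using s by (intro prod.neutral) auto
  have "(\<integral>\<^sup>+v. K (\<lambda>i\<in>{..<n}. s i * v i) \<partial>leb n) = ennreal (\<Prod>i<n. 1 / \<bar>s i\<bar>) * (\<integral>\<^sup>+b. K b \<partial>leb n)"
    using nn_integral_leb_affine[of n s K "\<lambda>_. 0", OF s K] by simp
  then have "ennreal (\<Prod>i<n. \<bar>s i\<bar>) * (\<integral>\<^sup>+v. K (\<lambda>i\<in>{..<n}. s i * v i) \<partial>leb n)
     = ennreal ((\<Prod>i<n. \<bar>s i\<bar>) * (\<Prod>i<n. 1 / \<bar>s i\<bar>)) * (\<integral>\<^sup>+b. K b \<partial>leb n)"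
    by (simp add: ennreal_mult prod_nonneg mult.assoc)
  then show ?thesis unfolding p by simp
qed

text \<open>In the variables \<open>w i = b i / s i\<close> the sign pattern becomes positivity,
  since \<open>e i\<close> and \<open>s i\<close> have equal signs. The Jacobian
  \<open>\<bar>s i\<bar>\<close> and the same factor under the inverse square root leave
  \<open>sqrt \<bar>s i\<bar>\<close>; the rest of the weight is \<open>dsq\<close>, the density of
  squares.\<close>

lemma nn_integral_leb_altpos:
  fixes s e :: "nat \<Rightarrow> real"
  assumes s: "\<And>i. i < n \<Longrightarrow> e i * s i > 0" and K[measurable]: "K \<in> borel_measurable (leb n)"
  shows "(\<integral>\<^sup>+b. (if altpos n e b then ennreal (invsq n b) * K (\<lambda>i\<in>{..<n}. b i / s i) else 0) \<partial>leb n)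
    = ennreal (sqrt (\<Prod>i<n. \<bar>s i\<bar>)) * (\<integral>\<^sup>+w. (\<Prod>i<n. dsq (w i)) * K w \<partial>leb n)"
proof -
  have s0: "s i \<noteq> 0" if "i < n" for i using s[OF that] by auto
  let ?P = "\<Prod>i<n. \<bar>s i\<bar>"
  have P: "?P > 0" using s0 by (intro prod_pos) auto
  have pw: "(if altpos n e (\<lambda>i\<in>{..<n}. s i * w i) then ennreal (invsq n (\<lambda>i\<in>{..<n}. s i * w i)) * K (\<lambda>i\<in>{..<n}. (\<lambda>i\<in>{..<n}. s i * w i) i / s i) else 0)
     = ennreal (1 / sqrt ?P) * ((\<Prod>i<n. dsq (w i)) * K w)" if w: "w \<in> space (leb n)" for w
  proof (cases "\<forall>i<n. w i > 0")
    case True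
    have a: "altpos n e (\<lambda>i\<in>{..<n}. s i * w i)"
      unfolding altpos_def
    proof (intro allI impI)
      fix i assume "i < n"
      then have "e i * s i > 0" "w i > 0" using s True by auto
      then have "(e i * s i) * w i > 0" by (rule mult_pos_pos)
      then show "e i * (\<lambda>i\<in>{..<n}. s i * w i) i > 0" using \<open>i < n\<close> by (simp add: mult.assoc)
    qed
    have r: "(\<lambda>i\<in>{..<n}. (\<lambda>i\<in>{..<n}. s i * w i) i / s i) = w"
    proof
      fix i show "(\<lambda>i\<in>{..<n}. (\<lambda>i\<in>{..<n}. s i * w i) i / s i) i = w i"
        using w s0[of i] by (cases "i < n") (auto simp: leb_space_ext extensional_def)
    qed
    have "invsq n (\<lambda>i\<in>{..<n}. s i * w i) = (\<Prod>i<n. (1 / sqrt \<bar>s i\<bar>) * (1 / sqrt (w i)))"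
      unfolding invsq_def using True by (intro prod.cong) (auto simp: abs_mult real_sqrt_mult)
    also have "\<dots> = (1 / sqrt ?P) * (\<Prod>i<n. 1 / sqrt (w i))"
      by (subst prod.distrib) (simp add: prod_dividef sqrt_prod)
    finally have "ennreal (invsq n (\<lambda>i\<in>{..<n}. s i * w i)) = ennreal (1 / sqrt ?P) * ennreal (\<Prod>i<n. 1 / sqrt (w i))"
      using P True by (subst ennreal_mult[symmetric]) (auto intro!: prod_nonneg simp: less_imp_le)
    also have "ennreal (\<Prod>i<n. 1 / sqrt (w i)) = (\<Prod>i<n. dsq (w i))"
      using True by (subst prod_ennreal[symmetric]) (auto simp: dsq_def less_imp_le intro!: prod.cong)
    finally show ?thesis using a r by (simp only: if_True mult.assoc)
  next
    case False
    then obtain i where i: "i < n" "\<not> w i > 0" by auto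
    have "\<not> e i * (s i * w i) > 0"
    proof -
      have "(e i * s i) * w i \<le> 0" using s[OF i(1)] i(2) by (intro mult_nonneg_nonpos) auto
      then show ?thesis by (simp add: mult.assoc)
    qed
    then have "\<not> altpos n e (\<lambda>i\<in>{..<n}. s i * w i)" using i by (auto simp: altpos_def)
    moreover have "(\<Prod>i<n. dsq (w i)) = 0" using i by (intro prod_zero) (auto simp: dsq_def)
    ultimately show ?thesis by (simp only: if_False mult_zero_left mult_zero_right)
  qed
  have "(\<integral>\<^sup>+b. (if altpos n e b then ennreal (invsq n b) * K (\<lambda>i\<in>{..<n}. b i / s i) else 0) \<partial>leb n)
    = ennreal ?P * (\<integral>\<^sup>+w. (if altpos n e (\<lambda>i\<in>{..<n}. s i * w i) then ennreal (invsq n (\<lambda>i\<in>{..<n}. s i * w i)) * K (\<lambda>i\<in>{..<n}. (\<lambda>i\<in>{..<n}. s i * w i) i / s i) else 0) \<partial>leb n)"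
    by (rule nn_integral_leb_scale[OF s0]) measurable
  also have "\<dots> = ennreal ?P * (\<integral>\<^sup>+w. ennreal (1 / sqrt ?P) * ((\<Prod>i<n. dsq (w i)) * K w) \<partial>leb n)"
    by (intro arg_cong2[where f="(*)"] refl nn_integral_cong pw)
  also have "\<dots> = ennreal ?P * (ennreal (1 / sqrt ?P) * (\<integral>\<^sup>+w. (\<Prod>i<n. dsq (w i)) * K w \<partial>leb n))"
    by (subst nn_integral_cmult) measurable
  also have "\<dots> = ennreal (?P * (1 / sqrt ?P)) * (\<integral>\<^sup>+w. (\<Prod>i<n. dsq (w i)) * K w \<partial>leb n)"
    using P by (subst ennreal_mult) (auto simp: mult.assoc)
  also have "?P * (1 / sqrt ?P) = sqrt ?P" using P real_div_sqrt[of ?P] by simp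
  finally show ?thesis .
qed

lemma nn_integral_leb_squares:
  assumes K[measurable]: "K \<in> borel_measurable (leb n)"
  shows "(\<integral>\<^sup>+v. K (\<lambda>i\<in>{..<n}. (v i)\<^sup>2) \<partial>leb n) = (\<integral>\<^sup>+w. (\<Prod>i<n. dsq (w i)) * K w \<partial>leb n)"
  by (rule nn_integral_leb_coordinatewise) (auto simp: nn_integral_square dsq_def)

text \<open>With \<open>s = 0\<close> the coefficient \<open>y\<close> becomes the leading one; with
  \<open>s = 1\<close> it turns into the factor \<open>x + y\<close> of the highest remaining power.
  Both readings are used.\<close>

lemma hor_case_nat: "hor s (Suc n) (case_nat y c) x = hor (s * x + y) n c x"
  by (induction n) auto

lemma hor_lead: "hor s n c x = s * x ^ n + hor 0 n c x"
  by (induction n) (auto simp: algebra_simps)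

lemma hor_scale: "hor (t * s) n (\<lambda>i. t * c i) x = t * hor s n c x"
  by (induction n) (auto simp: algebra_simps)

text \<open>The product of \<open>\<bar>\<mu> i - l j\<bar>\<close> to the power -1/2 over all
  pairs. It arises from values at the \<open>\<mu> i\<close> when a matrix is bordered, and from
  values at the \<open>l j\<close> when the \<open>\<mu>\<close> are integrated out.\<close>

definition dixon_weight :: "nat \<Rightarrow> (nat \<Rightarrow> real) \<Rightarrow> (nat \<Rightarrow> real) \<Rightarrow> real" where
  "dixon_weight n l \<mu> = invsq n (\<lambda>i. \<Prod>j<Suc n. \<mu> i - l j)"

lemma dixon_weight_swap: "dixon_weight n l \<mu> = invsq (Suc n) (\<lambda>j. \<Prod>i<n. l j - \<mu> i)"
proof -
  have "dixon_weight n l \<mu> = (\<Prod>i<n. \<Prod>j<Suc n. 1 / sqrt \<bar>\<mu> i - l j\<bar>)"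
    unfolding dixon_weight_def invsq_def
    by (intro prod.cong refl) (simp add: abs_prod sqrt_prod prod_dividef del: prod.lessThan_Suc)
  also have "\<dots> = (\<Prod>j<Suc n. \<Prod>i<n. 1 / sqrt \<bar>l j - \<mu> i\<bar>)"
    by (subst prod.swap) (simp add: abs_minus_commute)
  also have "\<dots> = invsq (Suc n) (\<lambda>j. \<Prod>i<n. l j - \<mu> i)"
    unfolding invsq_def
    by (intro prod.cong refl) (simp add: abs_prod sqrt_prod prod_dividef)
  finally show ?thesis .
qed

lemma Gamma_nn_integral:
  fixes a :: real assumes "a > 0"
  shows "(\<integral>\<^sup>+s. (if s > 0 then ennreal (exp (- s) * s powr (a - 1)) else 0) \<partial>lborel) = ennreal (Gamma a)"
proof -
  have "(\<integral>\<^sup>+s. (if s > 0 then ennreal (exp (- s) * s powr (a - 1)) else 0) \<partial>lborel)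
     = (\<integral>\<^sup>+s. ennreal (indicator {0..} s * s powr (a - 1) / exp s) \<partial>lborel)"
  proof (rule nn_integral_cong_AE)
    have "AE s in lborel. s \<noteq> (0::real)" by (rule AE_lborel_singleton)
    then show "AE s in lborel. (if s > 0 then ennreal (exp (- s) * s powr (a - 1)) else 0) = ennreal (indicator {0..} s * s powr (a - 1) / exp s)"
      by eventually_elim (auto simp: exp_minus field_simps split: split_indicator)
  qed
  also have "\<dots> = ennreal (Gamma a)" using Gamma_conv_nn_integral_real[OF assms] by simp
  finally show ?thesis .
qed

text \<open>Multiplying by \<open>\<Gamma>((n + 1) / 2)\<close> turns the monic polynomial with roots \<open>\<mu>\<close> into one with free
  leading coefficient \<open>s > 0\<close>; in the residues \<open>w\<^sub>j\<close> of its quotient by \<open>\<Prod>(x - l\<^sub>j)\<close> one has \<open>s = \<Sum> w\<^sub>j\<close>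
  and the integral factorises.\<close>

lemma dixon_anderson:
  assumes l: "chamber (Suc n) l"
  shows "(\<integral>\<^sup>+\<mu>. (if chamber n \<mu> \<and> interlace n \<mu> l then ennreal (vand n \<mu> * dixon_weight n l \<mu>) else 0) \<partial>leb n)
     = ennreal (Gamma (1/2) ^ Suc n / Gamma (real (Suc n) / 2))"
proof -
  let ?e = "\<lambda>j. (-1) ^ (n - j) :: real"
  let ?m = "Suc n"
  define vals where "vals s c = (\<lambda>j\<in>{..<?m}. hor s n c (l j))" for s c
  have mvals[measurable (raw)]: "(\<lambda>w. vals s (f w)) \<in> M \<rightarrow>\<^sub>M leb ?m" if "f \<in> M \<rightarrow>\<^sub>M leb n" for s f and M :: "(nat \<Rightarrow> real) measure"
    unfolding vals_def using that by measurable
  define H where "H b = (if altpos ?m ?e b then ennreal (invsq ?m b) else 0)" for b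
  have [measurable]: "H \<in> borel_measurable (leb ?m)" unfolding H_def by measurable
  have lj: "inj_on l {..<?m}" by (rule chamber_inj_on[OF l])
  \<comment> \<open>\<open>H\<close> already forces the sign pattern at \<open>l\<close> and with it
    real, interlacing roots, so it absorbs the condition that the passage from roots to coefficients
    brings along.\<close>
  have real_rooted_iff: "H (vals 1 d) = (if real_rooted n d then H (vals 1 d) else 0)" for d
  proof (cases "altpos ?m ?e (vals 1 d)")
    case True
    then have "\<forall>i\<le>n. (-1) ^ (n - i) * hor 1 n d (l i) > 0" by (auto simp: altpos_def vals_def)
    then have "real_rooted n d" unfolding interlace_below_iff[OF l] real_rooted_def by blast
    then show ?thesis by simp
  qed (simp add: H_def)
  have "(\<integral>\<^sup>+\<mu>. (if chamber n \<mu> \<and> interlace n \<mu> l then ennreal (vand n \<mu> * dixon_weight n l \<mu>) else 0) \<partial>leb n)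
     = (\<integral>\<^sup>+\<mu>. (if chamber n \<mu> then ennreal (vand n \<mu>) * H (vals 1 (\<lambda>j\<in>{..<n}. co n \<mu> j)) else 0) \<partial>leb n)"
  proof (intro nn_integral_cong)
    fix \<mu>
    show "(if chamber n \<mu> \<and> interlace n \<mu> l then ennreal (vand n \<mu> * dixon_weight n l \<mu>) else 0)
      = (if chamber n \<mu> then ennreal (vand n \<mu>) * H (vals 1 (\<lambda>j\<in>{..<n}. co n \<mu> j)) else 0)"
    proof (cases "chamber n \<mu>")
      case ch: True
      have v: "vals 1 (\<lambda>j\<in>{..<n}. co n \<mu> j) = (\<lambda>j\<in>{..<?m}. \<Prod>i<n. l j - \<mu> i)"
        unfolding vals_def hor_restrict hor_co ..
      have "altpos ?m ?e (vals 1 (\<lambda>j\<in>{..<n}. co n \<mu> j)) \<longleftrightarrow> (\<forall>i\<le>n. (-1) ^ (n - i) * hor 1 n (co n \<mu>) (l i) > 0)"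
        unfolding vals_def hor_restrict by (auto simp: altpos_def)
      also have "\<dots> \<longleftrightarrow> (\<exists>\<mu>'. has_roots n (co n \<mu>) \<mu>' \<and> interlace n \<mu>' l)"
        by (rule interlace_below_iff[OF l])
      also have "\<dots> \<longleftrightarrow> interlace n \<mu> l"
        using has_roots_co[OF ch] has_roots_unique[OF has_roots_co[OF ch]] by (metis interlace_def)
      finally have a: "altpos ?m ?e (vals 1 (\<lambda>j\<in>{..<n}. co n \<mu> j)) \<longleftrightarrow> interlace n \<mu> l" .
      have "invsq ?m (vals 1 (\<lambda>j\<in>{..<n}. co n \<mu> j)) = dixon_weight n l \<mu>"
        unfolding v dixon_weight_swap by (rule invsq_cong) auto
      moreover have "dixon_weight n l \<mu> \<ge> 0" unfolding dixon_weight_def invsq_def by (intro prod_nonneg) auto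
      ultimately show ?thesis
        using ch a vand_pos[OF ch] by (simp add: H_def ennreal_mult)
    qed simp
  qed
  also have "\<dots> = (\<integral>\<^sup>+d. (if real_rooted n d then H (vals 1 d) else 0) \<partial>leb n)"
    by (rule nn_integral_Viete) measurable
  also have "\<dots> = (\<integral>\<^sup>+d. H (vals 1 d) \<partial>leb n)"
    by (simp only: real_rooted_iff[symmetric])
  finally have J: "(\<integral>\<^sup>+\<mu>. (if chamber n \<mu> \<and> interlace n \<mu> l then ennreal (vand n \<mu> * dixon_weight n l \<mu>) else 0) \<partial>leb n)
     = (\<integral>\<^sup>+d. H (vals 1 d) \<partial>leb n)" .
  define a where "a = real ?m / 2"
  have a0: "a > 0" by (simp add: a_def)
  \<comment> \<open>Homogeneity: scaling \<open>n\<close> coefficients gives \<open>s ^ n\<close>,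
    and the \<open>n + 1\<close> inverse square roots give \<open>s powr (- a)\<close>. Together
    this is \<open>s powr (a - 1)\<close>, the integrand of \<open>Gamma a\<close> apart from
    \<open>exp (- s)\<close>.\<close>
  have scale: "ennreal (s powr (a - 1)) * (\<integral>\<^sup>+d. H (vals 1 d) \<partial>leb n) = (\<integral>\<^sup>+c. H (vals s c) \<partial>leb n)" if s: "s > 0" for s
  proof -
    have "(\<integral>\<^sup>+c. H (vals s c) \<partial>leb n) = ennreal (\<Prod>i<n. \<bar>s\<bar>) * (\<integral>\<^sup>+d. H (vals s (\<lambda>i\<in>{..<n}. s * d i)) \<partial>leb n)"
      using s by (intro nn_integral_leb_scale) measurable
    also have "(\<lambda>d. H (vals s (\<lambda>i\<in>{..<n}. s * d i))) = (\<lambda>d. ennreal (s powr (- a)) * H (vals 1 d))"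
    proof
      fix d
      have v: "vals s (\<lambda>i\<in>{..<n}. s * d i) j = s * vals 1 d j" if "j < ?m" for j
        using that hor_scale[of s 1 n d "l j"] by (simp add: vals_def)
      have al: "altpos ?m ?e (vals s (\<lambda>i\<in>{..<n}. s * d i)) = altpos ?m ?e (vals 1 d)"
      proof -
        have "?e j * vals s (\<lambda>i\<in>{..<n}. s * d i) j > 0 \<longleftrightarrow> ?e j * vals 1 d j > 0" if "j < ?m" for j
        proof -
          have "?e j * vals s (\<lambda>i\<in>{..<n}. s * d i) j = s * (?e j * vals 1 d j)" using v[OF that] by simp
          then show ?thesis using s by (metis mult_pos_pos zero_less_mult_pos)
        qed
        then show ?thesis by (auto simp: altpos_def)
      qed
      have "invsq ?m (vals s (\<lambda>i\<in>{..<n}. s * d i)) = (\<Prod>j<?m. (1 / sqrt s) * (1 / sqrt \<bar>vals 1 d j\<bar>))"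
        unfolding invsq_def using v s by (intro prod.cong) (auto simp: abs_mult real_sqrt_mult)
      also have "\<dots> = (1 / sqrt s) ^ ?m * invsq ?m (vals 1 d)"
        by (subst prod.distrib) (simp add: invsq_def del: prod.lessThan_Suc)
      also have "(1 / sqrt s) ^ ?m = s powr (- a)"
      proof -
        have "1 / sqrt s = s powr (- (1/2))" using s by (simp add: powr_minus powr_half_sqrt divide_simps)
        then have "(1 / sqrt s) ^ ?m = (s powr (- (1/2))) powr (real ?m)" using s by (simp only: powr_realpow powr_gt_zero)
        also have "\<dots> = s powr (- a)" unfolding powr_powr a_def by simp
        finally show ?thesis .
      qed
      finally have "invsq ?m (vals s (\<lambda>i\<in>{..<n}. s * d i)) = s powr (- a) * invsq ?m (vals 1 d)" .
      then have "ennreal (invsq ?m (vals s (\<lambda>i\<in>{..<n}. s * d i))) = ennreal (s powr (- a)) * ennreal (invsq ?m (vals 1 d))"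
        by (simp only:) (rule ennreal_mult', simp)
      then show "H (vals s (\<lambda>i\<in>{..<n}. s * d i)) = ennreal (s powr (- a)) * H (vals 1 d)"
        unfolding H_def al by simp
    qed
    also have "(\<integral>\<^sup>+d. ennreal (s powr (- a)) * H (vals 1 d) \<partial>leb n) = ennreal (s powr (- a)) * (\<integral>\<^sup>+d. H (vals 1 d) \<partial>leb n)"
      by (rule nn_integral_cmult) measurable
    also have "ennreal (\<Prod>i<n. \<bar>s\<bar>) * (ennreal (s powr (- a)) * (\<integral>\<^sup>+d. H (vals 1 d) \<partial>leb n))
       = ennreal (s ^ n * s powr (- a)) * (\<integral>\<^sup>+d. H (vals 1 d) \<partial>leb n)"
      using s by (simp add: ennreal_mult mult.assoc)
    also have "s ^ n * s powr (- a) = s powr (a - 1)"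
      using s by (simp add: powr_realpow[symmetric] powr_add[symmetric] a_def field_simps)
    finally show ?thesis by simp
  qed
  \<comment> \<open>The sum of the residues. By the Lagrange identity it equals the leading
    coefficient, so \<open>exp (- s)\<close> becomes a product over the residues.\<close>
  define sg where "sg b = (\<Sum>j<?m. b j / node_deriv ?m l j)" for b
  have sg: "sg (vals s c) = s" for s c
  proof -
    have "sg (vals s c) = (\<Sum>j<?m. hor s n c (l j) / (\<Prod>i\<in>{..<?m} - {j}. l j - l i))"
      unfolding sg_def node_deriv_def by (intro sum.cong) (auto simp: vals_def)
    then show ?thesis using hor_lagrange_lead[OF lj, of s c] by simp
  qed
  \<comment> \<open>Under the sign pattern all residues are positive. Hence nonpositive
    \<open>s\<close> contribute nothing, and the integral may run over the whole line.\<close>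
  have spos: "s > 0" if "altpos ?m ?e (vals s c)" for s c
  proof -
    have "vals s c j / node_deriv ?m l j > 0" if j: "j < ?m" for j
    proof -
      have "?e j * vals s c j > 0" "?e j * node_deriv ?m l j > 0"
        using \<open>altpos ?m ?e (vals s c)\<close> j sign_node_deriv[OF l j] by (auto simp: altpos_def)
      then show ?thesis by (auto simp: zero_less_mult_iff zero_less_divide_iff)
    qed
    then have "sg (vals s c) > 0" unfolding sg_def by (intro sum_pos) auto
    then show ?thesis by (simp add: sg)
  qed
  have ms[measurable]: "sg \<in> borel_measurable (leb ?m)"
    unfolding sg_def by (intro borel_measurable_sum borel_measurable_divide measurable_leb_component[OF measurable_ident]) auto
  have "ennreal (Gamma a) * (\<integral>\<^sup>+d. H (vals 1 d) \<partial>leb n)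
     = (\<integral>\<^sup>+s. (if s > 0 then ennreal (exp (- s) * s powr (a - 1)) else 0) * (\<integral>\<^sup>+d. H (vals 1 d) \<partial>leb n) \<partial>lborel)"
    unfolding Gamma_nn_integral[OF a0, symmetric] by (rule nn_integral_multc[symmetric]) measurable
  also have "\<dots> = (\<integral>\<^sup>+s. \<integral>\<^sup>+c. ennreal (exp (- sg (vals s c))) * H (vals s c) \<partial>leb n \<partial>lborel)"
  proof (rule nn_integral_cong)
    fix s :: real
    have "(\<integral>\<^sup>+c. ennreal (exp (- sg (vals s c))) * H (vals s c) \<partial>leb n) = ennreal (exp (- s)) * (\<integral>\<^sup>+c. H (vals s c) \<partial>leb n)"
      unfolding sg by (rule nn_integral_cmult) measurable
    also have "\<dots> = (if s > 0 then ennreal (exp (- s) * s powr (a - 1)) else 0) * (\<integral>\<^sup>+d. H (vals 1 d) \<partial>leb n)"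
    proof (cases "s > 0")
      case True
      then show ?thesis by (subst scale[OF True, symmetric]) (simp add: ennreal_mult mult.assoc)
    next
      case False
      then have "H (vals s c) = 0" for c using spos[of s c] by (auto simp: H_def)
      then show ?thesis using False by simp
    qed
    finally show "(if s > 0 then ennreal (exp (- s) * s powr (a - 1)) else 0) * (\<integral>\<^sup>+d. H (vals 1 d) \<partial>leb n)
      = (\<integral>\<^sup>+c. ennreal (exp (- sg (vals s c))) * H (vals s c) \<partial>leb n)" by simp
  qed
  \<comment> \<open>The pair of \<open>s\<close> and \<open>c\<close> becomes one vector
    \<open>C\<close> of \<open>n + 1\<close> free coefficients, the formal leading coefficient being
    0. Evaluation at the \<open>l j\<close> is then an interpolation problem with as many unknowns
    as nodes.\<close>
  also have "\<dots> = (\<integral>\<^sup>+s. \<integral>\<^sup>+c. (\<lambda>C. ennreal (exp (- sg (\<lambda>j\<in>{..<?m}. hor 0 ?m C (l j)))) * H (\<lambda>j\<in>{..<?m}. hor 0 ?m C (l j))) (case_nat s c) \<partial>leb n \<partial>lborel)"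
    unfolding vals_def hor_case_nat by simp
  also have "\<dots> = (\<integral>\<^sup>+C. ennreal (exp (- sg (\<lambda>j\<in>{..<?m}. hor 0 ?m C (l j)))) * H (\<lambda>j\<in>{..<?m}. hor 0 ?m C (l j)) \<partial>leb ?m)"
    by (rule nn_integral_leb_case_nat[symmetric]) measurable
  also have "\<dots> = ennreal (1 / \<bar>vand ?m l\<bar>) * (\<integral>\<^sup>+b. ennreal (exp (- sg b)) * H b \<partial>leb ?m)"
    by (rule nn_integral_leb_interpolation[OF lj]) measurable
  also have "(\<integral>\<^sup>+b. ennreal (exp (- sg b)) * H b \<partial>leb ?m)
     = (\<integral>\<^sup>+b. (if altpos ?m ?e b then ennreal (invsq ?m b) * ennreal (exp (- (\<Sum>j<?m. (\<lambda>i\<in>{..<?m}. b i / node_deriv ?m l i) j))) else 0) \<partial>leb ?m)"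
  proof (intro nn_integral_cong)
    fix b
    have "(\<Sum>j<?m. (\<lambda>i\<in>{..<?m}. b i / node_deriv ?m l i) j) = sg b"
      unfolding sg_def by (rule sum.cong) auto
    then show "ennreal (exp (- sg b)) * H b = (if altpos ?m ?e b then ennreal (invsq ?m b) * ennreal (exp (- (\<Sum>j<?m. (\<lambda>i\<in>{..<?m}. b i / node_deriv ?m l i) j))) else 0)"
      by (simp only: H_def mult.commute if_distrib[of "\<lambda>x. _ * x"] mult_zero_left mult_zero_right split: if_split)
  qed
  also have "\<dots> = ennreal (sqrt (\<Prod>i<?m. \<bar>node_deriv ?m l i\<bar>)) * (\<integral>\<^sup>+w. (\<Prod>i<?m. dsq (w i)) * ennreal (exp (- (\<Sum>j<?m. w j))) \<partial>leb ?m)"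
    by (rule nn_integral_leb_altpos) (use sign_node_deriv[OF l] in \<open>auto simp del: sum.lessThan_Suc\<close>)
  also have "sqrt (\<Prod>i<?m. \<bar>node_deriv ?m l i\<bar>) = vand ?m l"
    unfolding prod_node_deriv using vand_pos[OF l] by simp
  also have "(\<integral>\<^sup>+w. (\<Prod>i<?m. dsq (w i)) * ennreal (exp (- (\<Sum>j<?m. w j))) \<partial>leb ?m)
     = (\<integral>\<^sup>+w. (\<Prod>i<?m. dsq (w i) * ennreal (exp (- w i))) \<partial>leb ?m)"
  proof (intro nn_integral_cong)
    fix w :: "nat \<Rightarrow> real"
    have "ennreal (exp (- (\<Sum>j<?m. w j))) = (\<Prod>j<?m. ennreal (exp (- w j)))"
      by (subst prod_ennreal) (auto simp: exp_sum[symmetric] sum_negf simp del: sum.lessThan_Suc prod.lessThan_Suc)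
    then show "(\<Prod>i<?m. dsq (w i)) * ennreal (exp (- (\<Sum>j<?m. w j))) = (\<Prod>i<?m. dsq (w i) * ennreal (exp (- w i)))"
      by (simp add: prod.distrib del: prod.lessThan_Suc)
  qed
  also have "\<dots> = (\<Prod>i<?m. \<integral>\<^sup>+w. dsq w * ennreal (exp (- w)) \<partial>lborel)"
    by (rule leb.product_nn_integral_prod) auto
  also have "(\<integral>\<^sup>+w. dsq w * ennreal (exp (- w)) \<partial>lborel) = ennreal (Gamma (1/2))"
    unfolding Gamma_nn_integral[of "1/2", simplified, symmetric]
    by (intro nn_integral_cong)
       (auto simp: dsq_def ennreal_mult[symmetric] powr_minus powr_half_sqrt divide_simps mult.commute)
  also have "(\<Prod>i<?m. ennreal (Gamma (1/2))) = ennreal (Gamma (1/2) ^ ?m)"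
    by (simp add: ennreal_power Gamma_real_nonneg del: power_Suc prod.lessThan_Suc)
  finally have "ennreal (Gamma a) * (\<integral>\<^sup>+d. H (vals 1 d) \<partial>leb n) = ennreal (Gamma (1/2) ^ ?m)"
    using vand_pos[OF l] by (simp add: mult.assoc[symmetric] ennreal_mult[symmetric] del: power_Suc)
  then have "ennreal (1 / Gamma a) * (ennreal (Gamma a) * (\<integral>\<^sup>+d. H (vals 1 d) \<partial>leb n)) = ennreal (Gamma (1/2) ^ ?m / Gamma a)"
    using Gamma_real_pos[OF a0] by (simp add: ennreal_mult[symmetric] Gamma_real_nonneg del: power_Suc)
  moreover have "ennreal (1 / Gamma a) * (ennreal (Gamma a) * X) = X" for X
    using Gamma_real_pos[OF a0] by (simp add: mult.assoc[symmetric] ennreal_mult[symmetric])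
  ultimately show ?thesis unfolding J a_def[symmetric] by simp
qed

section \<open>Joint density of the eigenvalues\<close>

definition arr :: "nat \<Rightarrow> (nat \<Rightarrow> real) \<Rightarrow> (nat \<Rightarrow> real) \<Rightarrow> real \<Rightarrow> nat \<times> nat \<Rightarrow> real" where
  "arr n \<mu> v a = (\<lambda>p\<in>goe_index (Suc n). arrow n \<mu> v a (fst p) (snd p))"

lemma arrow_sym: "arrow n \<mu> v a i j = arrow n \<mu> v a j i"
  by (auto simp: arrow_def)

lemma goe_matrix_arr: "goe_matrix (Suc n) (arr n \<mu> v a) = fm (Suc n) (arrow n \<mu> v a)"
  unfolding goe_matrix_fm
  by (rule fm_eqI) (auto simp: arr_def goe_index_def min_def max_def arrow_sym)

lemma measurable_arr [measurable (raw)]: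
  assumes f: "f \<in> M \<rightarrow>\<^sub>M leb n" and g: "g \<in> M \<rightarrow>\<^sub>M leb n" and h[measurable]: "h \<in> borel_measurable M"
  shows "(\<lambda>w. arr n (f w) (g w) (h w)) \<in> M \<rightarrow>\<^sub>M entries (Suc n)"
  unfolding arr_def
proof (rule measurable_restrict)
  fix p assume p: "p \<in> goe_index (Suc n)"
  have [measurable]: "(\<lambda>w. f w i) \<in> borel_measurable M" "(\<lambda>w. g w i) \<in> borel_measurable M" if "i < n" for i
    using measurable_leb_component[OF f that] measurable_leb_component[OF g that] by auto
  show "(\<lambda>w. arrow n (f w) (g w) (h w) (fst p) (snd p)) \<in> borel_measurable M"
    using p unfolding arrow_def
    by (cases "fst p = n"; cases "snd p = n"; cases "fst p = snd p") (auto simp: goe_index_def)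
qed

lemma eigs_cong_char_poly:
  assumes "char_poly (goe_matrix N x) = char_poly (goe_matrix N y)"
  shows "eigs N x = eigs N y"
proof -
  have "dim_row (goe_matrix N x) = dim_row (goe_matrix N y)" by (simp add: goe_matrix_def)
  with assms have "ordered_eigenvalues (goe_matrix N x) = ordered_eigenvalues (goe_matrix N y)"
    by (simp add: ordered_eigenvalues_def)
  then show ?thesis by (simp add: eigs_def goe_eig_def)
qed

text \<open>The characteristic polynomial of an arrowhead matrix involves the border only through
  squares, so \<open>v\<close> may be replaced by the nonnegative roots of its squares.\<close>

lemma eigs_arr_squares:
  assumes "\<And>i. i < n \<Longrightarrow> (v i)\<^sup>2 = (v' i)\<^sup>2"
  shows "eigs (Suc n) (arr n \<mu> v a) = eigs (Suc n) (arr n \<mu> v' a)"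
proof (rule eigs_cong_char_poly)
  show "char_poly (goe_matrix (Suc n) (arr n \<mu> v a)) = char_poly (goe_matrix (Suc n) (arr n \<mu> v' a))"
    unfolding goe_matrix_arr char_poly_arrow_eq using assms
    by (intro arg_cong2[where f="(-)"] refl sum.cong) auto
qed

text \<open>The prescribed corner makes the difference \<open>r\<close> of degree below
  \<open>n\<close>, and the prescribed squares make it agree with \<open>s\<close> at the
  \<open>n\<close> nodes \<open>\<mu>\<close>. Corner and squares are thus the inverse of the
  passage to the new eigenvalues.\<close>

lemma eigs_arr_interlace:
  assumes \<mu>: "chamber n \<mu>" and l: "chamber (Suc n) l"
    and v: "\<And>i. i < n \<Longrightarrow> (v i)\<^sup>2 = - (\<Prod>j<Suc n. \<mu> i - l j) / node_deriv n \<mu> i"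
  shows "eigs (Suc n) (arr n \<mu> v ((\<Sum>i<Suc n. l i) - (\<Sum>i<n. \<mu> i))) = (\<lambda>i\<in>{..<Suc n}. l i)"
proof (rule eigs_eqI)
  let ?a = "(\<Sum>i<Suc n. l i) - (\<Sum>i<n. \<mu> i)"
  let ?q = "\<lambda>i. \<Prod>j\<in>{..<n} - {i}. [:- \<mu> j, 1:]"
  define r where "r = rootp (Suc n) l - [:- ?a, 1:] * rootp n \<mu>"
  define s where "s = - (\<Sum>i<n. Polynomial.smult ((v i)\<^sup>2) (?q i))"
  have "r = s"
  proof (cases "n = 0")
    case True
    then have "r = 0" unfolding r_def by (intro poly_eqI) (simp only: coeff_0 coeff_rootp_bordered zero_le)
    then show ?thesis using True by (simp add: s_def)
  next
    case False
    have inj: "inj_on \<mu> {..<n}" by (rule chamber_inj_on[OF \<mu>])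
    show ?thesis
    proof (rule poly_eqI_degree[where A="\<mu> ` {..<n}"])
      have card: "card (\<mu> ` {..<n}) = n" using card_image[OF inj] by simp
      have "degree r \<le> n - 1"
        unfolding r_def using False by (intro degree_le allI impI coeff_rootp_bordered) auto
      then show "degree r < card (\<mu> ` {..<n})" using card False by simp
      have "degree (?q i) \<le> n - 1" if "i < n" for i
        using that by (subst degree_prod_eq_sum_degree) auto
      then have "degree s \<le> n - 1" unfolding s_def degree_minus
        by (intro degree_sum_le) (auto intro: order_trans[OF degree_smult_le])
      then show "degree s < card (\<mu> ` {..<n})" using card False by simp
      fix x assume "x \<in> \<mu> ` {..<n}"
      then obtain k where k: "k < n" "x = \<mu> k" by auto
      have "(\<Prod>j<n. \<mu> k - \<mu> j) = 0" using k by (intro prod_zero) auto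
      then have "poly r x = (\<Prod>j<Suc n. \<mu> k - l j)"
        unfolding r_def poly_diff poly_mult poly_rootp k by (simp del: prod.lessThan_Suc)
      moreover have "poly s x = - ((v k)\<^sup>2 * node_deriv n \<mu> k)"
      proof -
        have "poly s x = - (\<Sum>i<n. (v i)\<^sup>2 * (\<Prod>j\<in>{..<n} - {i}. \<mu> k - \<mu> j))"
          by (simp add: s_def poly_sum poly_prod k)
        also have "(\<Sum>i<n. (v i)\<^sup>2 * (\<Prod>j\<in>{..<n} - {i}. \<mu> k - \<mu> j)) = (\<Sum>i<n. if i = k then (v k)\<^sup>2 * node_deriv n \<mu> k else 0)"
          using k by (intro sum.cong refl) (auto simp: node_deriv_def intro!: prod_zero)
        finally show ?thesis using k by (simp add: sum.delta)
      qed
      moreover have "node_deriv n \<mu> k \<noteq> 0" using sign_node_deriv k \<mu> by fastforce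
      ultimately show "poly r x = poly s x" using v[OF k(1)] by simp
    qed
  qed
  then show "char_poly (goe_matrix (Suc n) (arr n \<mu> v ?a)) = rootp (Suc n) l"
    unfolding goe_matrix_arr char_poly_arrow_eq r_def s_def by (simp add: algebra_simps del: mult_pCons_left)
  show "l i \<le> l j" if "i \<le> j" "j < Suc n" for i j
    using chamber_less[OF l, of i j] that by (cases "i = j") auto
qed

lemma co_0: "co (Suc n) l 0 = - (\<Sum>i<Suc n. l i)"
  by (induction n) (auto simp: lift_root_def)

text \<open>For fixed \<open>\<mu>\<close> the chain, read from right to left, is: roots
  \<open>l\<close>; coefficients \<open>c\<close>; the corner \<open>a\<close>, obtained from
  \<open>c 0\<close>, and the values \<open>b i\<close> at the nodes;
  \<open>w i = - b i / node_deriv n \<mu> i\<close>; finally \<open>v\<close> with squares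
  \<open>w\<close>. The passage to coefficients accounts for \<open>vand (Suc n) l\<close> and the
  squares for \<open>dixon_weight\<close>; the interpolation constant
  \<open>1 / vand n \<mu>\<close> cancels against the scaling by the node derivatives.\<close>

lemma GOE_step_inner:
  assumes \<mu>: "chamber n \<mu>" and \<mu>s[measurable]: "\<mu> \<in> space (leb n)" and F[measurable]: "F \<in> borel_measurable (leb (Suc n))"
  shows "(\<integral>\<^sup>+a. \<integral>\<^sup>+v. ennreal (exp (- a\<^sup>2 / 2 - (\<Sum>i<n. (v i)\<^sup>2))) * F (eigs (Suc n) (arr n \<mu> v a)) \<partial>leb n \<partial>lborel)
    = (\<integral>\<^sup>+l. (if chamber (Suc n) l \<and> interlace n \<mu> l
        then ennreal (vand (Suc n) l * exp (- ((\<Sum>i<Suc n. (l i)\<^sup>2) - (\<Sum>i<n. (\<mu> i)\<^sup>2)) / 2) * dixon_weight n l \<mu>) * F l else 0) \<partial>leb (Suc n))"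
proof -
  let ?e = "\<lambda>i. (-1) ^ (n - i) :: real"
  let ?s = "\<lambda>i. - node_deriv n \<mu> i"
  define K where "K a w = ennreal (exp (- a\<^sup>2 / 2 - (\<Sum>i<n. w i))) * F (eigs (Suc n) (arr n \<mu> (\<lambda>i\<in>{..<n}. sqrt (w i)) a))" for a w
  have K[measurable]: "(\<lambda>(a, w). K a w) \<in> borel_measurable (lborel \<Otimes>\<^sub>M leb n)"
    unfolding K_def by measurable
  have K'[measurable]: "K a \<in> borel_measurable (leb n)" for a
    using measurable_Pair2[OF K, of a] by simp
  define \<Phi> where "\<Phi> a b = (if altpos n ?e b then ennreal (invsq n b) * K a (\<lambda>i\<in>{..<n}. b i / ?s i) else 0)" for a b
  have \<Phi>[measurable]: "(\<lambda>(a, b). \<Phi> a b) \<in> borel_measurable (lborel \<Otimes>\<^sub>M leb n)"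
  proof -
    have "(\<lambda>x. (fst x, \<lambda>i\<in>{..<n}. snd x i / ?s i)) \<in> lborel \<Otimes>\<^sub>M leb n \<rightarrow>\<^sub>M lborel \<Otimes>\<^sub>M leb n" by measurable
    from measurable_compose[OF this K]
    have [measurable]: "(\<lambda>x. K (fst x) (\<lambda>i\<in>{..<n}. snd x i / ?s i)) \<in> borel_measurable (lborel \<Otimes>\<^sub>M leb n)" by simp
    show ?thesis unfolding \<Phi>_def case_prod_beta by measurable
  qed
  have \<Phi>'[measurable]: "\<Phi> a \<in> borel_measurable (leb n)" for a
    using measurable_Pair2[OF \<Phi>, of a] by simp
  \<comment> \<open>\<open>c 0\<close> is minus the trace of the bordered matrix, so this is the
    corner as a function of \<open>y = c 0\<close>.\<close>
  let ?A = "\<lambda>y. - y - (\<Sum>i<n. \<mu> i)"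
  define H where "H c = \<Phi> (?A (c 0)) (\<lambda>i\<in>{..<n}. hor 1 (Suc n) c (\<mu> i))" for c
  have H[measurable]: "H \<in> borel_measurable (leb (Suc n))"
  proof -
    have "(\<lambda>c. (?A (c 0), \<lambda>i\<in>{..<n}. hor 1 (Suc n) c (\<mu> i))) \<in> leb (Suc n) \<rightarrow>\<^sub>M lborel \<Otimes>\<^sub>M leb n"
      by measurable
    from measurable_compose[OF this \<Phi>] show ?thesis by (simp add: H_def[abs_def])
  qed
  have pos: "?e i * ?s i > 0" if "i < n" for i
  proof -
    have "n - i = Suc (n - Suc i)" using that by simp
    then show ?thesis using sign_node_deriv[OF \<mu> that] by simp
  qed
  have integrand: "(if chamber (Suc n) l \<and> interlace n \<mu> l
        then ennreal (vand (Suc n) l * exp (- ((\<Sum>i<Suc n. (l i)\<^sup>2) - (\<Sum>i<n. (\<mu> i)\<^sup>2)) / 2) * dixon_weight n l \<mu>) * F l else 0)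
     = (if chamber (Suc n) l then ennreal (vand (Suc n) l) * H (\<lambda>j\<in>{..<Suc n}. co (Suc n) l j) else 0)"
    if ls: "l \<in> space (leb (Suc n))" for l
  proof (cases "chamber (Suc n) l")
    case ch: True
    define P where "P = (\<lambda>i\<in>{..<n}. \<Prod>j<Suc n. \<mu> i - l j)"
    have vals: "(\<lambda>i\<in>{..<n}. hor 1 (Suc n) (\<lambda>j\<in>{..<Suc n}. co (Suc n) l j) (\<mu> i)) = P"
      unfolding P_def hor_restrict hor_co ..
    have A: "?A ((\<lambda>j\<in>{..<Suc n}. co (Suc n) l j) 0) = (\<Sum>i<Suc n. l i) - (\<Sum>i<n. \<mu> i)"
      using co_0[of n l] by simp
    have Hl: "H (\<lambda>j\<in>{..<Suc n}. co (Suc n) l j) = \<Phi> ((\<Sum>i<Suc n. l i) - (\<Sum>i<n. \<mu> i)) P"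
      unfolding H_def vals A ..
    have "altpos n ?e P \<longleftrightarrow> (\<forall>i<n. (-1) ^ (n - i) * hor 1 (Suc n) (co (Suc n) l) (\<mu> i) > 0)"
      unfolding P_def hor_co by (auto simp: altpos_def)
    also have "\<dots> \<longleftrightarrow> (\<exists>l'. has_roots (Suc n) (co (Suc n) l) l' \<and> interlace n \<mu> l')"
      by (rule interlace_above_iff[OF \<mu>])
    also have "\<dots> \<longleftrightarrow> interlace n \<mu> l"
    proof
      assume "\<exists>l'. has_roots (Suc n) (co (Suc n) l) l' \<and> interlace n \<mu> l'"
      then obtain l' where l': "has_roots (Suc n) (co (Suc n) l) l'" "interlace n \<mu> l'" by blast
      have "l i = l' i" if "i < Suc n" for i by (rule has_roots_unique[OF has_roots_co[OF ch] l'(1) that])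
      then show "interlace n \<mu> l" using l'(2) by (auto simp: interlace_def)
    qed (use has_roots_co[OF ch] in blast)
    finally have al: "altpos n ?e P \<longleftrightarrow> interlace n \<mu> l" .
    show ?thesis
    proof (cases "interlace n \<mu> l")
      case True
      let ?a = "(\<Sum>i<Suc n. l i) - (\<Sum>i<n. \<mu> i)"
      define w where "w = (\<lambda>i\<in>{..<n}. P i / ?s i)"
      have wpos: "w i > 0" if "i < n" for i
      proof -
        have "?e i * P i > 0" using True al that by (auto simp: altpos_def)
        then have "(?e i * P i) / (?e i * ?s i) > 0" using pos[OF that] by (rule divide_pos_pos)
        also have "(?e i * P i) / (?e i * ?s i) = P i / ?s i" by (rule mult_divide_mult_cancel_left) simp
        finally show ?thesis using that by (simp add: w_def)
      qed
      have wi: "w i = - (\<Prod>j<Suc n. \<mu> i - l j) / node_deriv n \<mu> i" if "i < n" for i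
        using that by (simp add: w_def P_def)
      have "eigs (Suc n) (arr n \<mu> (\<lambda>i\<in>{..<n}. sqrt (w i)) ?a) = (\<lambda>i\<in>{..<Suc n}. l i)"
      proof (rule eigs_arr_interlace[OF \<mu> ch])
        fix i assume i: "i < n"
        have "((\<lambda>i\<in>{..<n}. sqrt (w i)) i)\<^sup>2 = w i" using i wpos[OF i] by simp
        then show "((\<lambda>i\<in>{..<n}. sqrt (w i)) i)\<^sup>2 = - (\<Prod>j<Suc n. \<mu> i - l j) / node_deriv n \<mu> i"
          using wi[OF i] by simp
      qed
      also have "\<dots> = l" by (rule restrict_leb_space[OF ls])
      finally have eig: "eigs (Suc n) (arr n \<mu> (\<lambda>i\<in>{..<n}. sqrt (w i)) ?a) = l" .
      have sumw: "(\<Sum>i<n. w i) = - (\<Sum>i<n. (\<Prod>j<Suc n. \<mu> i - l j) / (\<Prod>k\<in>{..<n} - {i}. \<mu> i - \<mu> k))"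
        unfolding sum_negf[symmetric] using wi by (intro sum.cong) (auto simp: node_deriv_def)
      have "- ?a\<^sup>2 / 2 - (\<Sum>i<n. w i) = - ((\<Sum>i<Suc n. (l i)\<^sup>2) - (\<Sum>i<n. (\<mu> i)\<^sup>2)) / 2"
        unfolding sumw bordered_trace_identity[OF chamber_inj_on[OF \<mu>], of l] by simp
      then have KK: "K ?a w = ennreal (exp (- ((\<Sum>i<Suc n. (l i)\<^sup>2) - (\<Sum>i<n. (\<mu> i)\<^sup>2)) / 2)) * F l"
        unfolding K_def eig by (simp only:)
      have iq: "invsq n P = dixon_weight n l \<mu>"
        unfolding dixon_weight_def P_def by (rule invsq_cong) auto
      have dn: "dixon_weight n l \<mu> \<ge> 0" unfolding dixon_weight_def invsq_def by (intro prod_nonneg) auto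
      have "\<Phi> ?a P = ennreal (dixon_weight n l \<mu>) * K ?a w"
        unfolding \<Phi>_def iq w_def[symmetric] using al True by (simp only: if_True)
      then show ?thesis unfolding Hl KK using ch True vand_pos[OF ch] dn
        by (simp add: ennreal_mult mult_ac)
    next
      case False
      then have "\<Phi> ((\<Sum>i<Suc n. l i) - (\<Sum>i<n. \<mu> i)) P = 0" using al unfolding \<Phi>_def by (simp only: if_False)
      then show ?thesis unfolding Hl using False by (simp del: sum.lessThan_Suc)
    qed
  qed simp
  have rr: "(if real_rooted (Suc n) c then H c else 0) = H c" for c
  proof (cases "altpos n ?e (\<lambda>i\<in>{..<n}. hor 1 (Suc n) c (\<mu> i))")
    case True
    then have "\<forall>i<n. (-1) ^ (n - i) * hor 1 (Suc n) c (\<mu> i) > 0" by (auto simp: altpos_def simp del: hor.simps)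
    then have "real_rooted (Suc n) c" unfolding interlace_above_iff[OF \<mu>] real_rooted_def by blast
    then show ?thesis by simp
  next
    case False
    then have "H c = 0" unfolding H_def \<Phi>_def by (simp only: if_False)
    then show ?thesis by simp
  qed
  have "(\<integral>\<^sup>+l. (if chamber (Suc n) l \<and> interlace n \<mu> l
        then ennreal (vand (Suc n) l * exp (- ((\<Sum>i<Suc n. (l i)\<^sup>2) - (\<Sum>i<n. (\<mu> i)\<^sup>2)) / 2) * dixon_weight n l \<mu>) * F l else 0) \<partial>leb (Suc n))
     = (\<integral>\<^sup>+l. (if chamber (Suc n) l then ennreal (vand (Suc n) l) * H (\<lambda>j\<in>{..<Suc n}. co (Suc n) l j) else 0) \<partial>leb (Suc n))"
    by (intro nn_integral_cong integrand)
  also have "\<dots> = (\<integral>\<^sup>+c. (if real_rooted (Suc n) c then H c else 0) \<partial>leb (Suc n))"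
    by (rule nn_integral_Viete[OF H])
  also have "\<dots> = (\<integral>\<^sup>+c. H c \<partial>leb (Suc n))" unfolding rr ..
  also have "\<dots> = (\<integral>\<^sup>+y. \<integral>\<^sup>+c. H (case_nat y c) \<partial>leb n \<partial>lborel)"
    by (rule nn_integral_leb_case_nat[OF H])
  also have "\<dots> = (\<integral>\<^sup>+y. \<integral>\<^sup>+w. (\<Prod>i<n. dsq (w i)) * K (?A y) w \<partial>leb n \<partial>lborel)"
  proof (rule nn_integral_cong)
    fix y :: real
    \<comment> \<open>The terms of degree \<open>n + 1\<close> and \<open>n\<close> at the node. For
      fixed \<open>y\<close> they only translate the values; what remains is an evaluation with
      formal leading coefficient 0.\<close>
    let ?t = "\<lambda>i. (\<mu> i + y) * \<mu> i ^ n"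
    have Hc: "H (case_nat y c) = \<Phi> (?A y) (\<lambda>i\<in>{..<n}. (\<lambda>i\<in>{..<n}. hor 0 n c (\<mu> i)) i + ?t i)" for c
    proof -
      have "(\<lambda>i\<in>{..<n}. hor 1 (Suc n) (case_nat y c) (\<mu> i)) = (\<lambda>i\<in>{..<n}. (\<lambda>i\<in>{..<n}. hor 0 n c (\<mu> i)) i + ?t i)"
        by (rule restrict_ext) (subst hor_case_nat, subst hor_lead, simp)
      then show ?thesis unfolding H_def by simp
    qed
    have "(\<integral>\<^sup>+c. H (case_nat y c) \<partial>leb n) = ennreal (1 / \<bar>vand n \<mu>\<bar>) * (\<integral>\<^sup>+b. \<Phi> (?A y) (\<lambda>i\<in>{..<n}. b i + ?t i) \<partial>leb n)"
      unfolding Hc by (rule nn_integral_leb_interpolation[OF chamber_inj_on[OF \<mu>]]) measurable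
    also have "(\<integral>\<^sup>+b. \<Phi> (?A y) (\<lambda>i\<in>{..<n}. b i + ?t i) \<partial>leb n) = (\<integral>\<^sup>+b. \<Phi> (?A y) b \<partial>leb n)"
      by (rule nn_integral_leb_translate) measurable
    also have "\<dots> = ennreal (sqrt (\<Prod>i<n. \<bar>?s i\<bar>)) * (\<integral>\<^sup>+w. (\<Prod>i<n. dsq (w i)) * K (?A y) w \<partial>leb n)"
      unfolding \<Phi>_def by (rule nn_integral_leb_altpos[OF pos]) measurable
    also have "sqrt (\<Prod>i<n. \<bar>?s i\<bar>) = vand n \<mu>"
      unfolding abs_minus_cancel prod_node_deriv using vand_pos[OF \<mu>] by simp
    also have "ennreal (1 / \<bar>vand n \<mu>\<bar>) * (ennreal (vand n \<mu>) * (\<integral>\<^sup>+w. (\<Prod>i<n. dsq (w i)) * K (?A y) w \<partial>leb n))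
       = (\<integral>\<^sup>+w. (\<Prod>i<n. dsq (w i)) * K (?A y) w \<partial>leb n)"
      using vand_pos[OF \<mu>] by (simp add: mult.assoc[symmetric] ennreal_mult[symmetric])
    finally show "(\<integral>\<^sup>+c. H (case_nat y c) \<partial>leb n) = (\<integral>\<^sup>+w. (\<Prod>i<n. dsq (w i)) * K (?A y) w \<partial>leb n)" .
  qed
  \<comment> \<open>\<open>?A\<close> is a reflection followed by a translation, so the corner
    \<open>a\<close> can replace \<open>y\<close> as the variable.\<close>
  also have "\<dots> = (\<integral>\<^sup>+a. \<integral>\<^sup>+w. (\<Prod>i<n. dsq (w i)) * K a w \<partial>leb n \<partial>lborel)"
    by (subst (2) nn_integral_real_affine[where c="-1" and t="- (\<Sum>i<n. \<mu> i)"]) (auto simp: algebra_simps)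
  also have "\<dots> = (\<integral>\<^sup>+a. \<integral>\<^sup>+v. K a (\<lambda>i\<in>{..<n}. (v i)\<^sup>2) \<partial>leb n \<partial>lborel)"
    by (intro nn_integral_cong nn_integral_leb_squares[symmetric] K')
  also have "\<dots> = (\<integral>\<^sup>+a. \<integral>\<^sup>+v. ennreal (exp (- a\<^sup>2 / 2 - (\<Sum>i<n. (v i)\<^sup>2))) * F (eigs (Suc n) (arr n \<mu> v a)) \<partial>leb n \<partial>lborel)"
  proof (intro nn_integral_cong)
    fix a :: real and v :: "nat \<Rightarrow> real"
    have "eigs (Suc n) (arr n \<mu> (\<lambda>i\<in>{..<n}. sqrt ((\<lambda>i\<in>{..<n}. (v i)\<^sup>2) i)) a) = eigs (Suc n) (arr n \<mu> v a)"
      by (rule eigs_arr_squares) simp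
    moreover have "(\<Sum>i<n. (\<lambda>i\<in>{..<n}. (v i)\<^sup>2) i) = (\<Sum>i<n. (v i)\<^sup>2)" by (rule sum.cong) auto
    ultimately show "K a (\<lambda>i\<in>{..<n}. (v i)\<^sup>2) = ennreal (exp (- a\<^sup>2 / 2 - (\<Sum>i<n. (v i)\<^sup>2))) * F (eigs (Suc n) (arr n \<mu> v a))"
      unfolding K_def by (simp only:)
  qed
  finally show ?thesis by (rule sym)
qed

section \<open>Appending a last column to the independent entries\<close>

definition bord :: "nat \<Rightarrow> (nat \<times> nat \<Rightarrow> real) \<Rightarrow> (nat \<Rightarrow> real) \<Rightarrow> nat \<times> nat \<Rightarrow> real" where
  "bord n x z = (\<lambda>p\<in>goe_index (Suc n). if snd p = n then z (fst p) else x p)"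

lemma finite_goe_index [simp]: "finite (goe_index n)"
  by (rule finite_subset[of _ "{..<n} \<times> {..<n}"]) (auto simp: goe_index_def)

lemma measurable_bord [measurable (raw)]:
  assumes f: "f \<in> M \<rightarrow>\<^sub>M entries n" and g: "g \<in> M \<rightarrow>\<^sub>M leb (Suc n)"
  shows "(\<lambda>w. bord n (f w) (g w)) \<in> M \<rightarrow>\<^sub>M entries (Suc n)"
  unfolding bord_def
proof (rule measurable_restrict)
  fix p assume p: "p \<in> goe_index (Suc n)"
  show "(\<lambda>w. if snd p = n then g w (fst p) else f w p) \<in> borel_measurable M"
  proof (cases "snd p = n")
    case True
    then show ?thesis using p measurable_leb_component[OF g, of "fst p"] by (auto simp: goe_index_def)
  next
    case False
    then have "p \<in> goe_index n" using p by (auto simp: goe_index_def)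
    then show ?thesis using False measurable_compose[OF f measurable_component_singleton[of p "goe_index n" "\<lambda>_. borel"]] by simp
  qed
qed

text \<open>Conjugation by the eigenbasis of the old block rotates the border \<open>v\<close> and
  keeps the corner \<open>a\<close>; the old entries survive only through \<open>d\<close> and
  \<open>u\<close>.\<close>

lemma eigs_bord_rot:
  assumes "\<And>i j. i < n \<Longrightarrow> j < n \<Longrightarrow> (\<Sum>k<n. u i k * u j k) = (if i = j then 1 else 0)"
    and "\<And>i j. i < n \<Longrightarrow> j < n \<Longrightarrow> x (min i j, max i j) = (\<Sum>k<n. u i k * d k * u j k)"
  shows "eigs (Suc n) (bord n x (v(n := a))) = eigs (Suc n) (arr n d (rot n u v) a)"
proof (rule eigs_cong_char_poly)
  let ?f = "\<lambda>i j. bord n x (v(n := a)) (min i j, max i j)"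
  have fi: "?f i j = x (min i j, max i j)" if "i < n" "j < n" for i j
    using that by (auto simp: bord_def goe_index_def)
  have fn: "?f i n = v i" "?f n i = v i" if "i < n" for i
    using that by (auto simp: bord_def goe_index_def)
  have fnn: "?f n n = a" by (auto simp: bord_def goe_index_def)
  have "char_poly (goe_matrix (Suc n) (bord n x (v(n := a))))
     = char_poly (fm (Suc n) (arrow n d (\<lambda>k. \<Sum>i<n. u i k * ?f i n) (?f n n)))"
    unfolding goe_matrix_fm
    by (rule bordered_char_poly[OF assms(1)]) (use fi fn assms(2) in auto)
  also have "\<dots> = char_poly (goe_matrix (Suc n) (arr n d (rot n u v) a))"
    unfolding goe_matrix_arr
  proof (intro arg_cong[of _ _ char_poly] fm_eqI)
    fix i j assume ij: "i < Suc n" "j < Suc n"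
    have "(\<Sum>i<n. u i k * ?f i n) = rot n u v k" if "k < n" for k
      using that fn by (simp add: rot_def)
    then show "arrow n d (\<lambda>k. \<Sum>i<n. u i k * ?f i n) (?f n n) i j = arrow n d (rot n u v) a i j"
      using ij fnn by (auto simp: arrow_def less_Suc_eq)
  qed
  finally show "char_poly (goe_matrix (Suc n) (bord n x (v(n := a)))) = char_poly (goe_matrix (Suc n) (arr n d (rot n u v) a))" .
qed

abbreviation goe_entry :: "nat \<times> nat \<Rightarrow> real measure" where
  "goe_entry p \<equiv> density lborel (\<lambda>x. ennreal (normal_density 0 (if fst p = snd p then 1 else sqrt (1/2)) x))"

lemma prob_space_goe_entry: "prob_space (goe_entry p)"
  by (cases "fst p = snd p") (auto intro!: prob_space_normal_density)

lemma sets_GOE_entries [measurable_cong]: "sets (GOE_entries N) = sets (entries N)"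
  unfolding GOE_entries_def by (rule sets_PiM_cong) auto

text \<open>Normalisation of the new column: one Gaussian of variance 1 and \<open>n\<close> of
  variance 1/2.\<close>

definition border_const :: "nat \<Rightarrow> real" where
  "border_const n = 1 / sqrt (2 * pi) * (1 / sqrt pi) ^ n"

text \<open>The index set splits into the old one and the column \<open>n\<close>, whose entries
  form a product over \<open>{..<Suc n}\<close> after reindexing. The squares of \<open>v\<close>
  carry no factor 1/2 in the exponent because their variance is 1/2.\<close>

lemma GOE_entries_Suc:
  assumes F[measurable]: "F \<in> borel_measurable (entries (Suc n))"
  shows "(\<integral>\<^sup>+x. F x \<partial>GOE_entries (Suc n)) = (\<integral>\<^sup>+x. ennreal (border_const n) *
    (\<integral>\<^sup>+a. \<integral>\<^sup>+v. ennreal (exp (- a\<^sup>2 / 2 - (\<Sum>i<n. (v i)\<^sup>2))) * F (bord n x (v(n := a))) \<partial>leb n \<partial>lborel) \<partial>GOE_entries n)"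
proof -
  let ?J = "(\<lambda>i. (i, n)) ` {..<Suc n}"
  interpret P: product_sigma_finite goe_entry
    by (rule product_sigma_finite.intro) (rule prob_space_imp_sigma_finite[OF prob_space_goe_entry])
  have split: "goe_index (Suc n) = goe_index n \<union> ?J" "goe_index n \<inter> ?J = {}"
    by (auto simp: goe_index_def image_iff less_Suc_eq)
  have sJ: "sets (Pi\<^sub>M A goe_entry) = sets (\<Pi>\<^sub>M p\<in>A. borel)" for A
    by (rule sets_PiM_cong) auto
  have Fm: "F \<in> borel_measurable (Pi\<^sub>M (goe_index n \<union> ?J) goe_entry)"
    using F unfolding split(1)[symmetric] measurable_cong_sets[OF sJ refl] .
  have "(\<integral>\<^sup>+x. F x \<partial>GOE_entries (Suc n)) = (\<integral>\<^sup>+x. \<integral>\<^sup>+y. F (merge (goe_index n) ?J (x, y)) \<partial>Pi\<^sub>M ?J goe_entry \<partial>GOE_entries n)"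
    unfolding GOE_entries_def split(1) by (rule P.product_nn_integral_fold[OF split(2) _ _ Fm]) auto
  also have "\<dots> = (\<integral>\<^sup>+x. ennreal (border_const n) *
    (\<integral>\<^sup>+a. \<integral>\<^sup>+v. ennreal (exp (- a\<^sup>2 / 2 - (\<Sum>i<n. (v i)\<^sup>2))) * F (bord n x (v(n := a))) \<partial>leb n \<partial>lborel) \<partial>GOE_entries n)"
  proof (rule nn_integral_cong)
    fix x assume "x \<in> space (GOE_entries n)"
    then have x[measurable]: "x \<in> space (entries n)" by (simp add: sets_eq_imp_space_eq[OF sets_GOE_entries])
    have xe: "x \<in> extensional (goe_index n)" using x by (auto simp: space_PiM PiE_def)
    let ?D = "\<Pi>\<^sub>M i\<in>{..<Suc n}. goe_entry (i, n)"
    have sD: "sets ?D = sets (leb (Suc n))" by (rule sets_PiM_cong) auto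
    have G[measurable]: "(\<lambda>z. F (bord n x z)) \<in> borel_measurable (leb (Suc n))" by measurable
    have Gm: "(\<lambda>z. F (bord n x z)) \<in> borel_measurable ?D"
      using G unfolding measurable_cong_sets[OF sD refl] .
    have re: "distr (Pi\<^sub>M ?J goe_entry) ?D (\<lambda>\<omega>. \<lambda>i\<in>{..<Suc n}. \<omega> (i, n)) = ?D"
      by (rule distr_PiM_reindex) (auto simp: prob_space_goe_entry inj_on_def)
    have mt: "(\<lambda>\<omega>. \<lambda>i\<in>{..<Suc n}. \<omega> (i, n)) \<in> Pi\<^sub>M ?J goe_entry \<rightarrow>\<^sub>M ?D"
      by (intro measurable_restrict measurable_component_singleton) auto
    have "(\<integral>\<^sup>+y. F (merge (goe_index n) ?J (x, y)) \<partial>Pi\<^sub>M ?J goe_entry)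
       = (\<integral>\<^sup>+y. F (bord n x (\<lambda>i\<in>{..<Suc n}. y (i, n))) \<partial>Pi\<^sub>M ?J goe_entry)"
    proof (rule nn_integral_cong)
      fix y
      have "merge (goe_index n) ?J (x, y) = bord n x (\<lambda>i\<in>{..<Suc n}. y (i, n))"
      proof
        fix p :: "nat \<times> nat"
        obtain i j where p: "p = (i, j)" by (cases p)
        show "merge (goe_index n) ?J (x, y) p = bord n x (\<lambda>i\<in>{..<Suc n}. y (i, n)) p"
          unfolding p by (auto simp: merge_def bord_def goe_index_def image_iff)
      qed
      then show "F (merge (goe_index n) ?J (x, y)) = F (bord n x (\<lambda>i\<in>{..<Suc n}. y (i, n)))" by simp
    qed
    also have "\<dots> = (\<integral>\<^sup>+z. F (bord n x z) \<partial>?D)"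
      by (subst re[symmetric], subst nn_integral_distr[OF mt]) (use Gm in auto)
    also have "\<dots> = (\<integral>\<^sup>+z. (\<Prod>i<Suc n. ennreal (normal_density 0 (if i = n then 1 else sqrt (1/2)) (z i))) * F (bord n x z) \<partial>leb (Suc n))"
      using nn_integral_PiM_density[of "\<lambda>i x. ennreal (normal_density 0 (if i = n then 1 else sqrt (1/2)) x)", OF _ _ G]
        prob_space_goe_entry[of "(i, n)" for i] by simp
    also have "\<dots> = (\<integral>\<^sup>+a. \<integral>\<^sup>+v. (\<Prod>i<Suc n. ennreal (normal_density 0 (if i = n then 1 else sqrt (1/2)) ((v(n := a)) i))) * F (bord n x (v(n := a))) \<partial>leb n \<partial>lborel)"
      by (rule nn_integral_leb_Suc_rev) measurable
    also have "\<dots> = (\<integral>\<^sup>+a. \<integral>\<^sup>+v. ennreal (border_const n) * (ennreal (exp (- a\<^sup>2 / 2 - (\<Sum>i<n. (v i)\<^sup>2))) * F (bord n x (v(n := a)))) \<partial>leb n \<partial>lborel)"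
    proof (intro nn_integral_cong)
      fix a :: real and v :: "nat \<Rightarrow> real"
      have nd: "normal_density 0 (sqrt (1/2)) t = 1 / sqrt pi * exp (- t\<^sup>2)" for t
        by (simp add: normal_density_def)
      have nd1: "normal_density 0 1 a = 1 / sqrt (2 * pi) * exp (- a\<^sup>2 / 2)"
        by (simp add: normal_density_def)
      have "(\<Prod>i<Suc n. ennreal (normal_density 0 (if i = n then 1 else sqrt (1/2)) ((v(n := a)) i)))
         = (\<Prod>i<n. ennreal (1 / sqrt pi * exp (- (v i)\<^sup>2))) * ennreal (1 / sqrt (2 * pi) * exp (- a\<^sup>2 / 2))"
        unfolding nd[symmetric] nd1[symmetric] by (subst prod.lessThan_Suc) (auto intro!: arg_cong2[where f="(*)"] prod.cong)
      also have "(\<Prod>i<n. ennreal (1 / sqrt pi * exp (- (v i)\<^sup>2))) = ennreal (\<Prod>i<n. 1 / sqrt pi * exp (- (v i)\<^sup>2))"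
        by (rule prod_ennreal) simp
      also have "(\<Prod>i<n. 1 / sqrt pi * exp (- (v i)\<^sup>2)) = (1 / sqrt pi) ^ n * exp (- (\<Sum>i<n. (v i)\<^sup>2))"
        by (subst prod.distrib) (simp add: exp_sum[symmetric] sum_negf)
      also have "ennreal ((1 / sqrt pi) ^ n * exp (- (\<Sum>i<n. (v i)\<^sup>2))) * ennreal (1 / sqrt (2 * pi) * exp (- a\<^sup>2 / 2))
         = ennreal (border_const n * exp (- a\<^sup>2 / 2 - (\<Sum>i<n. (v i)\<^sup>2)))"
      proof -
        have "exp (- a\<^sup>2 / 2 - (\<Sum>i<n. (v i)\<^sup>2)) = exp (- (\<Sum>i<n. (v i)\<^sup>2)) * exp (- a\<^sup>2 / 2)"
          unfolding exp_add[symmetric] by simp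
        then show ?thesis by (subst ennreal_mult[symmetric]) (auto simp: border_const_def mult_ac)
      qed
      also have "\<dots> = ennreal (border_const n) * ennreal (exp (- a\<^sup>2 / 2 - (\<Sum>i<n. (v i)\<^sup>2)))"
        by (rule ennreal_mult) (auto simp: border_const_def)
      finally show "(\<Prod>i<Suc n. ennreal (normal_density 0 (if i = n then 1 else sqrt (1/2)) ((v(n := a)) i))) * F (bord n x (v(n := a)))
         = ennreal (border_const n) * (ennreal (exp (- a\<^sup>2 / 2 - (\<Sum>i<n. (v i)\<^sup>2))) * F (bord n x (v(n := a))))"
        by (simp only: mult.assoc)
    qed
    also have "\<dots> = (\<integral>\<^sup>+a. ennreal (border_const n) * (\<integral>\<^sup>+v. ennreal (exp (- a\<^sup>2 / 2 - (\<Sum>i<n. (v i)\<^sup>2))) * F (bord n x (v(n := a))) \<partial>leb n) \<partial>lborel)"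
      by (rule nn_integral_cong, rule nn_integral_cmult) measurable
    also have "\<dots> = ennreal (border_const n) * (\<integral>\<^sup>+a. \<integral>\<^sup>+v. ennreal (exp (- a\<^sup>2 / 2 - (\<Sum>i<n. (v i)\<^sup>2))) * F (bord n x (v(n := a))) \<partial>leb n \<partial>lborel)"
      by (rule nn_integral_cmult) measurable
    finally show "(\<integral>\<^sup>+y. F (merge (goe_index n) ?J (x, y)) \<partial>Pi\<^sub>M ?J goe_entry)
       = ennreal (border_const n) * (\<integral>\<^sup>+a. \<integral>\<^sup>+v. ennreal (exp (- a\<^sup>2 / 2 - (\<Sum>i<n. (v i)\<^sup>2))) * F (bord n x (v(n := a))) \<partial>leb n \<partial>lborel)" .
  qed
  finally show ?thesis .
qed

text \<open>The recursion produced by one bordering step: the normalisation of the new column times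
  the Dixon-Anderson constant. The factor \<open>Suc n\<close> of the factorial is absorbed by
  \<open>Gamma (1 + x) = x * Gamma x\<close>, and \<open>Gamma (3/2)\<close> is half of
  \<open>Gamma (1/2)\<close>.\<close>

lemma k_const_Suc:
  "k_const (Suc n) * fact (Suc n) = border_const n * (Gamma (1/2) ^ Suc n / Gamma (real (Suc n) / 2)) * (k_const n * fact n)"
proof -
  have G32: "Gamma (3/2 :: real) = sqrt pi / 2"
  proof -
    have "(1/2 :: real) \<notin> \<int>\<^sub>\<le>\<^sub>0" using nonpos_Ints_nonpos[of "1/2 :: real"] by auto
    then show ?thesis using Gamma_plus1[of "1/2 :: real"] by (simp add: Gamma_one_half_real)
  qed
  have G: "Gamma (1 + real (Suc n) / 2) = real (Suc n) / 2 * Gamma (real (Suc n) / 2)"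
  proof -
    have "real (Suc n) / 2 \<notin> \<int>\<^sub>\<le>\<^sub>0" using nonpos_Ints_nonpos[of "real (Suc n) / 2"] by auto
    then show ?thesis using Gamma_plus1[of "real (Suc n) / 2"] by (simp add: add.commute)
  qed
  have Gp: "Gamma (real (Suc n) / 2) > 0" by (rule Gamma_real_pos) simp
  have pw: "(2 * pi) powr (- real (Suc n) / 2) = (2 * pi) powr (- real n / 2) * (1 / sqrt (2 * pi))"
  proof -
    have "- real (Suc n) / 2 = - real n / 2 + - (1/2)" by (simp add: field_simps)
    then have "(2 * pi) powr (- real (Suc n) / 2) = (2 * pi) powr (- real n / 2) * (2 * pi) powr (- (1/2))"
      by (simp only: powr_add)
    also have "(2 * pi) powr (- (1/2)) = 1 / sqrt (2 * pi)"
    proof -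
      have "(2 * pi) powr (1/2) = sqrt (2 * pi)" by (rule powr_half_sqrt) simp
      then show ?thesis by (simp only: powr_minus inverse_eq_divide)
    qed
    finally show ?thesis .
  qed
  have k: "k_const (Suc n) = k_const n * ((1 / sqrt (2 * pi)) * Gamma (3/2) / Gamma (1 + real (Suc n) / 2))"
  proof -
    have "(\<Prod>i=1..Suc n. Gamma (1 + real i / 2)) = (\<Prod>i=1..n. Gamma (1 + real i / 2)) * Gamma (1 + real (Suc n) / 2)"
      by (subst prod.nat_ivl_Suc') (simp, rule mult.commute)
    then show ?thesis unfolding k_const_def pw by (simp only: power_Suc times_divide_times_eq mult_ac)
  qed
  have "(1 / sqrt (2 * pi)) * Gamma (3/2) / Gamma (1 + real (Suc n) / 2) * real (Suc n) = 1 / sqrt (2 * pi) * sqrt pi / Gamma (real (Suc n) / 2)"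
    unfolding G G32 using Gp by (simp add: divide_simps)
  also have "\<dots> = border_const n * (Gamma (1/2) ^ Suc n / Gamma (real (Suc n) / 2))"
    by (simp add: border_const_def Gamma_one_half_real power_divide)
  finally have E: "(1 / sqrt (2 * pi)) * Gamma (3/2) / Gamma (1 + real (Suc n) / 2) * real (Suc n)
     = border_const n * (Gamma (1/2) ^ Suc n / Gamma (real (Suc n) / 2))" .
  have "k_const (Suc n) * fact (Suc n) = ((1 / sqrt (2 * pi)) * Gamma (3/2) / Gamma (1 + real (Suc n) / 2) * real (Suc n)) * (k_const n * fact n)"
    unfolding k fact_Suc by (simp only: mult_ac)
  then show ?thesis unfolding E .
qed

lemma k_const_nonneg: "k_const n \<ge> 0"
  unfolding k_const_def
  by (intro divide_nonneg_nonneg mult_nonneg_nonneg prod_nonneg zero_le_power) (auto intro!: Gamma_real_nonneg)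

theorem GOE_joint_density:
  assumes "F \<in> borel_measurable (leb N)"
  shows "(\<integral>\<^sup>+x. F (eigs N x) \<partial>GOE_entries N) = ennreal (k_const N * fact N) *
    (\<integral>\<^sup>+l. (if chamber N l then ennreal (vand N l * exp (- (\<Sum>i<N. (l i)\<^sup>2) / 2)) * F l else 0) \<partial>leb N)"
  using assms
proof (induction N arbitrary: F)
  case 0
  have e: "eigs 0 x = (\<lambda>_. undefined)" for x by (simp add: eigs_def restrict_def)
  have "goe_index 0 = {}" by (auto simp: goe_index_def)
  then have "(\<integral>\<^sup>+x. F (eigs 0 x) \<partial>GOE_entries 0) = F (\<lambda>_. undefined)"
    by (simp add: GOE_entries_def PiM_empty e)
  then show ?case by (simp add: nn_integral_leb_0 chamber_def vand_def k_const_def del: nn_integral_const)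
next
  case (Suc n)
  note [measurable] = Suc.prems
  define \<Gamma> where "\<Gamma> \<mu> = (\<integral>\<^sup>+a. \<integral>\<^sup>+v. ennreal (exp (- a\<^sup>2 / 2 - (\<Sum>i<n. (v i)\<^sup>2))) * F (eigs (Suc n) (arr n \<mu> v a)) \<partial>leb n \<partial>lborel)" for \<mu>
  have [measurable]: "\<Gamma> \<in> borel_measurable (leb n)"
    unfolding \<Gamma>_def by measurable
  \<comment> \<open>The integral over the border depends on the old matrix only through its
    eigenvalues, because the rotation into the eigenbasis preserves the norm and Lebesgue measure.
    This lets the induction hypothesis apply to \<open>\<Gamma>\<close>.\<close>
  have rotate: "(\<integral>\<^sup>+a. \<integral>\<^sup>+v. ennreal (exp (- a\<^sup>2 / 2 - (\<Sum>i<n. (v i)\<^sup>2))) * F (eigs (Suc n) (bord n x (v(n := a)))) \<partial>leb n \<partial>lborel)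
     = \<Gamma> (eigs n x)" if "x \<in> space (GOE_entries n)" for x
  proof -
    have [measurable]: "eigs n x \<in> space (leb n)"
      using measurable_space[OF measurable_eigs, of x n] that by (simp add: sets_eq_imp_space_eq[OF sets_GOE_entries])
    obtain u where u: "\<And>i j. i < n \<Longrightarrow> j < n \<Longrightarrow> (\<Sum>k<n. u i k * u j k) = (if i = j then 1 else 0)"
      "\<And>i j. i < n \<Longrightarrow> j < n \<Longrightarrow> (\<Sum>k<n. u k i * u k j) = (if i = j then 1 else 0)"
      "\<And>i j. i < n \<Longrightarrow> j < n \<Longrightarrow> x (min i j, max i j) = (\<Sum>k<n. u i k * eigs n x k * u j k)"
      by (rule goe_spectral[of n x]) blast
    show ?thesis unfolding \<Gamma>_def
    proof (rule nn_integral_cong)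
      fix a :: real
      let ?G = "\<lambda>v. ennreal (exp (- a\<^sup>2 / 2 - (\<Sum>i<n. (v i)\<^sup>2))) * F (eigs (Suc n) (arr n (eigs n x) v a))"
      have "(\<integral>\<^sup>+v. ennreal (exp (- a\<^sup>2 / 2 - (\<Sum>i<n. (v i)\<^sup>2))) * F (eigs (Suc n) (bord n x (v(n := a)))) \<partial>leb n)
         = (\<integral>\<^sup>+v. ?G (rot n u v) \<partial>leb n)"
        by (simp only: rot_norm[OF u(1)] eigs_bord_rot[OF u(1) u(3)])
      also have "\<dots> = (\<integral>\<^sup>+v. ?G v \<partial>leb n)"
        by (rule nn_integral_leb_rotate[OF u(1) u(2)]) measurable
      finally show "(\<integral>\<^sup>+v. ennreal (exp (- a\<^sup>2 / 2 - (\<Sum>i<n. (v i)\<^sup>2))) * F (eigs (Suc n) (bord n x (v(n := a)))) \<partial>leb n)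
         = (\<integral>\<^sup>+v. ?G v \<partial>leb n)" .
    qed
  qed
  have "(\<integral>\<^sup>+x. F (eigs (Suc n) x) \<partial>GOE_entries (Suc n))
     = (\<integral>\<^sup>+x. ennreal (border_const n) * \<Gamma> (eigs n x) \<partial>GOE_entries n)"
    by (subst GOE_entries_Suc, measurable)
       (rule nn_integral_cong, rule arg_cong2[where f="(*)", OF refl], rule rotate)
  also have "\<dots> = ennreal (border_const n) * (\<integral>\<^sup>+x. \<Gamma> (eigs n x) \<partial>GOE_entries n)"
    by (rule nn_integral_cmult) measurable
  also have "(\<integral>\<^sup>+x. \<Gamma> (eigs n x) \<partial>GOE_entries n) = ennreal (k_const n * fact n) *
    (\<integral>\<^sup>+\<mu>. (if chamber n \<mu> then ennreal (vand n \<mu> * exp (- (\<Sum>i<n. (\<mu> i)\<^sup>2) / 2)) * \<Gamma> \<mu> else 0) \<partial>leb n)"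
    by (rule Suc.IH) measurable
  \<comment> \<open>The Gaussian factor of the old density cancels the old squares in the exponent
    of the bordering step, so that \<open>\<mu>\<close> survives only in the Dixon-Anderson
    integrand.\<close>
  also have "(\<integral>\<^sup>+\<mu>. (if chamber n \<mu> then ennreal (vand n \<mu> * exp (- (\<Sum>i<n. (\<mu> i)\<^sup>2) / 2)) * \<Gamma> \<mu> else 0) \<partial>leb n)
    = (\<integral>\<^sup>+\<mu>. \<integral>\<^sup>+l. (if chamber (Suc n) l then ennreal (vand (Suc n) l * exp (- (\<Sum>i<Suc n. (l i)\<^sup>2) / 2)) * F l else 0)
        * (if chamber n \<mu> \<and> interlace n \<mu> l then ennreal (vand n \<mu> * dixon_weight n l \<mu>) else 0) \<partial>leb (Suc n) \<partial>leb n)"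
  proof (rule nn_integral_cong)
    fix \<mu> assume \<mu>s[measurable]: "\<mu> \<in> space (leb n)"
    show "(if chamber n \<mu> then ennreal (vand n \<mu> * exp (- (\<Sum>i<n. (\<mu> i)\<^sup>2) / 2)) * \<Gamma> \<mu> else 0)
      = (\<integral>\<^sup>+l. (if chamber (Suc n) l then ennreal (vand (Suc n) l * exp (- (\<Sum>i<Suc n. (l i)\<^sup>2) / 2)) * F l else 0)
        * (if chamber n \<mu> \<and> interlace n \<mu> l then ennreal (vand n \<mu> * dixon_weight n l \<mu>) else 0) \<partial>leb (Suc n))"
    proof (cases "chamber n \<mu>")
      case ch: True
      let ?R = "\<lambda>l. (if chamber (Suc n) l \<and> interlace n \<mu> l
        then ennreal (vand (Suc n) l * exp (- ((\<Sum>i<Suc n. (l i)\<^sup>2) - (\<Sum>i<n. (\<mu> i)\<^sup>2)) / 2) * dixon_weight n l \<mu>) * F l else 0)"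
      have dwm: "(\<lambda>l. dixon_weight n l \<mu>) \<in> borel_measurable (leb (Suc n))"
        unfolding dixon_weight_def invsq_def
        by (intro borel_measurable_prod borel_measurable_divide borel_measurable_const borel_measurable_sqrt
             borel_measurable_abs borel_measurable_diff measurable_leb_component[OF measurable_ident]) auto
      note [measurable] = dwm
      have "ennreal (vand n \<mu> * exp (- (\<Sum>i<n. (\<mu> i)\<^sup>2) / 2)) * \<Gamma> \<mu>
          = ennreal (vand n \<mu> * exp (- (\<Sum>i<n. (\<mu> i)\<^sup>2) / 2)) * (\<integral>\<^sup>+l. ?R l \<partial>leb (Suc n))"
        unfolding \<Gamma>_def by (subst GOE_step_inner[OF ch \<mu>s Suc.prems]) simp
      also have "\<dots> = (\<integral>\<^sup>+l. ennreal (vand n \<mu> * exp (- (\<Sum>i<n. (\<mu> i)\<^sup>2) / 2)) * ?R l \<partial>leb (Suc n))"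
        by (rule nn_integral_cmult[symmetric]) measurable
      also have "\<dots> = (\<integral>\<^sup>+l. (if chamber (Suc n) l then ennreal (vand (Suc n) l * exp (- (\<Sum>i<Suc n. (l i)\<^sup>2) / 2)) * F l else 0)
        * (if chamber n \<mu> \<and> interlace n \<mu> l then ennreal (vand n \<mu> * dixon_weight n l \<mu>) else 0) \<partial>leb (Suc n))"
      proof (rule nn_integral_cong)
        fix l
        show "ennreal (vand n \<mu> * exp (- (\<Sum>i<n. (\<mu> i)\<^sup>2) / 2)) * ?R l
          = (if chamber (Suc n) l then ennreal (vand (Suc n) l * exp (- (\<Sum>i<Suc n. (l i)\<^sup>2) / 2)) * F l else 0)
        * (if chamber n \<mu> \<and> interlace n \<mu> l then ennreal (vand n \<mu> * dixon_weight n l \<mu>) else 0)"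
        proof (cases "chamber (Suc n) l \<and> interlace n \<mu> l")
          case True
          define E where "E = (\<Sum>i<Suc n. (l i)\<^sup>2)"
          define E' where "E' = (\<Sum>i<n. (\<mu> i)\<^sup>2)"
          have dn: "dixon_weight n l \<mu> \<ge> 0" unfolding dixon_weight_def invsq_def by (intro prod_nonneg) auto
          have vp: "vand n \<mu> > 0" "vand (Suc n) l > 0" using vand_pos ch True by auto
          have "exp (- E' / 2) * exp (- (E - E') / 2) = exp (- E / 2)"
            unfolding exp_add[symmetric] by (rule arg_cong[of _ _ exp]) (simp add: field_simps)
          then have "(vand n \<mu> * exp (- E' / 2)) * (vand (Suc n) l * exp (- (E - E') / 2) * dixon_weight n l \<mu>)
             = (vand (Suc n) l * exp (- E / 2)) * (vand n \<mu> * dixon_weight n l \<mu>)" by (simp add: mult_ac) 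
          then have "ennreal (vand n \<mu> * exp (- E' / 2)) * ennreal (vand (Suc n) l * exp (- (E - E') / 2) * dixon_weight n l \<mu>)
             = ennreal (vand (Suc n) l * exp (- E / 2)) * ennreal (vand n \<mu> * dixon_weight n l \<mu>)"
            using vp dn by (simp add: ennreal_mult[symmetric])
          then show ?thesis unfolding E_def[symmetric] E'_def[symmetric] using True ch
            by (simp add: mult.assoc[symmetric]) (simp add: mult_ac)
        qed auto
      qed
      finally show ?thesis using ch by simp
    qed simp
  qed
  also have "\<dots> = (\<integral>\<^sup>+l. \<integral>\<^sup>+\<mu>. (if chamber (Suc n) l then ennreal (vand (Suc n) l * exp (- (\<Sum>i<Suc n. (l i)\<^sup>2) / 2)) * F l else 0)
        * (if chamber n \<mu> \<and> interlace n \<mu> l then ennreal (vand n \<mu> * dixon_weight n l \<mu>) else 0) \<partial>leb n \<partial>leb (Suc n))"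
  proof (rule leb_leb_Fubini)
    have "(\<lambda>p. snd p j) \<in> borel_measurable (leb n \<Otimes>\<^sub>M leb (Suc n))" if "j < Suc n" for j
      by (rule measurable_leb_component[OF measurable_snd that])
    moreover have "(\<lambda>p. fst p i) \<in> borel_measurable (leb n \<Otimes>\<^sub>M leb (Suc n))" if "i < n" for i
      by (rule measurable_leb_component[OF measurable_fst that])
    ultimately have [measurable]: "(\<lambda>p. dixon_weight n (snd p) (fst p)) \<in> borel_measurable (leb n \<Otimes>\<^sub>M leb (Suc n))"
      unfolding dixon_weight_def invsq_def
      by (intro borel_measurable_prod borel_measurable_divide borel_measurable_const borel_measurable_sqrt
           borel_measurable_abs borel_measurable_diff) auto
    show "(\<lambda>(\<mu>, l). (if chamber (Suc n) l then ennreal (vand (Suc n) l * exp (- (\<Sum>i<Suc n. (l i)\<^sup>2) / 2)) * F l else 0)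
        * (if chamber n \<mu> \<and> interlace n \<mu> l then ennreal (vand n \<mu> * dixon_weight n l \<mu>) else 0)) \<in> borel_measurable (leb n \<Otimes>\<^sub>M leb (Suc n))"
      unfolding case_prod_beta by measurable
  qed
  \<comment> \<open>The inner integral is constant on the chamber: the density keeps its form and
    only the constant changes.\<close>
  also have "\<dots> = (\<integral>\<^sup>+l. ennreal (Gamma (1/2) ^ Suc n / Gamma (real (Suc n) / 2)) *
      (if chamber (Suc n) l then ennreal (vand (Suc n) l * exp (- (\<Sum>i<Suc n. (l i)\<^sup>2) / 2)) * F l else 0) \<partial>leb (Suc n))"
  proof (rule nn_integral_cong)
    fix l assume [measurable]: "l \<in> space (leb (Suc n))"
    show "(\<integral>\<^sup>+\<mu>. (if chamber (Suc n) l then ennreal (vand (Suc n) l * exp (- (\<Sum>i<Suc n. (l i)\<^sup>2) / 2)) * F l else 0)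
        * (if chamber n \<mu> \<and> interlace n \<mu> l then ennreal (vand n \<mu> * dixon_weight n l \<mu>) else 0) \<partial>leb n)
      = ennreal (Gamma (1/2) ^ Suc n / Gamma (real (Suc n) / 2)) *
      (if chamber (Suc n) l then ennreal (vand (Suc n) l * exp (- (\<Sum>i<Suc n. (l i)\<^sup>2) / 2)) * F l else 0)"
    proof (cases "chamber (Suc n) l")
      case True
      have [measurable]: "dixon_weight n l \<in> borel_measurable (leb n)"
        unfolding dixon_weight_def[abs_def] invsq_def
        by (intro borel_measurable_prod borel_measurable_divide borel_measurable_const borel_measurable_sqrt
           borel_measurable_abs borel_measurable_diff measurable_leb_component[OF measurable_ident]) auto
      show ?thesis
        by (subst nn_integral_cmult) (simp_all add: dixon_anderson[OF True] mult.commute)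
    qed simp
  qed
  also have "\<dots> = ennreal (Gamma (1/2) ^ Suc n / Gamma (real (Suc n) / 2)) *
     (\<integral>\<^sup>+l. (if chamber (Suc n) l then ennreal (vand (Suc n) l * exp (- (\<Sum>i<Suc n. (l i)\<^sup>2) / 2)) * F l else 0) \<partial>leb (Suc n))"
    by (rule nn_integral_cmult) measurable
  finally show ?case
  proof -
    let ?I = "\<integral>\<^sup>+l. (if chamber (Suc n) l then ennreal (vand (Suc n) l * exp (- (\<Sum>i<Suc n. (l i)\<^sup>2) / 2)) * F l else 0) \<partial>leb (Suc n)"
    let ?g = "Gamma (1/2) ^ Suc n / Gamma (real (Suc n) / 2)"
    assume "(\<integral>\<^sup>+x. F (eigs (Suc n) x) \<partial>GOE_entries (Suc n)) = ennreal (border_const n) * (ennreal (k_const n * fact n) * (ennreal ?g * ?I))"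
    also have "\<dots> = ennreal (border_const n) * ennreal ?g * ennreal (k_const n * fact n) * ?I" by (simp only: mult_ac)
    also have "ennreal (border_const n) * ennreal ?g * ennreal (k_const n * fact n) = ennreal (border_const n * ?g * (k_const n * fact n))"
    proof -
      have "border_const n \<ge> 0" "?g \<ge> 0" "k_const n * fact n \<ge> 0"
        by (auto simp: border_const_def k_const_nonneg intro!: divide_nonneg_nonneg Gamma_real_nonneg zero_le_power)
      then show ?thesis by (simp only: ennreal_mult mult_nonneg_nonneg)
    qed
    finally show ?thesis unfolding k_const_Suc .
  qed
qed

section \<open>Pfaffians and de Bruijn's formula\<close>

abbreviation rsign :: "(nat \<Rightarrow> nat) \<Rightarrow> real" where
  "rsign p \<equiv> of_int (sign p)"

lemma rsign_mult_self: "rsign p * rsign p = 1"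
  by (cases p rule: sign_cases) auto

lemma rsign_compose:
  assumes "p permutes {..<n::nat}" "q permutes {..<n}"
  shows "rsign (p \<circ> q) = rsign p * rsign q"
  using assms by (simp add: sign_compose permutes_imp_permutation[of "{..<n}"])

text \<open>In the Newton basis the Vandermonde matrix becomes triangular.\<close>

lemma vandermonde_det:
  "(\<Sum>p | p permutes {..<n}. rsign p * (\<Prod>j<n. x j ^ p j)) = vand n x"
proof -
  let ?X = "fm n (\<lambda>k j. x j ^ k)"
  let ?C = "fm n (\<lambda>i k. coeff (rootp i x) k)"
  let ?P = "fm n (\<lambda>i j. \<Prod>k<i. x j - x k)"
  have "?C * ?X = ?P" unfolding fm_mult
  proof (rule fm_eqI)
    fix i j assume i: "i < n" "j < n"
    have "(\<Sum>k<n. coeff (rootp i x) k * x j ^ k) = (\<Sum>k\<le>i. coeff (rootp i x) k * x j ^ k)"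
      using i by (intro sum.mono_neutral_right) (auto simp: coeff_eq_0 degree_rootp)
    also have "\<dots> = poly (rootp i x) (x j)" by (simp add: poly_altdef degree_rootp)
    finally show "(\<Sum>k<n. coeff (rootp i x) k * x j ^ k) = (\<Prod>k<i. x j - x k)" by (simp add: poly_rootp)
  qed
  then have "det ?C * det ?X = det ?P" by (subst det_mult[symmetric, of _ n]) auto
  moreover have "det ?C = 1"
    by (subst det_lower_triangular[of n]) (auto simp: prod_list_diag_prod coeff_eq_0 degree_rootp coeff_rootp_top)
  moreover have "det ?P = vand n x"
  proof -
    have "upper_triangular ?P"
      by (rule upper_triangularI) (auto intro!: prod_zero)
    then have "det ?P = prod_list (diag_mat ?P)" by (rule det_upper_triangular[of _ n]) simp
    then show ?thesis by (simp add: prod_list_diag_prod vand_def atLeast0LessThan)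
  qed
  moreover have "det ?X = det (transpose_mat ?X)" by (rule det_transpose[symmetric, of _ n]) simp
  moreover have "det (transpose_mat ?X) = (\<Sum>p | p permutes {..<n}. rsign p * (\<Prod>j<n. x j ^ p j))"
    unfolding fm_transpose
  proof (subst det_def'[OF mat_carrier], unfold atLeast0LessThan, intro sum.cong refl arg_cong2[where f="(*)"] prod.cong)
    fix p i assume "p \<in> {p. p permutes {..<n}}" "i \<in> {..<n}"
    then have "i < n" "p i < n" using permutes_in_image[of p "{..<n}" i] by auto
    then show "fm n (\<lambda>j k. x j ^ k) $$ (i, p i) = x i ^ p i" by simp
  qed
  ultimately show ?thesis by simp
qed

text \<open>The determinant of the matrix with entries \<open>\<psi> i (x j)\<close>, in Leibniz
  form.\<close>

definition alt_sum :: "nat \<Rightarrow> (nat \<Rightarrow> real \<Rightarrow> real) \<Rightarrow> (nat \<Rightarrow> real) \<Rightarrow> real" where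
  "alt_sum n \<psi> x = (\<Sum>p | p permutes {..<n}. rsign p * (\<Prod>j<n. \<psi> (p j) (x j)))"

lemma alt_sum_permute:
  assumes q: "q permutes {..<n}"
  shows "alt_sum n \<psi> (x \<circ> q) = rsign q * alt_sum n \<psi> x"
proof -
  have "alt_sum n \<psi> (x \<circ> q) = (\<Sum>p | p permutes {..<n}. rsign (p \<circ> q) * (\<Prod>j<n. \<psi> ((p \<circ> q) j) ((x \<circ> q) j)))"
    unfolding alt_sum_def by (rule sum.reindex_bij_witness[where i="\<lambda>p. p \<circ> q" and j="\<lambda>p. p \<circ> inv_into UNIV q"])
      (use q in \<open>auto simp: permutes_compose permutes_inv o_assoc[symmetric] permutes_inv_o\<close>)
  also have "\<dots> = (\<Sum>p | p permutes {..<n}. rsign q * (rsign p * (\<Prod>j<n. \<psi> (p j) (x j))))"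
  proof (rule sum.cong[OF refl])
    fix p assume "p \<in> {p. p permutes {..<n}}"
    moreover have "(\<Prod>j<n. \<psi> ((p \<circ> q) j) ((x \<circ> q) j)) = (\<Prod>j<n. \<psi> (p j) (x j))"
      using prod.permute[OF q, of "\<lambda>j. \<psi> (p j) (x j)"] by (simp add: o_def)
    ultimately show "rsign (p \<circ> q) * (\<Prod>j<n. \<psi> ((p \<circ> q) j) ((x \<circ> q) j)) = rsign q * (rsign p * (\<Prod>j<n. \<psi> (p j) (x j)))"
      using rsign_compose[of p n q] q by simp
  qed
  finally show ?thesis by (simp add: alt_sum_def sum_distrib_left)
qed

lemma vand_alt_sum: "vand n x = alt_sum n (\<lambda>i t. t ^ i) x"
  by (simp add: alt_sum_def vandermonde_det)

lemma vand_permute: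
  assumes "q permutes {..<n}"
  shows "vand n (x \<circ> q) = rsign q * vand n x"
  unfolding vand_alt_sum by (rule alt_sum_permute[OF assms])

lemma chamber_sorting_unique:
  assumes "vand n x \<noteq> 0"
  obtains p where "p permutes {..<n}" "\<And>q. q permutes {..<n} \<Longrightarrow> chamber n (x \<circ> q) \<longleftrightarrow> q = p"
proof -
  have inj: "x i \<noteq> x j" if "i < j" "j < n" for i j
  proof
    assume "x i = x j"
    then have "(\<Prod>k<j. x j - x k) = 0" using that by (intro prod_zero bexI[of _ i]) auto
    then have "vand n x = 0" unfolding vand_def using that by (intro prod_zero) auto
    with assms show False by simp
  qed
  then have inj': "i = j" if "x i = x j" "i < n" "j < n" for i j
    using that by (metis nat_neq_iff)
  obtain p where p: "p permutes {..<n}" "\<And>i j. i \<le> j \<Longrightarrow> j < n \<Longrightarrow> x (p i) \<le> x (p j)"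
    using sorting_permutation by blast
  have pin: "q i < n \<longleftrightarrow> i < n" if "q permutes {..<n}" for q i
    using permutes_in_image[OF that, of i] by simp
  have ch: "chamber n (x \<circ> p)" unfolding chamber_def
  proof (intro allI impI)
    fix i j assume ij: "j < n" "i < j"
    then have "p i \<noteq> p j" using permutes_inj[OF p(1)] by (auto dest: injD)
    then have "x (p i) \<noteq> x (p j)" using inj'[of "p i" "p j"] pin[OF p(1)] ij by auto
    then show "(x \<circ> p) i < (x \<circ> p) j" using p(2)[of i j] ij by simp
  qed
  have "q = p" if q: "q permutes {..<n}" "chamber n (x \<circ> q)" for q
  proof
    fix i show "q i = p i"
    proof (cases "i < n")
      case True
      have "(x \<circ> q) i = (x \<circ> p) i"
        by (rule chamber_unique[OF q(2) ch _ True])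
           (simp only: image_comp[symmetric] permutes_image[OF q(1)] permutes_image[OF p(1)])
      then show ?thesis using inj'[of "q i" "p i"] pin[OF q(1)] pin[OF p(1)] True by simp
    next
      case False
      then show ?thesis using q(1) p(1) by (simp add: permutes_not_in)
    qed
  qed
  then show ?thesis using that[OF p(1)] ch by blast
qed

text \<open>If the entries of \<open>x\<close> are distinct, exactly one \<open>q\<close> sorts
  them; alternation gives its term the sign of \<open>q\<close>, which is the sign of
  \<open>vand n x\<close>. Otherwise both sides vanish. Under an integral this trades the chamber
  for the kernel \<open>sgn (vand n x)\<close>.\<close>

lemma symmetrize_chamber:
  assumes alt: "\<And>q. q permutes {..<n} \<Longrightarrow> G (x \<circ> q) = rsign q * G x"
  shows "G x * sgn (vand n x) = (\<Sum>q | q permutes {..<n}. if chamber n (x \<circ> q) then G (x \<circ> q) else (0::real))"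
proof (cases "vand n x = 0")
  case True
  have "\<not> chamber n (x \<circ> q)" if "q permutes {..<n}" for q
    using vand_pos[of n "x \<circ> q"] vand_permute[OF that, of x] True by auto
  then show ?thesis using True by (simp add: sum.neutral)
next
  case False
  obtain p where p: "p permutes {..<n}" "\<And>q. q permutes {..<n} \<Longrightarrow> chamber n (x \<circ> q) \<longleftrightarrow> q = p"
    using chamber_sorting_unique[OF False] by blast
  have "(\<Sum>q | q permutes {..<n}. if chamber n (x \<circ> q) then G (x \<circ> q) else 0) = (\<Sum>q | q permutes {..<n}. if q = p then G (x \<circ> p) else 0)"
    using p(2) by (intro sum.cong) auto
  also have "\<dots> = rsign p * G x" using p(1) alt[OF p(1)] by (simp add: sum.delta finite_permutations)
  finally have "(\<Sum>q | q permutes {..<n}. if chamber n (x \<circ> q) then G (x \<circ> q) else 0) = rsign p * G x" .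
  moreover have "sgn (vand n x) = rsign p"
  proof -
    have "rsign p * vand n x > 0" using vand_pos[of n "x \<circ> p"] p vand_permute[OF p(1), of x] by simp
    then show ?thesis by (cases p rule: sign_cases) auto
  qed
  ultimately show ?thesis by simp
qed

lemma prod_pairs: "(\<Prod>j<2 * m. g j) = (\<Prod>i<m. g (2 * i) * g (2 * i + 1 :: nat))"
  by (induction m) (simp_all add: mult_ac)

section \<open>The Pfaffian of the sign matrix\<close>

definition ord_sgn :: "nat \<Rightarrow> nat \<Rightarrow> real" where
  "ord_sgn a b = sgn (real b - real a)"

text \<open>One summand of the unnormalised Pfaffian. For antisymmetric \<open>A\<close> the sum
  over all permutations counts each perfect matching \<open>2 ^ m * fact m\<close> times.\<close>

definition pf_term :: "nat \<Rightarrow> (nat \<Rightarrow> nat \<Rightarrow> real) \<Rightarrow> (nat \<Rightarrow> nat) \<Rightarrow> real" where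
  "pf_term m A \<tau> = rsign \<tau> * (\<Prod>i<m. A (\<tau> (2 * i)) (\<tau> (2 * i + 1)))"

text \<open>Exchanging two whole blocks takes two transpositions, so the sign stays and only the
  order of the factors changes.\<close>

lemma pf_term_block_swap:
  assumes \<tau>: "\<tau> permutes {..<2 * m}" and i: "i < m" and k: "k < m"
  defines "\<beta> \<equiv> Transposition.transpose (2 * i) (2 * k) \<circ> Transposition.transpose (2 * i + 1) (2 * k + 1)"
  shows "\<beta> permutes {..<2 * m}" "pf_term m A (\<tau> \<circ> \<beta>) = pf_term m A \<tau>"
proof -
  have t1: "Transposition.transpose (2 * i) (2 * k) permutes {..<2 * m}" "Transposition.transpose (2 * i + 1) (2 * k + 1) permutes {..<2 * m}"
    using i k by (auto intro!: permutes_swap_id)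
  show \<beta>: "\<beta> permutes {..<2 * m}" unfolding \<beta>_def by (rule permutes_compose[OF t1(2) t1(1)])
  have "rsign \<beta> = 1"
    unfolding \<beta>_def rsign_compose[OF t1] by (simp add: sign_swap_id)
  then have s: "rsign (\<tau> \<circ> \<beta>) = rsign \<tau>" using rsign_compose[OF \<tau> \<beta>] by simp
  have b: "\<beta> (2 * j) = 2 * Transposition.transpose i k j" "\<beta> (2 * j + 1) = 2 * Transposition.transpose i k j + 1" for j
    unfolding \<beta>_def by (auto simp: Transposition.transpose_def, (presburger+)?)
  have tm: "Transposition.transpose i k permutes {..<m}" using i k by (intro permutes_swap_id) auto
  have "(\<Prod>j<m. A ((\<tau> \<circ> \<beta>) (2 * j)) ((\<tau> \<circ> \<beta>) (2 * j + 1))) = (\<Prod>j<m. A (\<tau> (2 * j)) (\<tau> (2 * j + 1)))"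
    unfolding o_apply b using prod.permute[OF tm, of "\<lambda>j. A (\<tau> (2 * j)) (\<tau> (2 * j + 1))"] by (simp add: o_def)
  then show "pf_term m A (\<tau> \<circ> \<beta>) = pf_term m A \<tau>" unfolding pf_term_def s by (simp only:)
qed

text \<open>The sign of the transposition cancels the antisymmetry of the one affected
  factor.\<close>

lemma pf_term_inner_swap:
  assumes \<tau>: "\<tau> permutes {..<2 * m}" and i: "i < m" and A: "\<And>a b. A a b = - A b a"
  defines "\<kappa> \<equiv> Transposition.transpose (2 * i) (2 * i + 1)"
  shows "\<kappa> permutes {..<2 * m}" "pf_term m A (\<tau> \<circ> \<kappa>) = pf_term m A \<tau>"
proof -
  show \<kappa>: "\<kappa> permutes {..<2 * m}" unfolding \<kappa>_def using i by (intro permutes_swap_id) auto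
  have s: "rsign (\<tau> \<circ> \<kappa>) = - rsign \<tau>" using rsign_compose[OF \<tau> \<kappa>] by (simp add: \<kappa>_def sign_swap_id)
  have "(\<Prod>j<m. A ((\<tau> \<circ> \<kappa>) (2 * j)) ((\<tau> \<circ> \<kappa>) (2 * j + 1)))
     = (\<Prod>j<m. (if j = i then -1 else 1) * A (\<tau> (2 * j)) (\<tau> (2 * j + 1)))"
  proof (rule prod.cong[OF refl])
    fix j
    have "\<kappa> (2 * j) = (if j = i then 2 * j + 1 else 2 * j)" "\<kappa> (2 * j + 1) = (if j = i then 2 * j else 2 * j + 1)"
      unfolding \<kappa>_def Transposition.transpose_def by (auto, (presburger+)?)
    then show "A ((\<tau> \<circ> \<kappa>) (2 * j)) ((\<tau> \<circ> \<kappa>) (2 * j + 1)) = (if j = i then -1 else 1) * A (\<tau> (2 * j)) (\<tau> (2 * j + 1))"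
      using A[of "\<tau> (2 * j + 1)" "\<tau> (2 * j)"] by auto
  qed
  also have "\<dots> = - (\<Prod>j<m. A (\<tau> (2 * j)) (\<tau> (2 * j + 1)))"
    using i by (subst prod.distrib) (simp add: prod.delta)
  finally show "pf_term m A (\<tau> \<circ> \<kappa>) = pf_term m A \<tau>" unfolding pf_term_def s by simp
qed

lemma sum_compose_right:
  fixes \<rho> :: "nat \<Rightarrow> nat"
  assumes \<rho>: "\<rho> permutes S" and T: "\<And>\<tau>. \<tau> permutes S \<Longrightarrow> T (\<tau> \<circ> \<rho>) = (T \<tau> :: real)"
  shows "(\<Sum>\<tau> | \<tau> permutes S \<and> Q \<tau>. T \<tau>) = (\<Sum>\<tau> | \<tau> permutes S \<and> Q (\<tau> \<circ> inv_into UNIV \<rho>). T \<tau>)"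
proof (rule sum.reindex_bij_witness[where i="\<lambda>\<tau>. \<tau> \<circ> inv_into UNIV \<rho>" and j="\<lambda>\<tau>. \<tau> \<circ> \<rho>"])
  fix \<tau> :: "nat \<Rightarrow> nat"
  show "(\<tau> \<circ> \<rho>) \<circ> inv_into UNIV \<rho> = \<tau>" "(\<tau> \<circ> inv_into UNIV \<rho>) \<circ> \<rho> = \<tau>"
    using permutes_inv_o[OF \<rho>] by (simp_all add: o_assoc[symmetric])
  then show "\<tau> \<in> {\<tau>. \<tau> permutes S \<and> Q \<tau>} \<Longrightarrow> \<tau> \<circ> \<rho> \<in> {\<tau>. \<tau> permutes S \<and> Q (\<tau> \<circ> inv_into UNIV \<rho>)}"
    using \<rho> by (auto simp: permutes_compose)
  show "\<tau> \<in> {\<tau>. \<tau> permutes S \<and> Q (\<tau> \<circ> inv_into UNIV \<rho>)} \<Longrightarrow> \<tau> \<circ> inv_into UNIV \<rho> \<in> {\<tau>. \<tau> permutes S \<and> Q \<tau>}"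
    using \<rho> by (auto simp: permutes_compose permutes_inv)
  show "\<tau> \<in> {\<tau>. \<tau> permutes S \<and> Q \<tau>} \<Longrightarrow> T (\<tau> \<circ> \<rho>) = T \<tau>" using T by auto
qed

lemma sum_compose_left:
  fixes q :: "nat \<Rightarrow> nat" and T :: "(nat \<Rightarrow> nat) \<Rightarrow> real"
  assumes q: "q permutes S"
  shows "(\<Sum>\<tau> | \<tau> permutes S. T (q \<circ> \<tau>)) = (\<Sum>\<tau> | \<tau> permutes S. T \<tau>)"
proof (rule sum.reindex_bij_witness[where i="\<lambda>\<tau>. inv_into UNIV q \<circ> \<tau>" and j="\<lambda>\<tau>. q \<circ> \<tau>"])
  fix \<tau> :: "nat \<Rightarrow> nat"
  show "inv_into UNIV q \<circ> (q \<circ> \<tau>) = \<tau>" "q \<circ> (inv_into UNIV q \<circ> \<tau>) = \<tau>"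
    using permutes_inv_o[OF q] by (simp_all add: o_assoc)
qed (use q in \<open>auto simp: permutes_compose permutes_inv\<close>)

definition partner :: "nat \<Rightarrow> nat" where
  "partner j = (if even j then j + 1 else j - 1)"

lemma partner_partner: "partner (partner j) = j"
  by (cases "even j") (auto simp: partner_def)

lemma partner_less: "j < 2 * k \<Longrightarrow> partner j < 2 * k"
  unfolding partner_def by presburger

text \<open>An involution argument. Permutations that do not place the two largest values in a
  common block cancel in pairs. In the others the smaller of the two may sit at any of the
  \<open>2 * Suc m\<close> positions, and by the two exchange lemmas each position contributes as
  much as the last block in natural order, where \<open>ord_sgn\<close> is 1.\<close>

lemma ord_sgn_pf_Suc:
  "(\<Sum>\<tau> | \<tau> permutes {..<2 * Suc m}. pf_term (Suc m) ord_sgn \<tau>)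
    = 2 * real (Suc m) * (\<Sum>\<tau> | \<tau> permutes {..<2 * m}. pf_term m ord_sgn \<tau>)"
proof -
  let ?S = "{..<2 * Suc m}"
  let ?T = "pf_term (Suc m) ord_sgn"
  let ?a = "2 * m" and ?b = "2 * m + 1"
  let ?K = "\<Sum>\<tau> | \<tau> permutes {..<2 * m}. pf_term m ord_sgn \<tau>"
  define paired where "paired \<tau> \<longleftrightarrow> (\<exists>j\<in>?S. \<tau> j = ?a \<and> \<tau> (partner j) = ?b)" for \<tau>
  have fin: "finite {\<tau>. \<tau> permutes ?S \<and> Q \<tau>}" for Q
    by (rule finite_subset[OF _ finite_permutations[of ?S]]) auto
  have antisym: "ord_sgn a b = - ord_sgn b a" for a b
    by (auto simp: ord_sgn_def sgn_real_def)
  \<comment> \<open>Exchanging the two largest values flips the sign unless they form a pair.\<close>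
  define \<theta> where "\<theta> = Transposition.transpose ?a ?b"
  have \<theta>: "\<theta> permutes ?S" unfolding \<theta>_def by (intro permutes_swap_id) auto
  have \<theta>\<theta>: "\<theta> (\<theta> k) = k" for k by (simp add: \<theta>_def)
  have \<theta>_low: "\<theta> k = k" if "k < 2 * m" for k using that by (simp add: \<theta>_def Transposition.transpose_def)
  have \<theta>_high: "\<theta> k \<ge> 2 * m" if "k \<ge> 2 * m" for k using that by (simp add: \<theta>_def Transposition.transpose_def)
  have flip: "?T (\<theta> \<circ> \<tau>) = - ?T \<tau>" if \<tau>: "\<tau> permutes ?S" and np: "\<not> paired \<tau>" for \<tau>
  proof -
    have s: "rsign (\<theta> \<circ> \<tau>) = - rsign \<tau>" using rsign_compose[OF \<theta> \<tau>] by (simp add: \<theta>_def sign_swap_id)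
    have "(\<Prod>i<Suc m. ord_sgn ((\<theta> \<circ> \<tau>) (2 * i)) ((\<theta> \<circ> \<tau>) (2 * i + 1))) = (\<Prod>i<Suc m. ord_sgn (\<tau> (2 * i)) (\<tau> (2 * i + 1)))"
    proof (rule prod.cong[OF refl])
      fix i assume "i \<in> {..<Suc m}"
      then have i: "2 * i \<in> ?S" "2 * i + 1 \<in> ?S" by auto
      have lt: "\<tau> (2 * i) < 2 * m + 2" "\<tau> (2 * i + 1) < 2 * m + 2"
        using permutes_in_image[OF \<tau>, of "2 * i"] permutes_in_image[OF \<tau>, of "2 * i + 1"] i by auto
      have "\<not> (\<tau> (2 * i) = ?a \<and> \<tau> (2 * i + 1) = ?b)" "\<not> (\<tau> (2 * i + 1) = ?a \<and> \<tau> (2 * i) = ?b)"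
      proof -
        show "\<not> (\<tau> (2 * i) = ?a \<and> \<tau> (2 * i + 1) = ?b)"
        proof
          assume "\<tau> (2 * i) = ?a \<and> \<tau> (2 * i + 1) = ?b"
          then have "paired \<tau>" unfolding paired_def using i(1) by (intro bexI[of _ "2 * i"]) (auto simp: partner_def)
          with np show False ..
        qed
        show "\<not> (\<tau> (2 * i + 1) = ?a \<and> \<tau> (2 * i) = ?b)"
        proof
          assume "\<tau> (2 * i + 1) = ?a \<and> \<tau> (2 * i) = ?b"
          then have "paired \<tau>" unfolding paired_def using i(2) by (intro bexI[of _ "2 * i + 1"]) (auto simp: partner_def)
          with np show False ..
        qed
      qed
      moreover have "\<tau> (2 * i) \<noteq> \<tau> (2 * i + 1)" using inj_eq[OF permutes_inj[OF \<tau>], of "2 * i" "2 * i + 1"] by simp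
      ultimately consider "\<tau> (2 * i) < 2 * m" "\<tau> (2 * i + 1) < 2 * m" | "\<tau> (2 * i) < 2 * m" "\<tau> (2 * i + 1) \<ge> 2 * m"
          | "\<tau> (2 * i) \<ge> 2 * m" "\<tau> (2 * i + 1) < 2 * m"
        using lt by linarith
      then show "ord_sgn ((\<theta> \<circ> \<tau>) (2 * i)) ((\<theta> \<circ> \<tau>) (2 * i + 1)) = ord_sgn (\<tau> (2 * i)) (\<tau> (2 * i + 1))"
      proof cases
        case 1 then show ?thesis by (simp add: \<theta>_low)
      next
        case 2
        then have "real (\<theta> (\<tau> (2 * i + 1))) > real (\<tau> (2 * i))" "real (\<tau> (2 * i + 1)) > real (\<tau> (2 * i))"
          using \<theta>_high[of "\<tau> (2 * i + 1)"] by auto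
        then show ?thesis using 2 by (simp add: \<theta>_low ord_sgn_def)
      next
        case 3
        then have "real (\<theta> (\<tau> (2 * i))) > real (\<tau> (2 * i + 1))" "real (\<tau> (2 * i)) > real (\<tau> (2 * i + 1))"
          using \<theta>_high[of "\<tau> (2 * i)"] by auto
        then show ?thesis using 3 by (simp add: \<theta>_low ord_sgn_def)
      qed
    qed
    then show ?thesis unfolding pf_term_def s by simp
  qed
  have unpaired: "(\<Sum>\<tau> | \<tau> permutes ?S \<and> \<not> paired \<tau>. ?T \<tau>) = 0"
  proof -
    have pres: "paired (\<theta> \<circ> \<tau>) \<longleftrightarrow> paired \<tau>" if \<tau>: "\<tau> permutes ?S" for \<tau>
    proof -
      have *: "paired (\<theta> \<circ> \<tau>)" if "paired \<tau>" for \<tau>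
      proof -
        obtain j where j: "j \<in> ?S" "\<tau> j = ?a" "\<tau> (partner j) = ?b" using \<open>paired \<tau>\<close> unfolding paired_def by blast
        have "partner j \<in> ?S" "partner (partner j) = j"
          using partner_less[of j "Suc m"] partner_partner[of j] j(1) by auto
        then show ?thesis unfolding paired_def using j
          by (intro bexI[of _ "partner j"]) (auto simp: \<theta>_def)
      qed
      have "\<theta> \<circ> (\<theta> \<circ> \<tau>) = \<tau>" by (auto simp: fun_eq_iff \<theta>\<theta>)
      then show ?thesis using *[of \<tau>] *[of "\<theta> \<circ> \<tau>"] by auto
    qed
    have "(\<Sum>\<tau> | \<tau> permutes ?S \<and> \<not> paired \<tau>. ?T \<tau>) = (\<Sum>\<tau> | \<tau> permutes ?S \<and> \<not> paired \<tau>. ?T (\<theta> \<circ> \<tau>))"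
    proof (rule sum.reindex_bij_witness[where i="\<lambda>\<tau>. \<theta> \<circ> \<tau>" and j="\<lambda>\<tau>. \<theta> \<circ> \<tau>"])
      fix \<tau> :: "nat \<Rightarrow> nat"
      show id: "\<theta> \<circ> (\<theta> \<circ> \<tau>) = \<tau>" by (auto simp: fun_eq_iff \<theta>\<theta>)
      then show "\<theta> \<circ> (\<theta> \<circ> \<tau>) = \<tau>" .
      show "?T (\<theta> \<circ> (\<theta> \<circ> \<tau>)) = ?T \<tau>" unfolding id ..
      assume "\<tau> \<in> {\<tau>. \<tau> permutes ?S \<and> \<not> paired \<tau>}"
      then show "\<theta> \<circ> \<tau> \<in> {\<tau>. \<tau> permutes ?S \<and> \<not> paired \<tau>}"
        using permutes_compose[OF _ \<theta>, of \<tau>] pres[of \<tau>] by blast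
      then show "\<theta> \<circ> \<tau> \<in> {\<tau>. \<tau> permutes ?S \<and> \<not> paired \<tau>}" .
    qed
    also have "\<dots> = - (\<Sum>\<tau> | \<tau> permutes ?S \<and> \<not> paired \<tau>. ?T \<tau>)"
      unfolding sum_negf[symmetric] using flip by (intro sum.cong) auto
    finally show ?thesis by simp
  qed
  have top: "(\<Sum>\<tau> | \<tau> permutes ?S \<and> \<tau> ?a = ?a \<and> \<tau> ?b = ?b. ?T \<tau>) = ?K"
  proof (rule sum.cong)
    show "{\<tau>. \<tau> permutes ?S \<and> \<tau> ?a = ?a \<and> \<tau> ?b = ?b} = {\<tau>. \<tau> permutes {..<2 * m}}"
    proof (intro equalityI subsetI)
      fix \<tau> assume "\<tau> \<in> {\<tau>. \<tau> permutes ?S \<and> \<tau> ?a = ?a \<and> \<tau> ?b = ?b}"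
      then have t: "\<tau> permutes ?S" "\<tau> ?a = ?a" "\<tau> ?b = ?b" by auto
      have "\<tau> permutes {..<2 * m}"
        by (rule permutes_superset[OF t(1)]) (use t(2,3) in \<open>auto simp: less_Suc_eq\<close>)
      then show "\<tau> \<in> {\<tau>. \<tau> permutes {..<2 * m}}" by simp
    next
      fix \<tau> assume "\<tau> \<in> {\<tau>. \<tau> permutes {..<2 * m}}"
      then have t: "\<tau> permutes {..<2 * m}" by simp
      then show "\<tau> \<in> {\<tau>. \<tau> permutes ?S \<and> \<tau> ?a = ?a \<and> \<tau> ?b = ?b}"
        using permutes_subset[OF t, of ?S] permutes_not_in[OF t, of ?a] permutes_not_in[OF t, of ?b] by auto
    qed
    fix \<tau> assume "\<tau> \<in> {\<tau>. \<tau> permutes {..<2 * m}}"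
    then have t: "\<tau> permutes {..<2 * m}" by simp
    have "\<tau> ?a = ?a" "\<tau> ?b = ?b" using permutes_not_in[OF t] by auto
    then show "?T \<tau> = pf_term m ord_sgn \<tau>" by (simp add: pf_term_def ord_sgn_def)
  qed
  \<comment> \<open>Right composition exchanges the block containing \<open>j\<close> with the last
    one; for odd \<open>j\<close> an exchange within the block first reduces to the even
    case.\<close>
  have each: "(\<Sum>\<tau> | \<tau> permutes ?S \<and> \<tau> j = ?a \<and> \<tau> (partner j) = ?b. ?T \<tau>) = ?K" if j: "j \<in> ?S" for j
  proof -
    have even_case: "(\<Sum>\<tau> | \<tau> permutes ?S \<and> \<tau> (2 * i) = ?a \<and> \<tau> (2 * i + 1) = ?b. ?T \<tau>) = ?K" if i: "i < Suc m" for i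
    proof -
      let ?\<beta> = "Transposition.transpose (2 * i) (2 * m) \<circ> Transposition.transpose (2 * i + 1) (2 * m + 1)"
      have \<beta>: "?\<beta> permutes ?S" using pf_term_block_swap(1)[OF permutes_id i lessI] .
      have inv: "inv_into UNIV ?\<beta> (2 * i) = ?a" "inv_into UNIV ?\<beta> (2 * i + 1) = ?b"
      proof -
        have "?\<beta> ?a = 2 * i" "?\<beta> ?b = 2 * i + 1" by (auto simp: Transposition.transpose_def, (presburger+)?)
        then show "inv_into UNIV ?\<beta> (2 * i) = ?a" "inv_into UNIV ?\<beta> (2 * i + 1) = ?b"
          using permutes_inverses(2)[OF \<beta>] by metis+
      qed
      have "(\<Sum>\<tau> | \<tau> permutes ?S \<and> \<tau> (2 * i) = ?a \<and> \<tau> (2 * i + 1) = ?b. ?T \<tau>)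
        = (\<Sum>\<tau> | \<tau> permutes ?S \<and> ((\<tau> \<circ> inv_into UNIV ?\<beta>) (2 * i) = ?a \<and> (\<tau> \<circ> inv_into UNIV ?\<beta>) (2 * i + 1) = ?b). ?T \<tau>)"
        by (rule sum_compose_right[OF \<beta>]) (rule pf_term_block_swap(2)[OF _ i lessI])
      also have "\<dots> = ?K" unfolding o_apply inv by (rule top)
      finally show ?thesis .
    qed
    show ?thesis
    proof (cases "even j")
      case True
      then obtain i where i: "j = 2 * i" by (elim evenE)
      then show ?thesis using even_case[of i] j by (simp add: partner_def)
    next
      case False
      then obtain i where i: "j = 2 * i + 1" by (elim oddE)
      have im: "i < Suc m" using i j by simp
      let ?\<kappa> = "Transposition.transpose (2 * i) (2 * i + 1)"
      have \<kappa>: "?\<kappa> permutes ?S" using pf_term_inner_swap(1)[where A=ord_sgn, OF permutes_id im antisym] .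
      have inv: "inv_into UNIV ?\<kappa> = ?\<kappa>" by simp
      have "(\<Sum>\<tau> | \<tau> permutes ?S \<and> \<tau> (2 * i + 1) = ?a \<and> \<tau> (2 * i) = ?b. ?T \<tau>)
        = (\<Sum>\<tau> | \<tau> permutes ?S \<and> ((\<tau> \<circ> inv_into UNIV ?\<kappa>) (2 * i + 1) = ?a \<and> (\<tau> \<circ> inv_into UNIV ?\<kappa>) (2 * i) = ?b). ?T \<tau>)"
        by (rule sum_compose_right[OF \<kappa>]) (rule pf_term_inner_swap(2)[OF _ im antisym])
      also have "\<dots> = ?K" unfolding inv using even_case[OF im] by simp
      finally show ?thesis unfolding i by (simp add: partner_def)
    qed
  qed
  have "(\<Sum>\<tau> | \<tau> permutes ?S \<and> paired \<tau>. ?T \<tau>) = (\<Sum>j\<in>?S. \<Sum>\<tau> | \<tau> permutes ?S \<and> \<tau> j = ?a \<and> \<tau> (partner j) = ?b. ?T \<tau>)"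
  proof -
    have "{\<tau>. \<tau> permutes ?S \<and> paired \<tau>} = (\<Union>j\<in>?S. {\<tau>. \<tau> permutes ?S \<and> \<tau> j = ?a \<and> \<tau> (partner j) = ?b})"
      by (auto simp: paired_def)
    moreover have "j = j'" if "\<tau> permutes ?S" "\<tau> j = ?a" "\<tau> j' = ?a" for j j' \<tau>
      using inj_eq[OF permutes_inj[OF that(1)], of j j'] that by simp
    ultimately show ?thesis by (simp only:) (rule sum.UNION_disjoint, use fin in \<open>auto simp del: mult_Suc_right\<close>)
  qed
  also have "\<dots> = (\<Sum>j\<in>?S. ?K)" using each by (rule sum.cong[OF refl])
  also have "\<dots> = 2 * real (Suc m) * ?K" by simp
  finally have paired: "(\<Sum>\<tau> | \<tau> permutes ?S \<and> paired \<tau>. ?T \<tau>) = 2 * real (Suc m) * ?K" .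
  have "(\<Sum>\<tau> | \<tau> permutes ?S. ?T \<tau>) = (\<Sum>\<tau> | \<tau> permutes ?S \<and> paired \<tau>. ?T \<tau>) + (\<Sum>\<tau> | \<tau> permutes ?S \<and> \<not> paired \<tau>. ?T \<tau>)"
  proof -
    have eq: "{\<tau>. \<tau> permutes ?S} = {\<tau>. \<tau> permutes ?S \<and> paired \<tau>} \<union> {\<tau>. \<tau> permutes ?S \<and> \<not> paired \<tau>}" by blast
    show ?thesis by (subst eq, rule sum.union_disjoint[OF fin fin]) blast
  qed
  then show ?thesis unfolding paired unpaired by simp
qed

lemma ord_sgn_pf: "(\<Sum>\<tau> | \<tau> permutes {..<2 * m}. pf_term m ord_sgn \<tau>) = 2 ^ m * fact m"
proof (induction m)
  case 0 then show ?case by (simp add: pf_term_def)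
next
  case (Suc m)
  then show ?case unfolding ord_sgn_pf_Suc by simp
qed

text \<open>For odd \<open>n\<close> the additional index \<open>n\<close> plays the role of a variable at \<open>+\<infinity>\<close>.\<close>

definition ext_sgn :: "nat \<Rightarrow> nat \<Rightarrow> nat \<Rightarrow> real \<Rightarrow> real \<Rightarrow> real" where
  "ext_sgn n a b s t = (if a < n \<and> b < n then sgn (t - s) else if a < n then 1 else if b < n then -1 else 0)"

text \<open>Both sides alternate in \<open>y\<close> and agree on the chamber, where the left side
  is the Pfaffian of \<open>ord_sgn\<close>. Symmetrising both gives equality wherever the entries
  are distinct; with two equal entries both vanish.\<close>

lemma sgn_pfaffian:
  fixes y :: "nat \<Rightarrow> real"
  shows "(\<Sum>\<tau> | \<tau> permutes {..<2 * m}. pf_term m (\<lambda>a b. sgn (y b - y a)) \<tau>) = 2 ^ m * fact m * sgn (vand (2 * m) y)"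
proof -
  let ?S = "{..<2 * m}"
  define G where "G y = (\<Sum>\<tau> | \<tau> permutes ?S. pf_term m (\<lambda>a b. sgn (y b - y a)) \<tau>)" for y :: "nat \<Rightarrow> real"
  have alt: "G (y \<circ> q) = rsign q * G y" if q: "q permutes ?S" for q y
  proof -
    have "rsign q * G (y \<circ> q) = (\<Sum>\<tau> | \<tau> permutes ?S. pf_term m (\<lambda>a b. sgn (y b - y a)) (q \<circ> \<tau>))"
      unfolding G_def sum_distrib_left
    proof (rule sum.cong[OF refl])
      fix \<tau> assume "\<tau> \<in> {\<tau>. \<tau> permutes ?S}"
      then have "rsign (q \<circ> \<tau>) = rsign q * rsign \<tau>" using rsign_compose[OF q] by simp
      then show "rsign q * pf_term m (\<lambda>a b. sgn ((y \<circ> q) b - (y \<circ> q) a)) \<tau> = pf_term m (\<lambda>a b. sgn (y b - y a)) (q \<circ> \<tau>)"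
        unfolding pf_term_def by simp
    qed
    also have "\<dots> = G y"
      unfolding G_def by (rule sum_compose_left[OF q])
    finally have "rsign q * (rsign q * G (y \<circ> q)) = rsign q * G y" by simp
    then show ?thesis by (simp add: mult.assoc[symmetric] rsign_mult_self)
  qed
  have ch: "G y = 2 ^ m * fact m" if "chamber (2 * m) y" for y
  proof -
    have "G y = (\<Sum>\<tau> | \<tau> permutes ?S. pf_term m ord_sgn \<tau>)"
      unfolding G_def
    proof (rule sum.cong[OF refl])
      fix \<tau> assume "\<tau> \<in> {\<tau>. \<tau> permutes ?S}"
      then have \<tau>: "\<tau> permutes ?S" by simp
      have s: "sgn (y b - y a) = ord_sgn a b" if "a < 2 * m" "b < 2 * m" for a b
        using chamber_less[OF \<open>chamber (2 * m) y\<close>, of a b] chamber_less[OF \<open>chamber (2 * m) y\<close>, of b a] that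
        by (cases a b rule: linorder_cases) (auto simp: ord_sgn_def sgn_real_def)
      show "pf_term m (\<lambda>a b. sgn (y b - y a)) \<tau> = pf_term m ord_sgn \<tau>"
        unfolding pf_term_def
      proof (intro arg_cong2[where f="(*)"] refl prod.cong)
        fix i assume "i \<in> {..<m}"
        then have "\<tau> (2 * i) < 2 * m" "\<tau> (2 * i + 1) < 2 * m"
          using permutes_in_image[OF \<tau>, of "2 * i"] permutes_in_image[OF \<tau>, of "2 * i + 1"] by auto
        then show "sgn (y (\<tau> (2 * i + 1)) - y (\<tau> (2 * i))) = ord_sgn (\<tau> (2 * i)) (\<tau> (2 * i + 1))" by (rule s)
      qed
    qed
    then show ?thesis by (simp add: ord_sgn_pf)
  qed
  have "G y * sgn (vand (2 * m) y) = 2 ^ m * fact m * (sgn (vand (2 * m) y))\<^sup>2"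
  proof -
    have "G y * sgn (vand (2 * m) y) = (\<Sum>q | q permutes ?S. if chamber (2 * m) (y \<circ> q) then G (y \<circ> q) else 0)"
      by (rule symmetrize_chamber[OF alt])
    also have "\<dots> = (\<Sum>q | q permutes ?S. if chamber (2 * m) (y \<circ> q) then 2 ^ m * fact m * sgn (vand (2 * m) (y \<circ> q)) else 0)"
      using ch vand_pos by (intro sum.cong) auto
    also have "\<dots> = 2 ^ m * fact m * sgn (vand (2 * m) y) * sgn (vand (2 * m) y)"
    proof (rule symmetrize_chamber[symmetric, where G="\<lambda>y. 2 ^ m * fact m * sgn (vand (2 * m) y)"])
      fix q assume "q permutes ?S"
      from vand_permute[OF this, of y] show "2 ^ m * fact m * sgn (vand (2 * m) (y \<circ> q)) = rsign q * (2 ^ m * fact m * sgn (vand (2 * m) y))"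
        by (cases q rule: sign_cases) (auto simp: sgn_mult)
    qed
    finally show ?thesis by (simp only: power2_eq_square mult.assoc)
  qed
  moreover have "G y = 0" if v0: "vand (2 * m) y = 0"
  proof -
    obtain a b where ab: "a < b" "b < 2 * m" "y b = y a"
      using v0 by (auto simp: vand_def)
    let ?t = "Transposition.transpose a b"
    have t: "?t permutes ?S" using ab by (intro permutes_swap_id) auto
    have "y \<circ> ?t = y" using ab by (auto simp: fun_eq_iff Transposition.transpose_def)
    moreover have "rsign ?t = -1" using ab by (simp add: sign_swap_id)
    ultimately show ?thesis using alt[OF t, of y] by simp
  qed
  ultimately have "G y = 2 ^ m * fact m * sgn (vand (2 * m) y)"
  proof (cases "vand (2 * m) y = 0")
    case False
    then have "sgn (vand (2 * m) y) \<noteq> 0" by (simp add: sgn_zero_iff)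
    moreover assume "G y * sgn (vand (2 * m) y) = 2 ^ m * fact m * (sgn (vand (2 * m) y))\<^sup>2"
    ultimately show ?thesis unfolding power2_eq_square mult.assoc[symmetric] by (rule_tac mult_right_cancel[THEN iffD1])
  qed simp
  then show ?thesis by (simp add: G_def)
qed

text \<open>For odd \<open>n\<close> the additional index is realised by a real number
  \<open>B\<close> above all entries of \<open>x\<close>: comparisons with it have the constant
  signs of \<open>ext_sgn\<close>, and the new Vandermonde factors are positive. This reduces to
  \<open>2 * m\<close> genuine variables.\<close>

lemma ext_sgn_pfaffian:
  fixes x :: "nat \<Rightarrow> real" and n :: nat
  defines "m \<equiv> (n + 1) div 2"
  shows "(\<Sum>\<tau> | \<tau> permutes {..<2 * m}. pf_term m (\<lambda>a b. ext_sgn n a b (x a) (x b)) \<tau>) = 2 ^ m * fact m * sgn (vand n x)"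
proof -
  define B where "B = 1 + (\<Sum>i<n. \<bar>x i\<bar>)"
  have B: "x i < B" if "i < n" for i
  proof -
    have "\<bar>x i\<bar> \<le> (\<Sum>i<n. \<bar>x i\<bar>)" using that by (intro member_le_sum) auto
    then show ?thesis unfolding B_def by linarith
  qed
  have cases: "2 * m = n \<or> 2 * m = Suc n" unfolding m_def by presburger
  define y where "y = x(n := B)"
  have v: "sgn (vand (2 * m) y) = sgn (vand n x)"
  proof (cases "2 * m = n")
    case True
    then show ?thesis by (simp add: y_def vand_cong[of n "x(n := B)" x])
  next
    case False
    then have "2 * m = Suc n" using cases by simp
    moreover have "(\<Prod>i<n. B - x i) > 0" using B by (intro prod_pos) auto
    ultimately show ?thesis by (simp add: y_def vand_Suc_upd sgn_mult del: fun_upd_apply)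
  qed
  have s: "ext_sgn n a b (x a) (x b) = sgn (y b - y a)" if "a < 2 * m" "b < 2 * m" for a b
    using that cases B[of a] B[of b] by (auto simp: ext_sgn_def y_def less_Suc_eq sgn_real_def)
  have "(\<Sum>\<tau> | \<tau> permutes {..<2 * m}. pf_term m (\<lambda>a b. ext_sgn n a b (x a) (x b)) \<tau>)
     = (\<Sum>\<tau> | \<tau> permutes {..<2 * m}. pf_term m (\<lambda>a b. sgn (y b - y a)) \<tau>)"
    unfolding pf_term_def
  proof (intro sum.cong arg_cong2[where f="(*)"] refl prod.cong)
    fix \<tau> i assume "\<tau> \<in> {\<tau>. \<tau> permutes {..<2 * m}}" "i \<in> {..<m}"
    then have "\<tau> (2 * i) < 2 * m" "\<tau> (2 * i + 1) < 2 * m"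
      using permutes_in_image[of \<tau> "{..<2 * m}" "2 * i"] permutes_in_image[of \<tau> "{..<2 * m}" "2 * i + 1"] by auto
    then show "ext_sgn n (\<tau> (2 * i)) (\<tau> (2 * i + 1)) (x (\<tau> (2 * i))) (x (\<tau> (2 * i + 1))) = sgn (y (\<tau> (2 * i + 1)) - y (\<tau> (2 * i)))"
      by (rule s)
  qed
  then show ?thesis using sgn_pfaffian[of m y] v by simp
qed

text \<open>Fubini, one pair of coordinates at a time. Since \<open>S\<close> is bounded by 1,
  everything is dominated by a product of integrable functions of one variable. The measures
  \<open>M j\<close> may differ, which leaves room for a point mass at an additional index.\<close>

lemma pair_product_integral:
  fixes M :: "nat \<Rightarrow> real measure" and f :: "nat \<Rightarrow> real \<Rightarrow> real" and S :: "nat \<Rightarrow> real \<Rightarrow> real \<Rightarrow> real"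
  assumes M: "product_sigma_finite M" and sM[measurable_cong]: "\<And>j. sets (M j) = sets borel"
    and \<tau>: "inj \<tau>" and f: "\<And>j. integrable (M j) (f j)"
    and S: "\<And>i. case_prod (S i) \<in> borel_measurable (borel \<Otimes>\<^sub>M borel)" and S1: "\<And>i s t. \<bar>S i s t\<bar> \<le> 1"
  shows "integrable (Pi\<^sub>M (\<tau> ` {..<2 * m}) M) (\<lambda>x. \<Prod>i<m. f (\<tau> (2 * i)) (x (\<tau> (2 * i))) * f (\<tau> (2 * i + 1)) (x (\<tau> (2 * i + 1))) * S i (x (\<tau> (2 * i))) (x (\<tau> (2 * i + 1))))"
    "(\<integral>x. (\<Prod>i<m. f (\<tau> (2 * i)) (x (\<tau> (2 * i))) * f (\<tau> (2 * i + 1)) (x (\<tau> (2 * i + 1))) * S i (x (\<tau> (2 * i))) (x (\<tau> (2 * i + 1)))) \<partial>Pi\<^sub>M (\<tau> ` {..<2 * m}) M)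
     = (\<Prod>i<m. \<integral>s. \<integral>t. f (\<tau> (2 * i)) s * f (\<tau> (2 * i + 1)) t * S i s t \<partial>M (\<tau> (2 * i + 1)) \<partial>M (\<tau> (2 * i)))"
proof -
  interpret product_sigma_finite M by (rule M)
  define P where "P m x = (\<Prod>i<m. f (\<tau> (2 * i)) (x (\<tau> (2 * i))) * f (\<tau> (2 * i + 1)) (x (\<tau> (2 * i + 1))) * S i (x (\<tau> (2 * i))) (x (\<tau> (2 * i + 1))))" for m x
  have fm[measurable]: "f j \<in> borel_measurable borel" for j
    using borel_measurable_integrable[OF f[of j]] by (simp add: measurable_cong_sets[OF sM refl])
  have Sm[measurable (raw)]: "(\<lambda>w. S i (g w) (h w)) \<in> borel_measurable N"
    if "g \<in> borel_measurable N" "h \<in> borel_measurable N" for i g h and N :: "(nat \<Rightarrow> real) measure"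
    using measurable_compose[OF measurable_Pair[OF that] S[of i]] by simp
  have comp: "(\<lambda>x. x j) \<in> borel_measurable (Pi\<^sub>M J M)" if "j \<in> J" for j J
    using measurable_component_singleton[OF that, of M] by (simp add: measurable_cong_sets[OF refl sM])
  have Pm: "P m \<in> borel_measurable (Pi\<^sub>M J M)" if "\<tau> ` {..<2 * m} \<subseteq> J" for m J
    unfolding P_def
  proof (intro borel_measurable_prod)
    fix i assume "i \<in> {..<m}"
    then have i: "\<tau> (2 * i) \<in> J" "\<tau> (2 * i + 1) \<in> J" using that by auto
    note [measurable] = comp[OF i(1)] comp[OF i(2)]
    show "(\<lambda>x. f (\<tau> (2 * i)) (x (\<tau> (2 * i))) * f (\<tau> (2 * i + 1)) (x (\<tau> (2 * i + 1))) * S i (x (\<tau> (2 * i))) (x (\<tau> (2 * i + 1)))) \<in> borel_measurable (Pi\<^sub>M J M)"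
      by measurable
  qed
  have Pb: "\<bar>P m x\<bar> \<le> \<bar>\<Prod>j\<in>\<tau> ` {..<2 * m}. f j (x j)\<bar>" for m x
  proof -
    have "\<bar>P m x\<bar> = (\<Prod>i<m. \<bar>f (\<tau> (2 * i)) (x (\<tau> (2 * i)))\<bar> * \<bar>f (\<tau> (2 * i + 1)) (x (\<tau> (2 * i + 1)))\<bar> * \<bar>S i (x (\<tau> (2 * i))) (x (\<tau> (2 * i + 1)))\<bar>)"
      unfolding P_def by (simp add: abs_prod abs_mult)
    also have "\<dots> \<le> (\<Prod>i<m. \<bar>f (\<tau> (2 * i)) (x (\<tau> (2 * i)))\<bar> * \<bar>f (\<tau> (2 * i + 1)) (x (\<tau> (2 * i + 1)))\<bar>)"
      using S1 by (intro prod_mono) (auto intro!: mult_left_le)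
    also have "\<dots> = (\<Prod>j<2 * m. \<bar>f (\<tau> j) (x (\<tau> j))\<bar>)" by (rule prod_pairs[symmetric])
    also have "\<dots> = \<bar>\<Prod>j\<in>\<tau> ` {..<2 * m}. f j (x j)\<bar>"
      by (subst prod.reindex) (auto simp: inj_on_subset[OF \<tau>] abs_prod)
    finally show ?thesis .
  qed
  have Pint: "integrable (Pi\<^sub>M (\<tau> ` {..<2 * m}) M) (P m)" for m
    by (rule Bochner_Integration.integrable_bound[OF product_integrable_prod[of "\<tau> ` {..<2 * m}" f]])
       (use f Pb Pm in auto)
  then show "integrable (Pi\<^sub>M (\<tau> ` {..<2 * m}) M) (\<lambda>x. \<Prod>i<m. f (\<tau> (2 * i)) (x (\<tau> (2 * i))) * f (\<tau> (2 * i + 1)) (x (\<tau> (2 * i + 1))) * S i (x (\<tau> (2 * i))) (x (\<tau> (2 * i + 1))))"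
    unfolding P_def .
  have "integral\<^sup>L (Pi\<^sub>M (\<tau> ` {..<2 * m}) M) (P m) = (\<Prod>i<m. \<integral>s. \<integral>t. f (\<tau> (2 * i)) s * f (\<tau> (2 * i + 1)) t * S i s t \<partial>M (\<tau> (2 * i + 1)) \<partial>M (\<tau> (2 * i)))"
  proof (induction m)
    case 0
    then show ?case by (simp add: P_def PiM_empty)
  next
    case (Suc m)
    let ?a = "\<tau> (2 * m)" and ?b = "\<tau> (2 * m + 1)"
    let ?U = "\<tau> ` {..<2 * m}"
    have U: "\<tau> ` {..<2 * Suc m} = insert ?b (insert ?a ?U)" by (auto simp: less_Suc_eq)
    have na: "?a \<notin> ?U" and nb: "?b \<notin> insert ?a ?U" using \<tau> by (auto simp: inj_eq)
    define h where "h s = (\<integral>t. f ?b t * S m s t \<partial>M ?b)" for s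
    have hm[measurable]: "h \<in> borel_measurable borel"
    proof -
      have "(\<lambda>(s, t). f ?b t * S m s t) \<in> borel_measurable (borel \<Otimes>\<^sub>M M ?b)"
        using S[of m] unfolding measurable_cong_sets[OF sets_pair_measure_cong[OF refl sM] refl]
        by (auto simp: case_prod_beta intro!: borel_measurable_times)
      then show ?thesis unfolding h_def by (rule sigma_finite_measure.borel_measurable_lebesgue_integral[OF sigma_finite_measures])
    qed
    have hb: "\<bar>h s\<bar> \<le> (\<integral>t. \<bar>f ?b t\<bar> \<partial>M ?b)" for s
    proof -
      have "\<bar>h s\<bar> \<le> (\<integral>t. \<bar>f ?b t * S m s t\<bar> \<partial>M ?b)" unfolding h_def by (rule integral_abs_bound)
      also have "\<dots> \<le> (\<integral>t. \<bar>f ?b t\<bar> \<partial>M ?b)"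
      proof (rule integral_mono')
        show "integrable (M ?b) (\<lambda>t. \<bar>f ?b t\<bar>)" using f by (rule integrable_abs)
        show "\<bar>f ?b t * S m s t\<bar> \<le> \<bar>f ?b t\<bar>" for t using S1[of m s t] by (auto simp: abs_mult intro!: mult_left_le)
      qed auto
      finally show ?thesis .
    qed
    have upd1: "P m (x(?b := t)) = P m x" for x t
      unfolding P_def using nb by (intro prod.cong refl) (auto simp: inj_eq[OF \<tau>])
    have upd2: "P m (x(?a := t)) = P m x" for x t
      unfolding P_def using na by (intro prod.cong refl) (auto simp: inj_eq[OF \<tau>])
    have ab: "?a \<noteq> ?b" using \<tau> by (simp add: inj_eq)
    have PS: "P (Suc m) (x(?b := t)) = (P m x * f ?a (x ?a)) * (f ?b t * S m (x ?a) t)" for x t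
    proof -
      have "P (Suc m) (x(?b := t)) = P m (x(?b := t)) * (f ?a ((x(?b := t)) ?a) * f ?b ((x(?b := t)) ?b) * S m ((x(?b := t)) ?a) ((x(?b := t)) ?b))"
        by (simp add: P_def)
      then show ?thesis unfolding upd1 using ab by (simp add: mult_ac)
    qed
    have "integral\<^sup>L (Pi\<^sub>M (\<tau> ` {..<2 * Suc m}) M) (P (Suc m)) = (\<integral>x. \<integral>t. P (Suc m) (x(?b := t)) \<partial>M ?b \<partial>Pi\<^sub>M (insert ?a ?U) M)"
      unfolding U by (rule product_integral_insert) (use nb Pint[of "Suc m"] U in auto)
    also have "\<dots> = (\<integral>x. (P m x * f ?a (x ?a)) * h (x ?a) \<partial>Pi\<^sub>M (insert ?a ?U) M)"
      unfolding PS h_def by simp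
    also have "\<dots> = (\<integral>x. \<integral>s. (P m (x(?a := s)) * f ?a ((x(?a := s)) ?a)) * h ((x(?a := s)) ?a) \<partial>M ?a \<partial>Pi\<^sub>M ?U M)"
    proof (rule product_integral_insert)
      let ?C = "\<integral>t. \<bar>f ?b t\<bar> \<partial>M ?b"
      have C: "?C \<ge> 0" by (rule integral_nonneg_AE) simp
      have "integrable (Pi\<^sub>M (insert ?a ?U) M) (\<lambda>x. \<Prod>j\<in>insert ?a ?U. f j (x j))"
        by (rule product_integrable_prod) (use f in auto)
      then have "integrable (Pi\<^sub>M (insert ?a ?U) M) (\<lambda>x. ?C * (\<Prod>j\<in>insert ?a ?U. f j (x j)))" by simp
      then show "integrable (Pi\<^sub>M (insert ?a ?U) M) (\<lambda>x. P m x * f ?a (x ?a) * h (x ?a))"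
      proof (rule Bochner_Integration.integrable_bound)
        note [measurable] = Pm[of m "insert ?a ?U", OF subset_insertI] comp[of ?a "insert ?a ?U", OF insertI1]
        show "(\<lambda>x. P m x * f ?a (x ?a) * h (x ?a)) \<in> borel_measurable (Pi\<^sub>M (insert ?a ?U) M)" by measurable
        show "AE x in Pi\<^sub>M (insert ?a ?U) M. norm (P m x * f ?a (x ?a) * h (x ?a)) \<le> norm (?C * (\<Prod>j\<in>insert ?a ?U. f j (x j)))"
        proof (rule AE_I2)
          fix x
          have "\<bar>P m x\<bar> * \<bar>f ?a (x ?a)\<bar> * \<bar>h (x ?a)\<bar> \<le> \<bar>\<Prod>j\<in>?U. f j (x j)\<bar> * \<bar>f ?a (x ?a)\<bar> * ?C"
            using Pb[of m x] hb[of "x ?a"] by (intro mult_mono) auto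
          then show "norm (P m x * f ?a (x ?a) * h (x ?a)) \<le> norm (?C * (\<Prod>j\<in>insert ?a ?U. f j (x j)))"
            using na C by (simp add: abs_mult mult_ac)
        qed
      qed
    qed (use na in auto)
    also have "\<dots> = (\<integral>x. P m x * (\<integral>s. f ?a s * h s \<partial>M ?a) \<partial>Pi\<^sub>M ?U M)"
      unfolding upd2 by (simp add: mult.assoc)
    also have "\<dots> = integral\<^sup>L (Pi\<^sub>M ?U M) (P m) * (\<integral>s. f ?a s * h s \<partial>M ?a)" by simp
    also have "(\<integral>s. f ?a s * h s \<partial>M ?a) = (\<integral>s. \<integral>t. f ?a s * f ?b t * S m s t \<partial>M ?b \<partial>M ?a)"
      unfolding h_def by (simp add: mult.assoc)
    finally show ?case unfolding Suc.IH by simp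
  qed
  then show "(\<integral>x. (\<Prod>i<m. f (\<tau> (2 * i)) (x (\<tau> (2 * i))) * f (\<tau> (2 * i + 1)) (x (\<tau> (2 * i + 1))) * S i (x (\<tau> (2 * i))) (x (\<tau> (2 * i + 1)))) \<partial>Pi\<^sub>M (\<tau> ` {..<2 * m}) M)
     = (\<Prod>i<m. \<integral>s. \<integral>t. f (\<tau> (2 * i)) s * f (\<tau> (2 * i + 1)) t * S i s t \<partial>M (\<tau> (2 * i + 1)) \<partial>M (\<tau> (2 * i)))"
    unfolding P_def .
qed

text \<open>The de Bruijn matrix. Index \<open>n\<close> is the border for odd \<open>n\<close>; its
  entries are what the sign leaves when one variable is sent to plus infinity.\<close>

definition pair_mat :: "nat \<Rightarrow> (nat \<Rightarrow> real \<Rightarrow> real) \<Rightarrow> nat \<Rightarrow> nat \<Rightarrow> real" where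
  "pair_mat n \<psi> i j = (if i < n \<and> j < n then (\<integral>s. \<integral>t. \<psi> i s * \<psi> j t * sgn (t - s) \<partial>lborel \<partial>lborel)
     else if i < n then (\<integral>s. \<psi> i s \<partial>lborel) else if j < n then - (\<integral>s. \<psi> j s \<partial>lborel) else 0)"

text \<open>Reordering by \<open>\<tau>\<close> groups the coordinates into the pairs on which the
  sign factors act, so the integral splits into double integrals.\<close>

lemma integral_ext_sgn:
  fixes n :: nat
  defines "m \<equiv> (n + 1) div 2"
  assumes \<psi>: "\<And>i. integrable lborel (\<psi> i)" and \<sigma>: "\<sigma> permutes {..<n}" and \<tau>: "\<tau> permutes {..<2 * m}"
  defines "E \<equiv> \<lambda>x. (\<Prod>j<n. \<psi> (\<sigma> j) (x j)) * (\<Prod>i<m. ext_sgn n (\<tau> (2 * i)) (\<tau> (2 * i + 1)) (x (\<tau> (2 * i))) (x (\<tau> (2 * i + 1))))"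
  shows "integrable (leb n) E" "integral\<^sup>L (leb n) E = (\<Prod>i<m. pair_mat n \<psi> (\<sigma> (\<tau> (2 * i))) (\<sigma> (\<tau> (2 * i + 1))))"
proof -
  \<comment> \<open>For odd \<open>n\<close> the missing coordinate \<open>n\<close> gets a point
    mass at 0 and the function 1, so that all \<open>2 * m\<close> indices can be paired
    alike.\<close>
  define M where "M j = (if j < n then lborel else return borel (0::real))" for j
  define f where "f j = (if j < n then \<psi> (\<sigma> j) else (\<lambda>_. 1))" for j
  define S where "S i = ext_sgn n (\<tau> (2 * i)) (\<tau> (2 * i + 1))" for i
  have cases: "2 * m = n \<or> 2 * m = Suc n" unfolding m_def by presburger
  have ret: "prob_space (return borel (0::real))" by (rule prob_space_return) simp
  have M: "product_sigma_finite M"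
    by (rule product_sigma_finite.intro) (auto simp: M_def prob_space_imp_sigma_finite[OF ret] sigma_finite_lborel)
  interpret product_sigma_finite M by (rule M)
  have sM: "sets (M j) = sets borel" for j by (simp add: M_def)
  have f: "integrable (M j) (f j)" for j
    using \<psi> finite_measure.integrable_const[OF prob_space.finite_measure[OF ret], of "1::real"] by (simp add: f_def M_def)
  have S: "case_prod (S i) \<in> borel_measurable (borel \<Otimes>\<^sub>M borel)" for i
    unfolding S_def ext_sgn_def by (auto simp: case_prod_beta intro!: borel_measurable_sgn)
  have S1: "\<bar>S i s t\<bar> \<le> 1" for i s t by (auto simp: S_def ext_sgn_def sgn_real_def)
  have \<tau>U: "\<tau> ` {..<2 * m} = {..<2 * m}" using permutes_image[OF \<tau>] .
  note fub = pair_product_integral[where M=M and f=f and S=S and \<tau>=\<tau> and m=m, OF M sM permutes_inj[OF \<tau>] f S S1, unfolded \<tau>U]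
  have Eeq: "(\<Prod>i<m. f (\<tau> (2 * i)) (x (\<tau> (2 * i))) * f (\<tau> (2 * i + 1)) (x (\<tau> (2 * i + 1))) * S i (x (\<tau> (2 * i))) (x (\<tau> (2 * i + 1)))) = E x" for x
  proof -
    have "(\<Prod>i<m. f (\<tau> (2 * i)) (x (\<tau> (2 * i))) * f (\<tau> (2 * i + 1)) (x (\<tau> (2 * i + 1)))) = (\<Prod>j<2 * m. f (\<tau> j) (x (\<tau> j)))"
      by (rule prod_pairs[symmetric])
    also have "\<dots> = (\<Prod>j<2 * m. f j (x j))"
      using prod.permute[OF \<tau>, of "\<lambda>j. f j (x j)"] by (simp add: o_def)
    also have "\<dots> = (\<Prod>j<n. f j (x j))" using cases by (auto simp: f_def)
    also have "\<dots> = (\<Prod>j<n. \<psi> (\<sigma> j) (x j))" by (rule prod.cong) (auto simp: f_def)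
    finally show ?thesis unfolding E_def S_def[symmetric] by (subst prod.distrib) simp
  qed
  have int: "integrable (Pi\<^sub>M {..<2 * m} M) E" using fub(1) unfolding Eeq .
  have PM: "Pi\<^sub>M {..<n} M = leb n" by (rule PiM_cong) (auto simp: M_def)
  have "integrable (leb n) E \<and> integral\<^sup>L (Pi\<^sub>M {..<2 * m} M) E = integral\<^sup>L (leb n) E"
  proof (cases "2 * m = n")
    case True
    then show ?thesis using int PM by simp
  next
    case False
    then have S: "2 * m = Suc n" using cases by simp
    \<comment> \<open>Comparisons with the index \<open>n\<close> are constant, so \<open>E\<close>
      ignores this coordinate and its integral against the point mass is trivial.\<close>
    have ind: "E (x(n := y)) = E x" for x y
    proof -
      have e: "ext_sgn n a b ((x(n := y)) a) ((x(n := y)) b) = ext_sgn n a b (x a) (x b)" for a b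
        by (auto simp: ext_sgn_def)
      have "(\<Prod>j<n. \<psi> (\<sigma> j) ((x(n := y)) j)) = (\<Prod>j<n. \<psi> (\<sigma> j) (x j))" by (rule prod.cong) auto
      then show ?thesis unfolding E_def e by (simp only:)
    qed
    have int': "integrable (Pi\<^sub>M (insert n {..<n}) M) E" using int unfolding S lessThan_Suc .
    have Em: "E \<in> borel_measurable (leb n)"
    proof -
      have "(\<lambda>x. x(n := 0)) \<in> leb n \<rightarrow>\<^sub>M leb (Suc n)" by measurable
      moreover have "sets (Pi\<^sub>M (insert n {..<n}) M) = sets (leb (Suc n))"
        unfolding lessThan_Suc by (rule sets_PiM_cong) (auto simp: M_def)
      then have "E \<in> borel_measurable (leb (Suc n))"
        using borel_measurable_integrable[OF int'] measurable_cong_sets[OF _ refl] by blast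
      ultimately have "(\<lambda>x. E (x(n := 0))) \<in> borel_measurable (leb n)" by (rule measurable_compose)
      then show ?thesis unfolding ind .
    qed
    have "integrable (leb n) (\<lambda>x. \<Prod>j<n. \<psi> (\<sigma> j) (x j))"
      by (rule leb.product_integrable_prod) (use \<psi> in auto)
    then have i1: "integrable (leb n) E"
    proof (rule Bochner_Integration.integrable_bound[OF _ Em])
      show "AE x in leb n. norm (E x) \<le> norm (\<Prod>j<n. \<psi> (\<sigma> j) (x j))"
      proof (rule AE_I2)
        fix x
        have "\<bar>\<Prod>i<m. ext_sgn n (\<tau> (2 * i)) (\<tau> (2 * i + 1)) (x (\<tau> (2 * i))) (x (\<tau> (2 * i + 1)))\<bar> \<le> 1"
          unfolding abs_prod using S1 by (intro prod_le_1) (auto simp: S_def)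
        then show "norm (E x) \<le> norm (\<Prod>j<n. \<psi> (\<sigma> j) (x j))"
          unfolding E_def real_norm_def abs_mult by (intro mult_left_le) auto
      qed
    qed
    have "integral\<^sup>L (Pi\<^sub>M (insert n {..<n}) M) E = (\<integral>x. \<integral>y. E (x(n := y)) \<partial>M n \<partial>Pi\<^sub>M {..<n} M)"
      by (rule product_integral_insert[OF _ _ int']) auto
    also have "\<dots> = integral\<^sup>L (leb n) E"
    proof -
      have "(\<integral>y. c \<partial>M n) = c" for c :: real
        using prob_space.prob_space[OF ret] by (simp add: M_def)
      then show ?thesis unfolding ind PM by simp
    qed
    finally show ?thesis using i1 unfolding S lessThan_Suc by simp
  qed
  then show "integrable (leb n) E" and eq: "integral\<^sup>L (leb n) E = (\<Prod>i<m. pair_mat n \<psi> (\<sigma> (\<tau> (2 * i))) (\<sigma> (\<tau> (2 * i + 1))))"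
  proof -
    assume a: "integrable (leb n) E \<and> integral\<^sup>L (Pi\<^sub>M {..<2 * m} M) E = integral\<^sup>L (leb n) E"
    then show "integrable (leb n) E" ..
    have sn: "\<sigma> j < n \<longleftrightarrow> j < n" for j using permutes_in_image[OF \<sigma>, of j] by simp
    have "integral\<^sup>L (leb n) E = integral\<^sup>L (Pi\<^sub>M {..<2 * m} M) E" using a by simp
    also have "\<dots> = (\<Prod>i<m. \<integral>s. \<integral>t. f (\<tau> (2 * i)) s * f (\<tau> (2 * i + 1)) t * S i s t \<partial>M (\<tau> (2 * i + 1)) \<partial>M (\<tau> (2 * i)))"
      using fub(2) unfolding Eeq .
    also have "\<dots> = (\<Prod>i<m. pair_mat n \<psi> (\<sigma> (\<tau> (2 * i))) (\<sigma> (\<tau> (2 * i + 1))))"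
    proof (rule prod.cong[OF refl])
      fix i
      have r: "Sigma_Algebra.measure (return borel (0::real)) UNIV = 1"
        using prob_space.prob_space[OF ret] by simp
      show "(\<integral>s. \<integral>t. f (\<tau> (2 * i)) s * f (\<tau> (2 * i + 1)) t * S i s t \<partial>M (\<tau> (2 * i + 1)) \<partial>M (\<tau> (2 * i))) = pair_mat n \<psi> (\<sigma> (\<tau> (2 * i))) (\<sigma> (\<tau> (2 * i + 1)))"
        unfolding f_def M_def S_def ext_sgn_def pair_mat_def
        by (cases "\<tau> (2 * i) < n"; cases "\<tau> (2 * i + 1) < n") (simp_all add: sn r)
    qed
    finally show "integral\<^sup>L (leb n) E = (\<Prod>i<m. pair_mat n \<psi> (\<sigma> (\<tau> (2 * i))) (\<sigma> (\<tau> (2 * i + 1))))" .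
  qed
qed

lemma integrable_alt_sum:
  assumes "\<And>i. integrable lborel (\<psi> i)"
  shows "integrable (leb n) (alt_sum n \<psi>)"
  unfolding alt_sum_def[abs_def]
  by (intro Bochner_Integration.integrable_sum integrable_mult_right leb.product_integrable_prod) (use assms in auto)

lemma integrable_chamber_alt_sum:
  assumes "\<And>i. integrable lborel (\<psi> i)"
  shows "integrable (leb n) (\<lambda>x. if chamber n x then alt_sum n \<psi> x else 0)"
proof (rule Bochner_Integration.integrable_bound[OF integrable_alt_sum[OF assms]])
  note [measurable] = borel_measurable_integrable[OF integrable_alt_sum[OF assms], of n]
  show "(\<lambda>x. if chamber n x then alt_sum n \<psi> x else 0) \<in> borel_measurable (leb n)" by measurable
qed auto

text \<open>Symmetrising replaces the chamber by the kernel \<open>sgn (vand n x)\<close>, at the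
  price of a factor \<open>fact n\<close>. Expanding this kernel as a Pfaffian of signs makes every
  term a product over pairs. For fixed \<open>\<sigma>\<close> the sum over \<open>\<tau>\<close> is
  reindexed by \<open>\<sigma> \<circ> \<tau>\<close>, so each of the \<open>fact n\<close> terms of
  the determinant yields the same Pfaffian.\<close>

theorem de_Bruijn:
  fixes n :: nat
  assumes \<psi>: "\<And>i. integrable lborel (\<psi> i)"
  shows "(\<integral>x. (if chamber n x then alt_sum n \<psi> x else 0) \<partial>leb n) = pfaffian ((n + 1) div 2) (pair_mat n \<psi>)"
proof -
  define m where "m = (n + 1) div 2"
  define c where "c = (2 ^ m * fact m :: real)"
  have c0: "c > 0" by (simp add: c_def)
  let ?S = "{\<sigma>. \<sigma> permutes {..<n}}" and ?T = "{\<tau>. \<tau> permutes {..<2 * m}}"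
  have finS: "finite ?S" and finT: "finite ?T" by (auto intro: finite_permutations)
  have nm: "{..<n} \<subseteq> {..<2 * m}" unfolding m_def by auto
  define g where "g x = (if chamber n x then alt_sum n \<psi> x else 0)" for x
  have gint: "integrable (leb n) g" unfolding g_def by (rule integrable_chamber_alt_sum[OF \<psi>])
  define E where "E \<sigma> \<tau> x = (\<Prod>j<n. \<psi> (\<sigma> j) (x j)) * (\<Prod>i<m. ext_sgn n (\<tau> (2 * i)) (\<tau> (2 * i + 1)) (x (\<tau> (2 * i))) (x (\<tau> (2 * i + 1))))" for \<sigma> \<tau> and x :: "nat \<Rightarrow> real"
  have Eint: "integrable (leb n) (E \<sigma> \<tau>)" and Eval: "integral\<^sup>L (leb n) (E \<sigma> \<tau>) = (\<Prod>i<m. pair_mat n \<psi> (\<sigma> (\<tau> (2 * i))) (\<sigma> (\<tau> (2 * i + 1))))"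
    if "\<sigma> \<in> ?S" "\<tau> \<in> ?T" for \<sigma> \<tau>
    using integral_ext_sgn[OF \<psi>, of \<sigma> n \<tau>] that unfolding E_def[abs_def] m_def by auto
  have pw: "c * (\<Sum>q\<in>?S. g (x \<circ> q)) = (\<Sum>\<sigma>\<in>?S. \<Sum>\<tau>\<in>?T. rsign \<sigma> * rsign \<tau> * E \<sigma> \<tau> x)" for x
  proof -
    have "c * (\<Sum>q\<in>?S. g (x \<circ> q)) = c * (alt_sum n \<psi> x * sgn (vand n x))"
      unfolding g_def using symmetrize_chamber[of n "alt_sum n \<psi>" x] alt_sum_permute by simp
    also have "\<dots> = alt_sum n \<psi> x * (c * sgn (vand n x))" by (simp only: mult.left_commute)
    also have "c * sgn (vand n x) = (\<Sum>\<tau>\<in>?T. pf_term m (\<lambda>a b. ext_sgn n a b (x a) (x b)) \<tau>)"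
      unfolding c_def m_def ext_sgn_pfaffian ..
    also have "alt_sum n \<psi> x * \<dots> = (\<Sum>\<sigma>\<in>?S. \<Sum>\<tau>\<in>?T. rsign \<sigma> * rsign \<tau> * E \<sigma> \<tau> x)"
      unfolding alt_sum_def pf_term_def E_def sum_product by (simp add: mult_ac)
    finally show ?thesis .
  qed
  have inv: "integrable (leb n) (\<lambda>x. g (x \<circ> q))" "(\<integral>x. g (x \<circ> q) \<partial>leb n) = integral\<^sup>L (leb n) g" if q: "q \<in> ?S" for q
  proof -
    have qp: "q permutes {..<n}" using q by simp
    have gm: "g \<in> borel_measurable (leb n)" using gint by auto
    have "integrable (distr (leb n) (leb n) (\<lambda>x. x \<circ> q)) g" using gint by (simp only: distr_leb_permute[OF qp])
    then show "integrable (leb n) (\<lambda>x. g (x \<circ> q))"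
      using integrable_distr_eq[OF measurable_leb_permute[OF qp] gm] by simp
    have "integral\<^sup>L (leb n) g = integral\<^sup>L (distr (leb n) (leb n) (\<lambda>x. x \<circ> q)) g" by (simp only: distr_leb_permute[OF qp])
    also have "\<dots> = (\<integral>x. g (x \<circ> q) \<partial>leb n)" by (rule integral_distr[OF measurable_leb_permute[OF qp] gm])
    finally show "(\<integral>x. g (x \<circ> q) \<partial>leb n) = integral\<^sup>L (leb n) g" by simp
  qed
  let ?P = "\<Sum>\<tau>\<in>?T. pf_term m (pair_mat n \<psi>) \<tau>"
  have cardS: "real (card ?S) = fact n" using card_permutations[of "{..<n}" n] by simp
  have "c * (fact n * integral\<^sup>L (leb n) g) = c * (\<Sum>q\<in>?S. \<integral>x. g (x \<circ> q) \<partial>leb n)"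
    using inv(2) cardS by simp
  also have "\<dots> = (\<integral>x. c * (\<Sum>q\<in>?S. g (x \<circ> q)) \<partial>leb n)"
    using inv(1) by (subst Bochner_Integration.integral_mult_right) (auto simp: Bochner_Integration.integral_sum)
  also have "\<dots> = (\<Sum>\<sigma>\<in>?S. \<Sum>\<tau>\<in>?T. rsign \<sigma> * rsign \<tau> * integral\<^sup>L (leb n) (E \<sigma> \<tau>))"
  proof -
    have "(\<integral>x. (\<Sum>\<sigma>\<in>?S. \<Sum>\<tau>\<in>?T. rsign \<sigma> * rsign \<tau> * E \<sigma> \<tau> x) \<partial>leb n)
       = (\<Sum>\<sigma>\<in>?S. \<integral>x. (\<Sum>\<tau>\<in>?T. rsign \<sigma> * rsign \<tau> * E \<sigma> \<tau> x) \<partial>leb n)"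
      by (intro Bochner_Integration.integral_sum Bochner_Integration.integrable_sum integrable_mult_right Eint)
    also have "\<dots> = (\<Sum>\<sigma>\<in>?S. \<Sum>\<tau>\<in>?T. \<integral>x. rsign \<sigma> * rsign \<tau> * E \<sigma> \<tau> x \<partial>leb n)"
      by (intro sum.cong[OF refl] Bochner_Integration.integral_sum integrable_mult_right Eint)
    finally show ?thesis unfolding pw by simp
  qed
  also have "\<dots> = (\<Sum>\<sigma>\<in>?S. ?P)"
  proof (rule sum.cong[OF refl])
    fix \<sigma> assume s: "\<sigma> \<in> ?S"
    \<comment> \<open>\<open>\<sigma>\<close> fixes the border index \<open>n\<close>, so it also
      permutes all \<open>2 * m\<close> indices, with the same sign.\<close>
    then have s2: "\<sigma> permutes {..<2 * m}" using permutes_subset[OF _ nm] by blast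
    have "(\<Sum>\<tau>\<in>?T. rsign \<sigma> * rsign \<tau> * integral\<^sup>L (leb n) (E \<sigma> \<tau>)) = (\<Sum>\<tau>\<in>?T. pf_term m (pair_mat n \<psi>) (\<sigma> \<circ> \<tau>))"
    proof (rule sum.cong[OF refl])
      fix \<tau> assume t: "\<tau> \<in> ?T"
      then have "rsign (\<sigma> \<circ> \<tau>) = rsign \<sigma> * rsign \<tau>" using rsign_compose[OF s2] by simp
      then show "rsign \<sigma> * rsign \<tau> * integral\<^sup>L (leb n) (E \<sigma> \<tau>) = pf_term m (pair_mat n \<psi>) (\<sigma> \<circ> \<tau>)"
        unfolding Eval[OF s t] pf_term_def by simp
    qed
    also have "\<dots> = ?P" by (rule sum_compose_left[OF s2])
    finally show "(\<Sum>\<tau>\<in>?T. rsign \<sigma> * rsign \<tau> * integral\<^sup>L (leb n) (E \<sigma> \<tau>)) = ?P" .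
  qed
  also have "\<dots> = fact n * ?P" using cardS by simp
  finally have "integral\<^sup>L (leb n) g = ?P / c" using c0 by (simp add: field_simps)
  then show ?thesis unfolding g_def m_def[symmetric] pfaffian_def c_def pf_term_def atLeast0LessThan .
qed

section \<open>The density of a single eigenvalue\<close>

text \<open>Composing \<open>\<mu>(n := t)\<close> with this cycle inserts \<open>t\<close> at
  position \<open>p\<close> and shifts the later entries of \<open>\<mu>\<close> up by one.\<close>

definition insert_cycle :: "nat \<Rightarrow> nat \<Rightarrow> nat \<Rightarrow> nat" where
  "insert_cycle n p i = (if i = p then n else if p < i \<and> i \<le> n then i - 1 else i)"

lemma insert_cycle_permutes:
  assumes "p \<le> n" shows "insert_cycle n p permutes {..<Suc n}"
proof (rule bij_imp_permutes)
  show "bij_betw (insert_cycle n p) {..<Suc n} {..<Suc n}"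
    by (rule bij_betw_byWitness[where f'="\<lambda>i. if i = n then p else if i < p then i else Suc i"])
       (use assms in \<open>auto simp: insert_cycle_def split: if_splits\<close>)
  show "insert_cycle n p i = i" if "i \<notin> {..<Suc n}" for i
    using that assms by (auto simp: insert_cycle_def)
qed

definition split_at :: "nat \<Rightarrow> nat \<Rightarrow> real \<Rightarrow> (nat \<Rightarrow> real) \<Rightarrow> bool" where
  "split_at n p t \<mu> \<longleftrightarrow> (\<forall>i<p. \<mu> i < t) \<and> (\<forall>i<n. p \<le> i \<longrightarrow> t < \<mu> i)"

lemma measurable_split_at [measurable (raw)]:
  assumes f: "f \<in> M \<rightarrow>\<^sub>M leb n" and g[measurable]: "g \<in> borel_measurable M" and p: "p \<le> n"
  shows "Measurable.pred M (\<lambda>w. split_at n p (g w) (f w))"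
proof -
  have [measurable]: "(\<lambda>w. f w i) \<in> borel_measurable M" if "i < n" for i
    by (rule measurable_leb_component[OF f that])
  have "Measurable.pred M (\<lambda>w. (\<forall>i\<in>{..<p}. f w i < g w) \<and> (\<forall>i\<in>{p..<n}. g w < f w i))"
    using p by (intro pred_intros_logic pred_intros_finite(3)) auto
  moreover have "(\<lambda>w. (\<forall>i\<in>{..<p}. f w i < g w) \<and> (\<forall>i\<in>{p..<n}. g w < f w i)) = (\<lambda>w. split_at n p (g w) (f w))"
    by (auto simp: split_at_def fun_eq_iff)
  ultimately show ?thesis by (simp only:)
qed

lemma chamber_insert_cycle:
  assumes p: "p \<le> n"
  shows "chamber (Suc n) ((\<mu>(n := t)) \<circ> insert_cycle n p) \<longleftrightarrow> chamber n \<mu> \<and> split_at n p t \<mu>"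
proof -
  define y where "y = (\<mu>(n := t)) \<circ> insert_cycle n p"
  have y: "y i = (if i < p then \<mu> i else if i = p then t else \<mu> (i - 1))" if "i \<le> n" for i
    using that p by (auto simp: y_def insert_cycle_def)
  have "chamber (Suc n) y \<longleftrightarrow> chamber n \<mu> \<and> split_at n p t \<mu>"
  proof
    assume ch: "chamber (Suc n) y"
    define e where "e i = (if i < p then i else Suc i)" for i
    have ye: "y (e i) = \<mu> i" if "i < n" for i using y[of "e i"] that by (auto simp: e_def)
    have "chamber n \<mu>" unfolding chamber_def
    proof (intro allI impI)
      fix i j assume ij: "j < n" "i < j"
      then have "y (e i) < y (e j)" by (intro chamber_less[OF ch]) (auto simp: e_def)
      then show "\<mu> i < \<mu> j" using ye ij by simp
    qed
    moreover have "split_at n p t \<mu>" unfolding split_at_def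
    proof (intro conjI allI impI)
      fix i assume "i < p"
      then show "\<mu> i < t" using chamber_less[OF ch, of i p] y[of i] y[of p] p by simp
    next
      fix i assume i: "i < n" "p \<le> i"
      then show "t < \<mu> i" using chamber_less[OF ch, of p "Suc i"] y[of "Suc i"] y[of p] p by simp
    qed
    ultimately show "chamber n \<mu> \<and> split_at n p t \<mu>" ..
  next
    assume a: "chamber n \<mu> \<and> split_at n p t \<mu>"
    then have lo: "\<mu> i < t" if "i < p" for i using that by (auto simp: split_at_def)
    have hi: "t < \<mu> i" if "p \<le> i" "i < n" for i using a that by (auto simp: split_at_def)
    have less: "\<mu> i < \<mu> j" if "i < j" "j < n" for i j using a that chamber_less by blast
    show "chamber (Suc n) y" unfolding chamber_def
    proof (intro allI impI)
      fix i j assume ij: "j < Suc n" "i < j"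
      consider "j < p" | "j = p" | "j > p" "i < p" | "j > p" "i = p" | "j > p" "i > p" by linarith
      then show "y i < y j"
      proof cases
        case 1 then show ?thesis using ij p less[of i j] y[of i] y[of j] by simp
      next
        case 2 then show ?thesis using ij p lo[of i] y[of i] y[of j] by simp
      next
        case 3
        then have "\<mu> i < t" "t < \<mu> (j - 1)" using ij lo[of i] hi[of "j - 1"] by auto
        then show ?thesis using 3 ij y[of i] y[of j] by simp
      next
        case 4 then show ?thesis using ij hi[of "j - 1"] y[of i] y[of j] by simp
      next
        case 5 then show ?thesis using ij less[of "i - 1" "j - 1"] y[of i] y[of j] by simp
      qed
    qed
  qed
  then show ?thesis unfolding y_def .
qed

text \<open>The joint density with entry \<open>p\<close>, counted from 0, fixed at
  \<open>t\<close>, apart from its constant and \<open>exp (- t\<^sup>2 / 2)\<close>. The product of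
  the \<open>\<mu> i - t\<close> is the part of the Vandermonde product that involves
  \<open>t\<close>.\<close>

definition marginal :: "nat \<Rightarrow> nat \<Rightarrow> real \<Rightarrow> (nat \<Rightarrow> real) \<Rightarrow> real" where
  "marginal n p t \<mu> = (if chamber n \<mu> \<and> split_at n p t \<mu>
     then vand n \<mu> * \<bar>\<Prod>i<n. \<mu> i - t\<bar> * exp (- (\<Sum>i<n. (\<mu> i)\<^sup>2) / 2) else 0)"

lemma marginal_nonneg: "marginal n p t \<mu> \<ge> 0"
  unfolding marginal_def using vand_pos[of n \<mu>] by (auto simp: less_imp_le)

lemma measurable_marginal [measurable (raw)]:
  assumes f: "f \<in> M \<rightarrow>\<^sub>M leb n" and g[measurable]: "g \<in> borel_measurable M" and p: "p \<le> n"
  shows "(\<lambda>w. marginal n p (g w) (f w)) \<in> borel_measurable M"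
proof -
  have [measurable]: "(\<lambda>w. f w i) \<in> borel_measurable M" if "i < n" for i
    by (rule measurable_leb_component[OF f that])
  note [measurable] = measurable_split_at[OF f g p] measurable_chamber[OF f] measurable_vand[OF f]
  have [measurable]: "(\<lambda>w. \<Prod>i<n. f w i - g w) \<in> borel_measurable M" "(\<lambda>w. \<Sum>i<n. (f w i)\<^sup>2) \<in> borel_measurable M"
    by (auto intro!: borel_measurable_prod borel_measurable_sum)
  show ?thesis unfolding marginal_def by measurable
qed

text \<open>A cycle of the coordinates, which preserves Lebesgue measure, moves the distinguished
  eigenvalue to the last place. Its sign disappears because the Vandermonde product of the ordered
  tuple is positive.\<close>

lemma GOE_eig_density:
  assumes p: "p \<le> n" and h[measurable]: "h \<in> borel_measurable borel"
  shows "(\<integral>\<^sup>+x. h (goe_eig (Suc n) (Suc p) x) \<partial>GOE_entries (Suc n))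
    = ennreal (k_const (Suc n) * fact (Suc n)) * (\<integral>\<^sup>+t. h t * (ennreal (exp (- t\<^sup>2 / 2)) * (\<integral>\<^sup>+\<mu>. ennreal (marginal n p t \<mu>) \<partial>leb n)) \<partial>lborel)"
proof -
  let ?s = "insert_cycle n p"
  have s: "?s permutes {..<Suc n}" by (rule insert_cycle_permutes[OF p])
  have pn: "p < Suc n" using p by simp
  have hm[measurable]: "(\<lambda>l. h (l p)) \<in> borel_measurable (leb (Suc n))"
    by (rule measurable_compose[OF measurable_leb_component[OF measurable_ident[unfolded id_def] pn] h])
  let ?H = "\<lambda>l. (if chamber (Suc n) l then ennreal (vand (Suc n) l * exp (- (\<Sum>i<Suc n. (l i)\<^sup>2) / 2)) * h (l p) else 0)"
  have H[measurable]: "?H \<in> borel_measurable (leb (Suc n))" by measurable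
  have "(\<integral>\<^sup>+x. h (goe_eig (Suc n) (Suc p) x) \<partial>GOE_entries (Suc n)) = (\<integral>\<^sup>+x. h (eigs (Suc n) x p) \<partial>GOE_entries (Suc n))"
    using pn by (simp add: eigs_def)
  also have "\<dots> = ennreal (k_const (Suc n) * fact (Suc n)) * (\<integral>\<^sup>+l. ?H l \<partial>leb (Suc n))"
    by (rule GOE_joint_density[OF hm])
  also have "(\<integral>\<^sup>+l. ?H l \<partial>leb (Suc n)) = (\<integral>\<^sup>+l. ?H l \<partial>distr (leb (Suc n)) (leb (Suc n)) (\<lambda>x. x \<circ> ?s))"
    by (simp only: distr_leb_permute[OF s])
  also have "\<dots> = (\<integral>\<^sup>+x. ?H (x \<circ> ?s) \<partial>leb (Suc n))"
    by (rule nn_integral_distr[OF measurable_leb_permute[OF s]]) (simp only: distr_leb_permute[OF s] H)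
  also have "\<dots> = (\<integral>\<^sup>+t. \<integral>\<^sup>+\<mu>. ?H ((\<mu>(n := t)) \<circ> ?s) \<partial>leb n \<partial>lborel)"
    by (rule nn_integral_leb_Suc_rev) (rule measurable_compose[OF measurable_leb_permute[OF s] H])
  also have "\<dots> = (\<integral>\<^sup>+t. \<integral>\<^sup>+\<mu>. (h t * ennreal (exp (- t\<^sup>2 / 2))) * ennreal (marginal n p t \<mu>) \<partial>leb n \<partial>lborel)"
  proof (intro nn_integral_cong)
    fix t :: real and \<mu> :: "nat \<Rightarrow> real"
    show "?H ((\<mu>(n := t)) \<circ> ?s) = (h t * ennreal (exp (- t\<^sup>2 / 2))) * ennreal (marginal n p t \<mu>)"
    proof (cases "chamber n \<mu> \<and> split_at n p t \<mu>")
      case True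
      let ?y = "(\<mu>(n := t)) \<circ> ?s"
      have ch: "chamber (Suc n) ?y" using True chamber_insert_cycle[OF p] by blast
      have "vand (Suc n) ?y = \<bar>rsign ?s * vand (Suc n) (\<mu>(n := t))\<bar>"
        using vand_pos[OF ch] vand_permute[OF s, of "\<mu>(n := t)"] by simp
      also have "\<dots> = \<bar>vand (Suc n) (\<mu>(n := t))\<bar>"
        by (cases ?s rule: sign_cases) (auto simp: abs_mult)
      also have "\<dots> = vand n \<mu> * \<bar>\<Prod>i<n. \<mu> i - t\<bar>"
        unfolding vand_Suc_upd abs_mult abs_prod using vand_pos[of n \<mu>] True by (simp add: abs_minus_commute)
      finally have v: "vand (Suc n) ?y = vand n \<mu> * \<bar>\<Prod>i<n. \<mu> i - t\<bar>" .
      have "(\<Sum>i<Suc n. (?y i)\<^sup>2) = (\<Sum>i<Suc n. ((\<mu>(n := t)) i)\<^sup>2)"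
        using sum.permute[OF s, of "\<lambda>i. ((\<mu>(n := t)) i)\<^sup>2"] by (simp only: o_def)
      also have "\<dots> = (\<Sum>i<n. (\<mu> i)\<^sup>2) + t\<^sup>2" by simp
      finally have sq: "(\<Sum>i<Suc n. (?y i)\<^sup>2) = (\<Sum>i<n. (\<mu> i)\<^sup>2) + t\<^sup>2" .
      have ex: "exp (- ((\<Sum>i<n. (\<mu> i)\<^sup>2) + t\<^sup>2) / 2) = exp (- (\<Sum>i<n. (\<mu> i)\<^sup>2) / 2) * exp (- t\<^sup>2 / 2)"
        unfolding exp_add[symmetric] by (rule arg_cong[of _ _ exp]) (simp add: field_simps)
      have yp: "?y p = t" by (simp add: insert_cycle_def)
      have mg: "marginal n p t \<mu> = vand n \<mu> * \<bar>\<Prod>i<n. \<mu> i - t\<bar> * exp (- (\<Sum>i<n. (\<mu> i)\<^sup>2) / 2)"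
        using True by (simp add: marginal_def)
      have "vand (Suc n) ?y * exp (- (\<Sum>i<Suc n. (?y i)\<^sup>2) / 2) = marginal n p t \<mu> * exp (- t\<^sup>2 / 2)"
        unfolding v sq ex mg by (simp only: mult_ac)
      then have "?H ?y = ennreal (marginal n p t \<mu> * exp (- t\<^sup>2 / 2)) * h t" using ch yp by (simp only: if_True)
      also have "\<dots> = (h t * ennreal (exp (- t\<^sup>2 / 2))) * ennreal (marginal n p t \<mu>)"
        using marginal_nonneg by (subst ennreal_mult) (auto simp: mult_ac)
      finally show ?thesis .
    next
      case False
      then have "\<not> chamber (Suc n) ((\<mu>(n := t)) \<circ> ?s)" using chamber_insert_cycle[OF p] by blast
      moreover have "marginal n p t \<mu> = 0" unfolding marginal_def using False by (simp only: if_False)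
      ultimately show ?thesis by (simp only: if_False ennreal_0 mult_zero_right)
    qed
  qed
  also have "\<dots> = (\<integral>\<^sup>+t. h t * (ennreal (exp (- t\<^sup>2 / 2)) * (\<integral>\<^sup>+\<mu>. ennreal (marginal n p t \<mu>) \<partial>leb n)) \<partial>lborel)"
  proof (rule nn_integral_cong)
    fix t :: real
    have [measurable]: "marginal n p t \<in> borel_measurable (leb n)"
      using measurable_marginal[OF measurable_ident measurable_const p, of t] by simp
    show "(\<integral>\<^sup>+\<mu>. (h t * ennreal (exp (- t\<^sup>2 / 2))) * ennreal (marginal n p t \<mu>) \<partial>leb n)
      = h t * (ennreal (exp (- t\<^sup>2 / 2)) * (\<integral>\<^sup>+\<mu>. ennreal (marginal n p t \<mu>) \<partial>leb n))"
      by (subst nn_integral_cmult) (auto simp: mult.assoc)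
  qed
  finally show ?thesis .
qed

text \<open>\<open>x - t\<close> is the Vandermonde factor of the fixed eigenvalue, distributed over
  the columns of the determinant; this is the origin of the exponent \<alpha> = 1.
  \<open>Suc i\<close> converts to the 1-based row index of \<open>D_set\<close>.\<close>

definition psi :: "nat set \<Rightarrow> real \<Rightarrow> nat \<Rightarrow> real \<Rightarrow> real" where
  "psi I t i x = indicator (D_set I t (Suc i)) x * (x ^ i * (x - t) * exp (- x\<^sup>2 / 2))"

lemma integrable_psi: "integrable lborel (psi I t i)"
proof -
  have mom: "integrable lborel (\<lambda>x. std_normal_density x * x ^ k)" for k
    by (rule integrable_std_normal_moment)
  have "integrable lborel (\<lambda>x. sqrt (2 * pi) * (std_normal_density x * x ^ Suc i) - t * sqrt (2 * pi) * (std_normal_density x * x ^ i))"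
    by (intro Bochner_Integration.integrable_diff integrable_mult_right mom)
  also have "(\<lambda>x. sqrt (2 * pi) * (std_normal_density x * x ^ Suc i) - t * sqrt (2 * pi) * (std_normal_density x * x ^ i))
     = (\<lambda>x. x ^ i * (x - t) * exp (- x\<^sup>2 / 2))"
    by (rule ext) (simp add: std_normal_density_def field_simps)
  finally have "integrable lborel (\<lambda>x. x ^ i * (x - t) * exp (- x\<^sup>2 / 2))" .
  from integrable_real_mult_indicator[OF _ this, of "D_set I t (Suc i)"] show ?thesis
    by (simp add: psi_def[abs_def] D_set_def mult.commute)
qed

lemma Pf_A_pair_mat: "Pf_A 1 n I t = pfaffian ((n + 1) div 2) (pair_mat n (psi I t))"
proof -
  let ?m = "(n + 1) div 2"
  have "A_mat 1 n I t i j = pair_mat n (psi I t) i j" if "i \<le> n" "j \<le> n" for i j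
  proof -
    have a: "a_entry 1 I t (i + 1) (j + 1) = (\<integral>x. \<integral>y. psi I t i x * psi I t j y * sgn (y - x) \<partial>lborel \<partial>lborel)" for i j
      unfolding a_entry_def psi_def
    proof (intro Bochner_Integration.integral_cong refl)
      fix x y :: real
      have "exp (- (x\<^sup>2 + y\<^sup>2) / 2) = exp (- x\<^sup>2 / 2) * exp (- y\<^sup>2 / 2)"
        unfolding exp_add[symmetric] by (rule arg_cong[of _ _ exp]) (simp add: field_simps)
      then show "indicator (D_set I t (i + 1)) x * indicator (D_set I t (j + 1)) y * sgn (y - x) * x ^ (i + 1 - 1) * y ^ (j + 1 - 1) * (x - t) ^ 1 * (y - t) ^ 1 * exp (- (x\<^sup>2 + y\<^sup>2) / 2)
         = indicator (D_set I t (Suc i)) x * (x ^ i * (x - t) * exp (- x\<^sup>2 / 2)) * (indicator (D_set I t (Suc j)) y * (y ^ j * (y - t) * exp (- y\<^sup>2 / 2))) * sgn (y - x)"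
        by (simp add: mult_ac)
    qed
    have b: "b_entry 1 I t (i + 1) = (\<integral>x. psi I t i x \<partial>lborel)" for i
      unfolding b_entry_def psi_def by (intro Bochner_Integration.integral_cong refl) (simp add: mult_ac)
    show ?thesis using that unfolding A_mat_def pair_mat_def a b by auto
  qed
  then have eq: "A_mat 1 n I t i j = pair_mat n (psi I t) i j" if "i < 2 * ?m" "j < 2 * ?m" for i j
    using that by auto
  show ?thesis
    unfolding Pf_A_def pfaffian_def
  proof (intro arg_cong2[where f="(/)"] arg_cong2[where f="(*)"] refl sum.cong prod.cong)
    fix \<sigma> i assume "\<sigma> \<in> {\<sigma>. \<sigma> permutes {0..<2 * ?m}}" "i \<in> {..<?m}"
    then show "A_mat 1 n I t (\<sigma> (2 * i)) (\<sigma> (2 * i + 1)) = pair_mat n (psi I t) (\<sigma> (2 * i)) (\<sigma> (2 * i + 1))"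
      using permutes_in_image[of \<sigma> "{0..<2 * ?m}" "2 * i"] permutes_in_image[of \<sigma> "{0..<2 * ?m}" "2 * i + 1"]
      by (intro eq) auto
  qed
qed

section \<open>Splitting the region over subsets\<close>

lemma finite_subsets_F: "finite (subsets_F p n)"
  by (rule finite_subset[of _ "Pow {1..n}"]) (auto simp: subsets_F_def)

text \<open>Exactly one \<open>I\<close> fits: the set of rows that \<open>\<sigma>\<close> assigns
  to the entries below \<open>t\<close>. It is counted when it has \<open>p\<close> elements, a
  condition from which \<open>\<sigma>\<close> has disappeared. This is why the domains can be
  attached to rows rather than to variables.\<close>

lemma sum_indicator_subsets:
  assumes \<sigma>: "\<sigma> permutes {..<n}" and ne: "\<And>j. j < n \<Longrightarrow> \<mu> j \<noteq> t"
  shows "(\<Sum>I\<in>subsets_F p n. \<Prod>j<n. indicator (D_set I t (Suc (\<sigma> j))) (\<mu> j)) = (if card {j. j < n \<and> \<mu> j < t} = p then 1 else (0::real))"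
proof -
  let ?B = "{j. j < n \<and> \<mu> j < t}"
  let ?I = "(\<lambda>j. Suc (\<sigma> j)) ` ?B"
  have sn: "\<sigma> j < n \<longleftrightarrow> j < n" for j using permutes_in_image[OF \<sigma>, of j] by simp
  have inj: "inj (\<lambda>j. Suc (\<sigma> j))" using permutes_inj[OF \<sigma>] by (auto simp: inj_def)
  have "(\<Prod>j<n. indicator (D_set I t (Suc (\<sigma> j))) (\<mu> j)) = (if I = ?I then 1 else (0::real))" if I: "I \<in> subsets_F p n" for I
  proof (cases "\<forall>j<n. Suc (\<sigma> j) \<in> I \<longleftrightarrow> \<mu> j < t")
    case True
    have "I = ?I"
    proof (intro equalityI subsetI)
      fix i assume i: "i \<in> I"
      then have "i \<in> {1..n}" using I by (auto simp: subsets_F_def)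
      then obtain i' where i': "i = Suc i'" "i' < n" by (cases i) auto
      obtain j where j: "i' = \<sigma> j" using permutes_surj[OF \<sigma>] by (metis surjD)
      then have "j < n" using i' sn by simp
      then show "i \<in> ?I" using True i i' j by auto
    next
      fix i assume "i \<in> ?I" then show "i \<in> I" using True by auto
    qed
    moreover have "(\<Prod>j<n. indicator (D_set I t (Suc (\<sigma> j))) (\<mu> j)) = (1::real)"
    proof (rule prod.neutral, rule ballI)
      fix j assume "j \<in> {..<n}"
      then show "indicator (D_set I t (Suc (\<sigma> j))) (\<mu> j) = (1::real)"
        using True ne[of j] by (auto simp: D_set_def)
    qed
    ultimately show ?thesis by simp
  next
    case False
    then obtain j where j: "j < n" "\<not> (Suc (\<sigma> j) \<in> I \<longleftrightarrow> \<mu> j < t)" by blast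
    then have "indicator (D_set I t (Suc (\<sigma> j))) (\<mu> j) = (0::real)" using ne[of j] by (auto simp: D_set_def)
    then have "(\<Prod>j<n. indicator (D_set I t (Suc (\<sigma> j))) (\<mu> j)) = (0::real)" using j(1) by (intro prod_zero) auto
    moreover have "I \<noteq> ?I"
    proof
      assume e: "I = ?I"
      have "Suc (\<sigma> j) \<in> ?I \<longleftrightarrow> j \<in> ?B" using inj_image_mem_iff[OF inj, of j ?B] by simp
      then show False using j e by simp
    qed
    ultimately show ?thesis by simp
  qed
  then have "(\<Sum>I\<in>subsets_F p n. \<Prod>j<n. indicator (D_set I t (Suc (\<sigma> j))) (\<mu> j)) = (\<Sum>I\<in>subsets_F p n. if I = ?I then 1 else (0::real))"
    by (rule sum.cong[OF refl])
  also have "\<dots> = (if ?I \<in> subsets_F p n then 1 else 0)" by (simp add: sum.delta' finite_subsets_F)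
  also have "?I \<in> subsets_F p n \<longleftrightarrow> card ?B = p"
  proof -
    have "card ?I = card ?B" by (rule card_image) (rule inj_on_subset[OF inj], simp)
    moreover have "?I \<subseteq> {1..n}"
    proof
      fix i assume "i \<in> ?I"
      then obtain j where "j < n" "i = Suc (\<sigma> j)" by blast
      then show "i \<in> {1..n}" using sn[of j] by simp
    qed
    ultimately show ?thesis unfolding subsets_F_def mem_Collect_eq by simp
  qed
  finally show ?thesis .
qed

text \<open>Summing over \<open>I\<close> before \<open>\<sigma>\<close> makes the indicator
  independent of \<open>\<sigma>\<close>, so it leaves the determinant together with the weights,
  and the Vandermonde determinant remains. If some entry equals \<open>t\<close>, no domain contains
  it, but then the factor \<open>\<mu> j - t\<close> makes both sides vanish.\<close>

lemma sum_alt_sum_psi: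
  "(\<Sum>I\<in>subsets_F p n. alt_sum n (psi I t) \<mu>)
    = (if card {j. j < n \<and> \<mu> j < t} = p then (\<Prod>j<n. \<mu> j - t) * exp (- (\<Sum>j<n. (\<mu> j)\<^sup>2) / 2) * vand n \<mu> else 0)"
proof (cases "\<exists>j<n. \<mu> j = t")
  case True
  then obtain j where j: "j < n" "\<mu> j = t" by blast
  have "alt_sum n (psi I t) \<mu> = 0" for I
    unfolding alt_sum_def
  proof (rule sum.neutral, rule ballI)
    fix \<sigma>
    have "(\<Prod>j<n. psi I t (\<sigma> j) (\<mu> j)) = 0" using j by (intro prod_zero bexI[of _ j]) (auto simp: psi_def)
    then show "rsign \<sigma> * (\<Prod>j<n. psi I t (\<sigma> j) (\<mu> j)) = 0" by simp
  qed
  moreover have "(\<Prod>j<n. \<mu> j - t) = 0" using j by (intro prod_zero bexI[of _ j]) auto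
  ultimately show ?thesis by simp
next
  case False
  then have ne: "\<And>j. j < n \<Longrightarrow> \<mu> j \<noteq> t" by auto
  let ?S = "{\<sigma>. \<sigma> permutes {..<n}}"
  let ?w = "(\<Prod>j<n. \<mu> j - t) * exp (- (\<Sum>j<n. (\<mu> j)\<^sup>2) / 2)"
  let ?d = "if card {j. j < n \<and> \<mu> j < t} = p then 1 else (0::real)"
  have psi: "(\<Prod>j<n. psi I t (\<sigma> j) (\<mu> j)) = (\<Prod>j<n. indicator (D_set I t (Suc (\<sigma> j))) (\<mu> j)) * ((\<Prod>j<n. \<mu> j ^ \<sigma> j) * ?w)" for I \<sigma>
  proof -
    have "exp (- (\<Sum>j<n. (\<mu> j)\<^sup>2) / 2) = (\<Prod>j<n. exp (- (\<mu> j)\<^sup>2 / 2))"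
      unfolding exp_sum[OF finite_lessThan, symmetric]
      by (rule arg_cong[of _ _ exp]) (simp add: sum_negf sum_divide_distrib)
    then show ?thesis unfolding psi_def by (simp add: prod.distrib mult_ac)
  qed
  have "(\<Sum>I\<in>subsets_F p n. alt_sum n (psi I t) \<mu>) = (\<Sum>\<sigma>\<in>?S. \<Sum>I\<in>subsets_F p n. rsign \<sigma> * (\<Prod>j<n. psi I t (\<sigma> j) (\<mu> j)))"
    unfolding alt_sum_def by (rule sum.swap)
  also have "\<dots> = (\<Sum>\<sigma>\<in>?S. (?d * ?w) * (rsign \<sigma> * (\<Prod>j<n. \<mu> j ^ \<sigma> j)))"
  proof (rule sum.cong[OF refl])
    fix \<sigma> assume "\<sigma> \<in> ?S"
    then have \<sigma>: "\<sigma> permutes {..<n}" by simp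
    have "(\<Sum>I\<in>subsets_F p n. rsign \<sigma> * (\<Prod>j<n. psi I t (\<sigma> j) (\<mu> j)))
       = (\<Sum>I\<in>subsets_F p n. (\<Prod>j<n. indicator (D_set I t (Suc (\<sigma> j))) (\<mu> j)) * (rsign \<sigma> * ((\<Prod>j<n. \<mu> j ^ \<sigma> j) * ?w)))"
      unfolding psi by (simp only: mult_ac)
    also have "\<dots> = ?d * (rsign \<sigma> * ((\<Prod>j<n. \<mu> j ^ \<sigma> j) * ?w))"
      unfolding sum_distrib_right[symmetric] using sum_indicator_subsets[where p=p, OF \<sigma> ne] by simp
    finally show "(\<Sum>I\<in>subsets_F p n. rsign \<sigma> * (\<Prod>j<n. psi I t (\<sigma> j) (\<mu> j))) = (?d * ?w) * (rsign \<sigma> * (\<Prod>j<n. \<mu> j ^ \<sigma> j))"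
      by (simp only: mult_ac)
  qed
  also have "\<dots> = (?d * ?w) * vand n \<mu>" unfolding sum_distrib_left[symmetric] vandermonde_det ..
  finally show ?thesis by simp
qed

text \<open>On the chamber the entries below \<open>t\<close> form an initial segment, so having
  \<open>p\<close> of them is the same as \<open>split_at\<close>, unless some entry equals
  \<open>t\<close> and the product is 0. The sign \<open>(-1) ^ p\<close> turns the product with its
  \<open>p\<close> negative factors into its absolute value.\<close>

lemma marginal_alt_sum:
  assumes p: "p \<le> n"
  shows "marginal n p t \<mu> = (-1) ^ p * (\<Sum>I\<in>subsets_F p n. if chamber n \<mu> then alt_sum n (psi I t) \<mu> else 0)"
proof (cases "chamber n \<mu>")
  case ch: True
  let ?B = "{j. j < n \<and> \<mu> j < t}"
  let ?X = "\<Prod>j<n. \<mu> j - t"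
  have sum: "(\<Sum>I\<in>subsets_F p n. if chamber n \<mu> then alt_sum n (psi I t) \<mu> else 0) = (\<Sum>I\<in>subsets_F p n. alt_sum n (psi I t) \<mu>)"
    using ch by simp
  show ?thesis
  proof (cases "split_at n p t \<mu>")
    case True
    have "?B = {..<p}"
    proof (intro equalityI subsetI)
      fix j assume "j \<in> ?B"
      then show "j \<in> {..<p}" using True unfolding split_at_def by (metis lessThan_iff mem_Collect_eq not_le_imp_less order_less_asym)
    qed (use True p in \<open>auto simp: split_at_def\<close>)
    then have card: "card ?B = p" by simp
    have "(-1) ^ (n - p) * (\<Prod>j<n. t - \<mu> j) > 0"
      using True p by (intro sign_prod_chamber) (auto simp: split_at_def)
    moreover have "(\<Prod>j<n. t - \<mu> j) = (-1) ^ n * ?X"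
    proof -
      have "(\<Prod>j<n. t - \<mu> j) = (\<Prod>j<n. (-1) * (\<mu> j - t))" by (rule prod.cong) auto
      then show ?thesis by (subst (asm) prod.distrib) simp
    qed
    moreover have "(-1) ^ (n - p) * (-1) ^ n = ((-1) ^ p :: real)"
    proof -
      have "n - p + n = 2 * (n - p) + p" using p by simp
      then show ?thesis by (simp only: power_add[symmetric]) (simp add: power_add)
    qed
    ultimately have "(-1) ^ p * ?X > 0" by (simp add: mult.assoc[symmetric])
    then have "\<bar>?X\<bar> = (-1) ^ p * ?X" by (cases "even p") auto
    then show ?thesis unfolding sum sum_alt_sum_psi marginal_def using ch True card by simp
  next
    case False
    have "?X = 0" if card: "card ?B = p"
    proof (rule ccontr)
      assume X: "?X \<noteq> 0"
      then have ne: "\<mu> j \<noteq> t" if "j < n" for j using that by auto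
      have down: "i \<in> ?B" if "j \<in> ?B" "i < j" for i j
        using that chamber_less[OF ch, of i j] by auto
      have "?B = {..<p}"
      proof -
        have "{..<j} \<subseteq> ?B" if "j \<in> ?B" for j using down[OF that] by auto
        then have lt: "j < p" if "j \<in> ?B" for j
        proof -
          have "{..j} \<subseteq> ?B" using that \<open>\<And>j. j \<in> ?B \<Longrightarrow> {..<j} \<subseteq> ?B\<close>[OF that] by (auto simp: le_less)
          from card_mono[OF _ this] card show ?thesis by simp
        qed
        then have "?B \<subseteq> {..<p}" by auto
        then show ?thesis using card by (intro card_subset_eq) auto
      qed
      then have "split_at n p t \<mu>"
        unfolding split_at_def using ne by (auto simp: set_eq_iff not_less) (metis leD le_neq_trans linorder_le_less_linear)
      with False show False ..
    qed
    then show ?thesis unfolding sum sum_alt_sum_psi marginal_def using False by simp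
  qed
qed (simp add: marginal_def)

lemma marginal_integral:
  assumes p: "p \<le> n"
  shows "integrable (leb n) (marginal n p t)"
    "integral\<^sup>L (leb n) (marginal n p t) = (-1) ^ p * (\<Sum>I\<in>subsets_F p n. Pf_A 1 n I t)"
proof -
  note int = integrable_chamber_alt_sum[OF integrable_psi, of n]
  show "integrable (leb n) (marginal n p t)"
    unfolding marginal_alt_sum[OF p, abs_def]
    by (intro integrable_mult_right Bochner_Integration.integrable_sum int)
  have "integral\<^sup>L (leb n) (marginal n p t) = (-1) ^ p * (\<integral>\<mu>. (\<Sum>I\<in>subsets_F p n. if chamber n \<mu> then alt_sum n (psi I t) \<mu> else 0) \<partial>leb n)"
    unfolding marginal_alt_sum[OF p, abs_def] by (rule integral_mult_right_zero)
  also have "(\<integral>\<mu>. (\<Sum>I\<in>subsets_F p n. if chamber n \<mu> then alt_sum n (psi I t) \<mu> else 0) \<partial>leb n)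
     = (\<Sum>I\<in>subsets_F p n. \<integral>\<mu>. (if chamber n \<mu> then alt_sum n (psi I t) \<mu> else 0) \<partial>leb n)"
    by (intro Bochner_Integration.integral_sum int)
  also have "\<dots> = (\<Sum>I\<in>subsets_F p n. Pf_A 1 n I t)"
    unfolding Pf_A_pair_mat by (intro sum.cong refl de_Bruijn integrable_psi)
  finally show "integral\<^sup>L (leb n) (marginal n p t) = (-1) ^ p * (\<Sum>I\<in>subsets_F p n. Pf_A 1 n I t)" .
qed

theorem theorem1:
  fixes N k :: nat
  assumes "N \<ge> 1" and "1 \<le> k" and "k \<le> N"
  defines "q \<equiv> (\<lambda>l::real. k_const N * fact N * (-1) ^ (k - 1) * exp (- l\<^sup>2 / 2)
              * (\<Sum>I\<in>subsets_F (k - 1) (N - 1). Pf_A 1 (N - 1) I l))"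
  shows "(\<forall>l. q l \<ge> 0) \<and>
         distr (GOE_entries N) lborel (goe_eig N k) = density lborel (\<lambda>l. ennreal (q l))"
proof -
  obtain n where n: "N = Suc n" using assms(1) by (cases N) auto
  obtain p where p: "k = Suc p" using assms(2) by (cases k) auto
  have pn: "p \<le> n" using assms(3) n p by simp
  define C where "C = k_const N * fact N"
  have C0: "C \<ge> 0" unfolding C_def using k_const_nonneg by simp
  \<comment> \<open>The signed sum of Pfaffians is the integral of the nonnegative function
    \<open>marginal\<close>. Both the nonnegativity of \<open>q\<close> and its measurability are
    read off from this form.\<close>
  have q: "q l = C * (exp (- l\<^sup>2 / 2) * integral\<^sup>L (leb n) (marginal n p l))" for l
    unfolding q_def marginal_integral(2)[OF pn] C_def using n p by (simp add: mult_ac)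
  have m0: "integral\<^sup>L (leb n) (marginal n p l) \<ge> 0" for l
    by (rule integral_nonneg_AE) (simp add: marginal_nonneg)
  have q0: "q l \<ge> 0" for l unfolding q using C0 m0 by simp
  have nn: "(\<integral>\<^sup>+\<mu>. ennreal (marginal n p l \<mu>) \<partial>leb n) = ennreal (integral\<^sup>L (leb n) (marginal n p l))" for l
    by (rule nn_integral_eq_integral[OF marginal_integral(1)[OF pn]]) (simp add: marginal_nonneg)
  have qe: "ennreal (q l) = ennreal C * (ennreal (exp (- l\<^sup>2 / 2)) * (\<integral>\<^sup>+\<mu>. ennreal (marginal n p l \<mu>) \<partial>leb n))" for l
    unfolding q nn using C0 m0 by (simp add: ennreal_mult)
  have [measurable]: "(\<lambda>w. marginal n p (fst w) (snd w)) \<in> borel_measurable (borel \<Otimes>\<^sub>M leb n)"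
    by (rule measurable_marginal[OF measurable_snd measurable_fst pn])
  have qm[measurable]: "(\<lambda>l. ennreal (q l)) \<in> borel_measurable borel"
    unfolding qe by measurable
  have gm: "goe_eig N k \<in> borel_measurable (GOE_entries N)"
    using measurable_goe_eig[of p N] pn unfolding n p measurable_cong_sets[OF sets_GOE_entries refl] by simp
  then have gm': "goe_eig N k \<in> GOE_entries N \<rightarrow>\<^sub>M lborel" by simp
  have "distr (GOE_entries N) lborel (goe_eig N k) = density lborel (\<lambda>l. ennreal (q l))"
  proof (rule measure_eqI)
    fix B assume "B \<in> sets (distr (GOE_entries N) lborel (goe_eig N k))"
    then have B[measurable]: "B \<in> sets borel" by simp
    have "emeasure (distr (GOE_entries N) lborel (goe_eig N k)) B = (\<integral>\<^sup>+l. indicator B l \<partial>distr (GOE_entries N) lborel (goe_eig N k))"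
      by (rule nn_integral_indicator[symmetric]) simp
    also have "\<dots> = (\<integral>\<^sup>+x. indicator B (goe_eig N k x) \<partial>GOE_entries N)"
      by (rule nn_integral_distr[OF gm']) simp
    also have "\<dots> = ennreal C * (\<integral>\<^sup>+t. indicator B t * (ennreal (exp (- t\<^sup>2 / 2)) * (\<integral>\<^sup>+\<mu>. ennreal (marginal n p t \<mu>) \<partial>leb n)) \<partial>lborel)"
      unfolding n p C_def by (rule GOE_eig_density[OF pn]) simp
    also have "\<dots> = (\<integral>\<^sup>+t. ennreal C * (indicator B t * (ennreal (exp (- t\<^sup>2 / 2)) * (\<integral>\<^sup>+\<mu>. ennreal (marginal n p t \<mu>) \<partial>leb n))) \<partial>lborel)"
      by (rule nn_integral_cmult[symmetric]) measurable
    also have "\<dots> = (\<integral>\<^sup>+t. ennreal (q t) * indicator B t \<partial>lborel)"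
      unfolding qe by (intro nn_integral_cong) (simp add: mult_ac)
    also have "\<dots> = emeasure (density lborel (\<lambda>l. ennreal (q l))) B"
      by (rule emeasure_density[symmetric]) auto
    finally show "emeasure (distr (GOE_entries N) lborel (goe_eig N k)) B = emeasure (density lborel (\<lambda>l. ennreal (q l))) B" .
  qed simp
  with q0 show ?thesis by simp
qed

end
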